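(* Let $n\ge2$, let $a=(a_1,\dots,a_n)$ with $a_j>1$ for every $j$, and put $|a|=a_1+a_2+\dots+a_n$. For $1\le q\le\infty$ and $s\in\mathbb{R}$, say that $(\ast)_{q,s}$ holds if there is a constant $C$ such that $$\|M^*f\|_{L^q(\mathbb{R}^n)}\le C\,\|f\|_{H_s}\qquad\text{for all } f\in\mathcal{S}(\mathbb{R}^n).$$ Then: (1) for $1\le q<2$, $(\ast)_{q,s}$ holds for no $s$; (2) for $q=2$, $(\ast)_{q,s}$ holds for $s>|a|/4$ and does not hold for $s<|a|/4$; (3) for $2<q<4$, $(\ast)_{q,s}$ holds if and only if $s\ge\frac n2-\frac{|a|}4+\frac{|a|}q-\frac nq$; (4) for $4\le q<\infty$, $(\ast)_{q,s}$ holds if and only if $s\ge n\left(\frac12-\frac1q\right)$; (5) for $q=\infty$, $(\ast)_{q,s}$ holds if and only if $s>\frac n2$.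
   Context: $\mathcal{S}(\mathbb{R}^n)$ is the Schwartz class and $\widehat f(\xi)=\int_{\mathbb{R}^n}e^{-ix\cdot\xi}f(x)\,dx$. For $f\in\mathcal{S}(\mathbb{R}^n)$ and $t=(t_1,\dots,t_n)\in\mathbb{R}^n$, $$S_tf(x)=\int_{\mathbb{R}^n}e^{ix\cdot\xi}e^{i(t_1|\xi_1|^{a_1}+t_2|\xi_2|^{a_2}+\dots+t_n|\xi_n|^{a_n})}\widehat f(\xi)\,d\xi,\qquad x\in\mathbb{R}^n,$$ and $M^*f(x)=\sup_{0<t_i<1,\ i=1,\dots,n}|S_tf(x)|$. The Sobolev norm is $\|f\|_{H_s}=\left(\int_{\mathbb{R}^n}(1+|\xi|^2)^s|\widehat f(\xi)|^2\,d\xi\right)^{1/2}$. *)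

theory Defs
  imports "HOL-Analysis.Analysis" "HOL-Probability.Essential_Supremum"
begin

(* Dimension n is CARD('n); the tuples a and t are vectors of type real ^ 'n. *)

definition partial_deriv :: "'n::finite \<Rightarrow> (real ^ 'n \<Rightarrow> complex) \<Rightarrow> real ^ 'n \<Rightarrow> complex" where
  "partial_deriv i f x = frechet_derivative f (at x) (axis i 1)"

primrec iter_partial_deriv ::
  "'n::finite list \<Rightarrow> (real ^ 'n \<Rightarrow> complex) \<Rightarrow> real ^ 'n \<Rightarrow> complex" where
  "iter_partial_deriv [] f = f"
| "iter_partial_deriv (i # is) f = partial_deriv i (iter_partial_deriv is f)"

(* Total differentiability of every iterated partial derivative is C-infinity smoothness.
   The list of indices plays the role of a multi-index (the order is irrelevant by symmetry). *)
definition schwartz :: "(real ^ 'n::finite \<Rightarrow> complex) \<Rightarrow> bool" where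
  "schwartz f \<longleftrightarrow>
     (\<forall>is. (\<forall>x. iter_partial_deriv is f differentiable (at x)) \<and>
           (\<forall>k::nat. bounded (range (\<lambda>x. norm x ^ k *\<^sub>R iter_partial_deriv is f x))))"

definition fourier :: "(real ^ 'n::finite \<Rightarrow> complex) \<Rightarrow> real ^ 'n \<Rightarrow> complex" where
  "fourier f \<xi> = (LINT x|lborel. exp (- \<i> * complex_of_real (x \<bullet> \<xi>)) * f x)"

definition S_op ::
  "real ^ 'n::finite \<Rightarrow> real ^ 'n \<Rightarrow> (real ^ 'n \<Rightarrow> complex) \<Rightarrow> real ^ 'n \<Rightarrow> complex" where
  "S_op a t f x =
     (LINT \<xi>|lborel. exp (\<i> * complex_of_real (x \<bullet> \<xi>)) *
        exp (\<i> * complex_of_real (\<Sum>j\<in>UNIV. t $ j * (\<bar>\<xi> $ j\<bar> powr (a $ j)))) * fourier f \<xi>)"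

definition maximal_op ::
  "real ^ 'n::finite \<Rightarrow> (real ^ 'n \<Rightarrow> complex) \<Rightarrow> real ^ 'n \<Rightarrow> ennreal" where
  "maximal_op a f x = (SUP t\<in>{t. \<forall>i. 0 < t $ i \<and> t $ i < 1}. ennreal (cmod (S_op a t f x)))"

(* Powers with finite positive exponent p; for p > 0 this gives 0 at 0 and top at top. *)
definition ennreal_powr :: "ennreal \<Rightarrow> real \<Rightarrow> ennreal" where
  "ennreal_powr y p = (if y = top then top else ennreal (enn2real y powr p))"

definition Lq_norm :: "ennreal \<Rightarrow> (real ^ 'n::finite \<Rightarrow> ennreal) \<Rightarrow> ennreal" where
  "Lq_norm q g =
     (if q = top then esssup lborel g
      else ennreal_powr (\<integral>\<^sup>+ x. ennreal_powr (g x) (enn2real q) \<partial>lborel) (1 / enn2real q))"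

definition sobolev_norm :: "real \<Rightarrow> (real ^ 'n::finite \<Rightarrow> complex) \<Rightarrow> real" where
  "sobolev_norm s f =
     sqrt (LINT \<xi>|lborel. (1 + (norm \<xi>)\<^sup>2) powr s * (cmod (fourier f \<xi>))\<^sup>2)"

definition maximal_estimate :: "real ^ 'n::finite \<Rightarrow> ennreal \<Rightarrow> real \<Rightarrow> bool" where
  "maximal_estimate a q s \<longleftrightarrow>
     (\<exists>C::real. \<forall>f. schwartz f \<longrightarrow>
        Lq_norm q (maximal_op a f) \<le> ennreal (C * sobolev_norm s f))"

end

theory Submission
  imports Defs "HOL-Probability.Probability" "HOL-Real_Asymp.Real_Asymp"
begin

text \<open>
  Sufficiency is a \<open>TT\<^sup>*\<close> argument. After linearising the supremum by a measurable choice of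
  times, the kernel of \<open>TT\<^sup>*\<close> is a product of one-dimensional oscillatory integrals
  \<open>K\<^sub>j(u, \<tau>)\<close> with phase \<open>u x + \<tau> \<bar>x\<bar>\<^sup>a\<close> and weight \<open>(1 + x\<^sup>2)\<^sup>-\<^sup>s\<close>, \<open>\<bar>\<tau>\<bar> \<le> 1\<close>, where the
  \<open>s\<^sub>j\<close> add up to \<open>s\<close>. For \<open>q > 2\<close> and the right \<open>s\<^sub>j\<close>, van der Corput's lemma bounds \<open>K\<^sub>j\<close> by
  \<open>\<bar>u\<bar>\<^sup>-\<^sup>2\<^sup>/\<^sup>q\<close> uniformly in \<open>\<tau>\<close>, and Hardy--Littlewood--Sobolev in each variable gives the bound; for
  \<open>q = 2\<close> and \<open>s\<^sub>j > a\<^sub>j/4\<close> the supremum of \<open>K\<^sub>j\<close> over \<open>\<tau>\<close> is dominated by an integrable function of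
  \<open>u\<close>, and \<open>q = \<infinity>\<close> is Cauchy--Schwarz.

  Necessity is tested on Gaussians. Dilations \<open>\<rho> \<rightarrow> 0\<close> and \<open>\<rho> \<rightarrow> \<infinity>\<close> at time \<open>0\<close> exclude \<open>q < 2\<close> and
  \<open>s < n(1/2 - 1/q)\<close>. A packet at frequency \<open>N\<close> of width \<open>N\<^sup>1\<^sup>-\<^sup>a\<^sup>/\<^sup>2\<close> in each variable travels over a
  distance of order \<open>N\<^sup>a\<^sup>-\<^sup>1\<close> without dispersing, which gives the threshold for \<open>2 \<le> q < 4\<close>. For
  \<open>q = \<infinity>\<close> a sum of dyadic dilates grows like \<open>K\<close> at the origin but its norm in \<open>H\<^sub>n\<^sub>/\<^sub>2\<close> only like
  \<open>\<surd>K\<close>.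
\<close>

section \<open>Lebesgue measure on \<open>\<real>\<^sup>n\<close> as a product\<close>

text \<open>The times are chosen independently in each variable and the phase is a sum over the
  variables, so the one obstacle to working one coordinate at a time is that the Sobolev weight is
  not a product. For s_j \<ge> 0 the product of the (1 + \<xi>_j^2)^(s_j) is at most (1 +
  |\<xi>|^2)^(s_1 + ... + s_n), which is enough for sufficiency and explains why the thresholds are
  sums over j.

  The exponents come from two scales of a single factor. Cutting at x = 1/|u|, where
  \<open>u x\<close> begins to oscillate, costs |u|^(2s - 1); equating this with |u|^(-2/q) gives s
  = 1/2 - 1/q. The stationary point lies at (|u|/a)^(1/(a-1)) or beyond because |\<tau>| \<le> 1,
  and it costs |u|^(-\<gamma>) with \<gamma> = 1/2 + (2s - 1/2)/(a - 1); equating gives s = 1/2 -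
  a/4 + (a - 1)/q. Both values are 1/4 at q = 4, where the regimes change, and at q = 2 the
  condition \<gamma> > 1 reads s > a/4.\<close>

lemma vec_lambda_measurable [measurable]:
  "(\<lambda>f. \<chi> i. f i) \<in> measurable (Pi\<^sub>M (UNIV :: 'n::finite set) (\<lambda>_. lborel :: real measure)) (borel :: (real ^ 'n) measure)"
proof (subst borel_measurable_euclidean_space, intro ballI)
  fix b :: "real ^ 'n"
  assume "b \<in> Basis"
  then obtain i where "b = axis i 1"
    by (auto simp: Basis_vec_def)
  then show "(\<lambda>f. (\<chi> i. f i) \<bullet> b) \<in> borel_measurable (Pi\<^sub>M UNIV (\<lambda>_. lborel))"
    by (simp add: inner_axis)
qed

lemma vec_nth_measurable [measurable]: "(\<lambda>x :: real ^ 'n::finite. x $ i) \<in> borel_measurable borel"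
  by (intro borel_measurable_continuous_onI continuous_intros)

interpretation lborel_prod: product_sigma_finite "\<lambda>_. lborel :: real measure"
  by standard

text \<open>Functions on the index type carry the theory of finite products, with induction over
  coordinates; this transfer makes it available for vectors. Agreement on open boxes is enough to
  identify Lebesgue measure.\<close>

lemma lborel_vec_eq_distr:
  "(lborel :: (real ^ 'n::finite) measure) = distr (Pi\<^sub>M UNIV (\<lambda>_. lborel)) borel (\<lambda>f. \<chi> i. f i)"
proof (rule lborel_eqI)
  fix l u :: "real ^ 'n"
  assume *: "\<And>b. b \<in> Basis \<Longrightarrow> l \<bullet> b \<le> u \<bullet> b"
  have le: "l $ i \<le> u $ i" for i
    using *[of "axis i 1"] by (auto simp: inner_axis Basis_vec_def)
  have "(\<lambda>f. \<chi> i. f i) -` box l u \<inter> space (Pi\<^sub>M UNIV (\<lambda>_. lborel)) = (\<Pi>\<^sub>E i\<in>UNIV. {l $ i <..< u $ i})"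
    by (auto simp: space_PiM mem_box_cart PiE_UNIV_domain Pi_iff)
  then have "emeasure (distr (Pi\<^sub>M UNIV (\<lambda>_. lborel)) borel (\<lambda>f. \<chi> i. f i)) (box l u) =
      (\<Prod>i\<in>UNIV. emeasure lborel {l $ i <..< u $ i})"
    by (subst emeasure_distr) (auto simp: lborel_prod.emeasure_PiM)
  also have "\<dots> = (\<Prod>i\<in>UNIV. ennreal (u $ i - l $ i))"
    using le by simp
  also have "\<dots> = ennreal (\<Prod>i\<in>UNIV. u $ i - l $ i)"
    using le by (simp add: prod_ennreal)
  also have "(\<Prod>i\<in>UNIV. u $ i - l $ i) = (\<Prod>b\<in>Basis. (u - l) \<bullet> b)"
  proof -
    have inj: "inj (\<lambda>i::'n. axis i (1::real))" by (auto simp: inj_on_def axis_eq_axis)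
    have *: "(Basis :: (real^'n) set) = range (\<lambda>i. axis i 1)" by (auto simp: Basis_vec_def)
    show ?thesis
      unfolding * prod.reindex[OF inj] by (simp add: inner_axis)
  qed
  finally show "emeasure (distr (Pi\<^sub>M UNIV (\<lambda>_. lborel)) borel (\<lambda>f. \<chi> i. f i)) (box l u) =
    ennreal (\<Prod>b\<in>Basis. (u - l) \<bullet> b)" .
qed simp

lemma nn_integral_lborel_vec:
  fixes f :: "real ^ 'n::finite \<Rightarrow> ennreal"
  assumes [measurable]: "f \<in> borel_measurable borel"
  shows "(\<integral>\<^sup>+x. f x \<partial>lborel) = (\<integral>\<^sup>+x. f (\<chi> i. x i) \<partial>Pi\<^sub>M UNIV (\<lambda>_. lborel))"
  by (subst lborel_vec_eq_distr) (simp add: nn_integral_distr)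

lemma nn_integral_lborel_vec_prod:
  fixes f :: "'n::finite \<Rightarrow> real \<Rightarrow> ennreal"
  assumes [measurable]: "\<And>i. f i \<in> borel_measurable borel"
  shows "(\<integral>\<^sup>+x. (\<Prod>i\<in>UNIV. f i (x $ i)) \<partial>lborel) = (\<Prod>i\<in>UNIV. \<integral>\<^sup>+x. f i x \<partial>lborel)"
  by (simp add: nn_integral_lborel_vec lborel_prod.product_nn_integral_prod)

lemma integrable_lborel_vec_prod:
  fixes f :: "'n::finite \<Rightarrow> real \<Rightarrow> 'b::{real_normed_field,banach,second_countable_topology}"
  assumes [measurable]: "\<And>i. integrable lborel (f i)"
  shows "integrable lborel (\<lambda>x :: real ^ 'n. \<Prod>i\<in>UNIV. f i (x $ i))"
proof -
  have [measurable]: "f i \<in> borel_measurable borel" for i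
    using borel_measurable_integrable[OF assms, of i] by simp
  show ?thesis
    by (subst lborel_vec_eq_distr, subst integrable_distr_eq)
      (auto intro!: lborel_prod.product_integrable_prod assms)
qed

lemma integral_lborel_vec_prod:
  fixes f :: "'n::finite \<Rightarrow> real \<Rightarrow> 'b::{real_normed_field,banach,second_countable_topology}"
  assumes "\<And>i. integrable lborel (f i)"
  shows "integral\<^sup>L lborel (\<lambda>x:: real ^ 'n. \<Prod>i\<in>UNIV. f i (x $ i)) = (\<Prod>i\<in>UNIV. LINT x|lborel. f i x)"
proof -
  have [measurable]: "f i \<in> borel_measurable borel" for i
    using borel_measurable_integrable[OF assms, of i] by simp
  show ?thesis
    by (subst lborel_vec_eq_distr, subst integral_distr)
      (auto intro!: lborel_prod.product_integral_prod assms)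
qed

lemma nn_integral_even:
  fixes h :: "real \<Rightarrow> ennreal"
  assumes [measurable]: "h \<in> borel_measurable borel"
  shows "(\<integral>\<^sup>+x. h \<bar>x\<bar> \<partial>lborel) = 2 * (\<integral>\<^sup>+x. h x * indicator {0..} x \<partial>lborel)"
proof -
  have "(\<integral>\<^sup>+x. h \<bar>x\<bar> \<partial>lborel) = (\<integral>\<^sup>+x. h x * indicator {0..} x + h (- x) * indicator {..0} x \<partial>lborel)"
    by (rule nn_integral_cong_AE) (use AE_lborel_singleton[of 0] in \<open>eventually_elim, auto split: split_indicator\<close>)
  also have "\<dots> = (\<integral>\<^sup>+x. h x * indicator {0..} x \<partial>lborel) + (\<integral>\<^sup>+x. h (- x) * indicator {..0} x \<partial>lborel)"
    by (rule nn_integral_add) auto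
  also have "(\<integral>\<^sup>+x. h (- x) * indicator {..0} x \<partial>lborel) = (\<integral>\<^sup>+x. h x * indicator {0..} x \<partial>lborel)"
    by (subst nn_integral_real_affine[where c="-1" and t=0]) (auto intro!: nn_integral_cong split: split_indicator)
  finally show ?thesis by (simp add: mult_2)
qed

lemma nn_integral_atLeast_powr:
  fixes r c :: real
  assumes "r > 1" "c > 0"
  shows "(\<integral>\<^sup>+x. ennreal (x powr (-r)) * indicator {c..} x \<partial>lborel) = ennreal (c powr (1 - r) / (r - 1))"
proof -
  have "(\<integral>\<^sup>+x. ennreal (x powr (-r)) * indicator {c..} x \<partial>lborel) = ennreal (0 - (c powr (1 - r) / (1 - r)))"
  proof (rule nn_integral_FTC_atLeast[where F="\<lambda>x. x powr (1 - r) / (1 - r)"])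
    fix x :: real assume "c \<le> x"
    then show "((\<lambda>x. x powr (1 - r) / (1 - r)) has_real_derivative x powr - r) (at x)"
      using assms has_real_derivative_powr[of x "1 - r", THEN DERIV_cdivide, of "1 - r"] by simp
  next
    have "((\<lambda>x. x powr (1 - r)) \<longlongrightarrow> 0) at_top"
      using assms by (intro tendsto_neg_powr filterlim_ident) auto
    then show "((\<lambda>x. x powr (1 - r) / (1 - r)) \<longlongrightarrow> 0) at_top"
      by (rule tendsto_divide_zero)
  qed auto
  also have "0 - (c powr (1 - r) / (1 - r)) = c powr (1 - r) / (r - 1)"
    using assms by (simp add: field_simps)
  finally show ?thesis .
qed

section \<open>Powers of 1 + |x|^2 and their comparison with products\<close>

lemma integrable_japanese_powr:
  fixes r :: real
  assumes "r > 1 / 2"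
  shows "integrable lborel (\<lambda>x::real. (1 + x\<^sup>2) powr (-r))"
proof (rule integrableI_nonneg)
  have A: "(\<integral>\<^sup>+x. ennreal ((1 + x\<^sup>2) powr (-r)) * indicator {0..} x \<partial>lborel) < \<infinity>"
  proof -
    have "(\<integral>\<^sup>+x. ennreal ((1 + x\<^sup>2) powr (-r)) * indicator {0..} x \<partial>lborel) \<le>
        (\<integral>\<^sup>+x. (indicator {0..<1} x + ennreal (x powr (-(2*r))) * indicator {1..} x) \<partial>lborel)"
    proof (rule nn_integral_mono)
      fix x :: real
      have "(1 + x\<^sup>2) powr (-r) \<le> 1"
        using assms by (simp add: powr_minus inverse_le_1_iff ge_one_powr_ge_zero)
      moreover have "(1 + x\<^sup>2) powr (-r) \<le> x powr (-(2*r))" if "x \<ge> 1"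
      proof -
        have "(1 + x\<^sup>2) powr (-r) \<le> (x powr 2) powr (-r)"
          using assms that by (intro powr_mono2') (auto simp: powr_numeral)
        then show ?thesis by (simp only: powr_powr) simp
      qed
      ultimately show "ennreal ((1 + x\<^sup>2) powr (-r)) * indicator {0..} x \<le>
         indicator {0..<1} x + ennreal (x powr (-(2*r))) * indicator {1..} x"
        by (auto split: split_indicator simp: ennreal_le_1 intro: order_trans)
    qed
    also have "\<dots> = 1 + ennreal (1 / (2 * r - 1))"
      using assms nn_integral_atLeast_powr[of "2*r" 1] by (subst nn_integral_add) auto
    also have "\<dots> < \<infinity>" by simp
    finally show ?thesis .
  qed
  show "(\<integral>\<^sup>+x. ennreal ((1 + x\<^sup>2) powr (-r)) \<partial>lborel) < \<infinity>"
    using nn_integral_even[of "\<lambda>x. ennreal ((1 + x\<^sup>2) powr (-r))"] A by (simp add: ennreal_mult_less_top)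
qed auto

text \<open>The bridge between the isotropic weight and the product structure. Each factor is
  enlarged to the full weight, which requires nonnegative exponents. The reverse inequality fails
  even up to constants, so products can be bounded by the Sobolev norm but not conversely.\<close>

lemma one_plus_norm_sq_ge_prod:
  fixes x :: "real ^ 'n::finite" and s :: "'n \<Rightarrow> real"
  assumes "\<And>j. s j \<ge> 0"
  shows "(\<Prod>j\<in>UNIV. (1 + (x $ j)\<^sup>2) powr s j) \<le> (1 + (norm x)\<^sup>2) powr (\<Sum>j\<in>UNIV. s j)"
proof -
  have "(\<Prod>j\<in>UNIV. (1 + (x $ j)\<^sup>2) powr s j) \<le> (\<Prod>j\<in>UNIV. (1 + (norm x)\<^sup>2) powr s j)"
  proof (intro prod_mono conjI powr_mono2 assms)
    fix j
    have "\<bar>x $ j\<bar> \<le> norm x" by (rule component_le_norm_cart)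
    then show "1 + (x $ j)\<^sup>2 \<le> 1 + (norm x)\<^sup>2"
      by (metis abs_le_square_iff abs_norm_cancel add_left_mono)
  qed auto
  also have "\<dots> = (1 + (norm x)\<^sup>2) powr (\<Sum>j\<in>UNIV. s j)"
    by (rule powr_sum[symmetric]) (auto simp: add_nonneg_eq_0_iff)
  finally show ?thesis .
qed

lemma integrable_japanese_powr_vec:
  fixes r :: real
  assumes "r > real CARD('n) / 2"
  shows "integrable lborel (\<lambda>x::real ^ 'n::finite. (1 + (norm x)\<^sup>2) powr (-r))"
proof (rule Bochner_Integration.integrable_bound)
  \<comment> \<open>Sharing \<open>r\<close> equally leaves more than 1/2 for each coordinate, which
    is exactly the one-dimensional condition.\<close>
  define p where "p = r / real CARD('n)"
  have p: "p > 1 / 2" "real CARD('n) * p = r" using assms by (auto simp: p_def field_simps)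
  show "integrable lborel (\<lambda>x::real ^ 'n. \<Prod>j\<in>UNIV. (1 + (x $ j)\<^sup>2) powr (-p))"
    by (intro integrable_lborel_vec_prod integrable_japanese_powr p)
  show "AE x::real ^ 'n in lborel. norm ((1 + (norm x)\<^sup>2) powr (-r)) \<le> norm (\<Prod>j\<in>UNIV. (1 + (x $ j)\<^sup>2) powr (-p))"
  proof (rule AE_I2)
    fix x :: "real ^ 'n"
    have "(\<Prod>j\<in>UNIV. (1 + (x $ j)\<^sup>2) powr p) \<le> (1 + (norm x)\<^sup>2) powr r"
      using one_plus_norm_sq_ge_prod[of "\<lambda>_. p" x] p by simp
    moreover have "(\<Prod>j\<in>UNIV. (1 + (x $ j)\<^sup>2) powr p) > 0"
      by (intro prod_pos) (auto simp: add_nonneg_eq_0_iff)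
    ultimately have "inverse ((1 + (norm x)\<^sup>2) powr r) \<le> inverse (\<Prod>j\<in>UNIV. (1 + (x $ j)\<^sup>2) powr p)"
      by (rule le_imp_inverse_le)
    then show "norm ((1 + (norm x)\<^sup>2) powr (-r)) \<le> norm (\<Prod>j\<in>UNIV. (1 + (x $ j)\<^sup>2) powr (-p))"
      by (simp add: powr_minus prod_inversef[unfolded o_def] prod_nonneg abs_of_nonneg)
  qed
qed auto

section \<open>Oscillatory integrals\<close>

text \<open>Integration by parts against \<open>\<psi> / \<phi>'\<close>. As \<open>\<phi>''\<close>
  has one sign and \<open>\<psi>\<close> decreases, the derivative of this quotient has a majorant
  with an explicit antiderivative, so the bound depends neither on the length of the interval nor on
  the size of \<open>\<phi>''\<close>. Of the constant 4, two units come from the endpoints and two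
  from the variation.\<close>

lemma van_der_Corput_first_pos:
  fixes \<phi> \<phi>' \<phi>'' \<psi> \<psi>' :: "real \<Rightarrow> real"
  assumes "\<alpha> \<le> \<beta>" "\<mu> > 0"
    and \<phi>: "\<And>x. x \<in> {\<alpha>..\<beta>} \<Longrightarrow> (\<phi> has_real_derivative \<phi>' x) (at x)"
    and \<phi>': "\<And>x. x \<in> {\<alpha>..\<beta>} \<Longrightarrow> (\<phi>' has_real_derivative \<phi>'' x) (at x)"
    and \<psi>: "\<And>x. x \<in> {\<alpha>..\<beta>} \<Longrightarrow> (\<psi> has_real_derivative \<psi>' x) (at x)"
    and \<psi>0: "\<And>x. x \<in> {\<alpha>..\<beta>} \<Longrightarrow> \<psi> x \<ge> 0" "\<And>x. x \<in> {\<alpha>..\<beta>} \<Longrightarrow> \<psi>' x \<le> 0"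
    and \<mu>: "\<And>x. x \<in> {\<alpha>..\<beta>} \<Longrightarrow> \<phi>' x \<ge> \<mu>"
    and mono: "(\<forall>x\<in>{\<alpha>..\<beta>}. \<phi>'' x \<ge> 0) \<or> (\<forall>x\<in>{\<alpha>..\<beta>}. \<phi>'' x \<le> 0)"
  shows "cmod (integral {\<alpha>..\<beta>} (\<lambda>x. iexp (\<phi> x) * complex_of_real (\<psi> x))) \<le> 4 * \<psi> \<alpha> / \<mu>"
proof -
  define Q where "Q = (\<lambda>x. \<psi> x / \<phi>' x)"
  define Q' where "Q' = (\<lambda>x. \<psi>' x / \<phi>' x - \<psi> x * \<phi>'' x / (\<phi>' x)\<^sup>2)"
  define E where "E = (\<lambda>x. iexp (\<phi> x))"
  have nz: "\<phi>' x > 0" if "x \<in> {\<alpha>..\<beta>}" for x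
    using \<mu>[OF that] \<open>\<mu> > 0\<close> by simp
  have E1: "cmod (E x) = 1" for x by (simp add: E_def)
  have QD: "(Q has_real_derivative Q' x) (at x)" if "x \<in> {\<alpha>..\<beta>}" for x
    unfolding Q_def Q'_def using nz[OF that] \<phi>'[OF that] \<psi>[OF that]
    by (auto intro!: derivative_eq_intros simp: field_simps power2_eq_square)
  have ED: "(E has_vector_derivative (\<i> * \<phi>' x * E x)) (at x)" if "x \<in> {\<alpha>..\<beta>}" for x
  proof -
    have "((\<lambda>x. \<i> * complex_of_real (\<phi> x)) has_vector_derivative (\<i> * complex_of_real (\<phi>' x))) (at x)"
      using \<phi>[OF that] by (intro has_vector_derivative_mult_right has_vector_derivative_of_real)
        (simp add: has_real_derivative_iff_has_vector_derivative)
    from field_vector_diff_chain_at[OF this DERIV_exp] show ?thesis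
      by (simp add: E_def o_def mult_ac)
  qed
  have 1: "((\<lambda>x. E x * of_real (Q x)) has_vector_derivative
      \<i> * (E x * of_real (\<psi> x)) + E x * of_real (Q' x)) (at x)" if "x \<in> {\<alpha>..\<beta>}" for x
  proof -
    have "((\<lambda>x. complex_of_real (Q x)) has_vector_derivative of_real (Q' x)) (at x)"
      using QD[OF that] by (intro has_vector_derivative_of_real)
        (simp add: has_real_derivative_iff_has_vector_derivative)
    from has_vector_derivative_mult[OF ED[OF that] this] show ?thesis
      using nz[OF that] by (simp add: Q_def field_simps)
  qed
  have int1: "((\<lambda>x. \<i> * (E x * of_real (\<psi> x)) + E x * of_real (Q' x)) has_integral
      (E \<beta> * of_real (Q \<beta>) - E \<alpha> * of_real (Q \<alpha>))) {\<alpha>..\<beta>}"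
    using 1 \<open>\<alpha> \<le> \<beta>\<close> by (intro fundamental_theorem_of_calculus)
      (auto intro: has_vector_derivative_at_within)
  have cont: "continuous_on {\<alpha>..\<beta>} (\<lambda>x. E x * of_real (\<psi> x))"
    unfolding E_def
    by (intro continuous_intros continuous_at_imp_continuous_on ballI DERIV_isCont[OF \<phi>] DERIV_isCont[OF \<psi>])
  have int2: "(\<lambda>x. E x * of_real (\<psi> x)) integrable_on {\<alpha>..\<beta>}"
    by (rule integrable_continuous_real[OF cont])
  have int3: "(\<lambda>x. E x * of_real (Q' x)) integrable_on {\<alpha>..\<beta>}"
    using integrable_diff[OF has_integral_integrable[OF int1] integrable_on_mult_right[OF int2, of \<i>]]
    by simp
  have eq: "\<i> * integral {\<alpha>..\<beta>} (\<lambda>x. E x * of_real (\<psi> x)) =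
     E \<beta> * of_real (Q \<beta>) - E \<alpha> * of_real (Q \<alpha>) - integral {\<alpha>..\<beta>} (\<lambda>x. E x * of_real (Q' x))"
    using integral_unique[OF int1] int2 int3 by (simp add: integral_add) (metis add_diff_cancel_right')
  \<comment> \<open>The constant sign of \<open>\<phi>''\<close>; it turns the absolute value of
    \<open>\<phi>''\<close> back into an exact derivative.\<close>
  obtain \<sigma> :: real where \<sigma>: "\<sigma> = 1 \<or> \<sigma> = -1" "\<And>x. x \<in> {\<alpha>..\<beta>} \<Longrightarrow> \<bar>\<phi>'' x\<bar> = \<sigma> * \<phi>'' x"
  proof (cases "\<forall>x\<in>{\<alpha>..\<beta>}. \<phi>'' x \<ge> 0")
    case True then show ?thesis by (intro that[of 1]) auto
  next
    case False then have "\<forall>x\<in>{\<alpha>..\<beta>}. \<phi>'' x \<le> 0" using mono by auto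
    then show ?thesis by (intro that[of "-1"]) auto
  qed
  \<comment> \<open>\<open>B\<close> dominates the modulus of \<open>Q'\<close> once
    \<open>\<psi>\<close> is frozen at its maximum \<open>\<psi> \<alpha>\<close> and, in the term
    with \<open>\<psi>'\<close>, \<open>\<phi>'\<close> is replaced by its lower bound
    \<open>\<mu>\<close>. \<open>P\<close> is its antiderivative, so only endpoint values
    remain.\<close>
  define B where "B = (\<lambda>x. - \<psi>' x / \<mu> + \<psi> \<alpha> * (\<sigma> * \<phi>'' x) / (\<phi>' x)\<^sup>2)"
  define P where "P = (\<lambda>x. - \<psi> x / \<mu> - \<psi> \<alpha> * \<sigma> / \<phi>' x)"
  have PD: "(P has_real_derivative B x) (at x)" if "x \<in> {\<alpha>..\<beta>}" for x
    unfolding P_def B_def using nz[OF that] \<phi>'[OF that] \<psi>[OF that] \<open>\<mu> > 0\<close>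
    by (auto intro!: derivative_eq_intros simp: field_simps power2_eq_square)
  have intB: "(B has_integral (P \<beta> - P \<alpha>)) {\<alpha>..\<beta>}"
  proof (rule fundamental_theorem_of_calculus)
    show "(P has_vector_derivative B x) (at x within {\<alpha>..\<beta>})" if "x \<in> {\<alpha>..\<beta>}" for x
      using has_field_derivative_at_within[OF PD[OF that]]
      by (rule has_real_derivative_iff_has_vector_derivative[THEN iffD1])
  qed fact
  have anti: "\<psi> x \<le> \<psi> \<alpha>" if "x \<in> {\<alpha>..\<beta>}" for x
  proof (rule DERIV_nonpos_imp_nonincreasing[where f=\<psi>])
    show "\<exists>y. (\<psi> has_real_derivative y) (at z) \<and> y \<le> 0" if "\<alpha> \<le> z" "z \<le> x" for z
      using \<psi>[of z] \<psi>0(2)[of z] that \<open>x \<in> {\<alpha>..\<beta>}\<close> by (intro exI[of _ "\<psi>' z"]) simp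
  qed (use that in auto)
  have "cmod (integral {\<alpha>..\<beta>} (\<lambda>x. E x * of_real (Q' x))) \<le> integral {\<alpha>..\<beta>} B"
  proof (rule Henstock_Kurzweil_Integration.integral_norm_bound_integral[OF int3 has_integral_integrable[OF intB]])
    fix x assume x: "x \<in> {\<alpha>..\<beta>}"
    have "cmod (E x * of_real (Q' x)) = \<bar>Q' x\<bar>" by (simp add: norm_mult E1)
    also have "\<dots> \<le> \<bar>\<psi>' x / \<phi>' x\<bar> + \<bar>\<psi> x * \<phi>'' x / (\<phi>' x)\<^sup>2\<bar>"
      unfolding Q'_def by (rule abs_triangle_ineq4)
    also have "\<bar>\<psi>' x / \<phi>' x\<bar> = - \<psi>' x / \<phi>' x"
      using nz[OF x] \<psi>0(2)[OF x] by (simp add: abs_of_nonpos divide_nonpos_pos)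
    also have "- \<psi>' x / \<phi>' x \<le> - \<psi>' x / \<mu>"
      using \<mu>[OF x] \<open>\<mu> > 0\<close> \<psi>0(2)[OF x] by (intro divide_left_mono) auto
    also have "\<bar>\<psi> x * \<phi>'' x / (\<phi>' x)\<^sup>2\<bar> = \<psi> x * \<bar>\<phi>'' x\<bar> / (\<phi>' x)\<^sup>2"
      using \<psi>0(1)[OF x] by (simp add: abs_mult)
    also have "\<dots> \<le> \<psi> \<alpha> * \<bar>\<phi>'' x\<bar> / (\<phi>' x)\<^sup>2"
      using anti[OF x] by (intro divide_right_mono mult_right_mono) auto
    finally show "cmod (E x * of_real (Q' x)) \<le> B x"
      by (simp add: B_def \<sigma>(2)[OF x])
  qed
  also have "\<dots> = P \<beta> - P \<alpha>" using intB by (rule integral_unique)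
  also have "\<dots> \<le> 2 * \<psi> \<alpha> / \<mu>"
  proof -
    have r: "0 \<le> 1 / \<phi>' x" "1 / \<phi>' x \<le> 1 / \<mu>" if "x \<in> {\<alpha>..\<beta>}" for x
      using \<mu>[OF that] \<open>\<mu> > 0\<close> by (auto simp: field_simps)
    have ab: "\<alpha> \<in> {\<alpha>..\<beta>}" "\<beta> \<in> {\<alpha>..\<beta>}" using \<open>\<alpha> \<le> \<beta>\<close> by auto
    have "\<sigma> * (1 / \<phi>' \<alpha> - 1 / \<phi>' \<beta>) \<le> 1 / \<mu>"
    proof -
      have "1 / \<phi>' \<alpha> - 1 / \<phi>' \<beta> \<le> 1 / \<mu>" "1 / \<phi>' \<beta> - 1 / \<phi>' \<alpha> \<le> 1 / \<mu>"
        using r[OF ab(1)] r[OF ab(2)] by linarith+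
      then show ?thesis using \<sigma>(1) by auto
    qed
    then have "\<psi> \<alpha> * (\<sigma> * (1 / \<phi>' \<alpha> - 1 / \<phi>' \<beta>)) \<le> \<psi> \<alpha> * (1 / \<mu>)"
      using \<psi>0(1)[OF ab(1)] by (rule mult_left_mono)
    moreover have "\<psi> \<beta> / \<mu> \<ge> 0" using \<psi>0(1)[OF ab(2)] \<open>\<mu> > 0\<close> by simp
    moreover have "P \<beta> - P \<alpha> = \<psi> \<alpha> / \<mu> - \<psi> \<beta> / \<mu> + \<psi> \<alpha> * (\<sigma> * (1 / \<phi>' \<alpha> - 1 / \<phi>' \<beta>))"
      by (simp add: P_def algebra_simps)
    moreover have "2 * \<psi> \<alpha> / \<mu> = \<psi> \<alpha> / \<mu> + \<psi> \<alpha> * (1 / \<mu>)" by simp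
    ultimately show ?thesis by linarith
  qed
  finally have 3: "cmod (integral {\<alpha>..\<beta>} (\<lambda>x. E x * of_real (Q' x))) \<le> 2 * \<psi> \<alpha> / \<mu>" .
  have Qb: "\<bar>Q x\<bar> \<le> \<psi> \<alpha> / \<mu>" if "x \<in> {\<alpha>..\<beta>}" for x
    unfolding Q_def using nz[OF that] \<psi>0(1)[OF that] \<mu>[OF that] anti[OF that] \<open>\<mu> > 0\<close>
    by (auto intro!: frac_le)
  have "cmod (integral {\<alpha>..\<beta>} (\<lambda>x. E x * of_real (\<psi> x))) =
     cmod (E \<beta> * of_real (Q \<beta>) - E \<alpha> * of_real (Q \<alpha>) - integral {\<alpha>..\<beta>} (\<lambda>x. E x * of_real (Q' x)))"
    unfolding eq[symmetric] by (simp add: norm_mult)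
  also have "\<dots> \<le> cmod (E \<beta> * of_real (Q \<beta>)) + cmod (E \<alpha> * of_real (Q \<alpha>)) + cmod (integral {\<alpha>..\<beta>} (\<lambda>x. E x * of_real (Q' x)))"
    by (meson add_mono norm_triangle_ineq4 order_refl order_trans)
  also have "\<dots> \<le> \<psi> \<alpha> / \<mu> + \<psi> \<alpha> / \<mu> + 2 * \<psi> \<alpha> / \<mu>"
    using Qb[of \<alpha>] Qb[of \<beta>] \<open>\<alpha> \<le> \<beta>\<close> 3 by (intro add_mono) (auto simp: norm_mult E1)
  finally show ?thesis by (simp add: E_def)
qed

lemma van_der_Corput_first:
  fixes \<phi> \<phi>' \<phi>'' \<psi> \<psi>' :: "real \<Rightarrow> real"
  assumes "\<alpha> \<le> \<beta>" "\<mu> > 0"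
    and \<phi>: "\<And>x. x \<in> {\<alpha>..\<beta>} \<Longrightarrow> (\<phi> has_real_derivative \<phi>' x) (at x)"
    and \<phi>': "\<And>x. x \<in> {\<alpha>..\<beta>} \<Longrightarrow> (\<phi>' has_real_derivative \<phi>'' x) (at x)"
    and \<psi>: "\<And>x. x \<in> {\<alpha>..\<beta>} \<Longrightarrow> (\<psi> has_real_derivative \<psi>' x) (at x)"
    and \<psi>0: "\<And>x. x \<in> {\<alpha>..\<beta>} \<Longrightarrow> \<psi> x \<ge> 0" "\<And>x. x \<in> {\<alpha>..\<beta>} \<Longrightarrow> \<psi>' x \<le> 0"
    and \<mu>: "(\<forall>x\<in>{\<alpha>..\<beta>}. \<phi>' x \<ge> \<mu>) \<or> (\<forall>x\<in>{\<alpha>..\<beta>}. \<phi>' x \<le> - \<mu>)"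
    and mono: "(\<forall>x\<in>{\<alpha>..\<beta>}. \<phi>'' x \<ge> 0) \<or> (\<forall>x\<in>{\<alpha>..\<beta>}. \<phi>'' x \<le> 0)"
  shows "cmod (integral {\<alpha>..\<beta>} (\<lambda>x. iexp (\<phi> x) * complex_of_real (\<psi> x))) \<le> 4 * \<psi> \<alpha> / \<mu>"
  using \<mu>
proof
  assume "\<forall>x\<in>{\<alpha>..\<beta>}. \<phi>' x \<ge> \<mu>"
  then show ?thesis
    by (intro van_der_Corput_first_pos[OF assms(1,2) \<phi> \<phi>' \<psi> \<psi>0 _ mono]) auto
next
  assume *: "\<forall>x\<in>{\<alpha>..\<beta>}. \<phi>' x \<le> - \<mu>"
  then have **: "\<forall>x\<in>{\<alpha>..\<beta>}. \<mu> \<le> - \<phi>' x" by force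
  \<comment> \<open>A decreasing phase becomes an increasing one under complex conjugation.\<close>
  have "cmod (integral {\<alpha>..\<beta>} (\<lambda>x. iexp (- \<phi> x) * complex_of_real (\<psi> x))) \<le> 4 * \<psi> \<alpha> / \<mu>"
  proof (rule van_der_Corput_first_pos[where \<phi>'="\<lambda>x. - \<phi>' x" and \<phi>''="\<lambda>x. - \<phi>'' x" and \<psi>'=\<psi>'])
    show "(\<forall>x\<in>{\<alpha>..\<beta>}. 0 \<le> - \<phi>'' x) \<or> (\<forall>x\<in>{\<alpha>..\<beta>}. - \<phi>'' x \<le> 0)"
      using mono by auto
    show "((\<lambda>x. - \<phi> x) has_real_derivative - \<phi>' x) (at x)"
      "((\<lambda>x. - \<phi>' x) has_real_derivative - \<phi>'' x) (at x)" if "x \<in> {\<alpha>..\<beta>}" for x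
      using \<phi>[OF that] \<phi>'[OF that] by (simp_all add: DERIV_minus)
  qed (use assms(1,2) ** in \<open>auto intro: \<psi> \<psi>0\<close>)
  also have "integral {\<alpha>..\<beta>} (\<lambda>x. iexp (- \<phi> x) * complex_of_real (\<psi> x)) =
      cnj (integral {\<alpha>..\<beta>} (\<lambda>x. iexp (\<phi> x) * complex_of_real (\<psi> x)))"
    unfolding Henstock_Kurzweil_Integration.integral_cnj by (simp add: exp_cnj)
  finally show ?thesis by simp
qed

text \<open>With b = a - 1 this keeps the derivative of the phase away from zero off the stationary
  point \<xi>, where it equals u (1 - r^b) with r = x/\<xi>. For b < 1 the lower half is the
  weighted arithmetic-geometric inequality. The upper half is its reciprocal, taken at e = d/(1 + d)
  \<ge> d/2, and this is why \<open>c\<close> gives away half of min 1 b.\<close>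

lemma powr_gap:
  fixes b d r :: real
  assumes "b > 0" "0 \<le> d" "d \<le> 1"
  defines "c \<equiv> min 1 b / 2"
  shows "0 \<le> r \<Longrightarrow> r \<le> 1 - d \<Longrightarrow> r powr b \<le> 1 - c * d"
    and "1 + d \<le> r \<Longrightarrow> r powr b \<ge> 1 + c * d"
proof -
  have low: "(1 - e) powr b \<le> 1 - 2 * c * e" if "0 \<le> e" "e \<le> 1" for e
  proof (cases "e = 1")
    case True then show ?thesis using assms by auto
  next
    case False
    then have e: "0 \<le> e" "e < 1" using that by auto
    show ?thesis
    proof (cases "b \<ge> 1")
      case True
      have "(1 - e) powr b \<le> (1 - e) powr 1"
        using True e by (intro powr_mono') auto
      then show ?thesis using e True by (simp add: c_def)
    next
      case b: False
      have "(1 - e) powr b * 1 powr (1 - b) \<le> b * (1 - e) + (1 - b) * 1"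
        using e b assms by (intro Youngs_inequality_0) auto
      then show ?thesis using b by (simp add: c_def algebra_simps min_def)
    qed
  qed
  {
    assume "0 \<le> r" "r \<le> 1 - d"
    then have "r powr b \<le> (1 - d) powr b" using assms by (intro powr_mono2) auto
    moreover have "c * d \<ge> 0" using assms by simp
    then have "1 - 2 * c * d \<le> 1 - c * d" by simp
    ultimately show "r powr b \<le> 1 - c * d" using low[of d] assms(2,3) by linarith
  }
  {
    assume r: "1 + d \<le> r"
    define e where "e = d / (1 + d)"
    have e: "0 \<le> e" "e < 1" "d / 2 \<le> e" "1 - e = 1 / (1 + d)"
      using assms by (auto simp: e_def field_simps intro: mult_left_le)
    have c: "0 < c" "2 * c \<le> 1" using assms by (auto simp: c_def)
    have pos: "1 - 2 * c * e > 0"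
      using mult_mono[of "2 * c" 1 e e] c e by auto
    have "(1 / (1 + d)) powr b \<le> 1 - 2 * c * e" using low[of e] e by simp
    then have "1 / (1 + d) powr b \<le> 1 - 2 * c * e" using assms by (simp add: powr_divide)
    then have "1 \<le> (1 + d) powr b * (1 - 2 * c * e)"
      using assms by (simp add: field_simps)
    moreover have "(1 + 2 * c * e) * (1 - 2 * c * e) = 1 - (2 * (c * e))\<^sup>2"
      by (simp add: power2_eq_square algebra_simps)
    then have "(1 + 2 * c * e) * (1 - 2 * c * e) \<le> 1" by simp
    ultimately have "(1 + 2 * c * e) * (1 - 2 * c * e) \<le> (1 + d) powr b * (1 - 2 * c * e)" by linarith
    then have "1 + 2 * c * e \<le> (1 + d) powr b" using pos by simp
    moreover have "(1 + d) powr b \<le> r powr b" using r assms by (intro powr_mono2) auto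
    moreover have "c * d \<le> 2 * c * e" using mult_left_mono[OF e(3), of "2*c"] c by simp
    ultimately show "r powr b \<ge> 1 + c * d" by linarith
  }
qed

text \<open>The stationary point of \<open>u x + \<tau> x powr a\<close> on the half-line when \<open>\<tau> < 0 < u\<close>.\<close>

definition osc_point :: "real \<Rightarrow> real \<Rightarrow> real \<Rightarrow> real" where
  "osc_point a u \<tau> = (u / (a * \<bar>\<tau>\<bar>)) powr (1 / (a - 1))"

text \<open>Near the stationary point \<xi> the second derivative of the phase has size u/\<xi>, so
  an interval of half-length \<delta> = sqrt(\<xi>/u) is estimated trivially. Just outside it the
  first derivative is at least a multiple of u \<delta>/\<xi> = 1/\<delta>, and the first-derivative
  test costs \<delta> once more. Left of \<xi>/2 the derivative has size u, which contributes
  \<open>\<psi> \<epsilon> / u\<close>. As \<open>\<psi>\<close> decreases, the stationary part only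
  sees its value at \<open>max \<epsilon> (\<xi> / 2)\<close>.\<close>

lemma oscillatory_half_line:
  fixes a u \<tau> \<epsilon> N :: real and \<psi> \<psi>' :: "real \<Rightarrow> real"
  assumes a: "a > 1" and u: "u > 0" and \<epsilon>: "0 < \<epsilon>" "\<epsilon> \<le> N"
    and \<psi>: "\<And>x. x > 0 \<Longrightarrow> (\<psi> has_real_derivative \<psi>' x) (at x)"
    and \<psi>0: "\<And>x. x > 0 \<Longrightarrow> \<psi> x \<ge> 0" "\<And>x. x > 0 \<Longrightarrow> \<psi>' x \<le> 0"
  defines "c \<equiv> min 1 (a - 1) / 2"
  defines "\<xi> \<equiv> osc_point a u \<tau>"
  shows "cmod (integral {\<epsilon>..N} (\<lambda>x. iexp (u * x + \<tau> * x powr a) * complex_of_real (\<psi> x)))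
    \<le> 16 / c * (\<psi> \<epsilon> / u + (if \<tau> < 0 then \<psi> (max \<epsilon> (\<xi> / 2)) * sqrt (\<xi> / u) else 0))"
proof -
  define f where "f = (\<lambda>x. iexp (u * x + \<tau> * x powr a) * complex_of_real (\<psi> x))"
  define \<phi>' where "\<phi>' = (\<lambda>x. u + \<tau> * (a * x powr (a - 1)))"
  define \<phi>'' where "\<phi>'' = (\<lambda>x. \<tau> * (a * ((a - 1) * x powr (a - 2))))"
  have c: "0 < c" "c \<le> 1/2" using a by (auto simp: c_def)
  have \<phi>: "((\<lambda>x. u * x + \<tau> * x powr a) has_real_derivative \<phi>' x) (at x)" if "x > 0" for x
    unfolding \<phi>'_def
    by (intro DERIV_add DERIV_cmult_Id DERIV_cmult has_real_derivative_powr that)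
  have \<phi>': "(\<phi>' has_real_derivative \<phi>'' x) (at x)" if "x > 0" for x
    unfolding \<phi>'_def \<phi>''_def
    using DERIV_add[OF DERIV_const DERIV_cmult[OF DERIV_cmult[OF has_real_derivative_powr[OF that, of "a - 1"]]]]
    by simp
  have vdC: "cmod (integral {\<alpha>..\<beta>} f) \<le> 4 * \<psi> \<alpha> / \<mu>"
    if "0 < \<alpha>" "\<alpha> \<le> \<beta>" "\<mu> > 0" "(\<forall>x\<in>{\<alpha>..\<beta>}. \<phi>' x \<ge> \<mu>) \<or> (\<forall>x\<in>{\<alpha>..\<beta>}. \<phi>' x \<le> - \<mu>)" for \<alpha> \<beta> \<mu>
    unfolding f_def
  proof (rule van_der_Corput_first[where \<phi>'=\<phi>' and \<phi>''=\<phi>'' and \<psi>'=\<psi>'])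
    show "(\<forall>x\<in>{\<alpha>..\<beta>}. 0 \<le> \<phi>'' x) \<or> (\<forall>x\<in>{\<alpha>..\<beta>}. \<phi>'' x \<le> 0)"
      using a by (cases "\<tau> \<ge> 0") (auto simp: \<phi>''_def mult_nonneg_nonneg mult_nonpos_nonneg)
  qed (use that in \<open>auto intro!: \<phi> \<phi>' \<psi> \<psi>0\<close>)
  have anti: "\<psi> y \<le> \<psi> x" if "0 < x" "x \<le> y" for x y
  proof (rule DERIV_nonpos_imp_nonincreasing[where f=\<psi>])
    show "\<exists>y'. (\<psi> has_real_derivative y') (at z) \<and> y' \<le> 0" if "x \<le> z" "z \<le> y" for z
      using \<psi>[of z] \<psi>0(2)[of z] that \<open>0 < x\<close> by (intro exI[of _ "\<psi>' z"]) simp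
  qed (use that in auto)
  have intf: "f integrable_on {x..y}" if "x > 0" for x y
  proof (intro integrable_continuous_real continuous_at_imp_continuous_on ballI)
    fix z assume "z \<in> {x..y}"
    then have z: "z > 0" using that by auto
    show "isCont f z"
      unfolding f_def
      by (intro isCont_mult isCont_exp' continuous_of_real continuous_const
          DERIV_isCont[OF \<phi>[OF z]] DERIV_isCont[OF \<psi>[OF z]])
  qed
  have \<psi>\<epsilon>: "\<psi> \<epsilon> / u \<ge> 0" using \<psi>0(1)[OF \<epsilon>(1)] u by simp
  show ?thesis
  proof (cases "\<tau> < 0")
    case False
    have "cmod (integral {\<epsilon>..N} f) \<le> 4 * \<psi> \<epsilon> / u"
      using False a u \<epsilon> by (intro vdC) (auto simp: \<phi>'_def)
    also have "\<dots> = 4 * (\<psi> \<epsilon> / u)" by simp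
    also have "\<dots> \<le> 16 / c * (\<psi> \<epsilon> / u)"
      using c \<psi>\<epsilon> by (intro mult_right_mono) (auto simp: field_simps)
    finally show ?thesis using False by (simp add: f_def)
  next
    case True
    have \<xi>: "\<xi> > 0" unfolding \<xi>_def osc_point_def using True a u by simp
    have \<xi>b: "\<xi> powr (a - 1) = u / (a * - \<tau>)"
      unfolding \<xi>_def osc_point_def abs_of_neg[OF True]
      using True a u mult_pos_neg[of a \<tau>] by (simp add: powr_powr abs_of_neg)
    have \<phi>'eq: "\<phi>' x = u * (1 - (x / \<xi>) powr (a - 1))" if "x > 0" for x
      using that \<xi> True a u by (simp add: \<phi>'_def powr_divide \<xi>b field_simps)
    define \<delta> where "\<delta> = sqrt (\<xi> / u)"
    have \<delta>: "\<delta> > 0" "\<delta> * \<delta> = \<xi> / u" using \<xi> u by (auto simp: \<delta>_def)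
    define M where "M = max \<epsilon> (\<xi> / 2)"
    have M: "M > 0" "M \<ge> \<epsilon>" "M \<ge> \<xi> / 2" using \<epsilon> by (auto simp: M_def)
    have \<psi>M: "\<psi> M \<ge> 0" using \<psi>0(1)[OF M(1)] .
    \<comment> \<open>Break points \<xi>/2, \<xi> - \<delta> and \<xi> + \<delta>, clamped so that
      they stay ordered inside [\<epsilon>, N]. A piece that is missed has length zero;
      \<open>lb\<close> and \<open>ub\<close> recover the intended position of the others.\<close>
    define p1 where "p1 = max \<epsilon> (min N (\<xi> / 2))"
    define p2 where "p2 = max p1 (min N (\<xi> - \<delta>))"
    define p3 where "p3 = max p2 (min N (\<xi> + \<delta>))"
    have p: "\<epsilon> \<le> p1" "p1 \<le> p2" "p2 \<le> p3" "p3 \<le> N" "0 < p1" "0 < p2" "0 < p3"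
      using \<epsilon> by (auto simp: p1_def p2_def p3_def)
    have lb: "p1 < N \<Longrightarrow> M \<le> p1" "p2 < N \<Longrightarrow> \<xi> - \<delta> \<le> p2" "p3 < N \<Longrightarrow> \<xi> + \<delta> \<le> p3"
      unfolding p1_def p2_def p3_def M_def less_max_iff_disj max_less_iff_conj min_less_iff_disj le_max_iff_disj
      by auto
    have ub: "p2 \<noteq> p1 \<Longrightarrow> p2 \<le> \<xi> - \<delta> \<and> p2 \<le> N" "p3 \<noteq> p2 \<Longrightarrow> p3 \<le> \<xi> + \<delta> \<and> p3 \<le> N"
      by (simp_all add: p2_def p3_def max_def split: if_splits)
    have I1: "cmod (integral {\<epsilon>..p1} f) \<le> 8 / c * (\<psi> \<epsilon> / u)"
    proof (cases "p1 = \<epsilon>")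
      case True then show ?thesis using c \<psi>0(1)[OF \<epsilon>(1)] u by simp
    next
      case False
      then have p1: "p1 \<le> \<xi> / 2" by (auto simp: p1_def)
      have "cmod (integral {\<epsilon>..p1} f) \<le> 4 * \<psi> \<epsilon> / (u * (c * (1 / 2)))"
      proof (rule vdC)
        have "u * (c * (1 / 2)) \<le> \<phi>' x" if "x \<in> {\<epsilon>..p1}" for x
        proof -
          have x: "x > 0" "x / \<xi> \<le> 1 - 1 / 2" using that p1 \<epsilon> \<xi> by (auto simp: field_simps)
          have "(x / \<xi>) powr (a - 1) \<le> 1 - c * (1 / 2)"
            unfolding c_def using x \<xi> a by (intro powr_gap(1)) auto
          then show ?thesis unfolding \<phi>'eq[OF x(1)] using u by (intro mult_left_mono) auto
        qed
        then show "(\<forall>x\<in>{\<epsilon>..p1}. u * (c * (1 / 2)) \<le> \<phi>' x) \<or> (\<forall>x\<in>{\<epsilon>..p1}. \<phi>' x \<le> - (u * (c * (1 / 2))))" by blast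
      qed (use \<epsilon> p c u in auto)
      also have "\<dots> = 8 / c * (\<psi> \<epsilon> / u)" by simp
      finally show ?thesis .
    qed
    have I2: "cmod (integral {p1..p2} f) \<le> 4 / c * (\<psi> M * \<delta>)"
    proof (cases "p2 = p1")
      case True then show ?thesis using c \<psi>M \<delta> by simp
    next
      case False
      then have *: "p2 \<le> \<xi> - \<delta>" "p1 \<ge> M" "p2 \<le> N" using p lb ub by auto
      have "cmod (integral {p1..p2} f) \<le> 4 * \<psi> p1 / (c / \<delta>)"
      proof (rule vdC)
        have "c / \<delta> \<le> \<phi>' x" if "x \<in> {p1..p2}" for x
        proof -
          have x: "x > 0" "x / \<xi> \<le> 1 - \<delta> / \<xi>" using that p * \<xi> by (auto simp: field_simps)
          have "(x / \<xi>) powr (a - 1) \<le> 1 - c * (\<delta> / \<xi>)"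
            unfolding c_def using x \<xi> a \<delta> * p by (intro powr_gap(1)) auto
          then have "u * (c * (\<delta> / \<xi>)) \<le> \<phi>' x" unfolding \<phi>'eq[OF x(1)] using u by (intro mult_left_mono) auto
          moreover have "u * (c * (\<delta> / \<xi>)) = c / \<delta>" using \<delta> \<xi> u by (simp add: field_simps)
          ultimately show ?thesis by simp
        qed
        then show "(\<forall>x\<in>{p1..p2}. c / \<delta> \<le> \<phi>' x) \<or> (\<forall>x\<in>{p1..p2}. \<phi>' x \<le> - (c / \<delta>))" by blast
      qed (use p c \<delta> in auto)
      also have "\<dots> = 4 / c * (\<psi> p1 * \<delta>)" by simp
      also have "\<dots> \<le> 4 / c * (\<psi> M * \<delta>)"
        using anti[OF M(1) *(2)] c \<delta> by (intro mult_left_mono mult_right_mono) auto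
      finally show ?thesis .
    qed
    have I3: "cmod (integral {p2..p3} f) \<le> 2 * (\<psi> M * \<delta>)"
    proof (cases "p3 = p2")
      case True then show ?thesis using \<psi>M \<delta> by simp
    next
      case False
      then have *: "p3 \<le> \<xi> + \<delta>" "p2 \<ge> M" "p2 \<ge> \<xi> - \<delta>" using p lb ub by auto
      have "cmod (integral (cbox p2 p3) f) \<le> \<psi> M * measure lborel (cbox p2 p3)"
      proof (rule has_integral_bound)
        show "(f has_integral integral (cbox p2 p3) f) (cbox p2 p3)"
          using intf[OF \<open>p2 > 0\<close>] by (simp add: integrable_integral)
        fix x assume "x \<in> cbox p2 p3"
        then have x: "x \<ge> p2" by simp
        have "cmod (f x) = \<psi> x" using x p \<psi>0(1)[of x] by (simp add: f_def norm_mult)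
        also have "\<dots> \<le> \<psi> M" using anti[of M x] M(1) * x by auto
        finally show "cmod (f x) \<le> \<psi> M" .
      qed (rule \<psi>M)
      also have "\<dots> \<le> \<psi> M * (2 * \<delta>)" using * p \<psi>M by (intro mult_left_mono) auto
      finally show ?thesis by simp
    qed
    have I4: "cmod (integral {p3..N} f) \<le> 4 / c * (\<psi> M * \<delta> + \<psi> \<epsilon> / u)"
    proof (cases "p3 = N")
      case True
      have "0 \<le> 4 / c * (\<psi> M * \<delta> + \<psi> \<epsilon> / u)"
        using c \<psi>M \<delta> \<psi>\<epsilon> by (intro mult_nonneg_nonneg add_nonneg_nonneg) auto
      then show ?thesis using True by simp
    next
      case False
      then have *: "p3 \<ge> \<xi> + \<delta>" "p3 \<ge> M" "p3 \<ge> \<epsilon>" using p lb M by auto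
      \<comment> \<open>\<open>powr_gap\<close> accepts gaps up to 1 only. If \<delta> exceeds \<xi>
        the gap is 1, the derivative has size u, and this piece joins the term
        \<open>\<psi> \<epsilon> / u\<close>.\<close>
      define d where "d = min 1 (\<delta> / \<xi>)"
      have d: "d > 0" "d \<le> 1" "d \<le> \<delta> / \<xi>" using \<delta> \<xi> by (auto simp: d_def)
      have "cmod (integral {p3..N} f) \<le> 4 * \<psi> p3 / (u * (c * d))"
      proof (rule vdC)
        have "\<phi>' x \<le> - (u * (c * d))" if "x \<in> {p3..N}" for x
        proof -
          have x: "x > 0" using that p by auto
          have "\<xi> + \<delta> \<le> x" using that * by auto
          then have "(\<xi> + \<delta>) / \<xi> \<le> x / \<xi>" using \<xi> by (intro divide_right_mono) auto
          then have "1 + \<delta> / \<xi> \<le> x / \<xi>" using \<xi> by (simp add: add_divide_distrib)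
          then have "1 + d \<le> x / \<xi>" using d by linarith
          then have "(x / \<xi>) powr (a - 1) \<ge> 1 + c * d"
            unfolding c_def using a d by (intro powr_gap(2)) auto
          then have "u * (1 - (x / \<xi>) powr (a - 1)) \<le> u * (- (c * d))" using u by (intro mult_left_mono) auto
          then show ?thesis unfolding \<phi>'eq[OF x(1)] by simp
        qed
        then show "(\<forall>x\<in>{p3..N}. u * (c * d) \<le> \<phi>' x) \<or> (\<forall>x\<in>{p3..N}. \<phi>' x \<le> - (u * (c * d)))" by blast
      qed (use p c d u in auto)
      also have "\<dots> = 4 / c * (\<psi> p3 / (u * d))" by simp
      also have "\<dots> \<le> 4 / c * (\<psi> M * \<delta> + \<psi> \<epsilon> / u)"
      proof (intro mult_left_mono)
        have "\<psi> p3 / (u * d) \<le> \<psi> M * \<delta>" if "d = \<delta> / \<xi>"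
        proof -
          have "1 / (u * d) = \<delta>" using \<delta> \<xi> u by (simp add: that field_simps)
          then have "\<psi> p3 / (u * d) = \<psi> p3 * \<delta>" by (metis times_divide_eq_right mult.right_neutral)
          then show ?thesis using anti[OF M(1) *(2)] \<delta> by (simp add: mult_right_mono)
        qed
        moreover have "\<psi> p3 / (u * d) \<le> \<psi> \<epsilon> / u" if "d = 1"
          using that anti[OF \<epsilon>(1) *(3)] u by (simp add: divide_right_mono)
        moreover have "d = 1 \<or> d = \<delta> / \<xi>" by (auto simp: d_def min_def)
        moreover have "\<psi> M * \<delta> \<ge> 0" using \<psi>M \<delta> by simp
        ultimately show "\<psi> p3 / (u * d) \<le> \<psi> M * \<delta> + \<psi> \<epsilon> / u" using \<psi>\<epsilon> by linarith
      qed (use c in auto)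
      finally show ?thesis .
    qed
    have "integral {\<epsilon>..N} f = integral {\<epsilon>..p1} f + (integral {p1..p2} f + (integral {p2..p3} f + integral {p3..N} f))"
      using Henstock_Kurzweil_Integration.integral_combine[OF _ _ intf[OF \<epsilon>(1)], of p1 N] Henstock_Kurzweil_Integration.integral_combine[OF _ _ intf[OF p(5)], of p2 N]
        Henstock_Kurzweil_Integration.integral_combine[OF _ _ intf[OF p(6)], of p3 N] p by simp
    also have "cmod \<dots> \<le> 8 / c * (\<psi> \<epsilon> / u) + (4 / c * (\<psi> M * \<delta>) + (2 * (\<psi> M * \<delta>) + 4 / c * (\<psi> M * \<delta> + \<psi> \<epsilon> / u)))"
      using I1 I2 I3 I4 by (intro norm_triangle_mono) auto
    also have "\<dots> = 12 / c * (\<psi> \<epsilon> / u) + (8 / c + 2) * (\<psi> M * \<delta>)"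
    proof -
      have "8 / c * X + (4 / c * Y + (2 * Y + 4 / c * (Y + X))) = 12 / c * X + (8 / c + 2) * Y" for X Y
        using c by (simp add: field_simps)
      then show ?thesis .
    qed
    also have "\<dots> \<le> 16 / c * (\<psi> \<epsilon> / u) + 16 / c * (\<psi> M * \<delta>)"
    proof (intro add_mono mult_right_mono)
      have "2 \<le> 8 / c" using c by (simp add: field_simps)
      then show "8 / c + 2 \<le> 16 / c" by (simp add: field_simps)
    qed (use c \<psi>\<epsilon> \<psi>M \<delta> in \<open>auto intro: divide_right_mono\<close>)
    also have "\<dots> = 16 / c * (\<psi> \<epsilon> / u + \<psi> M * \<delta>)" by (simp only: distrib_left)
    finally show ?thesis using True by (simp add: f_def M_def \<delta>_def)
  qed
qed

text \<open>The denominator only serves to make the weight integrable: all bounds are uniform in \<open>\<eta>\<close>, and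
  \<open>\<eta>\<close> tends to 0 in the end.\<close>

definition bessel_weight :: "real \<Rightarrow> real \<Rightarrow> real \<Rightarrow> real" where
  "bessel_weight s \<eta> x = (1 + x\<^sup>2) powr (-s) / (1 + \<eta> * x\<^sup>2)"

definition osc_kernel :: "real \<Rightarrow> real \<Rightarrow> real \<Rightarrow> real \<Rightarrow> real \<Rightarrow> complex" where
  "osc_kernel a s \<eta> u \<tau> =
     (LINT x|lborel. iexp (u * x + \<tau> * \<bar>x\<bar> powr a) * complex_of_real (bessel_weight s \<eta> x))"

definition osc_half :: "real \<Rightarrow> real \<Rightarrow> real \<Rightarrow> real \<Rightarrow> real \<Rightarrow> complex" where
  "osc_half a s \<eta> u \<tau> =
     (LINT x|lborel. indicator {0..} x *\<^sub>R (iexp (u * x + \<tau> * x powr a) * complex_of_real (bessel_weight s \<eta> x)))"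

section \<open>The regularised weight and the half-line integrals\<close>

lemma one_plus_sq_pos: "(1::real) + x\<^sup>2 > 0" by (simp add: add_pos_nonneg)

lemma bessel_weight_even [simp]: "bessel_weight s \<eta> (- x) = bessel_weight s \<eta> x"
  by (simp add: bessel_weight_def)

lemma bessel_weight_measurable [measurable]: "bessel_weight s \<eta> \<in> borel_measurable borel"
  unfolding bessel_weight_def by measurable

lemma bessel_weight_pos: "\<eta> > 0 \<Longrightarrow> bessel_weight s \<eta> x > 0"
  using one_plus_sq_pos[of x] by (auto intro!: divide_pos_pos add_pos_nonneg simp: bessel_weight_def)

lemma bessel_weight_le:
  assumes "\<eta> > 0"
  shows "bessel_weight s \<eta> x \<le> (1 + x\<^sup>2) powr (-s)"
  using assms by (simp add: bessel_weight_def divide_le_eq add_pos_nonneg mult_le_cancel_left1)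

lemma bessel_weight_le_powr:
  assumes "\<eta> > 0" "0 \<le> \<sigma>" "\<sigma> \<le> 2 * s" "x > 0"
  shows "bessel_weight s \<eta> x \<le> x powr (-\<sigma>)"
proof -
  have "bessel_weight s \<eta> x \<le> (1 + x\<^sup>2) powr (-s)" using assms by (intro bessel_weight_le)
  also have "\<dots> \<le> (1 + x\<^sup>2) powr (-\<sigma>/2)" using assms by (intro powr_mono) auto
  also have "\<dots> \<le> (x powr 2) powr (-\<sigma>/2)" using assms by (intro powr_mono2') (auto simp: powr_numeral)
  finally show ?thesis by (simp only: powr_powr) simp
qed

lemma bessel_weight_le_1:
  assumes "\<eta> > 0" "s \<ge> 0"
  shows "bessel_weight s \<eta> x \<le> 1"
proof -
  have "(1 + x\<^sup>2) powr (-s) \<le> 1"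
    using assms by (simp add: powr_minus inverse_le_1_iff ge_one_powr_ge_zero)
  then show ?thesis using bessel_weight_le[OF assms(1), of s x] by simp
qed

lemma bessel_weight_integrable:
  assumes "\<eta> > 0" "\<eta> \<le> 1" "s \<ge> 0"
  shows "integrable lborel (bessel_weight s \<eta>)"
proof (rule Bochner_Integration.integrable_bound)
  show "integrable lborel (\<lambda>x::real. (1 / \<eta>) * (1 + x\<^sup>2) powr (-1))"
    by (intro integrable_mult_right integrable_japanese_powr) auto
  show "AE x in lborel. norm (bessel_weight s \<eta> x) \<le> norm ((1 / \<eta>) * (1 + x\<^sup>2) powr (-1))"
  proof (rule AE_I2)
    fix x :: real
    have "(1 + x\<^sup>2) powr (-s) \<le> 1"
      using assms by (simp add: powr_minus inverse_le_1_iff ge_one_powr_ge_zero)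
    then have "bessel_weight s \<eta> x \<le> 1 / (1 + \<eta> * x\<^sup>2)"
      unfolding bessel_weight_def using assms by (intro divide_right_mono) auto
    also have "\<dots> \<le> 1 / (\<eta> * (1 + x\<^sup>2))"
      using assms one_plus_sq_pos[of x] by (intro divide_left_mono) (auto simp: algebra_simps intro!: mult_pos_pos add_pos_nonneg)
    also have "\<dots> = (1 / \<eta>) * (1 + x\<^sup>2) powr (-1)" using one_plus_sq_pos[of x] by (simp add: powr_minus divide_inverse)
    finally show "norm (bessel_weight s \<eta> x) \<le> norm ((1 / \<eta>) * (1 + x\<^sup>2) powr (-1))"
      using assms bessel_weight_pos[of \<eta> s x] by (simp add: abs_mult)
  qed
qed auto

lemma cmod_exp_i_of_real [simp]: "cmod (iexp x) = 1"
  by simp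

lemma osc_integrable:
  assumes "\<eta> > 0" "\<eta> \<le> 1" "s \<ge> 0" and [measurable]: "f \<in> borel_measurable borel"
  shows "integrable lborel (\<lambda>x. iexp (f x) * complex_of_real (bessel_weight s \<eta> x))"
  by (rule Bochner_Integration.integrable_bound[OF bessel_weight_integrable[OF assms(1-3)]])
    (auto simp: norm_mult)

lemma osc_half_uminus: "osc_half a s \<eta> (-u) (-\<tau>) = cnj (osc_half a s \<eta> u \<tau>)"
proof -
  have e: "iexp (- u * x + - \<tau> * x powr a) = cnj (iexp (u * x + \<tau> * x powr a))" for x
    unfolding exp_cnj by (simp add: algebra_simps)
  have "osc_half a s \<eta> (-u) (-\<tau>) = (LINT x|lborel. cnj (indicator {0..} x *\<^sub>R (iexp (u * x + \<tau> * x powr a) * complex_of_real (bessel_weight s \<eta> x))))"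
    unfolding osc_half_def e by (intro Bochner_Integration.integral_cong) auto
  also have "\<dots> = cnj (osc_half a s \<eta> u \<tau>)"
    unfolding osc_half_def by (rule Bochner_Integration.integral_cnj)
  finally show ?thesis .
qed

lemma osc_kernel_eq_half:
  assumes "\<eta> > 0" "\<eta> \<le> 1" "s \<ge> 0"
  shows "osc_kernel a s \<eta> u \<tau> = osc_half a s \<eta> u \<tau> + osc_half a s \<eta> (-u) \<tau>"
proof -
  define f where "f = (\<lambda>u x. iexp (u * x + \<tau> * \<bar>x\<bar> powr a) * complex_of_real (bessel_weight s \<eta> x))"
  have int: "integrable lborel (f u)" for u
    unfolding f_def using assms by (intro osc_integrable) auto
  have half: "osc_half a s \<eta> u \<tau> = (LINT x|lborel. indicator {0..} x *\<^sub>R f u x)" for u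
    unfolding osc_half_def f_def by (intro Bochner_Integration.integral_cong) (auto split: split_indicator)
  have "osc_half a s \<eta> (-u) \<tau> = (LINT x|lborel. indicator {..0} x *\<^sub>R f u x)"
    unfolding half by (subst lborel_integral_real_affine[where c="-1" and t=0])
      (auto intro!: Bochner_Integration.integral_cong simp: f_def split: split_indicator)
  also have "\<dots> = (LINT x|lborel. indicator {..<0} x *\<^sub>R f u x)"
  proof (rule integral_cong_AE)
    show "AE x in lborel. indicator {..0} x *\<^sub>R f u x = indicator {..<0} x *\<^sub>R f u x"
      using AE_lborel_singleton[of 0] by eventually_elim (auto split: split_indicator)
  qed (use borel_measurable_integrable[OF int] in measurable)
  finally have "osc_half a s \<eta> u \<tau> + osc_half a s \<eta> (-u) \<tau> =
     (LINT x|lborel. indicator {0..} x *\<^sub>R f u x + indicator {..<0} x *\<^sub>R f u x)"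
    unfolding half[of u] by (subst Bochner_Integration.integral_add) (auto intro!: integrable_mult_indicator int)
  also have "\<dots> = (LINT x|lborel. f u x)"
    by (intro Bochner_Integration.integral_cong) (auto split: split_indicator)
  finally show ?thesis by (simp add: osc_kernel_def f_def)
qed

text \<open>\<open>g\<close> is minus the logarithmic derivative of the weight. In this form both
  derivatives keep the weight as a factor, so that its decay and the bounds on \<open>g\<close> can
  be used separately. The second derivative serves \<open>osc_mid\<close>.\<close>

lemma bessel_weight_deriv:
  fixes s \<eta> :: real
  assumes "\<eta> > 0"
  defines "g \<equiv> \<lambda>x::real. 2 * s * x / (1 + x\<^sup>2) + 2 * \<eta> * x / (1 + \<eta> * x\<^sup>2)"
  defines "g' \<equiv> \<lambda>x::real. 2 * s * (1 - x\<^sup>2) / (1 + x\<^sup>2)\<^sup>2 + 2 * \<eta> * (1 - \<eta> * x\<^sup>2) / (1 + \<eta> * x\<^sup>2)\<^sup>2"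
  shows "(bessel_weight s \<eta> has_real_derivative - bessel_weight s \<eta> x * g x) (at x)"
    and "((\<lambda>x. - bessel_weight s \<eta> x * g x) has_real_derivative bessel_weight s \<eta> x * ((g x)\<^sup>2 - g' x)) (at x)"
proof -
  have p: "1 + x\<^sup>2 > 0" "1 + \<eta> * x\<^sup>2 > 0" for x using assms(1) by (auto intro: add_pos_nonneg)
  have 1: "(bessel_weight s \<eta> has_real_derivative - bessel_weight s \<eta> x * g x) (at x)" for x
  proof -
    have q: "((\<lambda>x. 1 + x\<^sup>2) has_real_derivative 2 * x) (at x)"
      by (auto intro!: derivative_eq_intros)
    have r: "((\<lambda>x. 1 + \<eta> * x\<^sup>2) has_real_derivative \<eta> * (2 * x)) (at x)"
      by (auto intro!: derivative_eq_intros)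
    have "((\<lambda>x. (1 + x\<^sup>2) powr (-s)) has_real_derivative (-s * (1 + x\<^sup>2) powr (-s - 1)) * (2 * x)) (at x)"
      by (rule DERIV_chain2[OF has_real_derivative_powr[OF p(1)] q])
    from DERIV_divide[OF this r] p(2)[of x]
    have "(bessel_weight s \<eta> has_real_derivative
       ((-s * (1 + x\<^sup>2) powr (-s - 1)) * (2 * x) * (1 + \<eta> * x\<^sup>2) - (1 + x\<^sup>2) powr (-s) * (\<eta> * (2 * x))) / ((1 + \<eta> * x\<^sup>2) * (1 + \<eta> * x\<^sup>2))) (at x)"
      unfolding bessel_weight_def[abs_def] by simp
    also have "((-s * (1 + x\<^sup>2) powr (-s - 1)) * (2 * x) * (1 + \<eta> * x\<^sup>2) - (1 + x\<^sup>2) powr (-s) * (\<eta> * (2 * x))) / ((1 + \<eta> * x\<^sup>2) * (1 + \<eta> * x\<^sup>2)) = - bessel_weight s \<eta> x * g x"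
    proof -
      define A where "A = 1 + x\<^sup>2"
      define B where "B = 1 + \<eta> * x\<^sup>2"
      define W where "W = A powr (-s)"
      have AB: "A > 0" "B > 0" using p[of x] by (auto simp: A_def B_def)
      have "A powr (-s - 1) = W / A" using AB by (simp add: powr_diff W_def)
      then show ?thesis
        unfolding bessel_weight_def g_def A_def[symmetric] B_def[symmetric] W_def[symmetric]
        using AB by (simp add: divide_simps) (simp add: algebra_simps)
    qed
    finally show ?thesis .
  qed
  then show "(bessel_weight s \<eta> has_real_derivative - bessel_weight s \<eta> x * g x) (at x)" .
  have 2: "(g has_real_derivative g' x) (at x)"
  proof -
    have "((\<lambda>x. 2 * s * x / (1 + x\<^sup>2)) has_real_derivative 2 * s * (1 - x\<^sup>2) / (1 + x\<^sup>2)\<^sup>2) (at x)"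
      using p(1)[of x] by (auto intro!: derivative_eq_intros simp: power2_eq_square algebra_simps)
    moreover have "((\<lambda>x. 2 * \<eta> * x / (1 + \<eta> * x\<^sup>2)) has_real_derivative 2 * \<eta> * (1 - \<eta> * x\<^sup>2) / (1 + \<eta> * x\<^sup>2)\<^sup>2) (at x)"
      using p(2)[of x] by (auto intro!: derivative_eq_intros simp: power2_eq_square algebra_simps)
    ultimately show ?thesis unfolding g_def g'_def by (rule DERIV_add)
  qed
  have "((\<lambda>x. - bessel_weight s \<eta> x * g x) has_real_derivative
      - (- bessel_weight s \<eta> x * g x) * g x + g' x * - bessel_weight s \<eta> x) (at x)"
    by (rule DERIV_mult[OF DERIV_minus[OF 1] 2])
  then show "((\<lambda>x. - bessel_weight s \<eta> x * g x) has_real_derivative bessel_weight s \<eta> x * ((g x)\<^sup>2 - g' x)) (at x)"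
    by (simp add: algebra_simps power2_eq_square)
qed

text \<open>The estimate on [\<epsilon>, N] does not depend on N, and the regularised weight is
  integrable, so N may tend to infinity.\<close>

lemma osc_tail:
  fixes a s \<eta> u \<tau> \<epsilon> :: real
  assumes "a > 1" "s \<ge> 0" "0 < \<eta>" "\<eta> \<le> 1" "u > 0" "\<epsilon> > 0"
  defines "c \<equiv> min 1 (a - 1) / 2"
  defines "\<xi> \<equiv> osc_point a u \<tau>"
  defines "w \<equiv> bessel_weight s \<eta>"
  shows "cmod (LINT x|lborel. indicator {\<epsilon>..} x *\<^sub>R (iexp (u * x + \<tau> * x powr a) * complex_of_real (w x)))
    \<le> 16 / c * (w \<epsilon> / u + (if \<tau> < 0 then w (max \<epsilon> (\<xi> / 2)) * sqrt (\<xi> / u) else 0))"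
    (is "_ \<le> ?R")
proof -
  define f where "f = (\<lambda>x. iexp (u * x + \<tau> * x powr a) * complex_of_real (w x))"
  have int: "integrable lborel f"
    unfolding f_def w_def using assms by (intro osc_integrable) auto
  have lim: "((\<lambda>y. LINT x|lborel. indicator {.. y} x *\<^sub>R (indicator {\<epsilon>..} x *\<^sub>R f x)) \<longlongrightarrow> (LINT x|lborel. indicator {\<epsilon>..} x *\<^sub>R f x)) at_top"
    by (rule tendsto_integral_at_top) (auto intro!: integrable_mult_indicator int)
  have le: "cmod (LINT x|lborel. indicator {.. y} x *\<^sub>R (indicator {\<epsilon>..} x *\<^sub>R f x)) \<le> ?R" if y: "y \<ge> \<epsilon>" for y
  proof -
    have "(LINT x|lborel. indicator {.. y} x *\<^sub>R (indicator {\<epsilon>..} x *\<^sub>R f x)) = (LINT x:{\<epsilon>..y}|lborel. f x)"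
      unfolding set_lebesgue_integral_def by (intro Bochner_Integration.integral_cong) (auto split: split_indicator)
    also have "\<dots> = integral {\<epsilon>..y} f"
      by (rule set_borel_integral_eq_integral) (auto simp: set_integrable_def intro!: integrable_mult_indicator int)
    also have "cmod \<dots> \<le> ?R"
      unfolding f_def c_def \<xi>_def
    proof (rule oscillatory_half_line[where \<psi>'="\<lambda>x. - w x * (2 * s * x / (1 + x\<^sup>2) + 2 * \<eta> * x / (1 + \<eta> * x\<^sup>2))"])
      fix x :: real assume x: "x > 0"
      show "(w has_real_derivative - w x * (2 * s * x / (1 + x\<^sup>2) + 2 * \<eta> * x / (1 + \<eta> * x\<^sup>2))) (at x)"
        unfolding w_def by (rule bessel_weight_deriv(1)[OF assms(3)])
      show "w x \<ge> 0" unfolding w_def using bessel_weight_pos[OF assms(3)] by (simp add: less_imp_le)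
      then have "w x * (2 * s * x / (1 + x\<^sup>2) + 2 * \<eta> * x / (1 + \<eta> * x\<^sup>2)) \<ge> 0"
        using x assms by (intro mult_nonneg_nonneg add_nonneg_nonneg divide_nonneg_nonneg) auto
      then show "- w x * (2 * s * x / (1 + x\<^sup>2) + 2 * \<eta> * x / (1 + \<eta> * x\<^sup>2)) \<le> 0" by simp
    qed (use assms y in auto)
    finally show ?thesis .
  qed
  have "cmod (LINT x|lborel. indicator {\<epsilon>..} x *\<^sub>R f x) \<le> ?R"
    by (rule tendsto_upperbound[OF tendsto_norm[OF lim] eventually_mono[OF eventually_ge_at_top[of \<epsilon>] le]]) auto
  then show ?thesis by (simp add: f_def)
qed

lemma osc_half_split:
  fixes a s \<eta> u \<tau> \<epsilon> :: real
  assumes "s \<ge> 0" "0 < \<eta>" "\<eta> \<le> 1" "\<epsilon> > 0"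
  defines "f \<equiv> \<lambda>x. iexp (u * x + \<tau> * x powr a) * complex_of_real (bessel_weight s \<eta> x)"
  shows "osc_half a s \<eta> u \<tau> = integral {0..\<epsilon>} f + (LINT x|lborel. indicator {\<epsilon>..} x *\<^sub>R f x)"
proof -
  have int: "integrable lborel f"
    unfolding f_def using assms by (intro osc_integrable) auto
  have [measurable]: "f \<in> borel_measurable borel" unfolding f_def by measurable
  have "osc_half a s \<eta> u \<tau> = (LINT x|lborel. indicator {0..\<epsilon>} x *\<^sub>R f x + indicator {\<epsilon><..} x *\<^sub>R f x)"
    unfolding osc_half_def f_def using assms(4) by (intro Bochner_Integration.integral_cong) (auto split: split_indicator)
  also have "\<dots> = (LINT x|lborel. indicator {0..\<epsilon>} x *\<^sub>R f x) + (LINT x|lborel. indicator {\<epsilon><..} x *\<^sub>R f x)"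
    by (subst Bochner_Integration.integral_add) (auto intro!: integrable_mult_indicator int)
  also have "(LINT x|lborel. indicator {\<epsilon><..} x *\<^sub>R f x) = (LINT x|lborel. indicator {\<epsilon>..} x *\<^sub>R f x)"
  proof (rule integral_cong_AE)
    show "AE x in lborel. indicator {\<epsilon><..} x *\<^sub>R f x = indicator {\<epsilon>..} x *\<^sub>R f x"
      using AE_lborel_singleton[of \<epsilon>] by eventually_elim (auto split: split_indicator)
  qed measurable
  also have "(LINT x|lborel. indicator {0..\<epsilon>} x *\<^sub>R f x) = (LINT x:{0..\<epsilon>}|lborel. f x)"
    by (simp add: set_lebesgue_integral_def)
  also have "\<dots> = integral {0..\<epsilon>} f"
    by (rule set_borel_integral_eq_integral) (auto simp: set_integrable_def intro!: integrable_mult_indicator int)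
  finally show ?thesis .
qed

lemma osc_head:
  fixes a s \<eta> u \<tau> \<epsilon> I :: real
  assumes "s \<ge> 0" "0 < \<eta>" "\<eta> \<le> 1" "\<epsilon> > 0"
    and "(h has_integral I) {0..\<epsilon>}" "\<And>x. 0 < x \<Longrightarrow> bessel_weight s \<eta> x \<le> h x" "h 0 \<ge> 0"
  shows "cmod (integral {0..\<epsilon>} (\<lambda>x. iexp (u * x + \<tau> * x powr a) * complex_of_real (bessel_weight s \<eta> x))) \<le> I"
proof -
  define f where "f = (\<lambda>x. iexp (u * x + \<tau> * x powr a) * complex_of_real (bessel_weight s \<eta> x))"
  have int: "integrable lborel f"
    unfolding f_def using assms by (intro osc_integrable) auto
  have fi: "f integrable_on {0..\<epsilon>}"
    by (rule set_borel_integral_eq_integral) (auto simp: set_integrable_def intro!: integrable_mult_indicator int)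
  \<comment> \<open>The majorant may be singular at the origin, and a power such as x^(-\<sigma>)
    has the value 0 there by convention. The integrand is therefore reset to 0 at this single point
    before the comparison.\<close>
  have "((\<lambda>x. if x = 0 then 0 else f x) has_integral integral {0..\<epsilon>} f) {0..\<epsilon>}"
    by (rule has_integral_spike_finite[OF _ _ integrable_integral[OF fi], of "{0}"]) auto
  then have "(\<lambda>x. if x = 0 then 0 else f x) integrable_on {0..\<epsilon>}" "integral {0..\<epsilon>} f = integral {0..\<epsilon>} (\<lambda>x. if x = 0 then 0 else f x)"
    by (auto simp: has_integral_iff)
  moreover have "cmod (integral {0..\<epsilon>} (\<lambda>x. if x = 0 then 0 else f x)) \<le> integral {0..\<epsilon>} h"
    using calculation(1) assms has_integral_integrable[OF assms(5)] bessel_weight_pos[OF assms(2), of s]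
    by (intro Henstock_Kurzweil_Integration.integral_norm_bound_integral)
      (auto simp: f_def norm_mult less_imp_le abs_of_pos)
  ultimately show ?thesis using assms(5) by (simp add: has_integral_iff f_def)
qed

text \<open>The restriction |\<tau>| \<le> 1 pushes the stationary point out to (u/a)^(1/(a-1)) at
  least. Its contribution is \<xi>^(1/2 - 2s) u^(-1/2), which for s \<ge> 1/4 is largest when \<xi>
  is smallest, that is for |\<tau>| = 1. Substituting this position gives the exponent
  \<open>\<gamma>\<close>.\<close>

lemma osc_stationary:
  fixes a s \<eta> u \<tau> M :: real
  assumes a: "a > 1" and s: "s \<ge> 1/4" and \<eta>: "0 < \<eta>" and u: "u > 0" and \<tau>: "\<tau> \<noteq> 0" "\<bar>\<tau>\<bar> \<le> 1"
  defines "\<xi> \<equiv> osc_point a u \<tau>"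
  defines "\<gamma> \<equiv> 1/2 + (2 * s - 1/2) / (a - 1)"
  assumes M2: "M \<ge> \<xi> / 2"
  shows "bessel_weight s \<eta> M * sqrt (\<xi> / u) \<le> 2 powr (2 * s) * a powr (\<gamma> - 1/2) * u powr (-\<gamma>)"
proof -
  have \<xi>: "\<xi> > 0" unfolding \<xi>_def osc_point_def using a u \<tau> by simp
  have M: "M > 0" using \<xi> M2 by linarith
  have "a * \<bar>\<tau>\<bar> \<le> a" using mult_left_mono[OF \<tau>(2), of a] a by simp
  then have "u / a \<le> u / (a * \<bar>\<tau>\<bar>)" using a u \<tau> by (intro divide_left_mono) auto
  then have "(u / a) powr (1 / (a - 1)) \<le> \<xi>"
    unfolding \<xi>_def osc_point_def using a u by (intro powr_mono2) auto
  then have "\<xi> powr (1/2 - 2 * s) \<le> ((u / a) powr (1 / (a - 1))) powr (1/2 - 2 * s)"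
    using a u s by (intro powr_mono2') auto
  also have "\<dots> = (u / a) powr (1/2 - \<gamma>)" unfolding powr_powr by (simp add: \<gamma>_def diff_divide_distrib)
  also have "\<dots> = u powr (1/2 - \<gamma>) * a powr (\<gamma> - 1/2)"
  proof -
    have "(u / a) powr e = u powr e * a powr (- e)" for e
    proof -
      have "(u / a) powr e = u powr e / a powr e" by (rule powr_divide)
      then show ?thesis by (simp add: powr_minus_divide)
    qed
    from this[of "1/2 - \<gamma>"] show ?thesis by simp
  qed
  finally have 1: "\<xi> powr (1/2 - 2 * s) \<le> u powr (1/2 - \<gamma>) * a powr (\<gamma> - 1/2)" .
  have "bessel_weight s \<eta> M \<le> M powr (-(2 * s))" using \<eta> s M by (intro bessel_weight_le_powr) auto
  also have "\<dots> \<le> (\<xi> / 2) powr (-(2 * s))" using s M2 \<xi> by (intro powr_mono2') auto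
  also have "\<dots> = 2 powr (2 * s) * \<xi> powr (- (2 * s))"
  proof -
    have "(\<xi> / 2) powr (-(2 * s)) = \<xi> powr (-(2 * s)) / 2 powr (-(2 * s))" by (rule powr_divide)
    then show ?thesis by (simp add: powr_minus_divide)
  qed
  finally have "bessel_weight s \<eta> M * sqrt (\<xi> / u) \<le> 2 powr (2 * s) * \<xi> powr (- (2 * s)) * sqrt (\<xi> / u)"
    using \<xi> u by (intro mult_right_mono) auto
  also have "2 powr (2 * s) * \<xi> powr (- (2 * s)) * sqrt (\<xi> / u) = 2 powr (2 * s) * \<xi> powr (- (2 * s)) * (\<xi> powr (1/2) * u powr (-1/2))"
  proof -
    have "sqrt (\<xi> / u) = (\<xi> / u) powr (1/2)" using \<xi> \<open>u > 0\<close> by (simp add: powr_half_sqrt)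
    also have "\<dots> = \<xi> powr (1/2) / u powr (1/2)" by (rule powr_divide)
    also have "\<dots> = \<xi> powr (1/2) * u powr (-(1/2))" unfolding powr_minus_divide by simp
    finally have "sqrt (\<xi> / u) = \<xi> powr (1/2) * u powr (-1/2)" by simp
    then show ?thesis by (simp only:)
  qed
  also have "2 powr (2 * s) * \<xi> powr (- (2 * s)) * (\<xi> powr (1/2) * u powr (-1/2)) =
      2 powr (2 * s) * u powr (-1/2) * \<xi> powr (1/2 - 2 * s)"
  proof -
    have "\<xi> powr (- (2 * s)) * \<xi> powr (1/2) = \<xi> powr (1/2 - 2 * s)" unfolding powr_add[symmetric] by simp
    moreover have "A * X * (Y * Z) = A * Z * W" if "X * Y = W" for A X Y Z W :: real
      by (simp add: that[symmetric])
    ultimately show ?thesis by blast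
  qed
  also have "\<dots> \<le> 2 powr (2 * s) * u powr (-1/2) * (u powr (1/2 - \<gamma>) * a powr (\<gamma> - 1/2))"
    using 1 by (intro mult_left_mono) auto
  also have "\<dots> = 2 powr (2 * s) * a powr (\<gamma> - 1/2) * (u powr (-1/2) * u powr (1/2 - \<gamma>))" by simp
  also have "u powr (-1/2) * u powr (1/2 - \<gamma>) = u powr (-\<gamma>)" unfolding powr_add[symmetric] by simp
  finally show ?thesis .
qed

text \<open>With the cut at 1/u both parts are compared with the homogeneous weight x^(-\<sigma>),
  so the answer is dictated by scaling. It is uniform over all \<tau> because for \<sigma> \<ge> 1/2
  the stationary term M^(1/2 - \<sigma>) (1/u)^(1/2) decreases in M: the worst stationary point sits
  at the cut itself.\<close>

lemma osc_half_bound_small: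
  fixes a s \<eta> u \<tau> \<sigma> :: real
  assumes "a > 1" "0 < \<eta>" "\<eta> \<le> 1" "u > 0" and \<sigma>: "1/2 \<le> \<sigma>" "\<sigma> < 1" "\<sigma> \<le> 2 * s"
  defines "c \<equiv> min 1 (a - 1) / 2"
  shows "cmod (osc_half a s \<eta> u \<tau>) \<le> (1 / (1 - \<sigma>) + 48 / c) * u powr (\<sigma> - 1)"
proof -
  define \<epsilon> where "\<epsilon> = 1 / u"
  define \<xi> where "\<xi> = osc_point a u \<tau>"
  define w where "w = bessel_weight s \<eta>"
  have \<epsilon>: "\<epsilon> > 0" using assms by (simp add: \<epsilon>_def)
  have s: "s \<ge> 0" using assms by simp
  have c: "c > 0" using assms by (simp add: c_def)
  have \<xi>: "\<xi> \<ge> 0" by (simp add: \<xi>_def osc_point_def)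
  have wle: "w x \<le> x powr (-\<sigma>)" if "x > 0" for x
    unfolding w_def using assms that by (intro bessel_weight_le_powr) auto
  have wpos: "w x > 0" for x unfolding w_def using assms by (intro bessel_weight_pos)
  have e1: "\<epsilon> powr (1 - \<sigma>) = u powr (\<sigma> - 1)"
    using assms by (simp add: \<epsilon>_def powr_divide powr_diff)
  have "cmod (integral {0..\<epsilon>} (\<lambda>x. iexp (u * x + \<tau> * x powr a) * complex_of_real (w x)))
      \<le> \<epsilon> powr (-\<sigma> + 1) / (-\<sigma> + 1)"
    unfolding w_def
  proof (rule osc_head)
    show "((\<lambda>x. x powr (-\<sigma>)) has_integral \<epsilon> powr (-\<sigma> + 1) / (-\<sigma> + 1)) {0..\<epsilon>}"
      using assms \<epsilon> by (intro has_integral_powr_from_0) auto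
  qed (use \<open>0 < \<eta>\<close> \<open>\<eta> \<le> 1\<close> \<epsilon> s wle in \<open>simp_all add: w_def\<close>)
  also have "\<dots> = 1 / (1 - \<sigma>) * u powr (\<sigma> - 1)" using e1 by simp
  finally have 1: "cmod (integral {0..\<epsilon>} (\<lambda>x. iexp (u * x + \<tau> * x powr a) * complex_of_real (w x)))
      \<le> 1 / (1 - \<sigma>) * u powr (\<sigma> - 1)" .
  define M where "M = max \<epsilon> (\<xi> / 2)"
  have M: "M \<ge> \<epsilon>" "M \<ge> \<xi> / 2" "M > 0" using \<epsilon> by (auto simp: M_def)
  have t1: "w \<epsilon> / u \<le> u powr (\<sigma> - 1)"
  proof -
    have "w \<epsilon> / u \<le> \<epsilon> powr (-\<sigma>) / u" using wle[OF \<epsilon>] assms by (intro divide_right_mono) auto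
    also have "\<dots> = \<epsilon> powr (-\<sigma>) * \<epsilon> powr 1" using \<epsilon> by (simp add: \<epsilon>_def)
    also have "\<dots> = \<epsilon> powr (1 - \<sigma>)" unfolding powr_add[symmetric] by simp
    finally show ?thesis by (simp add: e1)
  qed
  have t2: "w M * sqrt (\<xi> / u) \<le> 2 * u powr (\<sigma> - 1)"
  proof -
    have "w M * sqrt (\<xi> / u) \<le> M powr (-\<sigma>) * sqrt (4 * (M * \<epsilon>))"
    proof (intro mult_mono wle real_sqrt_le_mono)
      have "\<xi> / u \<le> (4 * M) / u" using M assms \<xi> by (intro divide_right_mono) auto
      then show "\<xi> / u \<le> 4 * (M * \<epsilon>)" by (simp add: \<epsilon>_def)
    qed (use M \<xi> assms in auto)
    also have "sqrt (4 * (M * \<epsilon>)) = 2 * (M powr (1/2) * \<epsilon> powr (1/2))"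
      using M \<epsilon> by (simp add: real_sqrt_mult powr_half_sqrt)
    also have "M powr (-\<sigma>) * (2 * (M powr (1/2) * \<epsilon> powr (1/2))) = 2 * \<epsilon> powr (1/2) * (M powr (-\<sigma>) * M powr (1/2))" by simp
    also have "M powr (-\<sigma>) * M powr (1/2) = M powr (1/2 - \<sigma>)" unfolding powr_add[symmetric] by simp
    also have "2 * \<epsilon> powr (1/2) * M powr (1/2 - \<sigma>) \<le> 2 * \<epsilon> powr (1/2) * \<epsilon> powr (1/2 - \<sigma>)"
      using M \<epsilon> \<sigma> by (intro mult_left_mono powr_mono2') auto
    also have "\<dots> = 2 * (\<epsilon> powr (1/2) * \<epsilon> powr (1/2 - \<sigma>))" by simp
    also have "\<epsilon> powr (1/2) * \<epsilon> powr (1/2 - \<sigma>) = \<epsilon> powr (1 - \<sigma>)" unfolding powr_add[symmetric] by simp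
    finally show ?thesis by (simp add: e1)
  qed
  have "cmod (LINT x|lborel. indicator {\<epsilon>..} x *\<^sub>R (iexp (u * x + \<tau> * x powr a) * complex_of_real (w x)))
     \<le> 16 / c * (w \<epsilon> / u + (if \<tau> < 0 then w M * sqrt (\<xi> / u) else 0))"
    unfolding w_def c_def \<xi>_def M_def by (intro osc_tail) (use \<open>a > 1\<close> \<open>0 < \<eta>\<close> \<open>\<eta> \<le> 1\<close> assms(4) s \<epsilon> in simp_all)
  also have "\<dots> \<le> 16 / c * (u powr (\<sigma> - 1) + 2 * u powr (\<sigma> - 1))"
    using t1 t2 c by (intro mult_left_mono add_mono) auto
  finally have 2: "cmod (LINT x|lborel. indicator {\<epsilon>..} x *\<^sub>R (iexp (u * x + \<tau> * x powr a) * complex_of_real (w x)))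
     \<le> 48 / c * u powr (\<sigma> - 1)" by simp
  have "cmod (osc_half a s \<eta> u \<tau>) \<le> 1 / (1 - \<sigma>) * u powr (\<sigma> - 1) + 48 / c * u powr (\<sigma> - 1)"
    unfolding osc_half_split[OF s assms(2,3) \<epsilon>]
    using 1 2 unfolding w_def by (rule norm_triangle_mono)
  then show ?thesis by (simp only: distrib_right)
qed

text \<open>The weight is no better than 1 on [0, 1/u], which costs 1/u; the rest is the stationary
  term. The summand 1/u is harmless for q > 2 but not integrable at infinity, and this is why q = 2
  calls for the finer \<open>osc_mid\<close>.\<close>

lemma osc_half_bound_large:
  fixes a s \<eta> u \<tau> :: real
  assumes a: "a > 1" and \<eta>: "0 < \<eta>" "\<eta> \<le> 1" and u: "u \<ge> 1" and s4: "s \<ge> 1/4" and \<tau>: "\<bar>\<tau>\<bar> \<le> 1"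
  defines "c \<equiv> min 1 (a - 1) / 2"
  defines "\<gamma> \<equiv> 1/2 + (2 * s - 1/2) / (a - 1)"
  shows "cmod (osc_half a s \<eta> u \<tau>) \<le> (1 + 16 / c) * u powr (-1) + 16 / c * (2 powr (2 * s) * a powr (\<gamma> - 1/2)) * u powr (-\<gamma>)"
proof -
  define \<epsilon> where "\<epsilon> = 1 / u"
  define \<xi> where "\<xi> = osc_point a u \<tau>"
  define w where "w = bessel_weight s \<eta>"
  define D where "D = 2 powr (2 * s) * a powr (\<gamma> - 1/2)"
  have \<epsilon>: "\<epsilon> > 0" using u by (simp add: \<epsilon>_def)
  have s: "s \<ge> 0" using s4 by simp
  have c: "c > 0" using a by (simp add: c_def)
  have ui: "u powr (-1) = \<epsilon>" unfolding powr_minus_divide \<epsilon>_def using u by simp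
  have w1: "w x \<le> 1" for x unfolding w_def using \<eta> s by (intro bessel_weight_le_1)
  have 1: "cmod (integral {0..\<epsilon>} (\<lambda>x. iexp (u * x + \<tau> * x powr a) * complex_of_real (w x))) \<le> \<epsilon>"
    unfolding w_def
  proof (rule osc_head)
    show "((\<lambda>x. 1::real) has_integral \<epsilon>) {0..\<epsilon>}"
      using has_integral_const_real[of "1::real" 0 \<epsilon>] \<epsilon> by simp
  qed (use \<open>0 < \<eta>\<close> \<open>\<eta> \<le> 1\<close> \<epsilon> s w1 in \<open>simp_all add: w_def\<close>)
  define M where "M = max \<epsilon> (\<xi> / 2)"
  have t1: "w \<epsilon> / u \<le> \<epsilon>"
    unfolding \<epsilon>_def using w1[of "1 / u"] u by (intro divide_right_mono) auto
  have t2: "(if \<tau> < 0 then w M * sqrt (\<xi> / u) else 0) \<le> D * u powr (-\<gamma>)"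
  proof (cases "\<tau> < 0")
    case True
    have "\<tau> \<noteq> 0" "u > 0" "M \<ge> osc_point a u \<tau> / 2" using True \<open>u \<ge> 1\<close> by (auto simp: M_def \<xi>_def)
    then have "w M * sqrt (\<xi> / u) \<le> D * u powr (-\<gamma>)"
      unfolding w_def \<xi>_def D_def \<gamma>_def using \<open>a > 1\<close> \<open>s \<ge> 1/4\<close> \<open>0 < \<eta>\<close> \<open>\<bar>\<tau>\<bar> \<le> 1\<close>
      by (intro osc_stationary)
    then show ?thesis using True by (simp only: if_True)
  qed (simp add: D_def)
  have "cmod (LINT x|lborel. indicator {\<epsilon>..} x *\<^sub>R (iexp (u * x + \<tau> * x powr a) * complex_of_real (w x)))
     \<le> 16 / c * (w \<epsilon> / u + (if \<tau> < 0 then w M * sqrt (\<xi> / u) else 0))"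
    unfolding w_def c_def \<xi>_def M_def by (intro osc_tail) (use \<open>a > 1\<close> \<open>0 < \<eta>\<close> \<open>\<eta> \<le> 1\<close> u s \<epsilon> in simp_all)
  also have "\<dots> \<le> 16 / c * (\<epsilon> + D * u powr (-\<gamma>))"
    using t1 t2 c by (intro mult_left_mono add_mono) auto
  finally have "cmod (osc_half a s \<eta> u \<tau>) \<le> \<epsilon> + 16 / c * (\<epsilon> + D * u powr (-\<gamma>))"
    unfolding osc_half_split[OF s \<eta> \<epsilon>]
    using 1 unfolding w_def by (intro norm_triangle_mono)
  also have "\<dots> = (1 + 16 / c) * \<epsilon> + 16 / c * D * u powr (-\<gamma>)" by (simp add: algebra_simps add_divide_distrib)
  finally show ?thesis unfolding ui D_def .
qed

text \<open>Uniformity in \<open>\<eta>\<close> rests on \<eta>/(1 + \<eta> x^2) \<le> 1/(1 + x^2)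
  for \<eta> \<le> 1: the regularising factor behaves no worse than one more power of 1 + x^2,
  whence 2 s + 2.\<close>

lemma bessel_log_deriv_bounds:
  fixes s \<eta> x :: real
  assumes s: "s \<ge> 0" and \<eta>: "0 < \<eta>" "\<eta> \<le> 1" and x: "x \<ge> 0"
  defines "g \<equiv> 2 * s * x / (1 + x\<^sup>2) + 2 * \<eta> * x / (1 + \<eta> * x\<^sup>2)"
  defines "g' \<equiv> 2 * s * (1 - x\<^sup>2) / (1 + x\<^sup>2)\<^sup>2 + 2 * \<eta> * (1 - \<eta> * x\<^sup>2) / (1 + \<eta> * x\<^sup>2)\<^sup>2"
  shows "0 \<le> g" "g \<le> 2 * s + 2" "\<bar>g\<^sup>2 - g'\<bar> \<le> ((2 * s + 2)\<^sup>2 + (2 * s + 2)) * (1 / (1 + x\<^sup>2))"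
proof -
  define A where "A = 1 + x\<^sup>2"
  define B where "B = 1 + \<eta> * x\<^sup>2"
  have A: "A \<ge> 1" and B: "B \<ge> 1" using \<eta> by (auto simp: A_def B_def)
  have x2: "x\<^sup>2 \<ge> 0" "\<eta> * x\<^sup>2 \<ge> 0" using \<eta> by auto
  have AB: "\<eta> / B \<le> 1 / A"
    using A B \<eta> by (simp add: divide_simps) (simp add: A_def B_def algebra_simps)
  have xA: "x / A \<le> 1"
  proof -
    have "A - x = (x - 1 / 2)\<^sup>2 + 3 / 4" by (simp add: A_def power2_eq_square algebra_simps)
    then have "x \<le> A" using zero_le_power2[of "x - 1 / 2"] by linarith
    then show ?thesis using A by simp
  qed
  have "2 * \<eta> * x / B = 2 * x * (\<eta> / B)" by simp
  also have "\<dots> \<le> 2 * x * (1 / A)" using AB x by (intro mult_left_mono) auto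
  finally have g1: "g \<le> (2 * s + 2) * (x / A)"
  proof -
    have "(2 * s + 2) * (x / A) = 2 * s * x / A + 2 * x * (1 / A)" by (simp add: distrib_right add_divide_distrib)
    then show "2 * \<eta> * x / B \<le> 2 * x * (1 / A) \<Longrightarrow> g \<le> (2 * s + 2) * (x / A)"
      unfolding g_def A_def[symmetric] B_def[symmetric] by linarith
  qed
  show g0: "0 \<le> g" unfolding g_def using s \<eta> x by (intro add_nonneg_nonneg divide_nonneg_nonneg) auto
  have "(2 * s + 2) * (x / A) \<le> (2 * s + 2) * 1" using xA s by (intro mult_left_mono) auto
  then show "g \<le> 2 * s + 2" using g1 by simp
  have "g\<^sup>2 \<le> ((2 * s + 2) * (x / A))\<^sup>2" using g0 g1 by (intro power_mono) auto
  also have "\<dots> = (2 * s + 2)\<^sup>2 * (x\<^sup>2 / A * (1 / A))" by (simp add: power2_eq_square)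
  also have "\<dots> \<le> (2 * s + 2)\<^sup>2 * (1 * (1 / A))"
  proof (intro mult_left_mono mult_right_mono)
    show "x\<^sup>2 / A \<le> 1" unfolding A_def by (simp add: divide_le_eq_1_pos one_plus_sq_pos)
  qed (use A in auto)
  finally have G2: "g\<^sup>2 \<le> (2 * s + 2)\<^sup>2 * (1 / A)" by simp
  have t1: "\<bar>2 * s * (1 - x\<^sup>2) / A\<^sup>2\<bar> \<le> 2 * s * (1 / A)"
  proof -
    have "\<bar>1 - x\<^sup>2\<bar> \<le> A" unfolding A_def using x2 by (simp add: abs_le_iff)
    then have "\<bar>1 - x\<^sup>2\<bar> / A\<^sup>2 \<le> A / A\<^sup>2" using A by (intro divide_right_mono) auto
    then have "2 * s * (\<bar>1 - x\<^sup>2\<bar> / A\<^sup>2) \<le> 2 * s * (A / A\<^sup>2)" using s by (intro mult_left_mono) auto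
    then show ?thesis using s A by (simp add: abs_mult power2_eq_square)
  qed
  have t2: "\<bar>2 * \<eta> * (1 - \<eta> * x\<^sup>2) / B\<^sup>2\<bar> \<le> 2 * (1 / A)"
  proof -
    have "\<bar>1 - \<eta> * x\<^sup>2\<bar> \<le> B" unfolding B_def using x2 by (simp add: abs_le_iff)
    then have "\<bar>1 - \<eta> * x\<^sup>2\<bar> / B\<^sup>2 \<le> B / B\<^sup>2" using B by (intro divide_right_mono) auto
    then have "2 * \<eta> * (\<bar>1 - \<eta> * x\<^sup>2\<bar> / B\<^sup>2) \<le> 2 * \<eta> * (B / B\<^sup>2)" using \<eta> by (intro mult_left_mono) auto
    also have "\<dots> = 2 * (\<eta> / B)" using B by (simp add: power2_eq_square)
    also have "\<dots> \<le> 2 * (1 / A)" using AB by simp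
    finally show ?thesis using \<eta> by (simp add: abs_mult)
  qed
  have "\<bar>g'\<bar> \<le> 2 * s * (1 / A) + 2 * (1 / A)"
    unfolding g'_def A_def[symmetric] B_def[symmetric] using t1 t2 by linarith
  then have "\<bar>g\<^sup>2 - g'\<bar> \<le> (2 * s + 2)\<^sup>2 * (1 / A) + (2 * s * (1 / A) + 2 * (1 / A))"
    using G2 zero_le_power2[of g] by linarith
  also have "\<dots> = ((2 * s + 2)\<^sup>2 + (2 * s + 2)) * (1 / A)" by (simp only: distrib_right)
  finally show "\<bar>g\<^sup>2 - g'\<bar> \<le> ((2 * s + 2)\<^sup>2 + (2 * s + 2)) * (1 / (1 + x\<^sup>2))" by (simp only: A_def)
qed

text \<open>The boundary term \<open>\<i> / u\<close> at the origin is independent of \<open>\<tau>\<close>, so it cancels when the two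
  half-line integrals are added; this is what makes the kernel integrable at infinity.\<close>

lemma osc_mid:
  fixes a s :: real
  assumes a: "a > 1" and s: "s \<ge> 1/4"
  defines "\<sigma> \<equiv> min (2 * s) ((a - 1) / 2)"
  defines "\<kappa> \<equiv> \<sigma> / (a - 1)"
  shows "\<exists>C\<ge>0. \<forall>\<eta> u \<tau>. 0 < \<eta> \<longrightarrow> \<eta> \<le> 1 \<longrightarrow> u \<ge> 1 \<longrightarrow> \<bar>\<tau>\<bar> \<le> 1 \<longrightarrow>
    cmod (integral {0..(u / (2 * a)) powr (1 / (a - 1))} (\<lambda>x. iexp (u * x + \<tau> * x powr a) * complex_of_real (bessel_weight s \<eta> x)) - \<i> / u)
      \<le> C * u powr (-(1 + \<kappa>))"
proof -
  \<comment> \<open>Capping \<open>\<sigma>\<close> at (a - 1)/2 keeps x^(a - 2 - \<sigma>)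
    integrable at 0 and \<open>\<kappa>\<close> below 1, so that u^(-2) is absorbed by u^(-(1 +
    \<kappa>)).\<close>
  have \<sigma>: "\<sigma> > 0" "\<sigma> \<le> 2 * s" "\<sigma> \<le> (a - 1) / 2" using a s by (auto simp: \<sigma>_def min_def)
  have \<kappa>: "\<kappa> > 0" "\<kappa> \<le> 1 / 2" using \<sigma> a by (auto simp: \<kappa>_def field_simps)
  define D where "D = (2 * s + 2)\<^sup>2 + (2 * s + 2)"
  define C1 where "C1 = (8 * s + 10) * (2 * a) powr \<kappa>"
  define C2 where "C2 = (36 + 32 * s) * (a * (a - 1)) * ((1 / (2 * a)) powr (1 - \<kappa>) / (a - 1 - \<sigma>))"
  define C3 where "C3 = 4 * D * (pi / 2)"
  have D: "D \<ge> 0" using s by (simp add: D_def)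
  have C: "C1 \<ge> 0" "C2 \<ge> 0" "C3 \<ge> 0" using s a \<sigma> D by (auto simp: C1_def C2_def C3_def)
  have "cmod (integral {0..(u / (2 * a)) powr (1 / (a - 1))} (\<lambda>x. iexp (u * x + \<tau> * x powr a) * complex_of_real (bessel_weight s \<eta> x)) - \<i> / u)
      \<le> (C1 + C2 + C3) * u powr (-(1 + \<kappa>))"
    if \<eta>: "0 < \<eta>" "\<eta> \<le> 1" and u: "u \<ge> 1" and \<tau>: "\<bar>\<tau>\<bar> \<le> 1" for \<eta> u \<tau>
  proof -
    \<comment> \<open>On [0, \<rho>] the term \<tau> a x^(a-1) is at most u/2 in modulus, so the
      derivative of the phase stays above u/2 for either sign of \<tau>; any stationary point lies
      beyond \<rho>.\<close>
    define \<rho> where "\<rho> = (u / (2 * a)) powr (1 / (a - 1))"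
    have \<rho>: "\<rho> > 0" using u a by (simp add: \<rho>_def)
    have \<rho>p: "\<rho> powr e = (u / (2 * a)) powr (e / (a - 1))" for e
      unfolding \<rho>_def powr_powr by simp
    have \<rho>a: "\<rho> powr (a - 1) = u / (2 * a)" unfolding \<rho>p using a u by simp
    define g where "g = (\<lambda>x::real. 2 * s * x / (1 + x\<^sup>2) + 2 * \<eta> * x / (1 + \<eta> * x\<^sup>2))"
    define g' where "g' = (\<lambda>x::real. 2 * s * (1 - x\<^sup>2) / (1 + x\<^sup>2)\<^sup>2 + 2 * \<eta> * (1 - \<eta> * x\<^sup>2) / (1 + \<eta> * x\<^sup>2)\<^sup>2)"
    define W where "W = bessel_weight s \<eta>"
    define W1 where "W1 = (\<lambda>x. - W x * g x)"
    define W2 where "W2 = (\<lambda>x. W x * ((g x)\<^sup>2 - g' x))"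
    have WD: "(W has_real_derivative W1 x) (at x)" for x
      unfolding W_def W1_def g_def by (rule bessel_weight_deriv(1)[OF \<eta>(1)])
    have W1D: "(W1 has_real_derivative W2 x) (at x)" for x
      unfolding W_def W1_def W2_def g_def g'_def by (rule bessel_weight_deriv(2)[OF \<eta>(1)])
    have s0: "s \<ge> 0" using s by simp
    have Wpos: "W x > 0" for x unfolding W_def using \<eta> by (intro bessel_weight_pos)
    have W1le: "\<bar>W1 x\<bar> \<le> (2 * s + 2) * W x" if "x \<ge> 0" for x
    proof -
      have "\<bar>W1 x\<bar> = g x * W x"
        using bessel_log_deriv_bounds(1)[OF s0 \<eta> that] Wpos[of x] by (simp add: W1_def g_def abs_mult)
      also have "\<dots> \<le> (2 * s + 2) * W x"
        using bessel_log_deriv_bounds(2)[OF s0 \<eta> that] Wpos[of x] unfolding g_def by (intro mult_right_mono) auto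
      finally show ?thesis .
    qed
    have W2le: "\<bar>W2 x\<bar> \<le> D * (1 / (1 + x\<^sup>2))" if "x \<ge> 0" for x
    proof -
      have "\<bar>W2 x\<bar> = W x * \<bar>(g x)\<^sup>2 - g' x\<bar>" using Wpos[of x] by (simp add: W2_def abs_mult)
      also have "\<dots> \<le> 1 * (D * (1 / (1 + x\<^sup>2)))"
        using bessel_log_deriv_bounds(3)[OF s0 \<eta> that] bessel_weight_le_1[OF \<eta>(1) s0, of x] Wpos[of x]
        unfolding g_def g'_def D_def W_def by (intro mult_mono) auto
      finally show ?thesis by simp
    qed
    have nt: "cmod (\<i> * complex_of_real y + complex_of_real z) \<le> \<bar>y\<bar> + \<bar>z\<bar>" for y z
      by (rule order_trans[OF norm_triangle_ineq]) (simp add: norm_mult)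
    define \<phi>' where "\<phi>' = (\<lambda>x. u + \<tau> * (a * x powr (a - 1)))"
    define \<phi>'' where "\<phi>'' = (\<lambda>x. \<tau> * (a * ((a - 1) * x powr (a - 2))))"
    define E where "E = (\<lambda>x. iexp (u * x + \<tau> * x powr a))"
    have E1: "cmod (E x) = 1" for x unfolding E_def by (rule cmod_exp_i_of_real)
    have \<phi>: "((\<lambda>x. u * x + \<tau> * x powr a) has_real_derivative \<phi>' x) (at x)" if "x > 0" for x
      unfolding \<phi>'_def by (intro DERIV_add DERIV_cmult_Id DERIV_cmult has_real_derivative_powr that)
    have \<phi>D: "(\<phi>' has_real_derivative \<phi>'' x) (at x)" if "x > 0" for x
      unfolding \<phi>'_def \<phi>''_def
      using DERIV_add[OF DERIV_const DERIV_cmult[OF DERIV_cmult[OF has_real_derivative_powr[OF that, of "a - 1"]]]]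
      by simp
    have \<phi>low: "\<phi>' x \<ge> u / 2" if "x \<in> {0..\<rho>}" for x
    proof -
      have "x powr (a - 1) \<le> \<rho> powr (a - 1)" using that a by (intro powr_mono2) auto
      then have "a * x powr (a - 1) \<le> u / 2" using a unfolding \<rho>a by (simp add: field_simps)
      moreover have "\<bar>\<tau> * (a * x powr (a - 1))\<bar> \<le> 1 * (a * x powr (a - 1))"
        unfolding abs_mult using \<tau> a by (intro mult_mono) auto
      ultimately show ?thesis unfolding \<phi>'_def by linarith
    qed
    have u2: "u / 2 > 0" using u by simp
    have \<phi>pos: "\<phi>' x > 0" if "x \<in> {0..\<rho>}" for x using \<phi>low[OF that] u2 by linarith
    \<comment> \<open>\<open>P\<close> below integrates by parts twice, but the second time only in
      the term with the derivative of the weight. The term with \<open>\<phi>''\<close>, which may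
      blow up like x^(a - 2) at 0, already carries the inverse square of \<open>\<phi>'\<close> and
      is left in \<open>err\<close>.\<close>
    define Q where "Q = (\<lambda>x. W x / \<phi>' x)"
    define R where "R = (\<lambda>x. W1 x / (\<phi>' x)\<^sup>2)"
    define Q' where "Q' = (\<lambda>x. W1 x / \<phi>' x - W x * \<phi>'' x / (\<phi>' x)\<^sup>2)"
    define R' where "R' = (\<lambda>x. W2 x / (\<phi>' x)\<^sup>2 - 2 * W1 x * \<phi>'' x / (\<phi>' x) ^ 3)"
    define P where "P = (\<lambda>x. E x * (- \<i> * of_real (Q x) + of_real (R x)))"
    define err where "err = (\<lambda>x. \<i> * complex_of_real (W x * \<phi>'' x / (\<phi>' x)\<^sup>2) + of_real (R' x))"
    have QD: "(Q has_real_derivative Q' x) (at x)" if "x \<in> {0<..<\<rho>}" for x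
      using DERIV_divide[OF WD \<phi>D, of x] \<phi>pos[of x] that
      unfolding Q_def Q'_def by (simp add: power2_eq_square diff_divide_distrib)
    have RD: "(R has_real_derivative R' x) (at x)" if "x \<in> {0<..<\<rho>}" for x
    proof -
      have p: "\<phi>' x > 0" "x > 0" using \<phi>pos[of x] that by auto
      have "((\<lambda>x. (\<phi>' x)\<^sup>2) has_real_derivative 2 * \<phi>' x * \<phi>'' x) (at x)"
        using DERIV_power[OF \<phi>D[OF p(2)], of 2] by (simp add: mult_ac)
      from DERIV_divide[OF W1D this] p have "(R has_real_derivative (W2 x * (\<phi>' x)\<^sup>2 - W1 x * (2 * \<phi>' x * \<phi>'' x)) / ((\<phi>' x)\<^sup>2 * (\<phi>' x)\<^sup>2)) (at x)"
        unfolding R_def by simp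
      also have "(W2 x * (\<phi>' x)\<^sup>2 - W1 x * (2 * \<phi>' x * \<phi>'' x)) / ((\<phi>' x)\<^sup>2 * (\<phi>' x)\<^sup>2) = R' x"
        using p unfolding R'_def diff_divide_distrib by (simp add: power2_eq_square power3_eq_cube mult_ac)
      finally show ?thesis .
    qed
    have ED: "(E has_vector_derivative (\<i> * \<phi>' x * E x)) (at x)" if "x > 0" for x
    proof -
      have "((\<lambda>x. \<i> * complex_of_real (u * x + \<tau> * x powr a)) has_vector_derivative (\<i> * complex_of_real (\<phi>' x))) (at x)"
        using \<phi>[OF that] by (intro has_vector_derivative_mult_right has_vector_derivative_of_real)
          (simp add: has_real_derivative_iff_has_vector_derivative)
      from field_vector_diff_chain_at[OF this DERIV_exp] show ?thesis
        unfolding E_def o_def by (simp only: mult_ac)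
    qed
    have PD: "(P has_vector_derivative (E x * of_real (W x) + E x * err x)) (at x)" if x: "x \<in> {0<..<\<rho>}" for x
    proof -
      have p: "\<phi>' x > 0" "x > 0" using \<phi>pos[of x] that by auto
      have "((\<lambda>x. - \<i> * of_real (Q x) + complex_of_real (R x)) has_vector_derivative (- \<i> * of_real (Q' x) + of_real (R' x))) (at x)"
        using QD[OF x] RD[OF x]
        by (intro has_vector_derivative_add has_vector_derivative_mult_right has_vector_derivative_of_real)
          (simp_all add: has_real_derivative_iff_has_vector_derivative)
      from has_vector_derivative_mult[OF ED[OF p(2)] this]
      have "(P has_vector_derivative E x * (- \<i> * of_real (Q' x) + of_real (R' x)) + \<i> * \<phi>' x * E x * (- \<i> * of_real (Q x) + of_real (R x))) (at x)"
        unfolding P_def by simp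
      also have "E x * (- \<i> * of_real (Q' x) + of_real (R' x)) + \<i> * \<phi>' x * E x * (- \<i> * of_real (Q x) + of_real (R x)) =
         E x * of_real (\<phi>' x * Q x) + E x * (\<i> * of_real (\<phi>' x * R x - Q' x) + of_real (R' x))"
        by (simp add: algebra_simps)
      also have "\<phi>' x * Q x = W x" using p by (simp add: Q_def)
      also have "\<phi>' x * R x - Q' x = W x * \<phi>'' x / (\<phi>' x)\<^sup>2" using p by (simp add: R_def Q'_def power2_eq_square)
      finally show ?thesis unfolding err_def .
    qed
    have contW: "continuous_on {0..\<rho>} W" "continuous_on {0..\<rho>} W1"
      using DERIV_isCont[OF WD] DERIV_isCont[OF W1D] by (auto intro: continuous_at_imp_continuous_on)
    have cont\<phi>: "continuous_on {0..\<rho>} \<phi>'"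
      unfolding \<phi>'_def using a by (intro continuous_intros continuous_on_powr') auto
    have contE: "continuous_on {0..\<rho>} E"
      unfolding E_def using a by (intro continuous_intros continuous_on_powr') auto
    have contP: "continuous_on {0..\<rho>} P"
    proof -
      have nz: "\<forall>x\<in>{0..\<rho>}. \<phi>' x \<noteq> 0" "\<forall>x\<in>{0..\<rho>}. (\<phi>' x)\<^sup>2 \<noteq> 0" using \<phi>pos by force+
      show ?thesis unfolding P_def Q_def R_def
        by (intro continuous_on_mult continuous_on_add continuous_on_of_real continuous_on_divide continuous_on_power continuous_on_const contE contW cont\<phi> nz)
    qed
    \<comment> \<open>For a < 2 the second derivative of the phase is unbounded near 0, so
      \<open>P\<close> is differentiated in the interior only; at the endpoints continuity is
      enough.\<close>
    have FTC: "((\<lambda>x. E x * of_real (W x) + E x * err x) has_integral P \<rho> - P 0) {0..\<rho>}"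
      using \<rho> PD contP by (intro fundamental_theorem_of_calculus_interior) auto
    have int1: "(\<lambda>x. E x * of_real (W x)) integrable_on {0..\<rho>}"
      by (intro integrable_continuous_real continuous_on_mult continuous_on_of_real contE contW)
    have int2: "(\<lambda>x. E x * err x) integrable_on {0..\<rho>}"
      using integrable_diff[OF has_integral_integrable[OF FTC] int1] by simp
    have eq: "integral {0..\<rho>} (\<lambda>x. E x * of_real (W x)) + integral {0..\<rho>} (\<lambda>x. E x * err x) = P \<rho> - P 0"
      using integral_unique[OF FTC] Henstock_Kurzweil_Integration.integral_add[OF int1 int2] by simp
    \<comment> \<open>At 0 the weight is 1, its derivative is 0 and \<open>\<phi>'\<close> is u. The
      boundary term is thus free of \<tau> and of \<eta>.\<close>
    have P0: "P 0 = - (\<i> / u)"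
      using a by (simp add: P_def E_def Q_def R_def W_def W1_def g_def \<phi>'_def bessel_weight_def)
    \<comment> \<open>Here 36 + 32 s = 4 (9 + 8 s): the 4 comes from bounding the inverse square of
      \<open>\<phi>'\<close> by 4/u^2, and 9 + 8 s = 1 + 4 (2 s + 2) collects the two terms with
      \<open>\<phi>''\<close>.\<close>
    define B where "B = (\<lambda>x. (1 / u\<^sup>2) * ((36 + 32 * s) * (a * (a - 1)) * x powr (a - 2 - \<sigma>) + 4 * D * (1 / (1 + x\<^sup>2))))"
    have intB: "(B has_integral (1 / u\<^sup>2) * ((36 + 32 * s) * (a * (a - 1)) * (\<rho> powr (a - 2 - \<sigma> + 1) / (a - 2 - \<sigma> + 1)) + 4 * D * (arctan \<rho> - arctan 0))) {0..\<rho>}"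
      unfolding B_def
    proof (intro has_integral_mult_right has_integral_add has_integral_powr_from_0)
      show "((\<lambda>x. 1 / (1 + x\<^sup>2)) has_integral arctan \<rho> - arctan 0) {0..\<rho>}"
        using \<rho> by (intro fundamental_theorem_of_calculus)
          (auto intro!: derivative_eq_intros DERIV_subset[OF DERIV_arctan] simp: has_real_derivative_iff_has_vector_derivative[symmetric] divide_inverse)
    qed (use \<sigma> a \<rho> in auto)
    have errB: "cmod (E x * err x) \<le> B x" if x: "x \<in> {0..\<rho>}" for x
    proof -
      define f where "f = \<phi>' x"
      have f: "f \<ge> u / 2" "f > 0" using \<phi>low[OF x] \<phi>pos[OF x] by (auto simp: f_def)
      have x0: "x \<ge> 0" using x by simp
      have f2: "1 / f\<^sup>2 \<le> 4 / u\<^sup>2"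
      proof -
        have "(u / 2)\<^sup>2 \<le> f\<^sup>2" using f u by (intro power_mono) auto
        then have "1 / f\<^sup>2 \<le> 1 / (u / 2)\<^sup>2" using u f by (intro divide_left_mono) auto
        then show ?thesis by (simp add: power_divide)
      qed
      \<comment> \<open>As u \<ge> 1, one of the three factors 1/f in the cubic term may be traded
        for the constant 2.\<close>
      have f1: "1 / f \<le> 2"
        using f u by (simp add: field_simps)
      have W\<phi>: "W x * \<bar>\<phi>'' x\<bar> \<le> a * (a - 1) * x powr (a - 2 - \<sigma>)"
      proof (cases "x = 0")
        case True then show ?thesis by (simp add: \<phi>''_def)
      next
        case False
        then have "x > 0" using x0 by simp
        then have "W x \<le> x powr (-\<sigma>)" unfolding W_def using \<eta> \<sigma> by (intro bessel_weight_le_powr) auto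
        moreover have "\<bar>\<phi>'' x\<bar> \<le> 1 * (a * ((a - 1) * x powr (a - 2)))"
          unfolding \<phi>''_def abs_mult[of \<tau>] using \<tau> a by (intro mult_mono) (auto simp: abs_mult)
        ultimately have "W x * \<bar>\<phi>'' x\<bar> \<le> x powr (-\<sigma>) * (1 * (a * ((a - 1) * x powr (a - 2))))"
          using Wpos[of x] by (intro mult_mono) auto
        also have "\<dots> = a * (a - 1) * (x powr (-\<sigma>) * x powr (a - 2))" by simp
        also have "x powr (-\<sigma>) * x powr (a - 2) = x powr (a - 2 - \<sigma>)" unfolding powr_add[symmetric] by (simp add: algebra_simps)
        finally show ?thesis .
      qed
      have "cmod (E x * err x) = cmod (err x)" by (simp add: norm_mult E1)
      also have "\<dots> \<le> \<bar>W x * \<phi>'' x / f\<^sup>2\<bar> + \<bar>R' x\<bar>"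
        unfolding err_def f_def[symmetric] by (rule nt)
      also have "\<bar>R' x\<bar> \<le> \<bar>W2 x / f\<^sup>2\<bar> + \<bar>2 * W1 x * \<phi>'' x / f ^ 3\<bar>"
        unfolding R'_def f_def[symmetric] by (rule abs_triangle_ineq4)
      also have "\<bar>W x * \<phi>'' x / f\<^sup>2\<bar> = (W x * \<bar>\<phi>'' x\<bar>) * (1 / f\<^sup>2)" using Wpos[of x] by (simp add: abs_mult)
      also have "\<bar>W2 x / f\<^sup>2\<bar> = \<bar>W2 x\<bar> * (1 / f\<^sup>2)" by simp
      also have "\<bar>2 * W1 x * \<phi>'' x / f ^ 3\<bar> = 2 * \<bar>W1 x\<bar> * \<bar>\<phi>'' x\<bar> * (1 / f) * (1 / f\<^sup>2)"
        using f by (simp add: abs_mult power3_eq_cube power2_eq_square)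
      also have "\<dots> \<le> 2 * ((2 * s + 2) * W x) * \<bar>\<phi>'' x\<bar> * 2 * (1 / f\<^sup>2)"
        using f f1 W1le[OF x0] by (intro mult_mono mult_nonneg_nonneg) (use s Wpos[of x] in auto)
      finally have "cmod (E x * err x) \<le> (1 / f\<^sup>2) * ((9 + 8 * s) * (W x * \<bar>\<phi>'' x\<bar>) + \<bar>W2 x\<bar>)"
        by (simp add: algebra_simps)
      also have "\<dots> \<le> (4 / u\<^sup>2) * ((9 + 8 * s) * (a * (a - 1) * x powr (a - 2 - \<sigma>)) + D * (1 / (1 + x\<^sup>2)))"
        by (rule mult_mono[OF f2 add_mono[OF mult_left_mono[OF W\<phi>] W2le[OF x0]]]) (use s Wpos[of x] in auto)
      also have "\<dots> = B x"
      proof -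
        have "4 * k * ((9 + 8 * s) * (m * X) + D * Y) = k * ((36 + 32 * s) * m * X + 4 * D * Y)" for k m X Y
          by (simp add: algebra_simps)
        from this[of "1 / u\<^sup>2"] show ?thesis unfolding B_def by simp
      qed
      finally show ?thesis .
    qed
    have up: "u powr (-(1 + \<kappa>)) = (1 / u) * u powr (-\<kappa>)"
    proof -
      have "u powr (-(1 + \<kappa>)) = u powr (-1) * u powr (-\<kappa>)" unfolding powr_add[symmetric] by simp
      also have "u powr (-1) = 1 / u" unfolding powr_minus_divide using u by simp
      finally show ?thesis .
    qed
    have uu: "1 / u\<^sup>2 = u powr (-2)" unfolding powr_minus_divide using u by (simp add: powr_numeral)
    have I2: "cmod (integral {0..\<rho>} (\<lambda>x. E x * err x)) \<le> (C2 + C3) * u powr (-(1 + \<kappa>))"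
    proof -
      have "cmod (integral {0..\<rho>} (\<lambda>x. E x * err x)) \<le> integral {0..\<rho>} B"
        by (rule Henstock_Kurzweil_Integration.integral_norm_bound_integral[OF int2 has_integral_integrable[OF intB] errB])
      also have "\<dots> = (1 / u\<^sup>2) * ((36 + 32 * s) * (a * (a - 1)) * (\<rho> powr (a - 1 - \<sigma>) / (a - 1 - \<sigma>)) + 4 * D * arctan \<rho>)"
        using integral_unique[OF intB] by (simp add: algebra_simps)
      also have "\<dots> \<le> (1 / u\<^sup>2) * ((36 + 32 * s) * (a * (a - 1)) * (\<rho> powr (a - 1 - \<sigma>) / (a - 1 - \<sigma>)) + 4 * D * (pi / 2))"
        using D arctan_ubound[of \<rho>] by (intro mult_left_mono add_left_mono) auto
      also have "\<rho> powr (a - 1 - \<sigma>) = (1 / (2 * a)) powr (1 - \<kappa>) * u powr (1 - \<kappa>)"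
      proof -
        have "(a - 1 - \<sigma>) / (a - 1) = 1 - \<kappa>" using a by (simp add: \<kappa>_def field_simps)
        then have "\<rho> powr (a - 1 - \<sigma>) = (1 / (2 * a) * u) powr (1 - \<kappa>)" unfolding \<rho>p by simp
        then show ?thesis using a u by (simp only: powr_mult)
      qed
      also have "(1 / u\<^sup>2) * ((36 + 32 * s) * (a * (a - 1)) * ((1 / (2 * a)) powr (1 - \<kappa>) * u powr (1 - \<kappa>) / (a - 1 - \<sigma>)) + 4 * D * (pi / 2))
         = C2 * ((1 / u\<^sup>2) * u powr (1 - \<kappa>)) + C3 * (1 / u\<^sup>2)"
      proof -
        have "k * (A * (Y * Z / V) + X) = A * (Y / V) * (k * Z) + X * k" for k A Y Z V X :: real
          by (simp add: algebra_simps)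
        then show ?thesis unfolding C2_def C3_def .
      qed
      also have "(1 / u\<^sup>2) * u powr (1 - \<kappa>) = u powr (-(1 + \<kappa>))"
        unfolding uu powr_add[symmetric] by simp
      also have "C3 * (1 / u\<^sup>2) \<le> C3 * u powr (-(1 + \<kappa>))"
      proof (intro mult_left_mono)
        have "u powr (-2) \<le> u powr (-(1 + \<kappa>))" using u \<kappa> by (intro powr_mono) auto
        then show "1 / u\<^sup>2 \<le> u powr (-(1 + \<kappa>))" unfolding uu .
      qed (rule C)
      finally show ?thesis by (simp only: distrib_right)
    qed
    have I1: "cmod (P \<rho>) \<le> C1 * u powr (-(1 + \<kappa>))"
    proof -
      have r: "\<rho> \<in> {0..\<rho>}" using \<rho> by simp
      define f where "f = \<phi>' \<rho>"
      have f: "f \<ge> u / 2" "f > 0" using \<phi>low[OF r] \<phi>pos[OF r] by (auto simp: f_def)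
      have f1: "1 / f \<le> 2 / u" "1 / f \<le> 2" using f u by (simp_all add: field_simps)
      have "cmod (P \<rho>) \<le> \<bar>Q \<rho>\<bar> + \<bar>R \<rho>\<bar>"
        using nt[of "- Q \<rho>" "R \<rho>"] unfolding P_def norm_mult E1 by simp
      also have "\<bar>Q \<rho>\<bar> = W \<rho> * (1 / f)" using Wpos[of \<rho>] f by (simp add: Q_def f_def)
      also have "\<bar>R \<rho>\<bar> = \<bar>W1 \<rho>\<bar> * (1 / f) * (1 / f)" using f by (simp add: R_def f_def power2_eq_square)
      also have "\<dots> \<le> ((2 * s + 2) * W \<rho>) * 2 * (2 / u)"
        using f f1 W1le[of \<rho>] \<rho> u s Wpos[of \<rho>] by (intro mult_mono mult_nonneg_nonneg) auto
      also have "W \<rho> * (1 / f) \<le> W \<rho> * (2 / u)" using f1 Wpos[of \<rho>] by (intro mult_left_mono) auto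
      also have "W \<rho> * (2 / u) + ((2 * s + 2) * W \<rho>) * 2 * (2 / u) = (8 * s + 10) * ((1 / u) * W \<rho>)"
      proof -
        have "w * (2 * k) + ((2 * s + 2) * w) * 2 * (2 * k) = (8 * s + 10) * (k * w)" for w k by (simp add: algebra_simps)
        from this[of "W \<rho>" "1 / u"] show ?thesis by simp
      qed
      also have "\<dots> \<le> (8 * s + 10) * ((1 / u) * ((2 * a) powr \<kappa> * u powr (-\<kappa>)))"
      proof (intro mult_left_mono)
        have "W \<rho> \<le> \<rho> powr (-\<sigma>)" unfolding W_def using \<eta> \<sigma> \<rho> by (intro bessel_weight_le_powr) auto
        also have "\<dots> = (u / (2 * a)) powr (-\<kappa>)" unfolding \<rho>p by (simp add: \<kappa>_def)
        also have "\<dots> = u powr (-\<kappa>) / (2 * a) powr (-\<kappa>)" by (rule powr_divide)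
        also have "\<dots> = (2 * a) powr \<kappa> * u powr (-\<kappa>)" unfolding powr_minus_divide by simp
        finally show "W \<rho> \<le> (2 * a) powr \<kappa> * u powr (-\<kappa>)" .
      qed (use u s in auto)
      also have "\<dots> = C1 * u powr (-(1 + \<kappa>))" unfolding up C1_def by (simp only: mult_ac)
      finally show ?thesis by simp
    qed
    have "integral {0..\<rho>} (\<lambda>x. E x * of_real (W x)) - \<i> / u = P \<rho> - integral {0..\<rho>} (\<lambda>x. E x * err x)"
      using eq unfolding P0 by (simp add: algebra_simps)
    also have "cmod \<dots> \<le> cmod (P \<rho>) + cmod (integral {0..\<rho>} (\<lambda>x. E x * err x))" by (rule norm_triangle_ineq4)
    also have "\<dots> \<le> C1 * u powr (-(1 + \<kappa>)) + (C2 + C3) * u powr (-(1 + \<kappa>))" using I1 I2 by (rule add_mono)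
    also have "\<dots> = (C1 + C2 + C3) * u powr (-(1 + \<kappa>))" by (simp only: distrib_right add.assoc)
    finally show ?thesis unfolding E_def W_def \<rho>_def .
  qed
  then show ?thesis using C by (intro exI[of _ "C1 + C2 + C3"]) auto
qed

section \<open>Kernel bounds uniform in the time difference\<close>

lemma osc_kernel_half_reflect:
  assumes "\<eta> > 0" "\<eta> \<le> 1" "s \<ge> 0"
  shows "osc_kernel a s \<eta> u \<tau> = osc_half a s \<eta> \<bar>u\<bar> \<tau> + cnj (osc_half a s \<eta> \<bar>u\<bar> (-\<tau>))"
  using osc_kernel_eq_half[OF assms, of a u \<tau>] osc_half_uminus[of a s \<eta> u "-\<tau>"] osc_half_uminus[of a s \<eta> "-u" "-\<tau>"]
  by (cases "u \<ge> 0") (simp_all add: add.commute)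

text \<open>The second half enters as a conjugate, so subtracting the same imaginary
  \<open>z\<close> from both halves does not change their sum. With z = 0 this is the triangle
  inequality; with z = \<i>/|u| it removes the boundary term at the origin.\<close>

lemma osc_kernel_bound_of_half:
  assumes "\<eta> > 0" "\<eta> \<le> 1" "s \<ge> 0"
    and "cmod (osc_half a s \<eta> \<bar>u\<bar> \<tau> - z) \<le> B" "cmod (osc_half a s \<eta> \<bar>u\<bar> (-\<tau>) - z) \<le> B" "Re z = 0"
  shows "cmod (osc_kernel a s \<eta> u \<tau>) \<le> 2 * B"
proof -
  have "osc_kernel a s \<eta> u \<tau> = (osc_half a s \<eta> \<bar>u\<bar> \<tau> - z) + cnj (osc_half a s \<eta> \<bar>u\<bar> (-\<tau>) - z)"
    unfolding osc_kernel_half_reflect[OF assms(1-3)] using assms(6) by (simp add: complex_eq_iff)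
  also have "cmod \<dots> \<le> B + B"
    using assms(4,5) by (intro norm_triangle_mono) (simp_all only: complex_mod_cnj)
  finally show ?thesis by simp
qed

text \<open>The homogeneous choice \<sigma> = 2 s = 1 - 2/q reaches the value 1/2, needed in
  \<open>osc_half_bound_small\<close>, precisely when q \<ge> 4; the stationary point then never
  dominates.\<close>

lemma osc_kernel_bound_ge_4:
  fixes a q :: real
  assumes "a > 1" "q \<ge> 4"
  shows "\<exists>C>0. \<forall>\<eta> u \<tau>. 0 < \<eta> \<longrightarrow> \<eta> \<le> 1 \<longrightarrow> u \<noteq> 0 \<longrightarrow> \<bar>\<tau>\<bar> \<le> 1 \<longrightarrow>
    cmod (osc_kernel a (1/2 - 1/q) \<eta> u \<tau>) \<le> C * \<bar>u\<bar> powr (-(2/q))"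
proof -
  define \<sigma> where "\<sigma> = 1 - 2 / q"
  define s where "s = 1/2 - 1/q"
  define C where "C = 1 / (1 - \<sigma>) + 48 / (min 1 (a - 1) / 2)"
  have \<sigma>: "1/2 \<le> \<sigma>" "\<sigma> < 1" "\<sigma> \<le> 2 * s" using assms by (auto simp: \<sigma>_def s_def field_simps)
  have s: "s \<ge> 0" using \<sigma> by simp
  have C: "C > 0" unfolding C_def using \<sigma> assms by (intro add_pos_pos) auto
  have "cmod (osc_kernel a s \<eta> u \<tau>) \<le> (2 * C) * \<bar>u\<bar> powr (-(2/q))"
    if \<eta>: "0 < \<eta>" "\<eta> \<le> 1" and u: "u \<noteq> 0" and "\<bar>\<tau>\<bar> \<le> 1" for \<eta> u \<tau>
  proof -
    have "cmod (osc_half a s \<eta> \<bar>u\<bar> \<tau>') \<le> C * \<bar>u\<bar> powr (-(2/q))" for \<tau>'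
      using osc_half_bound_small[OF assms(1) \<eta> _ \<sigma>, of "\<bar>u\<bar>" \<tau>'] u by (simp add: C_def \<sigma>_def)
    then show ?thesis
      using osc_kernel_bound_of_half[OF \<eta> s, of a u \<tau> 0 "C * \<bar>u\<bar> powr (-(2/q))"] by simp
  qed
  then show ?thesis using C unfolding s_def by (intro exI[of _ "2 * C"]) auto
qed

text \<open>Here \<open>s\<close> is the solution of \<gamma> = 2/q, and q < 4 makes it at least
  1/4. For |u| \<le> 1 the exponent 1/2 of \<open>osc_half_bound_small\<close> is already better
  than 2/q; for |u| > 1 both exponents 1 and \<gamma> of \<open>osc_half_bound_large\<close> are at
  least 2/q.\<close>

lemma osc_kernel_bound_between:
  fixes a q :: real
  assumes a: "a > 1" and q: "2 < q" "q < 4"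
  shows "\<exists>C>0. \<forall>\<eta> u \<tau>. 0 < \<eta> \<longrightarrow> \<eta> \<le> 1 \<longrightarrow> u \<noteq> 0 \<longrightarrow> \<bar>\<tau>\<bar> \<le> 1 \<longrightarrow>
    cmod (osc_kernel a (1/2 - a/4 + (a - 1)/q) \<eta> u \<tau>) \<le> C * \<bar>u\<bar> powr (-(2/q))"
proof -
  define s where "s = 1/2 - a/4 + (a - 1)/q"
  define c where "c = min 1 (a - 1) / 2"
  have c: "c > 0" using a by (simp add: c_def)
  have s_eq: "2 * s - 1/2 = (a - 1) * (2/q - 1/2)" by (simp add: s_def algebra_simps diff_divide_distrib)
  have "2 / q \<ge> 1 / 2" using q by (simp add: field_simps)
  then have "0 \<le> (a - 1) * (2/q - 1/2)" using a by (intro mult_nonneg_nonneg) auto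
  then have s4: "s \<ge> 1/4" unfolding s_eq[symmetric] by linarith
  then have s: "s \<ge> 0" by simp
  have \<gamma>: "1/2 + (2 * s - 1/2) / (a - 1) = 2 / q" unfolding s_eq using a by simp
  define C1 where "C1 = 1 / (1 - 1/2) + 48 / c"
  define C2 where "C2 = (1 + 16 / c) + 16 / c * (2 powr (2 * s) * a powr (2/q - 1/2))"
  have C: "C1 > 0" "C2 > 0" using c a by (auto simp: C1_def C2_def intro!: add_pos_pos add_pos_nonneg)
  have "cmod (osc_kernel a s \<eta> u \<tau>) \<le> (2 * (C1 + C2)) * \<bar>u\<bar> powr (-(2/q))"
    if \<eta>: "0 < \<eta>" "\<eta> \<le> 1" and u: "u \<noteq> 0" and \<tau>: "\<bar>\<tau>\<bar> \<le> 1" for \<eta> u \<tau>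
  proof -
    have "cmod (osc_half a s \<eta> \<bar>u\<bar> \<tau>') \<le> (C1 + C2) * \<bar>u\<bar> powr (-(2/q))" if \<tau>': "\<bar>\<tau>'\<bar> \<le> 1" for \<tau>'
    proof (cases "\<bar>u\<bar> \<le> 1")
      case True
      have "cmod (osc_half a s \<eta> \<bar>u\<bar> \<tau>') \<le> C1 * \<bar>u\<bar> powr (1/2 - 1)"
        unfolding C1_def c_def using a \<eta> u s4 by (intro osc_half_bound_small) auto
      also have "\<dots> \<le> C1 * \<bar>u\<bar> powr (-(2/q))"
        using C u True \<open>2 / q \<ge> 1 / 2\<close> by (intro mult_left_mono powr_mono') auto
      also have "\<dots> \<le> (C1 + C2) * \<bar>u\<bar> powr (-(2/q))" using C by (intro mult_right_mono) auto
      finally show ?thesis .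
    next
      case False
      have "cmod (osc_half a s \<eta> \<bar>u\<bar> \<tau>') \<le> (1 + 16 / c) * \<bar>u\<bar> powr (-1) + 16 / c * (2 powr (2 * s) * a powr (2/q - 1/2)) * \<bar>u\<bar> powr (-(2/q))"
        using osc_half_bound_large[OF a \<eta> _ s4 \<tau>', of "\<bar>u\<bar>"] False unfolding \<gamma> c_def by simp
      also have "\<dots> \<le> (1 + 16 / c) * \<bar>u\<bar> powr (-(2/q)) + 16 / c * (2 powr (2 * s) * a powr (2/q - 1/2)) * \<bar>u\<bar> powr (-(2/q))"
        using c False q by (intro add_right_mono mult_left_mono powr_mono) auto
      also have "\<dots> = C2 * \<bar>u\<bar> powr (-(2/q))" unfolding C2_def by (simp only: distrib_right)
      also have "\<dots> \<le> (C1 + C2) * \<bar>u\<bar> powr (-(2/q))" using C by (intro mult_right_mono) auto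
      finally show ?thesis .
    qed
    from this[OF \<tau>] this[of "-\<tau>"] \<tau>
    have "cmod (osc_kernel a s \<eta> u \<tau>) \<le> 2 * ((C1 + C2) * \<bar>u\<bar> powr (-(2/q)))"
      using osc_kernel_bound_of_half[OF \<eta> s, of a u \<tau> 0 "(C1 + C2) * \<bar>u\<bar> powr (-(2/q))"] by simp
    then show ?thesis by (simp only: mult.assoc)
  qed
  then show ?thesis using C unfolding s_def by (intro exI[of _ "2 * (C1 + C2)"]) auto
qed

text \<open>The threshold a/4 is the value of \<open>s\<close> at which \<gamma> = 1. The other
  exponent 1 + \<kappa> arises in \<open>osc_mid\<close> and from the size of the weight at the cut;
  \<open>\<beta>\<close> is the smaller of the two.\<close>

lemma osc_kernel_bound_2:
  fixes a s :: real
  assumes a: "a > 1" and s: "s > a / 4"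
  shows "\<exists>\<beta>>1. \<exists>C>0. \<forall>\<eta> u \<tau>. 0 < \<eta> \<longrightarrow> \<eta> \<le> 1 \<longrightarrow> u \<noteq> 0 \<longrightarrow> \<bar>\<tau>\<bar> \<le> 1 \<longrightarrow>
    cmod (osc_kernel a s \<eta> u \<tau>) \<le> C * (if \<bar>u\<bar> \<le> 1 then \<bar>u\<bar> powr (-(1/2)) else \<bar>u\<bar> powr (-\<beta>))"
proof -
  define c where "c = min 1 (a - 1) / 2"
  have c: "c > 0" using a by (simp add: c_def)
  have s4: "s \<ge> 1/4" and s0: "s \<ge> 0" using a s by auto
  define \<sigma> where "\<sigma> = min (2 * s) ((a - 1) / 2)"
  define \<kappa> where "\<kappa> = \<sigma> / (a - 1)"
  define \<gamma> where "\<gamma> = 1/2 + (2 * s - 1/2) / (a - 1)"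
  define \<beta> where "\<beta> = min (1 + \<kappa>) \<gamma>"
  have \<sigma>: "\<sigma> > 0" "\<sigma> \<le> 2 * s" using a s4 by (auto simp: \<sigma>_def)
  have \<kappa>: "\<kappa> > 0" using \<sigma> a by (simp add: \<kappa>_def)
  have "\<gamma> > 1" unfolding \<gamma>_def using a s by (simp add: field_simps)
  then have \<beta>: "\<beta> > 1" "\<beta> \<le> 1 + \<kappa>" "\<beta> \<le> \<gamma>" using \<kappa> by (auto simp: \<beta>_def)
  obtain C0 where C0: "C0 \<ge> 0" "\<And>\<eta> u \<tau>. 0 < \<eta> \<Longrightarrow> \<eta> \<le> 1 \<Longrightarrow> u \<ge> 1 \<Longrightarrow> \<bar>\<tau>\<bar> \<le> 1 \<Longrightarrow>
    cmod (integral {0..(u / (2 * a)) powr (1 / (a - 1))} (\<lambda>x. iexp (u * x + \<tau> * x powr a) * complex_of_real (bessel_weight s \<eta> x)) - \<i> / u)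
      \<le> C0 * u powr (-(1 + \<kappa>))"
    using osc_mid[OF a s4] unfolding \<kappa>_def \<sigma>_def by blast
  define C1 where "C1 = 1 / (1 - 1/2) + 48 / c"
  define D where "D = 2 powr (2 * s) * a powr (\<gamma> - 1/2)"
  define C2 where "C2 = C0 + 16 / c * ((2 * a) powr \<kappa> + D)"
  have D: "D > 0" using a by (simp add: D_def)
  have "16 / c * ((2 * a) powr \<kappa> + D) > 0" using a c D by (intro mult_pos_pos add_pos_pos) auto
  then have C: "C1 > 0" "C2 > 0" "D > 0"
    using c D C0(1) by (auto simp: C1_def C2_def intro!: add_pos_pos)
  have "cmod (osc_kernel a s \<eta> u \<tau>) \<le> (2 * (C1 + C2)) * (if \<bar>u\<bar> \<le> 1 then \<bar>u\<bar> powr (-(1/2)) else \<bar>u\<bar> powr (-\<beta>))"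
    if \<eta>: "0 < \<eta>" "\<eta> \<le> 1" and u: "u \<noteq> 0" and \<tau>: "\<bar>\<tau>\<bar> \<le> 1" for \<eta> u \<tau>
  proof (cases "\<bar>u\<bar> \<le> 1")
    case True
    have "cmod (osc_half a s \<eta> \<bar>u\<bar> \<tau>') \<le> C1 * \<bar>u\<bar> powr (-(1/2))" for \<tau>'
    proof -
      have "cmod (osc_half a s \<eta> \<bar>u\<bar> \<tau>') \<le> C1 * \<bar>u\<bar> powr (1/2 - 1)"
        unfolding C1_def c_def using a \<eta> u s4 by (intro osc_half_bound_small) auto
      then show ?thesis by simp
    qed
    then have "cmod (osc_kernel a s \<eta> u \<tau>) \<le> 2 * (C1 * \<bar>u\<bar> powr (-(1/2)))"
      using osc_kernel_bound_of_half[OF \<eta> s0, of a u \<tau> 0] by simp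
    also have "\<dots> = (2 * C1) * \<bar>u\<bar> powr (-(1/2))" by simp
    also have "\<dots> \<le> (2 * (C1 + C2)) * \<bar>u\<bar> powr (-(1/2))" using C by (intro mult_right_mono) auto
    finally show ?thesis using True by simp
  next
    case False
    define v where "v = \<bar>u\<bar>"
    have v: "v \<ge> 1" using False by (simp add: v_def)
    \<comment> \<open>The cut is moved from 1/v, used in the other ranges, to the end of the
      interval treated by \<open>osc_mid\<close>.\<close>
    define \<rho> where "\<rho> = (v / (2 * a)) powr (1 / (a - 1))"
    have \<rho>: "\<rho> > 0" using v a by (simp add: \<rho>_def)
    have half: "cmod (osc_half a s \<eta> v \<tau>' - \<i> / v) \<le> C2 * v powr (-\<beta>)" if \<tau>': "\<bar>\<tau>'\<bar> \<le> 1" for \<tau>'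
    proof -
      define \<xi> where "\<xi> = osc_point a v \<tau>'"
      define w where "w = bessel_weight s \<eta>"
      define X where "X = integral {0..\<rho>} (\<lambda>x. iexp (v * x + \<tau>' * x powr a) * complex_of_real (w x))"
      define Y where "Y = (LINT x|lborel. indicator {\<rho>..} x *\<^sub>R (iexp (v * x + \<tau>' * x powr a) * complex_of_real (w x)))"
      define M where "M = max \<rho> (\<xi> / 2)"
      have X: "cmod (X - \<i> / v) \<le> C0 * v powr (-(1 + \<kappa>))"
        unfolding X_def \<rho>_def w_def using C0(2)[OF \<eta> v \<tau>'] .
      have pb: "v powr (-(1 + \<kappa>)) \<le> v powr (-\<beta>)" "v powr (-\<gamma>) \<le> v powr (-\<beta>)"
        using v \<beta> by (auto intro!: powr_mono)
      have "w \<rho> \<le> \<rho> powr (-\<sigma>)" unfolding w_def using \<eta> \<sigma> \<rho> by (intro bessel_weight_le_powr) auto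
      also have "\<dots> = (v / (2 * a)) powr (-\<kappa>)" unfolding \<rho>_def powr_powr by (simp add: \<kappa>_def)
      also have "\<dots> = v powr (-\<kappa>) / (2 * a) powr (-\<kappa>)" by (rule powr_divide)
      also have "\<dots> = (2 * a) powr \<kappa> * v powr (-\<kappa>)" unfolding powr_minus_divide by simp
      finally have "w \<rho> / v \<le> (2 * a) powr \<kappa> * v powr (-\<kappa>) / v" using v by (intro divide_right_mono) auto
      also have "\<dots> = (2 * a) powr \<kappa> * (v powr (-\<kappa>) * v powr (-1))" unfolding powr_minus_divide using v by simp
      also have "v powr (-\<kappa>) * v powr (-1) = v powr (-(1 + \<kappa>))" unfolding powr_add[symmetric] by (simp add: algebra_simps)
      also have "(2 * a) powr \<kappa> * v powr (-(1 + \<kappa>)) \<le> (2 * a) powr \<kappa> * v powr (-\<beta>)"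
        using pb by (intro mult_left_mono) auto
      finally have t1: "w \<rho> / v \<le> (2 * a) powr \<kappa> * v powr (-\<beta>)" .
      have t2: "(if \<tau>' < 0 then w M * sqrt (\<xi> / v) else 0) \<le> D * v powr (-\<beta>)"
      proof (cases "\<tau>' < 0")
        case True
        then have "\<tau>' \<noteq> 0" "v > 0" "M \<ge> osc_point a v \<tau>' / 2" using v by (auto simp: M_def \<xi>_def)
        then have "w M * sqrt (\<xi> / v) \<le> D * v powr (-\<gamma>)"
          unfolding w_def \<xi>_def D_def \<gamma>_def using a s4 \<eta>(1) \<tau>' by (intro osc_stationary)
        also have "\<dots> \<le> D * v powr (-\<beta>)" using pb C by (intro mult_left_mono) auto
        finally show ?thesis using True by (simp only: if_True)
      next
        case False then show ?thesis using C by simp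
      qed
      have "cmod Y \<le> 16 / c * (w \<rho> / v + (if \<tau>' < 0 then w M * sqrt (\<xi> / v) else 0))"
        unfolding Y_def w_def c_def \<xi>_def M_def
        by (intro osc_tail) (use a \<eta> v s0 \<rho> in auto)
      also have "\<dots> \<le> 16 / c * ((2 * a) powr \<kappa> * v powr (-\<beta>) + D * v powr (-\<beta>))"
        using t1 t2 c by (intro mult_left_mono add_mono) auto
      finally have Y: "cmod Y \<le> 16 / c * ((2 * a) powr \<kappa> * v powr (-\<beta>) + D * v powr (-\<beta>))" .
      have "osc_half a s \<eta> v \<tau>' - \<i> / v = (X - \<i> / v) + Y"
        unfolding osc_half_split[OF s0 \<eta> \<rho>] X_def Y_def w_def by simp
      also have "cmod \<dots> \<le> C0 * v powr (-\<beta>) + 16 / c * ((2 * a) powr \<kappa> * v powr (-\<beta>) + D * v powr (-\<beta>))"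
        using order_trans[OF X mult_left_mono[OF pb(1) C0(1)]] Y by (intro norm_triangle_mono)
      also have "\<dots> = C2 * v powr (-\<beta>)" unfolding C2_def by (simp only: distrib_right distrib_left mult.assoc)
      finally show ?thesis .
    qed
    have "cmod (osc_kernel a s \<eta> u \<tau>) \<le> 2 * (C2 * v powr (-\<beta>))"
      using half[OF \<tau>] half[of "-\<tau>"] \<tau> unfolding v_def
      by (intro osc_kernel_bound_of_half[OF \<eta> s0, where z="\<i> / complex_of_real \<bar>u\<bar>"]) auto
    also have "\<dots> = (2 * C2) * v powr (-\<beta>)" by simp
    also have "\<dots> \<le> (2 * (C1 + C2)) * v powr (-\<beta>)" using C by (intro mult_right_mono) auto
    finally show ?thesis using False by (simp add: v_def)
  qed
  then show ?thesis using C \<beta> by (intro exI[of _ \<beta>] conjI exI[of _ "2 * (C1 + C2)"]) auto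
qed

section \<open>Bilinear bounds and Hardy--Littlewood--Sobolev\<close>

lemma ennreal_powr_ennreal [simp]: "r \<ge> 0 \<Longrightarrow> ennreal_powr (ennreal r) p = ennreal (r powr p)"
  by (simp add: ennreal_powr_def)

lemma ennreal_powr_top [simp]: "ennreal_powr top p = top"
  by (simp add: ennreal_powr_def)

lemma ennreal_powr_zero [simp]: "ennreal_powr 0 p = 0"
  by (simp add: ennreal_powr_def)

lemma ennreal_powr_measurable [measurable]: "(\<lambda>x. ennreal_powr x p) \<in> borel_measurable borel"
  unfolding ennreal_powr_def by measurable

lemma ennreal_powr_eq_0_iff: "ennreal_powr x p = 0 \<longleftrightarrow> x = 0"
  by (cases x rule: ennreal_cases) auto

lemma ennreal_powr_eq_top_iff: "ennreal_powr x p = top \<longleftrightarrow> x = top"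
  by (cases x rule: ennreal_cases) auto

lemma ennreal_powr_mult: "ennreal_powr (x * y) p = ennreal_powr x p * ennreal_powr y p"
proof (cases "x = 0 \<or> y = 0")
  case False
  show ?thesis
  proof (cases "x = top \<or> y = top")
    case True
    then show ?thesis using False by (auto simp: ennreal_top_mult ennreal_mult_top ennreal_powr_eq_0_iff)
  next
    case F: False
    then obtain r s where rs: "x = ennreal r" "y = ennreal s" "r \<ge> 0" "s \<ge> 0"
      by (metis ennreal_cases)
    have "ennreal_powr (x * y) p = ennreal_powr (ennreal (r * s)) p" using rs by (simp add: ennreal_mult)
    also have "\<dots> = ennreal (r powr p * s powr p)" using rs by (simp add: powr_mult)
    also have "\<dots> = ennreal_powr x p * ennreal_powr y p" using rs by (simp add: ennreal_mult)
    finally show ?thesis .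
  qed
qed auto

lemma ennreal_powr_powr: "ennreal_powr (ennreal_powr x p) q = ennreal_powr x (p * q)"
  by (cases x rule: ennreal_cases) (auto simp: powr_powr)

lemma ennreal_powr_1 [simp]: "ennreal_powr x 1 = x"
  by (cases x rule: ennreal_cases) auto

lemma ennreal_powr_mono: "x \<le> y \<Longrightarrow> p \<ge> 0 \<Longrightarrow> ennreal_powr x p \<le> ennreal_powr y p"
  by (cases x rule: ennreal_cases; cases y rule: ennreal_cases) (auto intro!: ennreal_leI powr_mono2 simp: top_unique)

text \<open>The dual form of boundedness of convolution with \<open>k\<close> from L^p to the space
  with conjugate exponent. Quantifying over all measurable extended nonnegative functions leaves no
  integrability conditions, so Tonelli's theorem applies freely when one-dimensional kernels are
  multiplied together.\<close>

definition bilinear_bound :: "real \<Rightarrow> (real \<Rightarrow> ennreal) \<Rightarrow> real \<Rightarrow> bool" where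
  "bilinear_bound p k C \<longleftrightarrow> C > 0 \<and> k \<in> borel_measurable borel \<and>
     (\<forall>f\<in>borel_measurable borel. \<forall>g\<in>borel_measurable borel.
       (\<integral>\<^sup>+x. \<integral>\<^sup>+y. f x * g y * k (x - y) \<partial>lborel \<partial>lborel) \<le>
       ennreal C * ennreal_powr (\<integral>\<^sup>+x. ennreal_powr (f x) p \<partial>lborel) (1 / p) * ennreal_powr (\<integral>\<^sup>+x. ennreal_powr (g x) p \<partial>lborel) (1 / p))"

lemma bilinear_boundI:
  assumes "C > 0" and p: "p > 0" and [measurable]: "k \<in> borel_measurable borel"
    and norm: "\<And>f g. f \<in> borel_measurable borel \<Longrightarrow> g \<in> borel_measurable borel \<Longrightarrow>
       (\<integral>\<^sup>+x. ennreal_powr (f x) p \<partial>lborel) \<le> 1 \<Longrightarrow> (\<integral>\<^sup>+x. ennreal_powr (g x) p \<partial>lborel) \<le> 1 \<Longrightarrow>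
       (\<integral>\<^sup>+x. \<integral>\<^sup>+y. f x * g y * k (x - y) \<partial>lborel \<partial>lborel) \<le> ennreal C"
  shows "bilinear_bound p k C"
  unfolding bilinear_bound_def
proof (intro conjI ballI)
  fix f g :: "real \<Rightarrow> ennreal"
  assume [measurable]: "f \<in> borel_measurable borel" "g \<in> borel_measurable borel"
  define A where "A = (\<integral>\<^sup>+x. ennreal_powr (f x) p \<partial>lborel)"
  define B where "B = (\<integral>\<^sup>+x. ennreal_powr (g x) p \<partial>lborel)"
  define L where "L = (\<integral>\<^sup>+x. \<integral>\<^sup>+y. f x * g y * k (x - y) \<partial>lborel \<partial>lborel)"
  have zero: "AE x in lborel. h x = 0" if "(\<integral>\<^sup>+x. ennreal_powr (h x) p \<partial>lborel) = 0"
     and [measurable]: "h \<in> borel_measurable borel" for h :: "real \<Rightarrow> ennreal"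
    using that(1) by (subst (asm) nn_integral_0_iff_AE) (auto simp: ennreal_powr_eq_0_iff)
  \<comment> \<open>Normalisation divides by the norms, so zero and infinite norms are split off
    first. Zero has to precede infinity: 0 times \<open>top\<close> is 0, hence a vanishing norm
    leaves no slack on the right and the left side must be shown to vanish too.\<close>
  consider "A = 0" | "B = 0" | "A \<noteq> 0" "B \<noteq> 0" "A = top \<or> B = top" | "A \<noteq> 0" "B \<noteq> 0" "A \<noteq> top" "B \<noteq> top"
    by blast
  then have "L \<le> ennreal C * ennreal_powr A (1 / p) * ennreal_powr B (1 / p)"
  proof cases
    case 1
    then have "AE x in lborel. f x = 0" unfolding A_def by (intro zero) auto
    then have "L = (\<integral>\<^sup>+x. 0 \<partial>(lborel::real measure))"
      unfolding L_def by (intro nn_integral_cong_AE, eventually_elim) simp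
    then show ?thesis by simp
  next
    case 2
    then have *: "AE x in lborel. g x = 0" unfolding B_def by (intro zero) auto
    have "(\<integral>\<^sup>+y. f x * g y * k (x - y) \<partial>lborel) = 0" for x
    proof -
      have "(\<integral>\<^sup>+y. f x * g y * k (x - y) \<partial>lborel) = (\<integral>\<^sup>+y. 0 \<partial>(lborel::real measure))"
        by (rule nn_integral_cong_AE) (use * in \<open>eventually_elim, simp\<close>)
      then show ?thesis by simp
    qed
    then show ?thesis by (simp add: L_def)
  next
    case 3
    then have "ennreal C * ennreal_powr A (1 / p) * ennreal_powr B (1 / p) = top"
      using \<open>C > 0\<close> by (auto simp: ennreal_top_mult ennreal_mult_top ennreal_powr_eq_0_iff)
    then show ?thesis by simp
  next
    case 4
    define \<alpha> where "\<alpha> = ennreal_powr A (1 / p)"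
    define \<beta> where "\<beta> = ennreal_powr B (1 / p)"
    have ab: "\<alpha> \<noteq> 0" "\<alpha> \<noteq> top" "\<beta> \<noteq> 0" "\<beta> \<noteq> top"
      using 4 by (auto simp: \<alpha>_def \<beta>_def ennreal_powr_eq_0_iff ennreal_powr_eq_top_iff)
    have inv: "inverse z * z = 1" if "z \<noteq> 0" "z \<noteq> top" for z :: ennreal
      using that by (cases z rule: ennreal_cases) (auto simp: inverse_ennreal ennreal_mult[symmetric])
    have 1: "(\<integral>\<^sup>+x. ennreal_powr (inverse \<alpha> * f x) p \<partial>lborel) \<le> 1"
    proof -
      have "(\<integral>\<^sup>+x. ennreal_powr (inverse \<alpha> * f x) p \<partial>lborel) = ennreal_powr (inverse \<alpha>) p * A"
        unfolding ennreal_powr_mult A_def by (rule nn_integral_cmult) measurable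
      also have "A = ennreal_powr \<alpha> p" unfolding \<alpha>_def ennreal_powr_powr using p by simp
      also have "ennreal_powr (inverse \<alpha>) p * ennreal_powr \<alpha> p = 1"
        unfolding ennreal_powr_mult[symmetric] inv[OF ab(1,2)] using ennreal_powr_ennreal[of 1 p] by simp
      finally show ?thesis by simp
    qed
    have 2: "(\<integral>\<^sup>+x. ennreal_powr (inverse \<beta> * g x) p \<partial>lborel) \<le> 1"
    proof -
      have "(\<integral>\<^sup>+x. ennreal_powr (inverse \<beta> * g x) p \<partial>lborel) = ennreal_powr (inverse \<beta>) p * B"
        unfolding ennreal_powr_mult B_def by (rule nn_integral_cmult) measurable
      also have "B = ennreal_powr \<beta> p" unfolding \<beta>_def ennreal_powr_powr using p by simp
      also have "ennreal_powr (inverse \<beta>) p * ennreal_powr \<beta> p = 1"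
        unfolding ennreal_powr_mult[symmetric] inv[OF ab(3,4)] using ennreal_powr_ennreal[of 1 p] by simp
      finally show ?thesis by simp
    qed
    have "L = (\<integral>\<^sup>+x. \<integral>\<^sup>+y. (\<alpha> * \<beta>) * ((inverse \<alpha> * f x) * (inverse \<beta> * g y) * k (x - y)) \<partial>lborel \<partial>lborel)"
      unfolding L_def
    proof (intro nn_integral_cong)
      fix x y
      have "(\<alpha> * \<beta>) * ((inverse \<alpha> * f x) * (inverse \<beta> * g y) * k (x - y)) =
         (inverse \<alpha> * \<alpha>) * (inverse \<beta> * \<beta>) * (f x * g y * k (x - y))" by (simp add: mult_ac)
      then show "f x * g y * k (x - y) = (\<alpha> * \<beta>) * ((inverse \<alpha> * f x) * (inverse \<beta> * g y) * k (x - y))"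
        by (simp add: inv ab)
    qed
    also have "\<dots> = (\<alpha> * \<beta>) * (\<integral>\<^sup>+x. \<integral>\<^sup>+y. (inverse \<alpha> * f x) * (inverse \<beta> * g y) * k (x - y) \<partial>lborel \<partial>lborel)"
      by (simp add: nn_integral_cmult)
    also have "\<dots> \<le> (\<alpha> * \<beta>) * ennreal C" using 1 2 by (intro mult_left_mono norm) auto
    finally show ?thesis by (simp add: \<alpha>_def \<beta>_def mult_ac)
  qed
  then show "(\<integral>\<^sup>+x. \<integral>\<^sup>+y. f x * g y * k (x - y) \<partial>lborel \<partial>lborel) \<le>
       ennreal C * ennreal_powr (\<integral>\<^sup>+x. ennreal_powr (f x) p \<partial>lborel) (1 / p) * ennreal_powr (\<integral>\<^sup>+x. ennreal_powr (g x) p \<partial>lborel) (1 / p)"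
    by (simp add: L_def A_def B_def)
qed fact+

lemma nn_integral_shift_reflect:
  fixes h :: "real \<Rightarrow> ennreal"
  assumes [measurable]: "h \<in> borel_measurable borel"
  shows "(\<integral>\<^sup>+y. h (x - y) \<partial>lborel) = (\<integral>\<^sup>+y. h y \<partial>lborel)"
  using nn_integral_real_affine[of h "-1" x] by simp

text \<open>After u v \<le> u^2 + v^2 the kernel is integrated in the variable that the square does
  not involve. Omitting the usual 1/2 spares a division in \<open>ennreal\<close> and costs the 2 in
  the constant.\<close>

lemma bilinear_bound_L1:
  assumes [measurable]: "k \<in> borel_measurable borel" and "(\<integral>\<^sup>+x. k x \<partial>lborel) \<le> ennreal C" "C > 0"
  shows "bilinear_bound 2 k (2 * C)"
proof (rule bilinear_boundI)
  fix f g :: "real \<Rightarrow> ennreal"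
  assume [measurable]: "f \<in> borel_measurable borel" "g \<in> borel_measurable borel"
  assume fg: "(\<integral>\<^sup>+x. ennreal_powr (f x) 2 \<partial>lborel) \<le> 1" "(\<integral>\<^sup>+x. ennreal_powr (g x) 2 \<partial>lborel) \<le> 1"
  have sq: "ennreal_powr z 2 = z * z" for z
    by (cases z rule: ennreal_cases) (auto simp: powr_numeral power2_eq_square ennreal_mult ennreal_top_mult)
  have le: "u * v \<le> ennreal_powr u 2 + ennreal_powr v 2" for u v :: ennreal
  proof (cases "u \<le> v")
    case True
    then have "u * v \<le> v * v" by (intro mult_right_mono) auto
    also have "\<dots> \<le> u * u + v * v" by simp
    finally show ?thesis by (simp add: sq)
  next
    case False
    then have "u * v \<le> u * u" by (intro mult_left_mono) auto
    also have "\<dots> \<le> u * u + v * v" by simp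
    finally show ?thesis by (simp add: sq)
  qed
  have "(\<integral>\<^sup>+x. \<integral>\<^sup>+y. f x * g y * k (x - y) \<partial>lborel \<partial>lborel) \<le>
    (\<integral>\<^sup>+x. \<integral>\<^sup>+y. ennreal_powr (f x) 2 * k (x - y) + ennreal_powr (g y) 2 * k (x - y) \<partial>lborel \<partial>lborel)"
    unfolding distrib_right[symmetric] by (intro nn_integral_mono mult_right_mono le) auto
  also have "\<dots> = (\<integral>\<^sup>+x. \<integral>\<^sup>+y. ennreal_powr (f x) 2 * k (x - y) \<partial>lborel \<partial>lborel) + (\<integral>\<^sup>+x. \<integral>\<^sup>+y. ennreal_powr (g y) 2 * k (x - y) \<partial>lborel \<partial>lborel)"
    by (simp add: nn_integral_add)
  also have "(\<integral>\<^sup>+x. \<integral>\<^sup>+y. ennreal_powr (g y) 2 * k (x - y) \<partial>lborel \<partial>lborel) = (\<integral>\<^sup>+y. \<integral>\<^sup>+x. ennreal_powr (g y) 2 * k (x - y) \<partial>lborel \<partial>lborel)"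
    by (rule lborel_pair.Fubini') measurable
  also have "\<dots> = (\<integral>\<^sup>+y. ennreal_powr (g y) 2 * (\<integral>\<^sup>+x. k x \<partial>lborel) \<partial>lborel)"
  proof (intro nn_integral_cong)
    fix y
    have "(\<integral>\<^sup>+x. k (x - y) \<partial>lborel) = (\<integral>\<^sup>+x. k x \<partial>lborel)"
      using nn_integral_real_affine[of k 1 "-y"] by simp
    then show "(\<integral>\<^sup>+x. ennreal_powr (g y) 2 * k (x - y) \<partial>lborel) = ennreal_powr (g y) 2 * (\<integral>\<^sup>+x. k x \<partial>lborel)"
      by (simp add: nn_integral_cmult)
  qed
  also have "\<dots> = (\<integral>\<^sup>+y. ennreal_powr (g y) 2 \<partial>lborel) * (\<integral>\<^sup>+x. k x \<partial>lborel)"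
    by (simp add: nn_integral_multc)
  also have "(\<integral>\<^sup>+x. \<integral>\<^sup>+y. ennreal_powr (f x) 2 * k (x - y) \<partial>lborel \<partial>lborel) = (\<integral>\<^sup>+y. ennreal_powr (f y) 2 \<partial>lborel) * (\<integral>\<^sup>+x. k x \<partial>lborel)"
    by (simp add: nn_integral_multc nn_integral_cmult nn_integral_shift_reflect)
  also have "(\<integral>\<^sup>+y. ennreal_powr (f y) 2 \<partial>lborel) * (\<integral>\<^sup>+x. k x \<partial>lborel) + (\<integral>\<^sup>+y. ennreal_powr (g y) 2 \<partial>lborel) * (\<integral>\<^sup>+x. k x \<partial>lborel) \<le> 1 * ennreal C + 1 * ennreal C"
    using fg assms by (intro add_mono mult_mono) auto
  also have "\<dots> = ennreal (2 * C)" using assms by (simp add: ennreal_plus[symmetric] del: ennreal_plus)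
  finally show "(\<integral>\<^sup>+x. \<integral>\<^sup>+y. f x * g y * k (x - y) \<partial>lborel \<partial>lborel) \<le> ennreal (2 * C)" .
qed (use assms in auto)

lemma measurable_kernel_prod:
  fixes k :: "'i \<Rightarrow> real \<Rightarrow> ennreal"
  assumes k [measurable]: "\<And>j. j \<in> J \<Longrightarrow> k j \<in> borel_measurable borel"
  shows "(\<lambda>(x, y). \<Prod>j\<in>J. k j (x j - y j)) \<in> borel_measurable (Pi\<^sub>M J (\<lambda>_. lborel) \<Otimes>\<^sub>M Pi\<^sub>M J (\<lambda>_. lborel))"
    and "(\<lambda>y. \<Prod>j\<in>J. k j (x j - y j)) \<in> borel_measurable (Pi\<^sub>M J (\<lambda>_. lborel))"
proof -
  have c: "(\<lambda>x. x j) \<in> borel_measurable (Pi\<^sub>M J (\<lambda>_. lborel :: real measure))" if "j \<in> J" for j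
    using measurable_component_singleton[OF that, of "\<lambda>_. lborel :: real measure"] by simp
  show "(\<lambda>(x, y). \<Prod>j\<in>J. k j (x j - y j)) \<in> borel_measurable (Pi\<^sub>M J (\<lambda>_. lborel) \<Otimes>\<^sub>M Pi\<^sub>M J (\<lambda>_. lborel))"
    unfolding case_prod_beta'
  proof (rule borel_measurable_prod_ennreal)
    fix j assume j: "j \<in> J"
    note [measurable] = k[OF j] c[OF j]
    show "(\<lambda>z. k j (fst z j - snd z j)) \<in> borel_measurable (Pi\<^sub>M J (\<lambda>_. lborel) \<Otimes>\<^sub>M Pi\<^sub>M J (\<lambda>_. lborel))"
      by measurable
  qed
  show "(\<lambda>y. \<Prod>j\<in>J. k j (x j - y j)) \<in> borel_measurable (Pi\<^sub>M J (\<lambda>_. lborel))"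
  proof (rule borel_measurable_prod_ennreal)
    fix j assume j: "j \<in> J"
    note [measurable] = k[OF j] c[OF j]
    show "(\<lambda>y. k j (x j - y j)) \<in> borel_measurable (Pi\<^sub>M J (\<lambda>_. lborel))"
      by measurable
  qed
qed

text \<open>Induction over coordinates. With all others frozen, the one-dimensional bound in
  coordinate i leaves the partial norms \<open>NF\<close> and \<open>NG\<close> as functions of the
  rest, paired against the same type of kernel. The same p in every coordinate makes the norm of a
  partial norm equal to the full norm by Tonelli's theorem. In this way a product of one-dimensional
  singularities, which is not a radial power, is treated by the theory on the line.\<close>

lemma tensor_bilinear_bound:
  fixes F G :: "('i \<Rightarrow> real) \<Rightarrow> ennreal"
  assumes "finite I" and p: "p > 0" and k: "\<And>i. i \<in> I \<Longrightarrow> bilinear_bound p (k i) (C i)"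
    and "F \<in> borel_measurable (Pi\<^sub>M I (\<lambda>_. lborel))" "G \<in> borel_measurable (Pi\<^sub>M I (\<lambda>_. lborel))"
  shows "(\<integral>\<^sup>+x. \<integral>\<^sup>+y. F x * G y * (\<Prod>i\<in>I. k i (x i - y i)) \<partial>Pi\<^sub>M I (\<lambda>_. lborel) \<partial>Pi\<^sub>M I (\<lambda>_. lborel)) \<le>
    (\<Prod>i\<in>I. ennreal (C i)) * ennreal_powr (\<integral>\<^sup>+x. ennreal_powr (F x) p \<partial>Pi\<^sub>M I (\<lambda>_. lborel)) (1 / p) *
      ennreal_powr (\<integral>\<^sup>+x. ennreal_powr (G x) p \<partial>Pi\<^sub>M I (\<lambda>_. lborel)) (1 / p)"
  using assms(1,3-)
proof (induction I arbitrary: F G rule: finite_induct)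
  case empty
  show ?case using p
    by (simp add: PiM_empty nn_integral_count_space_finite ennreal_powr_powr)
next
  case (insert i I)
  let ?P = "Pi\<^sub>M I (\<lambda>_. lborel :: real measure)" and ?Q = "Pi\<^sub>M (insert i I) (\<lambda>_. lborel :: real measure)"
  note [measurable] = insert.prems(2,3)
  have ki: "bilinear_bound p (k i) (C i)" and kI: "\<And>j. j \<in> I \<Longrightarrow> bilinear_bound p (k j) (C j)"
    using insert.prems(1) by auto
  have kM: "k j \<in> borel_measurable borel" if "j \<in> insert i I" for j
    using insert.prems(1)[OF that] by (simp add: bilinear_bound_def)
  have [measurable]: "k i \<in> borel_measurable borel" by (rule kM) simp
  interpret P: finite_product_sigma_finite "\<lambda>_. lborel :: real measure" I by standard (rule insert.hyps)
  interpret Q: finite_product_sigma_finite "\<lambda>_. lborel :: real measure" "insert i I" by standard (use insert.hyps in simp)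
  interpret PP: pair_sigma_finite lborel ?P by standard
  define K where "K = (\<lambda>x y. \<Prod>j\<in>I. k j (x j - y j :: real))"
  define KQ where "KQ = (\<lambda>x y. \<Prod>j\<in>insert i I. k j (x j - y j :: real))"
  have KM [measurable]: "case_prod K \<in> borel_measurable (?P \<Otimes>\<^sub>M ?P)" "K x \<in> borel_measurable ?P" for x
    unfolding K_def by (rule measurable_kernel_prod; use kM in simp)+
  have KQM [measurable]: "case_prod KQ \<in> borel_measurable (?Q \<Otimes>\<^sub>M ?Q)" "KQ x \<in> borel_measurable ?Q" for x
    unfolding KQ_def by (rule measurable_kernel_prod; use kM in simp)+
  have upd: "(\<lambda>(x, a). x(i := a)) \<in> measurable (?P \<Otimes>\<^sub>M lborel) ?Q"
    by (rule measurable_add_dim)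
  define NF where "NF = (\<lambda>x. ennreal_powr (\<integral>\<^sup>+a. ennreal_powr (F (x(i := a))) p \<partial>lborel) (1 / p))"
  define NG where "NG = (\<lambda>x. ennreal_powr (\<integral>\<^sup>+a. ennreal_powr (G (x(i := a))) p \<partial>lborel) (1 / p))"
  have FM [measurable]: "(\<lambda>(x, a). F (x(i := a))) \<in> borel_measurable (?P \<Otimes>\<^sub>M lborel)"
    and GM [measurable]: "(\<lambda>(x, a). G (x(i := a))) \<in> borel_measurable (?P \<Otimes>\<^sub>M lborel)"
    using measurable_compose[OF upd insert.prems(2)] measurable_compose[OF upd insert.prems(3)]
    by (simp_all add: case_prod_beta')
  have NFM [measurable]: "NF \<in> borel_measurable ?P" and NGM [measurable]: "NG \<in> borel_measurable ?P"
    unfolding NF_def NG_def by measurable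
  have prod: "KQ (x(i := a)) (y(i := b)) = k i (a - b) * K x y" for x y a b
  proof -
    have "(\<Prod>j\<in>I. k j ((x(i := a)) j - (y(i := b)) j)) = K x y"
      unfolding K_def using insert.hyps by (intro prod.cong) auto
    then show ?thesis using insert.hyps by (simp add: KQ_def)
  qed
  have Fx: "(\<lambda>a. F (x(i := a))) \<in> borel_measurable borel" "(\<lambda>a. G (x(i := a))) \<in> borel_measurable borel" if "x \<in> space ?P" for x
    using measurable_Pair2[OF FM that] measurable_Pair2[OF GM that] by simp_all
  have "(\<integral>\<^sup>+x. \<integral>\<^sup>+y. F x * G y * KQ x y \<partial>?Q \<partial>?Q) =
     (\<integral>\<^sup>+x. \<integral>\<^sup>+a. \<integral>\<^sup>+y. F (x(i := a)) * G y * KQ (x(i := a)) y \<partial>?Q \<partial>lborel \<partial>?P)"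
    by (rule lborel_prod.product_nn_integral_insert[OF insert.hyps])
      (rule Q.borel_measurable_nn_integral, measurable)
  also have "\<dots> = (\<integral>\<^sup>+x. \<integral>\<^sup>+a. \<integral>\<^sup>+y. \<integral>\<^sup>+b. F (x(i := a)) * G (y(i := b)) * (k i (a - b) * K x y) \<partial>lborel \<partial>?P \<partial>lborel \<partial>?P)"
    unfolding prod[symmetric]
    by (intro nn_integral_cong lborel_prod.product_nn_integral_insert[OF insert.hyps]) measurable
  \<comment> \<open>Moving the integral in a past the remaining coordinates of y brings the two
    variables of coordinate i next to each other.\<close>
  also have "\<dots> = (\<integral>\<^sup>+x. \<integral>\<^sup>+y. \<integral>\<^sup>+a. \<integral>\<^sup>+b. F (x(i := a)) * G (y(i := b)) * (k i (a - b) * K x y) \<partial>lborel \<partial>lborel \<partial>?P \<partial>?P)"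
  proof (intro nn_integral_cong)
    fix x assume x: "x \<in> space ?P"
    note [measurable] = Fx[OF x]
    show "(\<integral>\<^sup>+a. \<integral>\<^sup>+y. \<integral>\<^sup>+b. F (x(i := a)) * G (y(i := b)) * (k i (a - b) * K x y) \<partial>lborel \<partial>?P \<partial>lborel) =
       (\<integral>\<^sup>+y. \<integral>\<^sup>+a. \<integral>\<^sup>+b. F (x(i := a)) * G (y(i := b)) * (k i (a - b) * K x y) \<partial>lborel \<partial>lborel \<partial>?P)"
      by (rule PP.Fubini'[symmetric]) measurable
  qed
  also have "\<dots> \<le> (\<integral>\<^sup>+x. \<integral>\<^sup>+y. ennreal (C i) * (NF x * NG y * K x y) \<partial>?P \<partial>?P)"
  proof (intro nn_integral_mono)
    fix x y assume x: "x \<in> space ?P" and y: "y \<in> space ?P"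
    note [measurable] = Fx[OF x] Fx[OF y]
    have "(\<integral>\<^sup>+a. \<integral>\<^sup>+b. F (x(i := a)) * G (y(i := b)) * (k i (a - b) * K x y) \<partial>lborel \<partial>lborel) =
      (\<integral>\<^sup>+a. \<integral>\<^sup>+b. (F (x(i := a)) * G (y(i := b)) * k i (a - b)) * K x y \<partial>lborel \<partial>lborel)"
      by (simp add: mult_ac)
    also have "\<dots> = (\<integral>\<^sup>+a. \<integral>\<^sup>+b. F (x(i := a)) * G (y(i := b)) * k i (a - b) \<partial>lborel \<partial>lborel) * K x y"
      by (simp add: nn_integral_multc)
    also have "\<dots> \<le> ennreal (C i) * NF x * NG y * K x y"
      using ki Fx[OF x] Fx[OF y] unfolding bilinear_bound_def NF_def NG_def
      by (intro mult_right_mono) auto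
    finally show "(\<integral>\<^sup>+a. \<integral>\<^sup>+b. F (x(i := a)) * G (y(i := b)) * (k i (a - b) * K x y) \<partial>lborel \<partial>lborel) \<le> ennreal (C i) * (NF x * NG y * K x y)"
      by (simp add: mult_ac)
  qed
  also have "\<dots> = ennreal (C i) * (\<integral>\<^sup>+x. \<integral>\<^sup>+y. NF x * NG y * K x y \<partial>?P \<partial>?P)"
    by (simp add: nn_integral_cmult)
  also have "\<dots> \<le> ennreal (C i) * ((\<Prod>i\<in>I. ennreal (C i)) * ennreal_powr (\<integral>\<^sup>+x. ennreal_powr (NF x) p \<partial>?P) (1 / p) *
      ennreal_powr (\<integral>\<^sup>+x. ennreal_powr (NG x) p \<partial>?P) (1 / p))"
    unfolding K_def by (intro mult_left_mono insert.IH kI NFM NGM) auto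
  also have "(\<integral>\<^sup>+x. ennreal_powr (NF x) p \<partial>?P) = (\<integral>\<^sup>+x. ennreal_powr (F x) p \<partial>?Q)"
    unfolding NF_def ennreal_powr_powr using p insert.hyps
    by (subst lborel_prod.product_nn_integral_insert) auto
  also have "(\<integral>\<^sup>+x. ennreal_powr (NG x) p \<partial>?P) = (\<integral>\<^sup>+x. ennreal_powr (G x) p \<partial>?Q)"
    unfolding NG_def ennreal_powr_powr using p insert.hyps
    by (subst lborel_prod.product_nn_integral_insert) auto
  finally show ?case using insert.hyps by (simp add: mult_ac KQ_def)
qed

section \<open>Hardy-Littlewood-Sobolev on the line\<close>

lemma nn_integral_powr_atMost:
  fixes e c :: real
  assumes "e > -1" "c \<ge> 0"
  shows "(\<integral>\<^sup>+x. ennreal (x powr e) * indicator {0..c} x \<partial>lborel) = ennreal (c powr (e + 1) / (e + 1))"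
proof -
  have "((\<lambda>x. if x \<in> {0..c} then x powr e else 0) has_integral c powr (e + 1) / (e + 1)) UNIV"
    using has_integral_powr_from_0[OF assms] by (subst has_integral_restrict_UNIV)
  then have "(\<integral>\<^sup>+x. ennreal (if x \<in> {0..c} then x powr e else 0) \<partial>lborel) = ennreal (c powr (e + 1) / (e + 1))"
    by (intro nn_integral_has_integral_lborel) auto
  also have "(\<integral>\<^sup>+x. ennreal (if x \<in> {0..c} then x powr e else 0) \<partial>lborel) = (\<integral>\<^sup>+x. ennreal (x powr e) * indicator {0..c} x \<partial>lborel)"
    by (intro nn_integral_cong) auto
  finally show ?thesis .
qed

lemma nn_integral_abs_powr_near:
  fixes e c :: real
  assumes "e > -1" "c \<ge> 0"
  shows "(\<integral>\<^sup>+x. ennreal (\<bar>x\<bar> powr e) * indicator {..c} \<bar>x\<bar> \<partial>lborel) = ennreal (2 * (c powr (e + 1) / (e + 1)))"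
proof -
  have "(\<integral>\<^sup>+x. ennreal (\<bar>x\<bar> powr e) * indicator {..c} \<bar>x\<bar> \<partial>lborel) =
      2 * (\<integral>\<^sup>+x. ennreal (x powr e) * indicator {..c} x * indicator {0..} x \<partial>lborel)"
    by (rule nn_integral_even) measurable
  also have "(\<integral>\<^sup>+x. ennreal (x powr e) * indicator {..c} x * indicator {0..} x \<partial>lborel) =
      (\<integral>\<^sup>+x. ennreal (x powr e) * indicator {0..c} x \<partial>lborel)"
    by (intro nn_integral_cong) (auto split: split_indicator)
  also have "\<dots> = ennreal (c powr (e + 1) / (e + 1))" by (rule nn_integral_powr_atMost[OF assms])
  also have "2 * \<dots> = ennreal (2 * (c powr (e + 1) / (e + 1)))" using assms by (subst ennreal_mult) auto
  finally show ?thesis .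
qed

lemma nn_integral_abs_powr_far:
  fixes r c :: real
  assumes "r > 1" "c > 0"
  shows "(\<integral>\<^sup>+x. ennreal (\<bar>x\<bar> powr (-r)) * indicator {c..} \<bar>x\<bar> \<partial>lborel) = ennreal (2 * (c powr (1 - r) / (r - 1)))"
proof -
  have "(\<integral>\<^sup>+x. ennreal (\<bar>x\<bar> powr (-r)) * indicator {c..} \<bar>x\<bar> \<partial>lborel) =
      2 * (\<integral>\<^sup>+x. ennreal (x powr (-r)) * indicator {c..} x * indicator {0..} x \<partial>lborel)"
    by (rule nn_integral_even) measurable
  also have "(\<integral>\<^sup>+x. ennreal (x powr (-r)) * indicator {c..} x * indicator {0..} x \<partial>lborel) =
      (\<integral>\<^sup>+x. ennreal (x powr (-r)) * indicator {c..} x \<partial>lborel)"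
    using assms by (intro nn_integral_cong) (auto split: split_indicator)
  also have "\<dots> = ennreal (c powr (1 - r) / (r - 1))" by (rule nn_integral_atLeast_powr[OF assms])
  also have "2 * \<dots> = ennreal (2 * (c powr (1 - r) / (r - 1)))" using assms by (subst ennreal_mult) auto
  finally show ?thesis .
qed

text \<open>The radius r = \<alpha>^(-p) is the largest measure that a set on which g reaches
  \<alpha> can have. Within this radius g is replaced by \<alpha>. Beyond it Young's inequality
  separates g^p from the q-th power |x - y|^(-2) of the kernel, which is integrable there. All terms
  share the homogeneity \<alpha>^(p - 1).\<close>

lemma Riesz_potential_truncated:
  fixes g :: "real \<Rightarrow> ennreal" and q \<alpha> x :: real
  assumes q: "q > 2" and [measurable]: "g \<in> borel_measurable borel"
  defines "p \<equiv> q / (q - 1)"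
  assumes g1: "(\<integral>\<^sup>+y. ennreal_powr (g y) p \<partial>lborel) \<le> 1" and \<alpha>: "\<alpha> > 0"
  shows "(\<integral>\<^sup>+y. indicator {..ennreal \<alpha>} (g y) * g y * ennreal (\<bar>x - y\<bar> powr (-(2/q))) \<partial>lborel) \<le>
    ennreal ((2 / (1 - 2/q) + 3) * \<alpha> powr (p - 1))"
proof -
  have p: "p > 1" "1 / p + 1 / q = 1" using q by (auto simp: p_def field_simps)
  have q2: "0 < 2 / q" "2 / q < 1" using q by auto
  define r where "r = \<alpha> powr (-p)"
  have r: "r > 0" using \<alpha> by (simp add: r_def)
  define A where "A = \<alpha> powr (p - 1)"
  have A: "A > 0" using \<alpha> by (simp add: A_def)
  \<comment> \<open>The Young parameter: it turns g^p into \<alpha>^(p-1) g^p and the kernel into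
    \<alpha>^(-1) |x - y|^(-2), so that both far terms integrate to multiples of
    \<alpha>^(p-1).\<close>
  define t where "t = \<alpha> powr ((p - 1) / p)"
  have t: "t > 0" using \<alpha> by (simp add: t_def)
  have tp: "t powr p = A" unfolding t_def A_def powr_powr using p by simp
  have tq: "t powr (-q) = \<alpha> powr (-1)"
  proof -
    have "(p - 1) / p * -q = -1" using q by (simp add: p_def field_simps)
    then show ?thesis unfolding t_def powr_powr by simp
  qed
  have em: "ennreal (a * b + d * e) = ennreal a * ennreal b + ennreal d * ennreal e"
    if "a \<ge> 0" "b \<ge> 0" "d \<ge> 0" "e \<ge> 0" for a b d e :: real
    using that by (simp add: ennreal_plus ennreal_mult)
  have pt: "indicator {..ennreal \<alpha>} (g y) * g y * ennreal (\<bar>x - y\<bar> powr (-(2/q))) \<le>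
     ennreal \<alpha> * (ennreal (\<bar>x - y\<bar> powr (-(2/q))) * indicator {..r} \<bar>x - y\<bar>) +
     (ennreal A * ennreal_powr (g y) p + ennreal (\<alpha> powr (-1) / q) * (ennreal (\<bar>x - y\<bar> powr (-2)) * indicator {r..} \<bar>x - y\<bar>))" for y
  proof (cases "g y \<le> ennreal \<alpha>")
    case True
    then have "g y \<noteq> top" by (auto simp: top_unique)
    then obtain G where G: "g y = ennreal G" "G \<ge> 0" by (cases "g y" rule: ennreal_cases) auto
    have G\<alpha>: "G \<le> \<alpha>" using True \<alpha> unfolding G(1) by (simp add: ennreal_le_iff)
    define k where "k = \<bar>x - y\<bar> powr (-(2/q))"
    have k: "k \<ge> 0" by (simp add: k_def)
    have kq: "k powr q = \<bar>x - y\<bar> powr (-2)" unfolding k_def powr_powr using q by simp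
    show ?thesis
    proof (cases "\<bar>x - y\<bar> \<le> r")
      case near: True
      have "indicator {..ennreal \<alpha>} (g y) * g y * ennreal k = ennreal G * ennreal k" using True by (simp add: G)
      also have "\<dots> \<le> ennreal \<alpha> * ennreal k" using G\<alpha> by (intro mult_right_mono ennreal_leI) auto
      also have "\<dots> = ennreal \<alpha> * (ennreal k * indicator {..r} \<bar>x - y\<bar>)" using near by simp
      finally show ?thesis unfolding k_def by (rule order_trans) simp
    next
      case far: False
      have "G * k = (t * G) * (k / t)" using t by simp
      also have "\<dots> \<le> (t * G) powr p / p + (k / t) powr q / q"
        using p q t G k by (intro Youngs_inequality) auto
      also have "(t * G) powr p = A * G powr p" using t G by (simp add: powr_mult tp)
      also have "(k / t) powr q = \<alpha> powr (-1) * \<bar>x - y\<bar> powr (-2)"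
        unfolding powr_divide kq tq[symmetric] powr_minus_divide[of t q] by simp
      also have "A * G powr p / p \<le> A * G powr p"
        using p A mult_left_mono[of 1 p "A * G powr p"] by (simp add: divide_le_eq)
      finally have "G * k \<le> A * G powr p + \<alpha> powr (-1) / q * \<bar>x - y\<bar> powr (-2)" by simp
      then have "ennreal G * ennreal k \<le> ennreal (A * G powr p + \<alpha> powr (-1) / q * \<bar>x - y\<bar> powr (-2))"
        unfolding ennreal_mult[OF G(2) k, symmetric] by (rule ennreal_leI)
      also have "\<dots> = ennreal A * ennreal_powr (g y) p + ennreal (\<alpha> powr (-1) / q) * (ennreal (\<bar>x - y\<bar> powr (-2)) * indicator {r..} \<bar>x - y\<bar>)"
      proof -
        have "indicator {r..} \<bar>x - y\<bar> = (1 :: ennreal)" using far by simp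
        then show ?thesis unfolding G(1) ennreal_powr_ennreal[OF G(2)] mult_1_right
          using A q by (simp only: mult_1_right) (intro em, auto)
      qed
      finally have "indicator {..ennreal \<alpha>} (g y) * g y * ennreal k \<le> ennreal A * ennreal_powr (g y) p + ennreal (\<alpha> powr (-1) / q) * (ennreal (\<bar>x - y\<bar> powr (-2)) * indicator {r..} \<bar>x - y\<bar>)"
        using True by (simp add: G)
      then show ?thesis unfolding k_def by (rule order_trans) simp
    qed
  qed simp
  have sh1: "(\<integral>\<^sup>+y. ennreal (\<bar>x - y\<bar> powr (-(2/q))) * indicator {..r} \<bar>x - y\<bar> \<partial>lborel) = ennreal (2 * (r powr (-(2/q) + 1) / (-(2/q) + 1)))"
    by (rule trans[OF nn_integral_shift_reflect[of "\<lambda>u. ennreal (\<bar>u\<bar> powr (-(2/q))) * indicator {..r} \<bar>u\<bar>" x] nn_integral_abs_powr_near])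
      (use q2 r in auto)
  have sh2: "(\<integral>\<^sup>+y. ennreal (\<bar>x - y\<bar> powr (-2)) * indicator {r..} \<bar>x - y\<bar> \<partial>lborel) = ennreal (2 * (r powr (1 - 2) / (2 - 1)))"
    by (rule trans[OF nn_integral_shift_reflect[of "\<lambda>u. ennreal (\<bar>u\<bar> powr (-2)) * indicator {r..} \<bar>u\<bar>" x] nn_integral_abs_powr_far])
      (use q2 r in auto)
  have "(\<integral>\<^sup>+y. indicator {..ennreal \<alpha>} (g y) * g y * ennreal (\<bar>x - y\<bar> powr (-(2/q))) \<partial>lborel) \<le>
    (\<integral>\<^sup>+y. ennreal \<alpha> * (ennreal (\<bar>x - y\<bar> powr (-(2/q))) * indicator {..r} \<bar>x - y\<bar>) +
     (ennreal A * ennreal_powr (g y) p + ennreal (\<alpha> powr (-1) / q) * (ennreal (\<bar>x - y\<bar> powr (-2)) * indicator {r..} \<bar>x - y\<bar>)) \<partial>lborel)"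
    by (rule nn_integral_mono[OF pt])
  also have "\<dots> = ennreal \<alpha> * ennreal (2 * (r powr (-(2/q) + 1) / (-(2/q) + 1))) +
     (ennreal A * (\<integral>\<^sup>+y. ennreal_powr (g y) p \<partial>lborel) + ennreal (\<alpha> powr (-1) / q) * ennreal (2 * (r powr (1 - 2) / (2 - 1))))"
    by (simp add: nn_integral_add nn_integral_cmult sh1 sh2)
  also have "\<dots> \<le> ennreal \<alpha> * ennreal (2 * (r powr (-(2/q) + 1) / (-(2/q) + 1))) +
     (ennreal A * 1 + ennreal (\<alpha> powr (-1) / q) * ennreal (2 * (r powr (1 - 2) / (2 - 1))))"
    using g1 by (intro add_left_mono add_right_mono mult_left_mono) auto
  also have "\<dots> = ennreal (\<alpha> * (2 * (r powr (-(2/q) + 1) / (-(2/q) + 1))) + (A + \<alpha> powr (-1) / q * (2 * (r powr (1 - 2) / (2 - 1)))))"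
  proof -
    have "ennreal a * ennreal b + (ennreal A * 1 + ennreal d * ennreal e) = ennreal (a * b + (A + d * e))"
      if "a \<ge> 0" "b \<ge> 0" "d \<ge> 0" "e \<ge> 0" for a b d e :: real
      using that A by (simp add: ennreal_plus ennreal_mult)
    then show ?thesis using \<alpha> q q2 by auto
  qed
  also have "\<dots> \<le> ennreal ((2 / (1 - 2/q) + 3) * A)"
  proof (rule ennreal_leI)
    have e1: "\<alpha> * r powr (-(2/q) + 1) = A"
    proof -
      have e: "1 + (-p * (-(2/q) + 1)) = p - 1" using q by (simp add: p_def field_simps)
      have "\<alpha> powr 1 * r powr (-(2/q) + 1) = A"
        unfolding r_def powr_powr A_def powr_add[symmetric] by (simp only: e)
      then show ?thesis using \<alpha> by simp
    qed
    have e2: "\<alpha> powr (-1) * r powr (1 - 2) = A"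
      unfolding r_def powr_powr A_def powr_add[symmetric] by simp
    have "\<alpha> * (2 * (r powr (-(2/q) + 1) / (-(2/q) + 1))) = 2 / (1 - 2/q) * (\<alpha> * r powr (-(2/q) + 1))" by simp
    moreover have "\<alpha> powr (-1) / q * (2 * (r powr (1 - 2) / (2 - 1))) = 2 / q * (\<alpha> powr (-1) * r powr (1 - 2))" by simp
    moreover have "2 / q * A \<le> 1 * A" using q2 A by (intro mult_right_mono) auto
    ultimately show "\<alpha> * (2 * (r powr (-(2/q) + 1) / (-(2/q) + 1))) + (A + \<alpha> powr (-1) / q * (2 * (r powr (1 - 2) / (2 - 1)))) \<le> (2 / (1 - 2/q) + 3) * A"
      unfolding e1 e2 distrib_right using A by linarith
  qed
  finally show ?thesis unfolding A_def .
qed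

text \<open>Hardy--Littlewood--Sobolev on the diagonal. On the region \<open>g y \<le> f x\<close> the inner integral is
  at most \<open>C (f x) powr (p - 1)\<close>, and the other region is symmetric.\<close>

lemma bilinear_bound_Riesz:
  fixes q :: real
  assumes q: "q > 2"
  shows "\<exists>C. bilinear_bound (q / (q - 1)) (\<lambda>u. ennreal (\<bar>u\<bar> powr (-(2/q)))) C"
proof (intro exI)
  define p where "p = q / (q - 1)"
  define C where "C = 2 / (1 - 2/q) + 3"
  have p: "p > 1" using q by (auto simp: p_def field_simps)
  have C: "C > 0" unfolding C_def using q by (intro add_pos_pos divide_pos_pos) auto
  define k where "k = (\<lambda>u::real. ennreal (\<bar>u\<bar> powr (-(2/q))))"
  have [measurable]: "k \<in> borel_measurable borel" unfolding k_def by measurable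
  have sym: "k (x - y) = k (y - x)" for x y by (simp add: k_def abs_minus_commute)
  have half: "(\<integral>\<^sup>+x. f x * (\<integral>\<^sup>+y. indicator {..f x} (g y) * g y * k (x - y) \<partial>lborel) \<partial>lborel) \<le> ennreal C"
    if [measurable]: "f \<in> borel_measurable borel" "g \<in> borel_measurable borel"
      and fg: "(\<integral>\<^sup>+x. ennreal_powr (f x) p \<partial>lborel) \<le> 1" "(\<integral>\<^sup>+x. ennreal_powr (g x) p \<partial>lborel) \<le> 1" for f g :: "real \<Rightarrow> ennreal"
  proof -
    have "f x * (\<integral>\<^sup>+y. indicator {..f x} (g y) * g y * k (x - y) \<partial>lborel) \<le> ennreal C * ennreal_powr (f x) p" for x
    proof (cases "f x" rule: ennreal_cases)
      case top then show ?thesis using C by (simp add: ennreal_mult_top)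
    next
      case (real \<alpha>)
      show ?thesis
      proof (cases "\<alpha> = 0")
        case True then show ?thesis using real by simp
      next
        case False
        then have \<alpha>: "\<alpha> > 0" using real by simp
        have "f x * (\<integral>\<^sup>+y. indicator {..f x} (g y) * g y * k (x - y) \<partial>lborel) \<le> ennreal \<alpha> * ennreal (C * \<alpha> powr (p - 1))"
          unfolding real(2) k_def C_def p_def
          by (intro mult_left_mono Riesz_potential_truncated q \<alpha> fg(2)[unfolded p_def]) auto
        also have "\<dots> = ennreal C * ennreal (\<alpha> * \<alpha> powr (p - 1))"
          using \<alpha> C by (simp add: ennreal_mult mult_ac)
        also have "\<alpha> * \<alpha> powr (p - 1) = \<alpha> powr p" using \<alpha> by (simp add: powr_diff)
        finally show ?thesis using real by simp
      qed
    qed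
    then have "(\<integral>\<^sup>+x. f x * (\<integral>\<^sup>+y. indicator {..f x} (g y) * g y * k (x - y) \<partial>lborel) \<partial>lborel) \<le> (\<integral>\<^sup>+x. ennreal C * ennreal_powr (f x) p \<partial>lborel)"
      by (intro nn_integral_mono)
    also have "\<dots> = ennreal C * (\<integral>\<^sup>+x. ennreal_powr (f x) p \<partial>lborel)" by (simp add: nn_integral_cmult)
    also have "\<dots> \<le> ennreal C * 1" using fg by (intro mult_left_mono) auto
    finally show ?thesis by simp
  qed
  show "bilinear_bound (q / (q - 1)) (\<lambda>u. ennreal (\<bar>u\<bar> powr (-(2/q)))) (2 * C)"
    unfolding p_def[symmetric] k_def[symmetric]
  proof (rule bilinear_boundI)
    fix f g :: "real \<Rightarrow> ennreal"
    assume [measurable]: "f \<in> borel_measurable borel" "g \<in> borel_measurable borel"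
    assume fg: "(\<integral>\<^sup>+x. ennreal_powr (f x) p \<partial>lborel) \<le> 1" "(\<integral>\<^sup>+x. ennreal_powr (g x) p \<partial>lborel) \<le> 1"
    have "(\<integral>\<^sup>+x. \<integral>\<^sup>+y. f x * g y * k (x - y) \<partial>lborel \<partial>lborel) \<le>
      (\<integral>\<^sup>+x. \<integral>\<^sup>+y. f x * ((if g y \<le> f x then 1 else 0) * g y * k (x - y)) + g y * ((if f x \<le> g y then 1 else 0) * f x * k (y - x)) \<partial>lborel \<partial>lborel)"
    proof (intro nn_integral_mono)
      fix x y
      show "f x * g y * k (x - y) \<le> f x * ((if g y \<le> f x then 1 else 0) * g y * k (x - y)) + g y * ((if f x \<le> g y then 1 else 0) * f x * k (y - x))"
        using sym[of x y] by (cases "g y \<le> f x") (auto simp: mult_ac)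
    qed
    also have "\<dots> = (\<integral>\<^sup>+x. \<integral>\<^sup>+y. f x * ((if g y \<le> f x then 1 else 0) * g y * k (x - y)) \<partial>lborel \<partial>lborel) +
       (\<integral>\<^sup>+x. \<integral>\<^sup>+y. g y * ((if f x \<le> g y then 1 else 0) * f x * k (y - x)) \<partial>lborel \<partial>lborel)"
      by (simp add: nn_integral_add)
    also have "(\<integral>\<^sup>+x. \<integral>\<^sup>+y. g y * ((if f x \<le> g y then 1 else 0) * f x * k (y - x)) \<partial>lborel \<partial>lborel) =
       (\<integral>\<^sup>+y. \<integral>\<^sup>+x. g y * ((if f x \<le> g y then 1 else 0) * f x * k (y - x)) \<partial>lborel \<partial>lborel)"
      by (rule lborel_pair.Fubini') measurable
    also have "\<dots> = (\<integral>\<^sup>+y. g y * (\<integral>\<^sup>+x. indicator {..g y} (f x) * f x * k (y - x) \<partial>lborel) \<partial>lborel)"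
      by (simp add: nn_integral_cmult indicator_def of_bool_def)
    also have "\<dots> \<le> ennreal C" by (rule half) (use fg in auto)
    also have "(\<integral>\<^sup>+x. \<integral>\<^sup>+y. f x * ((if g y \<le> f x then 1 else 0) * g y * k (x - y)) \<partial>lborel \<partial>lborel) =
       (\<integral>\<^sup>+x. f x * (\<integral>\<^sup>+y. indicator {..f x} (g y) * g y * k (x - y) \<partial>lborel) \<partial>lborel)"
      by (simp add: nn_integral_cmult indicator_def of_bool_def)
    also have "\<dots> \<le> ennreal C" by (rule half) (use fg in auto)
    also have "ennreal C + ennreal C = ennreal (2 * C)" using C by (simp add: ennreal_plus[symmetric] del: ennreal_plus)
    finally show "(\<integral>\<^sup>+x. \<integral>\<^sup>+y. f x * g y * k (x - y) \<partial>lborel \<partial>lborel) \<le> ennreal (2 * C)"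
      by (auto intro: add_mono)
  qed (use C p in auto)
qed

lemma bilinear_bound_integrable_kernel:
  fixes \<beta> :: real
  assumes \<beta>: "\<beta> > 1"
  shows "\<exists>C. bilinear_bound 2 (\<lambda>u. ennreal (if \<bar>u\<bar> \<le> 1 then \<bar>u\<bar> powr (-(1/2)) else \<bar>u\<bar> powr (-\<beta>))) C"
proof -
  have "(\<integral>\<^sup>+u. ennreal (if \<bar>u::real\<bar> \<le> 1 then \<bar>u\<bar> powr (-(1/2)) else \<bar>u\<bar> powr (-\<beta>)) \<partial>lborel) \<le>
    (\<integral>\<^sup>+u. ennreal (\<bar>u::real\<bar> powr (-(1/2))) * indicator {..1} \<bar>u\<bar> + ennreal (\<bar>u\<bar> powr (-\<beta>)) * indicator {1..} \<bar>u\<bar> \<partial>lborel)"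
    by (intro nn_integral_mono) (auto split: split_indicator)
  also have "\<dots> = ennreal (2 * (1 powr (-(1/2) + 1) / (-(1/2) + 1))) + ennreal (2 * (1 powr (1 - \<beta>) / (\<beta> - 1)))"
    using \<beta> nn_integral_abs_powr_near[of "-(1/2)" 1] nn_integral_abs_powr_far[of \<beta> 1]
    by (subst nn_integral_add) auto
  also have "\<dots> = ennreal (4 + 2 / (\<beta> - 1))"
    using \<beta> by simp
  finally have le: "(\<integral>\<^sup>+u. ennreal (if \<bar>u::real\<bar> \<le> 1 then \<bar>u\<bar> powr (-(1/2)) else \<bar>u\<bar> powr (-\<beta>)) \<partial>lborel) \<le> ennreal (4 + 2 / (\<beta> - 1))" .
  have pos: "0 < 4 + 2 / (\<beta> - 1)" using \<beta> by (intro add_pos_pos) auto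
  have "bilinear_bound 2 (\<lambda>u. ennreal (if \<bar>u\<bar> \<le> 1 then \<bar>u\<bar> powr (-(1/2)) else \<bar>u\<bar> powr (-\<beta>))) (2 * (4 + 2 / (\<beta> - 1)))"
    by (rule bilinear_bound_L1[OF _ le pos]) measurable
  then show ?thesis by blast
qed

section \<open>Fourier transform of Schwartz functions\<close>

lemma iter_partial_deriv_append:
  "iter_partial_deriv is (partial_deriv i f) = iter_partial_deriv (is @ [i]) f"
  by (induction "is") auto

lemma schwartz_partial_deriv: "schwartz f \<Longrightarrow> schwartz (partial_deriv i f)"
  unfolding schwartz_def iter_partial_deriv_append by blast

lemma schwartz_differentiable: "schwartz f \<Longrightarrow> f differentiable (at x)"
  unfolding schwartz_def by (drule spec[of _ "[]"]) simp

lemma schwartz_measurable: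
  assumes "schwartz f" shows "f \<in> borel_measurable borel"
  by (intro borel_measurable_continuous_onI continuous_at_imp_continuous_on ballI
      differentiable_imp_continuous_within schwartz_differentiable[OF assms])

lemma one_plus_power_le: "(1 + t) ^ k \<le> 2 ^ k * (1 + t ^ k)" if "t \<ge> 0" for t :: real
proof -
  have "(1 + t) ^ k \<le> (2 * max 1 t) ^ k" using that by (intro power_mono) auto
  also have "\<dots> = 2 ^ k * (max 1 t) ^ k" by (simp add: power_mult_distrib)
  also have "(max 1 t) ^ k \<le> 1 + t ^ k" using that by (auto simp: max_def)
  finally show ?thesis by simp
qed

lemma schwartz_decay:
  assumes "schwartz f"
  shows "\<exists>C\<ge>0. \<forall>x. cmod (f x) \<le> C * (1 + (norm x)\<^sup>2) powr (- real k)"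
proof -
  have b: "bounded (range (\<lambda>x. norm x ^ k *\<^sub>R f x))" for k
    using assms unfolding schwartz_def by (drule_tac spec[of _ "[]"]) simp
  obtain B0 where B0: "\<And>x. cmod (f x) \<le> B0"
    using b[of 0] unfolding bounded_iff by auto
  obtain B1 where B1: "\<And>x. norm x ^ (2 * k) * cmod (f x) \<le> B1"
    using b[of "2 * k"] unfolding bounded_iff by auto
  have "cmod (f x) \<le> (2 ^ k * (B0 + B1)) * (1 + (norm x)\<^sup>2) powr (- real k)" for x
  proof -
    have p: "1 + (norm x)\<^sup>2 > 0" by (simp add: add_pos_nonneg)
    have "(1 + (norm x)\<^sup>2) ^ k * cmod (f x) \<le> (2 ^ k * (1 + ((norm x)\<^sup>2) ^ k)) * cmod (f x)"
      by (intro mult_right_mono one_plus_power_le) auto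
    also have "\<dots> = 2 ^ k * (cmod (f x) + norm x ^ (2 * k) * cmod (f x))"
      unfolding power_mult[of "norm x" 2 k] by (simp only: distrib_left distrib_right mult_1_left mult.assoc)
    also have "\<dots> \<le> 2 ^ k * (B0 + B1)" by (intro mult_left_mono add_mono B0 B1) auto
    finally show ?thesis using p
      by (simp add: powr_minus powr_realpow divide_inverse[symmetric] pos_le_divide_eq mult.commute)
  qed
  moreover have "2 ^ k * (B0 + B1) \<ge> 0"
  proof -
    have "B0 \<ge> 0" using order_trans[OF norm_ge_zero B0[of undefined]] .
    moreover have "B1 \<ge> 0" using order_trans[OF _ B1[of 0]] by simp
    ultimately show ?thesis by simp
  qed
  ultimately show ?thesis by blast
qed

lemma schwartz_integrable:
  fixes f :: "real ^ 'n::finite \<Rightarrow> complex"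
  assumes "schwartz f"
  shows "integrable lborel f"
proof -
  obtain C where C: "C \<ge> 0" "\<And>x. cmod (f x) \<le> C * (1 + (norm x)\<^sup>2) powr (- real CARD('n))"
    using schwartz_decay[OF assms, of "CARD('n)"] by blast
  show ?thesis
  proof (rule Bochner_Integration.integrable_bound)
    show "integrable lborel (\<lambda>x::real^'n. C * (1 + (norm x)\<^sup>2) powr (- real CARD('n)))"
      by (intro integrable_mult_right integrable_japanese_powr_vec) auto
  qed (use schwartz_measurable[OF assms] C in \<open>auto intro!: AE_I2 order_trans[OF C(2)]\<close>)
qed

lemma fourier_measurable [measurable]:
  assumes [measurable]: "f \<in> borel_measurable borel"
  shows "fourier f \<in> borel_measurable borel"
  unfolding fourier_def by measurable

lemma cmod_fourier_le:
  "cmod (fourier f \<xi>) \<le> (LINT x|lborel. cmod (f x))"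
proof -
  have "cmod (fourier f \<xi>) \<le> (LINT x|lborel. cmod (exp (- \<i> * complex_of_real (x \<bullet> \<xi>)) * f x))"
    unfolding fourier_def by (rule integral_norm_bound)
  also have "\<dots> = (LINT x|lborel. cmod (f x))" by (simp add: norm_mult)
  finally show ?thesis .
qed

lemma partial_deriv_has_vector_derivative:
  assumes "f differentiable (at (x + t *\<^sub>R axis i 1))"
  shows "((\<lambda>t. f (x + t *\<^sub>R axis i 1)) has_vector_derivative partial_deriv i f (x + t *\<^sub>R axis i 1)) (at t within S)"
proof -
  have 1: "(f has_derivative frechet_derivative f (at (x + t *\<^sub>R axis i 1))) (at (x + t *\<^sub>R axis i 1))"
    using assms by (rule frechet_derivative_works[THEN iffD1])
  have 2: "((\<lambda>t. x + t *\<^sub>R axis i 1) has_derivative (\<lambda>h. h *\<^sub>R axis i 1)) (at t within S)"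
    by (auto intro!: derivative_eq_intros)
  have "((\<lambda>t. f (x + t *\<^sub>R axis i 1)) has_derivative (\<lambda>h. frechet_derivative f (at (x + t *\<^sub>R axis i 1)) (h *\<^sub>R axis i 1))) (at t within S)"
    using has_derivative_compose[OF 2 1] by simp
  also have "(\<lambda>h. frechet_derivative f (at (x + t *\<^sub>R axis i 1)) (h *\<^sub>R axis i 1)) = (\<lambda>h. h *\<^sub>R partial_deriv i f (x + t *\<^sub>R axis i 1))"
    using has_derivative_linear[OF 1] by (simp add: partial_deriv_def linear_scale)
  finally show ?thesis by (simp add: has_vector_derivative_def)
qed

lemma integral_translate_vec:
  fixes f :: "'a::euclidean_space \<Rightarrow> complex"
  assumes [measurable]: "f \<in> borel_measurable borel"
  shows "(LINT x|lborel. f (x + a)) = (LINT x|lborel. f x)"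
proof -
  have "(LINT x|lborel. f x) = (LINT x|distr lborel borel ((+) a). f x)" by (simp add: lborel_distr_plus)
  also have "\<dots> = (LINT x|lborel. f (a + x))" by (rule integral_distr) auto
  finally show ?thesis by (simp add: add.commute)
qed

lemma has_vector_derivative_sequentially:
  fixes \<phi> :: "real \<Rightarrow> complex"
  assumes "(\<phi> has_vector_derivative d) (at 0)" and h: "h \<longlonglongrightarrow> 0" "\<And>m. h m \<noteq> 0"
  shows "(\<lambda>m. (\<phi> (h m) - \<phi> 0) /\<^sub>R h m) \<longlonglongrightarrow> d"
proof -
  have "(\<lambda>y. norm (\<phi> (0 + y) - \<phi> 0 - y *\<^sub>R d) / norm y) \<midarrow>0\<rightarrow> 0"
    using assms(1) unfolding has_vector_derivative_def has_derivative_at by blast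
  moreover have "filterlim h (at 0) sequentially"
    using h by (intro filterlim_atI) auto
  ultimately have "(\<lambda>m. norm (\<phi> (0 + h m) - \<phi> 0 - h m *\<^sub>R d) / norm (h m)) \<longlonglongrightarrow> 0"
    by (rule filterlim_compose)
  also have "(\<lambda>m. norm (\<phi> (0 + h m) - \<phi> 0 - h m *\<^sub>R d) / norm (h m)) = (\<lambda>m. norm ((\<phi> (h m) - \<phi> 0) /\<^sub>R h m - d))"
  proof
    fix m
    have "(\<phi> (h m) - \<phi> 0) /\<^sub>R h m - d = (\<phi> (h m) - \<phi> 0 - h m *\<^sub>R d) /\<^sub>R h m"
      using h(2)[of m] by (simp add: scaleR_diff_right)
    then show "norm (\<phi> (0 + h m) - \<phi> 0 - h m *\<^sub>R d) / norm (h m) = norm ((\<phi> (h m) - \<phi> 0) /\<^sub>R h m - d)"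
      by (simp add: divide_inverse mult.commute)
  qed
  finally show ?thesis using LIM_zero_cancel tendsto_norm_zero_iff by blast
qed

text \<open>Instead of integrating by parts, the derivative is kept as a difference quotient:
  translation invariance turns a shift of f by h into the factor exp(i h \<xi>_i), and dominated
  convergence takes h to 0. No boundary terms or iterated integrals occur.\<close>

lemma fourier_partial_deriv:
  fixes f :: "real ^ 'n::finite \<Rightarrow> complex"
  assumes "schwartz f"
  shows "fourier (partial_deriv i f) \<xi> = \<i> * \<xi> $ i * fourier f \<xi>"
proof -
  define e :: "real ^ 'n" where "e = axis i 1"
  define k where "k = CARD('n)"
  define h where "h = (\<lambda>m::nat. 1 / (real m + 1))"
  define K where "K = (\<lambda>x. exp (- \<i> * complex_of_real (x \<bullet> \<xi>)))"
  define g where "g = (\<lambda>m x. (f (x + h m *\<^sub>R e) - f x) /\<^sub>R h m)"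
  have h: "h m > 0" "h m \<le> 1" for m by (auto simp: h_def)
  have hlim: "h \<longlonglongrightarrow> 0" unfolding h_def using LIMSEQ_inverse_real_of_nat by (simp add: inverse_eq_divide add.commute)
  have ne: "norm e = 1" by (simp add: e_def)
  have [measurable]: "f \<in> borel_measurable borel" "partial_deriv i f \<in> borel_measurable borel"
    using schwartz_measurable assms schwartz_partial_deriv by auto
  have [measurable]: "K \<in> borel_measurable borel" unfolding K_def by measurable
  have K1: "cmod (K x) = 1" for x by (simp add: K_def)
  obtain C where C: "C \<ge> 0" "\<And>x. cmod (partial_deriv i f x) \<le> C * (1 + (norm x)\<^sup>2) powr (- real k)"
    using schwartz_decay[OF schwartz_partial_deriv[OF assms], of i k] by blast
  have VD: "((\<lambda>t. f (x + t *\<^sub>R e)) has_vector_derivative partial_deriv i f (x + t *\<^sub>R e)) (at t within S)" for x t S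
    unfolding e_def by (intro partial_deriv_has_vector_derivative schwartz_differentiable assms)
  \<comment> \<open>Majorant for dominated convergence: the mean value inequality on a segment of
    length at most 1, along which 1 + |x|^2 changes by a factor of at most 3.\<close>
  have gb: "cmod (g m x) \<le> C * 3 powr k * (1 + (norm x)\<^sup>2) powr (- real k)" for m x
  proof -
    define B where "B = C * 3 powr k * (1 + (norm x)\<^sup>2) powr (- real k)"
    have "norm (f (x + h m *\<^sub>R e) - f (x + 0 *\<^sub>R e)) \<le> B * norm (h m - 0)"
    proof (rule differentiable_bound[where f="\<lambda>t. f (x + t *\<^sub>R e)" and f'="\<lambda>t s. s *\<^sub>R partial_deriv i f (x + t *\<^sub>R e)" and S="{0..h m}"])
      fix t assume t: "t \<in> {0..h m}"
      show "((\<lambda>t. f (x + t *\<^sub>R e)) has_derivative (\<lambda>s. s *\<^sub>R partial_deriv i f (x + t *\<^sub>R e))) (at t within {0..h m})"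
        using VD unfolding has_vector_derivative_def .
      have "norm x \<le> norm (x + t *\<^sub>R e) + norm (t *\<^sub>R e)"
        using norm_triangle_ineq4[of "x + t *\<^sub>R e" "t *\<^sub>R e"] by simp
      also have "norm (t *\<^sub>R e) \<le> 1" using t h[of m] ne by simp
      finally have "norm x \<le> norm (x + t *\<^sub>R e) + 1" by simp
      then have "(norm x)\<^sup>2 \<le> (norm (x + t *\<^sub>R e) + 1)\<^sup>2" by (intro power_mono) auto
      also have "\<dots> \<le> 2 * (norm (x + t *\<^sub>R e))\<^sup>2 + 2"
        using zero_le_power2[of "norm (x + t *\<^sub>R e) - 1"] by (simp add: power2_eq_square algebra_simps)
      finally have XY: "(norm x)\<^sup>2 \<le> 2 * (norm (x + t *\<^sub>R e))\<^sup>2 + 2" .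
      have "1 + X \<le> 3 * (1 + Y)" if "X \<le> 2 * Y + 2" "0 \<le> Y" for X Y :: real using that by (smt (verit))
      from this[OF XY zero_le_power2]
      have "(1 + (norm x)\<^sup>2) / 3 \<le> 1 + (norm (x + t *\<^sub>R e))\<^sup>2" by simp
      then have "(1 + (norm (x + t *\<^sub>R e))\<^sup>2) powr (- real k) \<le> ((1 + (norm x)\<^sup>2) / 3) powr (- real k)"
        by (intro powr_mono2') (auto intro!: add_pos_nonneg)
      also have "\<dots> = 3 powr k * (1 + (norm x)\<^sup>2) powr (- real k)"
        unfolding powr_divide powr_minus_divide[of 3] by simp
      finally have "C * (1 + (norm (x + t *\<^sub>R e))\<^sup>2) powr (- real k) \<le> B"
        unfolding B_def mult.assoc using C(1) by (intro mult_left_mono)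
      then have "cmod (partial_deriv i f (x + t *\<^sub>R e)) \<le> B" using C(2) order_trans by blast
      then show "onorm (\<lambda>s. s *\<^sub>R partial_deriv i f (x + t *\<^sub>R e)) \<le> B"
        by (simp add: onorm_scaleR_left onorm_id)
    qed (use h[of m] in auto)
    then have "cmod (f (x + h m *\<^sub>R e) - f x) \<le> B * h m" using h[of m] by simp
    moreover have "cmod (g m x) = cmod (f (x + h m *\<^sub>R e) - f x) / h m"
      using h[of m] by (simp add: g_def divide_inverse mult.commute)
    ultimately show ?thesis unfolding B_def[symmetric] using h[of m] by (simp add: pos_divide_le_eq)
  qed
  have lim: "(\<lambda>m. LINT x|lborel. K x * g m x) \<longlonglongrightarrow> (LINT x|lborel. K x * partial_deriv i f x)"
  proof (rule integral_dominated_convergence[where w="\<lambda>x. C * 3 powr k * (1 + (norm x)\<^sup>2) powr (- real k)"])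
    show "integrable lborel (\<lambda>x::real^'n. C * 3 powr k * (1 + (norm x)\<^sup>2) powr (- real k))"
      unfolding k_def by (intro integrable_mult_right integrable_japanese_powr_vec) auto
    show "AE x in lborel. (\<lambda>m. K x * g m x) \<longlonglongrightarrow> K x * partial_deriv i f x"
    proof (intro AE_I2 tendsto_mult_left)
      fix x
      have "((\<lambda>t. f (x + t *\<^sub>R e)) has_vector_derivative partial_deriv i f x) (at 0)"
        using VD[of x 0 UNIV] by simp
      from has_vector_derivative_sequentially[OF this hlim] show "(\<lambda>m. g m x) \<longlonglongrightarrow> partial_deriv i f x"
        unfolding g_def using h by (simp add: less_imp_neq[symmetric])
    qed
    show "AE x in lborel. norm (K x * g m x) \<le> C * 3 powr k * (1 + (norm x)\<^sup>2) powr (- real k)" for m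
      using gb by (intro AE_I2) (simp add: norm_mult K1)
  qed (unfold g_def, measurable)
  have eq: "(LINT x|lborel. K x * g m x) = ((iexp (h m * \<xi> $ i) - 1) / h m) * fourier f \<xi>" for m
  proof -
    have int: "integrable lborel (\<lambda>x. K x * f x)"
      by (rule Bochner_Integration.integrable_bound[OF schwartz_integrable[OF assms]]) (auto simp: norm_mult K1)
    have int': "integrable lborel (\<lambda>x. K x * f (x + h m *\<^sub>R e))"
    proof -
      have "integrable (distr lborel borel ((+) (h m *\<^sub>R e))) f" using schwartz_integrable[OF assms] by (simp add: lborel_distr_plus)
      then have "integrable lborel (\<lambda>x. f (x + h m *\<^sub>R e))" by (subst (asm) integrable_distr_eq) (auto simp: add.commute)
      then show ?thesis by (rule Bochner_Integration.integrable_bound) (auto simp: norm_mult K1)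
    qed
    have Kshift: "K x = iexp (h m * \<xi> $ i) * K (x + h m *\<^sub>R e)" for x
      unfolding K_def exp_add[symmetric] e_def by (simp add: inner_add_left inner_axis algebra_simps inner_commute[of "axis i 1"])
    have "(LINT x|lborel. K x * f (x + h m *\<^sub>R e)) = (LINT x|lborel. iexp (h m * \<xi> $ i) * (K (x + h m *\<^sub>R e) * f (x + h m *\<^sub>R e)))"
      by (intro Bochner_Integration.integral_cong refl) (subst Kshift, simp only: mult.assoc)
    also have "\<dots> = iexp (h m * \<xi> $ i) * (LINT x|lborel. K x * f x)"
      by (subst integral_mult_right_zero, subst integral_translate_vec[of "\<lambda>x. K x * f x"]) auto
    finally have sh: "(LINT x|lborel. K x * f (x + h m *\<^sub>R e)) = iexp (h m * \<xi> $ i) * fourier f \<xi>"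
      by (simp add: fourier_def K_def)
    have "(LINT x|lborel. K x * g m x) = (LINT x|lborel. (K x * f (x + h m *\<^sub>R e) - K x * f x) / complex_of_real (h m))"
      by (intro Bochner_Integration.integral_cong refl) (simp add: g_def scaleR_conv_of_real field_simps)
    also have "\<dots> = ((LINT x|lborel. K x * f (x + h m *\<^sub>R e)) - (LINT x|lborel. K x * f x)) / complex_of_real (h m)"
      using int int' by (simp add: Bochner_Integration.integral_diff)
    finally show ?thesis unfolding sh by (simp add: fourier_def K_def algebra_simps diff_divide_distrib)
  qed
  have "((\<lambda>t. \<i> * complex_of_real (t * \<xi> $ i)) has_vector_derivative (\<i> * complex_of_real (\<xi> $ i))) (at 0)"
    by (intro has_vector_derivative_mult_right has_vector_derivative_of_real)
      (auto intro!: derivative_eq_intros simp: has_real_derivative_iff_has_vector_derivative[symmetric])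
  from field_vector_diff_chain_at[OF this DERIV_exp]
  have "((\<lambda>t. iexp (t * \<xi> $ i)) has_vector_derivative \<i> * \<xi> $ i) (at 0)"
    by (simp add: o_def)
  from has_vector_derivative_sequentially[OF this hlim]
  have "(\<lambda>m. (iexp (h m * \<xi> $ i) - 1) /\<^sub>R h m) \<longlonglongrightarrow> \<i> * \<xi> $ i"
    using h by (simp add: less_imp_neq[symmetric])
  then have "(\<lambda>m. ((iexp (h m * \<xi> $ i) - 1) / h m) * fourier f \<xi>) \<longlonglongrightarrow> \<i> * \<xi> $ i * fourier f \<xi>"
    by (intro tendsto_mult_right) (simp add: scaleR_conv_of_real divide_inverse mult.commute)
  then have "(\<lambda>m. LINT x|lborel. K x * g m x) \<longlonglongrightarrow> \<i> * \<xi> $ i * fourier f \<xi>"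
    unfolding eq .
  from LIMSEQ_unique[OF lim this] show ?thesis by (simp add: fourier_def K_def)
qed

lemma fourier_decay:
  fixes f :: "real ^ 'n::finite \<Rightarrow> complex"
  assumes "schwartz f"
  shows "\<exists>C\<ge>0. \<forall>\<xi>. cmod (fourier f \<xi>) \<le> C * (1 + (norm \<xi>)\<^sup>2) powr (- real k)"
proof -
  have it: "\<exists>B\<ge>0. \<forall>\<xi>. \<bar>\<xi> $ i\<bar> ^ m * cmod (fourier g \<xi>) \<le> B" if "schwartz g" for i m and g :: "real ^ 'n \<Rightarrow> complex"
    using that
  proof (induction m arbitrary: g)
    case 0
    show ?case by (rule exI[of _ "LINT x|lborel. cmod (g x)"]) (auto intro: cmod_fourier_le)
  next
    case (Suc m)
    obtain B where "B \<ge> 0" "\<And>\<xi>. \<bar>\<xi> $ i\<bar> ^ m * cmod (fourier (partial_deriv i g) \<xi>) \<le> B"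
      using Suc.IH[OF schwartz_partial_deriv[OF Suc.prems]] by blast
    then show ?case unfolding fourier_partial_deriv[OF Suc.prems]
      by (intro exI[of _ B]) (auto simp: norm_mult mult_ac)
  qed
  have "\<forall>i. \<exists>B\<ge>0. \<forall>\<xi>. \<bar>\<xi> $ i\<bar> ^ (2 * k) * cmod (fourier f \<xi>) \<le> B" using it[OF assms] by blast
  then obtain B where B: "\<And>i. B i \<ge> 0" "\<And>i \<xi>. \<bar>\<xi> $ i\<bar> ^ (2 * k) * cmod (fourier f \<xi>) \<le> B i" by metis
  define B0 where "B0 = (LINT x|lborel. cmod (f x))"
  have B0: "B0 \<ge> 0" by (simp add: B0_def)
  define n where "n = real CARD('n)"
  define C where "C = 2 ^ k * (B0 + n ^ k * (\<Sum>i\<in>UNIV. B i))"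
  have "cmod (fourier f \<xi>) \<le> C * (1 + (norm \<xi>)\<^sup>2) powr (- real k)" for \<xi>
  proof -
    \<comment> \<open>Only powers of single coordinates have been bounded so far; the largest
      coordinate controls the norm up to a factor depending on the dimension.\<close>
    obtain i where i: "\<And>j. \<bar>\<xi> $ j\<bar> \<le> \<bar>\<xi> $ i\<bar>"
    proof -
      have "Max (range (\<lambda>j. \<bar>\<xi> $ j\<bar>)) \<in> range (\<lambda>j. \<bar>\<xi> $ j\<bar>)" by (rule Max_in) auto
      then obtain i where "Max (range (\<lambda>j. \<bar>\<xi> $ j\<bar>)) = \<bar>\<xi> $ i\<bar>" by blast
      moreover have "\<bar>\<xi> $ j\<bar> \<le> Max (range (\<lambda>j. \<bar>\<xi> $ j\<bar>))" for j by (rule Max_ge) auto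
      ultimately show ?thesis using that by metis
    qed
    have "(norm \<xi>)\<^sup>2 = (\<Sum>j\<in>UNIV. \<bar>\<xi> $ j\<bar>\<^sup>2)"
      unfolding norm_vec_def L2_set_def by (subst real_sqrt_pow2) (auto intro: sum_nonneg)
    also have "\<dots> \<le> (\<Sum>j\<in>(UNIV::'n set). \<bar>\<xi> $ i\<bar>\<^sup>2)" using i by (intro sum_mono power_mono) auto
    also have "\<dots> = n * \<bar>\<xi> $ i\<bar>\<^sup>2" by (simp add: n_def)
    finally have "((norm \<xi>)\<^sup>2) ^ k \<le> (n * \<bar>\<xi> $ i\<bar>\<^sup>2) ^ k" by (intro power_mono) auto
    also have "\<dots> = n ^ k * \<bar>\<xi> $ i\<bar> ^ (2 * k)" by (simp add: power_mult_distrib power_mult)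
    finally have 1: "((norm \<xi>)\<^sup>2) ^ k * cmod (fourier f \<xi>) \<le> n ^ k * (\<bar>\<xi> $ i\<bar> ^ (2 * k) * cmod (fourier f \<xi>))"
      unfolding mult.assoc[symmetric] by (intro mult_right_mono) auto
    also have "\<dots> \<le> n ^ k * (\<Sum>i\<in>UNIV. B i)"
    proof (intro mult_left_mono)
      have "B i \<le> (\<Sum>i\<in>UNIV. B i)" using B(1) by (intro member_le_sum) auto
      then show "\<bar>\<xi> $ i\<bar> ^ (2 * k) * cmod (fourier f \<xi>) \<le> (\<Sum>i\<in>UNIV. B i)" using B(2)[of \<xi> i] by linarith
    qed (simp add: n_def)
    finally have 2: "((norm \<xi>)\<^sup>2) ^ k * cmod (fourier f \<xi>) \<le> n ^ k * (\<Sum>i\<in>UNIV. B i)" .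
    have p: "1 + (norm \<xi>)\<^sup>2 > 0" by (simp add: add_pos_nonneg)
    have "(1 + (norm \<xi>)\<^sup>2) ^ k * cmod (fourier f \<xi>) \<le> (2 ^ k * (1 + ((norm \<xi>)\<^sup>2) ^ k)) * cmod (fourier f \<xi>)"
      by (intro mult_right_mono one_plus_power_le) auto
    also have "\<dots> = 2 ^ k * (cmod (fourier f \<xi>) + ((norm \<xi>)\<^sup>2) ^ k * cmod (fourier f \<xi>))"
      by (simp add: algebra_simps)
    also have "\<dots> \<le> C" unfolding C_def B0_def using 2 by (intro mult_left_mono add_mono cmod_fourier_le) auto
    finally show ?thesis using p
      by (simp add: powr_minus powr_realpow divide_inverse[symmetric] pos_le_divide_eq mult.commute)
  qed
  moreover have "C \<ge> 0" unfolding C_def n_def using B B0 by (intro mult_nonneg_nonneg add_nonneg_nonneg sum_nonneg) auto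
  ultimately show ?thesis by blast
qed

lemma fourier_integrable:
  fixes f :: "real ^ 'n::finite \<Rightarrow> complex"
  assumes "schwartz f"
  shows "integrable lborel (fourier f)"
proof -
  obtain C where C: "C \<ge> 0" "\<And>x. cmod (fourier f x) \<le> C * (1 + (norm x)\<^sup>2) powr (- real CARD('n))"
    using fourier_decay[OF assms, of "CARD('n)"] by blast
  show ?thesis
  proof (rule Bochner_Integration.integrable_bound)
    show "integrable lborel (\<lambda>x::real^'n. C * (1 + (norm x)\<^sup>2) powr (- real CARD('n)))"
      by (intro integrable_mult_right integrable_japanese_powr_vec) auto
  qed (use schwartz_measurable[OF assms] C in \<open>auto intro!: AE_I2 order_trans[OF C(2)]\<close>)
qed

text \<open>Required wherever the Sobolev norm is compared with another integral: a divergent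
  Bochner integral would have the value 0 by convention, and the norm would say nothing.\<close>

lemma sobolev_integrable:
  fixes f :: "real ^ 'n::finite \<Rightarrow> complex"
  assumes "schwartz f"
  shows "integrable lborel (\<lambda>\<xi>. (1 + (norm \<xi>)\<^sup>2) powr s * (cmod (fourier f \<xi>))\<^sup>2)"
proof -
  define k where "k = nat \<lceil>\<bar>s\<bar>\<rceil> + CARD('n)"
  have k: "real k \<ge> s + real CARD('n)" unfolding k_def by linarith
  obtain C where C: "C \<ge> 0" "\<And>x. cmod (fourier f x) \<le> C * (1 + (norm x)\<^sup>2) powr (- real k)"
    using fourier_decay[OF assms, of k] by blast
  have [measurable]: "fourier f \<in> borel_measurable borel" using schwartz_measurable[OF assms] by measurable
  show ?thesis
  proof (rule Bochner_Integration.integrable_bound)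
    show "integrable lborel (\<lambda>x::real^'n. C\<^sup>2 * (1 + (norm x)\<^sup>2) powr (- real CARD('n)))"
      by (intro integrable_mult_right integrable_japanese_powr_vec) auto
    show "AE \<xi> in lborel. norm ((1 + (norm \<xi>)\<^sup>2) powr s * (cmod (fourier f \<xi>))\<^sup>2) \<le> norm (C\<^sup>2 * (1 + (norm \<xi>)\<^sup>2) powr (- real CARD('n)))"
    proof (rule AE_I2)
      fix \<xi> :: "real ^ 'n"
      define y where "y = 1 + (norm \<xi>)\<^sup>2"
      have y: "y \<ge> 1" by (simp add: y_def)
      have "y powr s * (cmod (fourier f \<xi>))\<^sup>2 \<le> y powr s * (C * y powr (- real k))\<^sup>2"
        using C(2)[of \<xi>] unfolding y_def by (intro mult_left_mono power_mono) auto
      also have "\<dots> = C\<^sup>2 * (y powr s * y powr (- real k) * y powr (- real k))" by (simp add: power2_eq_square)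
      also have "y powr s * y powr (- real k) * y powr (- real k) = y powr (s - real k - real k)"
        unfolding powr_add[symmetric] by simp
      also have "\<dots> \<le> y powr (- real CARD('n))" using y k by (intro powr_mono) auto
      finally show "norm ((1 + (norm \<xi>)\<^sup>2) powr s * (cmod (fourier f \<xi>))\<^sup>2) \<le> norm (C\<^sup>2 * (1 + (norm \<xi>)\<^sup>2) powr (- real CARD('n)))"
        by (simp add: y_def abs_mult mult_left_mono)
    qed
  qed measurable
qed

lemma sobolev_norm_mono:
  assumes "schwartz f" "s \<le> s'"
  shows "sobolev_norm s f \<le> sobolev_norm s' f"
  unfolding sobolev_norm_def
  by (intro real_sqrt_le_mono integral_mono sobolev_integrable assms(1) mult_right_mono powr_mono assms(2)) auto

lemma maximal_estimate_mono:
  assumes "maximal_estimate a q s" "s \<le> s'"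
  shows "maximal_estimate a q s'"
proof -
  obtain C where C: "\<And>f. schwartz f \<Longrightarrow> Lq_norm q (maximal_op a f) \<le> ennreal (C * sobolev_norm s f)"
    using assms(1) unfolding maximal_estimate_def by blast
  \<comment> \<open>The definition of the estimate admits a negative constant, for which enlarging
    the norm would go the wrong way.\<close>
  have "Lq_norm q (maximal_op a f) \<le> ennreal (max C 0 * sobolev_norm s' f)" if "schwartz f" for f
  proof -
    have "C * sobolev_norm s f \<le> max C 0 * sobolev_norm s f"
      by (intro mult_right_mono) (auto simp: sobolev_norm_def intro!: Bochner_Integration.integral_nonneg)
    also have "\<dots> \<le> max C 0 * sobolev_norm s' f"
      using sobolev_norm_mono[OF that assms(2)] by (intro mult_left_mono) auto
    finally show ?thesis using C[OF that] ennreal_leI order_trans by blast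
  qed
  then show ?thesis unfolding maximal_estimate_def by blast
qed

section \<open>Gaussian packets\<close>

lemma partial_deriv_eq: "(f has_derivative f') (at x) \<Longrightarrow> partial_deriv i f x = f' (axis i 1)"
  unfolding partial_deriv_def by (metis frechet_derivative_at)

text \<open>Polynomials as a closure: the Schwartz property of Gaussians only requires stability
  under sums, products and partial derivatives and a growth bound, each of which is an induction, so
  no normal form has to be maintained.\<close>

inductive polyfun :: "(real ^ 'n::finite \<Rightarrow> complex) \<Rightarrow> bool" where
  const: "polyfun (\<lambda>_. c)"
| coord: "polyfun (\<lambda>x. complex_of_real (x $ i))"
| add: "polyfun P \<Longrightarrow> polyfun Q \<Longrightarrow> polyfun (\<lambda>x. P x + Q x)"
| mult: "polyfun P \<Longrightarrow> polyfun Q \<Longrightarrow> polyfun (\<lambda>x. P x * Q x)"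

lemma has_derivative_coord: "((\<lambda>x. complex_of_real (x $ i)) has_derivative (\<lambda>h. complex_of_real (h $ i))) (at x)"
  by (intro has_derivative_of_real bounded_linear_imp_has_derivative bounded_linear_vec_nth)

lemma polyfun_derivative:
  fixes P :: "real ^ 'n::finite \<Rightarrow> complex"
  assumes "polyfun P"
  shows "(\<forall>x. P differentiable (at x)) \<and> (\<forall>i. polyfun (partial_deriv i P))"
  using assms
proof induction
  case (const c)
  have "partial_deriv i (\<lambda>_ :: real ^ 'n. c) = (\<lambda>_. 0)" for i
    by (rule ext, subst partial_deriv_eq[OF has_derivative_const]) simp
  then show ?case using polyfun.const[of 0] by simp
next
  case (coord j)
  have "partial_deriv i (\<lambda>x. complex_of_real (x $ j)) = (\<lambda>_. if j = i then 1 else 0)" for i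
    by (rule ext, subst partial_deriv_eq[OF has_derivative_coord]) (simp add: axis_def)
  then show ?case using has_derivative_coord polyfun.const unfolding differentiable_def by metis
next
  case (add P Q)
  have P: "(P has_derivative frechet_derivative P (at x)) (at x)" and Q: "(Q has_derivative frechet_derivative Q (at x)) (at x)" for x
    using add.IH by (auto simp: frechet_derivative_works[symmetric])
  have "partial_deriv i (\<lambda>x. P x + Q x) = (\<lambda>x. partial_deriv i P x + partial_deriv i Q x)" for i
    by (rule ext, subst partial_deriv_eq[OF has_derivative_add[OF P Q]]) (simp add: partial_deriv_def)
  then show ?case using add.IH by (auto intro: polyfun.add differentiable_add)
next
  case (mult P Q)
  have P: "(P has_derivative frechet_derivative P (at x)) (at x)" and Q: "(Q has_derivative frechet_derivative Q (at x)) (at x)" for x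
    using mult.IH by (auto simp: frechet_derivative_works[symmetric])
  have "partial_deriv i (\<lambda>x. P x * Q x) = (\<lambda>x. P x * partial_deriv i Q x + partial_deriv i P x * Q x)" for i
    by (rule ext, subst partial_deriv_eq[OF has_derivative_mult[OF P Q]]) (simp add: partial_deriv_def)
  moreover have "polyfun (\<lambda>x. P x * partial_deriv i Q x + partial_deriv i P x * Q x)" for i
    using mult.IH mult.hyps by (intro polyfun.add polyfun.mult) auto
  ultimately show ?case using mult.IH by (auto intro: differentiable_mult)
qed

lemma polyfun_bound:
  assumes "polyfun P"
  shows "\<exists>C\<ge>0. \<exists>m::nat. \<forall>x. cmod (P x) \<le> C * (1 + norm x) ^ m"
  using assms
proof induction
  case (const c)
  show ?case by (rule exI[of _ "cmod c"], simp, rule exI[of _ 0]) simp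
next
  case (coord i)
  show ?case
    by (rule exI[of _ 1], simp, rule exI[of _ 1]) (auto intro: order_trans[OF component_le_norm_cart])
next
  case (add P Q)
  obtain C m D l where *: "C \<ge> 0" "\<And>x. cmod (P x) \<le> C * (1 + norm x) ^ m" "D \<ge> 0" "\<And>x. cmod (Q x) \<le> D * (1 + norm x) ^ l"
    using add.IH by blast
  have "cmod (P x + Q x) \<le> (C + D) * (1 + norm x) ^ (max m l)" for x
  proof -
    have "cmod (P x + Q x) \<le> C * (1 + norm x) ^ m + D * (1 + norm x) ^ l"
      using * by (intro norm_triangle_mono) auto
    also have "\<dots> \<le> C * (1 + norm x) ^ (max m l) + D * (1 + norm x) ^ (max m l)"
      using * by (intro add_mono mult_left_mono power_increasing) auto
    finally show ?thesis by (simp add: distrib_right)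
  qed
  moreover have "C + D \<ge> 0" using * by simp
  ultimately show ?case by blast
next
  case (mult P Q)
  obtain C m D l where *: "C \<ge> 0" "\<And>x. cmod (P x) \<le> C * (1 + norm x) ^ m" "D \<ge> 0" "\<And>x. cmod (Q x) \<le> D * (1 + norm x) ^ l"
    using mult.IH by blast
  have "cmod (P x * Q x) \<le> (C * D) * (1 + norm x) ^ (m + l)" for x
  proof -
    have "cmod (P x * Q x) \<le> (C * (1 + norm x) ^ m) * (D * (1 + norm x) ^ l)"
      unfolding norm_mult using * by (intro mult_mono) auto
    then show ?thesis by (simp add: power_add mult_ac)
  qed
  moreover have "C * D \<ge> 0" using * by simp
  ultimately show ?case by blast
qed

text \<open>A complex linear part \<open>b\<close> covers modulated Gaussians as well. The square is
  written as a product so that the product rule for derivatives applies directly.\<close>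

definition gauss_exp :: "('n::finite \<Rightarrow> complex) \<Rightarrow> ('n \<Rightarrow> real) \<Rightarrow> real ^ 'n \<Rightarrow> complex" where
  "gauss_exp b c x = exp (\<Sum>j\<in>UNIV. b j * complex_of_real (x $ j) - complex_of_real (c j) * (complex_of_real (x $ j) * complex_of_real (x $ j)))"

lemma gauss_exp_derivative:
  "(gauss_exp b c has_derivative
     (\<lambda>h. gauss_exp b c x * (\<Sum>j\<in>UNIV. b j * complex_of_real (h $ j) - complex_of_real (c j) * (complex_of_real (x $ j) * complex_of_real (h $ j) + complex_of_real (h $ j) * complex_of_real (x $ j))))) (at x)"
proof -
  have "((\<lambda>x. \<Sum>j\<in>UNIV. b j * complex_of_real (x $ j) - complex_of_real (c j) * (complex_of_real (x $ j) * complex_of_real (x $ j))) has_derivative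
    (\<lambda>h. \<Sum>j\<in>UNIV. b j * complex_of_real (h $ j) - complex_of_real (c j) * (complex_of_real (x $ j) * complex_of_real (h $ j) + complex_of_real (h $ j) * complex_of_real (x $ j)))) (at x)"
    by (intro has_derivative_sum has_derivative_diff has_derivative_mult_right has_derivative_mult has_derivative_coord)
  from has_derivative_compose[OF this DERIV_exp[THEN has_field_derivative_imp_has_derivative]]
  show ?thesis unfolding gauss_exp_def by simp
qed

lemma partial_deriv_gauss_exp:
  "partial_deriv i (gauss_exp b c) x = gauss_exp b c x * (b i - 2 * complex_of_real (c i) * complex_of_real (x $ i))"
proof -
  have "(\<Sum>j\<in>UNIV. b j * complex_of_real (axis i 1 $ j) - complex_of_real (c j) * (complex_of_real (x $ j) * complex_of_real (axis i 1 $ j) + complex_of_real (axis i 1 $ j) * complex_of_real (x $ j)))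
    = (\<Sum>j\<in>UNIV. if j = i then b i - 2 * complex_of_real (c i) * complex_of_real (x $ i) else 0)"
    by (intro sum.cong) (auto simp: axis_def)
  then show ?thesis unfolding partial_deriv_eq[OF gauss_exp_derivative] by simp
qed

text \<open>Differentiation multiplies the exponential by a polynomial and leaves \<open>b\<close>
  and \<open>c\<close> alone, so all derivatives stay in the class of polynomials times one fixed
  Gaussian.\<close>

lemma iter_partial_deriv_polyfun_gauss:
  assumes "polyfun P"
  shows "\<exists>Q. polyfun Q \<and> iter_partial_deriv is (\<lambda>x. P x * gauss_exp b c x) = (\<lambda>x. Q x * gauss_exp b c x)"
proof (induction "is")
  case Nil
  then show ?case using assms by auto
next
  case (Cons i "is")
  then obtain Q where Q: "polyfun Q" "iter_partial_deriv is (\<lambda>x. P x * gauss_exp b c x) = (\<lambda>x. Q x * gauss_exp b c x)" by blast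
  have QD: "(Q has_derivative frechet_derivative Q (at x)) (at x)" for x
    using polyfun_derivative[OF Q(1)] by (auto simp: frechet_derivative_works[symmetric])
  define R where "R = (\<lambda>x. Q x * (b i + (- 2 * complex_of_real (c i)) * complex_of_real (x $ i)) + partial_deriv i Q x)"
  have "polyfun R" unfolding R_def using Q(1) polyfun_derivative[OF Q(1)] by (intro polyfun.intros) auto
  moreover have "partial_deriv i (\<lambda>x. Q x * gauss_exp b c x) = (\<lambda>x. R x * gauss_exp b c x)"
  proof
    fix x
    have "partial_deriv i (\<lambda>x. Q x * gauss_exp b c x) x = Q x * partial_deriv i (gauss_exp b c) x + partial_deriv i Q x * gauss_exp b c x"
      unfolding partial_deriv_eq[OF has_derivative_mult[OF QD gauss_exp_derivative]] partial_deriv_eq[OF gauss_exp_derivative]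
      by (simp add: partial_deriv_def)
    then show "partial_deriv i (\<lambda>x. Q x * gauss_exp b c x) x = R x * gauss_exp b c x"
      unfolding partial_deriv_gauss_exp R_def by (simp add: algebra_simps)
  qed
  ultimately show ?case using Q(2) by auto
qed

lemma gauss_exp_decay:
  fixes b :: "'n::finite \<Rightarrow> complex"
  assumes "\<And>j. c j > 0"
  shows "\<exists>B. \<forall>x. (1 + norm x) ^ m * cmod (gauss_exp b c x) \<le> B"
proof -
  define c0 where "c0 = Min (range c)"
  have c0: "c0 > 0" "\<And>j. c0 \<le> c j" unfolding c0_def using assms by (auto simp: Min_gr_iff)
  define \<beta> where "\<beta> = (\<Sum>j\<in>UNIV. cmod (b j))"
  \<comment> \<open>The factor (1 + r)^m is at most exp(m r), so it merely enlarges the linear term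
    of the exponent; completing the square then gives the bound.\<close>
  define K where "K = real m + \<beta>"
  have "(1 + norm x) ^ m * cmod (gauss_exp b c x) \<le> exp (K\<^sup>2 / (4 * c0))" for x
  proof -
    define r where "r = norm x"
    have r: "r \<ge> 0" by (simp add: r_def)
    have "(1 + r) ^ m \<le> exp r ^ m" using r exp_ge_add_one_self[of r] by (intro power_mono) auto
    also have "\<dots> = exp (real m * r)" by (simp add: exp_of_nat_mult)
    finally have 1: "(1 + r) ^ m \<le> exp (real m * r)" .
    have "cmod (gauss_exp b c x) = exp (\<Sum>j\<in>UNIV. Re (b j) * x $ j - c j * (x $ j)\<^sup>2)"
      unfolding gauss_exp_def norm_exp_eq_Re by (simp add: power2_eq_square)
    also have "\<dots> \<le> exp (\<beta> * r - c0 * r\<^sup>2)"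
    proof -
      have "(\<Sum>j\<in>UNIV. Re (b j) * x $ j) \<le> (\<Sum>j\<in>UNIV. cmod (b j) * r)"
      proof (intro sum_mono)
        fix j
        have "Re (b j) * x $ j \<le> \<bar>Re (b j)\<bar> * \<bar>x $ j\<bar>" using abs_ge_self[of "Re (b j) * x $ j"] by (simp add: abs_mult)
        also have "\<dots> \<le> cmod (b j) * r" unfolding r_def by (intro mult_mono abs_Re_le_cmod component_le_norm_cart) auto
        finally show "Re (b j) * x $ j \<le> cmod (b j) * r" .
      qed
      also have "\<dots> = \<beta> * r" by (simp add: \<beta>_def sum_distrib_right)
      finally have A: "(\<Sum>j\<in>UNIV. Re (b j) * x $ j) \<le> \<beta> * r" .
      have "r\<^sup>2 = (\<Sum>j\<in>UNIV. (x $ j)\<^sup>2)"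
        unfolding r_def norm_vec_def L2_set_def by (subst real_sqrt_pow2) (auto intro: sum_nonneg)
      then have "c0 * r\<^sup>2 = (\<Sum>j\<in>UNIV. c0 * (x $ j)\<^sup>2)" by (simp add: sum_distrib_left)
      also have "\<dots> \<le> (\<Sum>j\<in>UNIV. c j * (x $ j)\<^sup>2)" using c0 by (intro sum_mono mult_right_mono) auto
      finally show ?thesis using A by (simp add: sum_subtractf)
    qed
    finally have "(1 + r) ^ m * cmod (gauss_exp b c x) \<le> exp (real m * r) * exp (\<beta> * r - c0 * r\<^sup>2)"
      using 1 by (intro mult_mono) auto
    also have "\<dots> = exp (K * r - c0 * r\<^sup>2)" unfolding exp_add[symmetric] K_def by (simp add: algebra_simps)
    also have "\<dots> \<le> exp (K\<^sup>2 / (4 * c0))"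
    proof -
      have "0 \<le> (K - 2 * c0 * r)\<^sup>2" by simp
      then have "4 * c0 * (K * r - c0 * r\<^sup>2) \<le> K\<^sup>2" by (simp add: power2_eq_square algebra_simps)
      then have "K * r - c0 * r\<^sup>2 \<le> K\<^sup>2 / (4 * c0)" using c0 by (simp add: pos_le_divide_eq mult.commute)
      then show ?thesis by simp
    qed
    finally show ?thesis by (simp add: r_def)
  qed
  then show ?thesis by blast
qed

lemma schwartz_gauss_exp:
  fixes c :: "'n::finite \<Rightarrow> real"
  assumes "\<And>j. c j > 0"
  shows "schwartz (\<lambda>x. z * gauss_exp b c x)"
  unfolding schwartz_def
proof (intro allI conjI)
  fix "is" :: "'n list"
  obtain Q where Q: "polyfun Q" "iter_partial_deriv is (\<lambda>x. z * gauss_exp b c x) = (\<lambda>x. Q x * gauss_exp b c x)"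
    using iter_partial_deriv_polyfun_gauss[OF polyfun.const[of z]] by blast
  show "iter_partial_deriv is (\<lambda>x. z * gauss_exp b c x) differentiable at x" for x
    unfolding Q(2) using polyfun_derivative[OF Q(1)] gauss_exp_derivative
    by (intro differentiable_mult) (auto simp: differentiable_def)
  fix k :: nat
  obtain C m where C: "C \<ge> 0" "\<And>x. cmod (Q x) \<le> C * (1 + norm x) ^ m" using polyfun_bound[OF Q(1)] by blast
  obtain B where B: "\<And>x. (1 + norm x) ^ (k + m) * cmod (gauss_exp b c x) \<le> B"
    using gauss_exp_decay[where b=b and c=c and m="k + m"] assms by blast
  have "norm (norm x ^ k *\<^sub>R (Q x * gauss_exp b c x)) \<le> C * B" for x
  proof -
    have "norm (norm x ^ k *\<^sub>R (Q x * gauss_exp b c x)) = norm x ^ k * (cmod (Q x) * cmod (gauss_exp b c x))"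
      by (simp add: norm_mult)
    also have "\<dots> \<le> (1 + norm x) ^ k * ((C * (1 + norm x) ^ m) * cmod (gauss_exp b c x))"
      using C by (intro mult_mono power_mono) auto
    also have "\<dots> = C * ((1 + norm x) ^ (k + m) * cmod (gauss_exp b c x))" by (simp add: power_add mult_ac)
    also have "\<dots> \<le> C * B" using C(1) B by (intro mult_left_mono)
    finally show ?thesis .
  qed
  then show "bounded (range (\<lambda>x. norm x ^ k *\<^sub>R iter_partial_deriv is (\<lambda>x. z * gauss_exp b c x) x))"
    unfolding Q(2) bounded_iff by blast
qed

section \<open>Linear combinations of Schwartz functions\<close>

lemma schwartz_add:
  fixes f g :: "real ^ 'n::finite \<Rightarrow> complex"
  assumes "schwartz f" "schwartz g"
  shows "schwartz (\<lambda>x. f x + g x)"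
proof -
  have it: "iter_partial_deriv is (\<lambda>x. f x + g x) = (\<lambda>x. iter_partial_deriv is f x + iter_partial_deriv is g x)" for "is"
  proof (induction "is")
    case (Cons i "is")
    have P: "(iter_partial_deriv is f has_derivative frechet_derivative (iter_partial_deriv is f) (at x)) (at x)"
      and Q: "(iter_partial_deriv is g has_derivative frechet_derivative (iter_partial_deriv is g) (at x)) (at x)" for x
      using assms unfolding schwartz_def by (auto simp: frechet_derivative_works[symmetric])
    show ?case
      by (rule ext, simp add: Cons, subst partial_deriv_eq[OF has_derivative_add[OF P Q]]) (simp add: partial_deriv_def)
  qed simp
  show ?thesis
    unfolding schwartz_def it scaleR_add_right
  proof (intro allI conjI)
    fix "is" :: "'n list" and k :: nat
    have "bounded (range (\<lambda>x. norm x ^ k *\<^sub>R iter_partial_deriv is f x))" "bounded (range (\<lambda>x. norm x ^ k *\<^sub>R iter_partial_deriv is g x))"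
      using assms unfolding schwartz_def by auto
    then obtain B D where "\<And>x. norm (norm x ^ k *\<^sub>R iter_partial_deriv is f x) \<le> B" "\<And>x. norm (norm x ^ k *\<^sub>R iter_partial_deriv is g x) \<le> D"
      unfolding bounded_iff by auto
    then have "norm (norm x ^ k *\<^sub>R iter_partial_deriv is f x + norm x ^ k *\<^sub>R iter_partial_deriv is g x) \<le> B + D" for x
      by (intro norm_triangle_mono)
    then show "bounded (range (\<lambda>x. norm x ^ k *\<^sub>R iter_partial_deriv is f x + norm x ^ k *\<^sub>R iter_partial_deriv is g x))"
      unfolding bounded_iff by blast
  qed (use assms in \<open>auto simp: schwartz_def intro!: differentiable_add\<close>)
qed

lemma schwartz_cmult:
  fixes f :: "real ^ 'n::finite \<Rightarrow> complex"
  assumes "schwartz f"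
  shows "schwartz (\<lambda>x. z * f x)"
proof -
  have it: "iter_partial_deriv is (\<lambda>x. z * f x) = (\<lambda>x. z * iter_partial_deriv is f x)" for "is"
  proof (induction "is")
    case (Cons i "is")
    have P: "(iter_partial_deriv is f has_derivative frechet_derivative (iter_partial_deriv is f) (at x)) (at x)" for x
      using assms unfolding schwartz_def by (auto simp: frechet_derivative_works[symmetric])
    show ?case
      by (rule ext, simp add: Cons, subst partial_deriv_eq[OF has_derivative_mult_right[OF P]]) (simp add: partial_deriv_def)
  qed simp
  show ?thesis
    unfolding schwartz_def it mult_scaleR_right[symmetric]
  proof (intro allI conjI)
    fix "is" :: "'n list" and k :: nat
    have "bounded (range (\<lambda>x. norm x ^ k *\<^sub>R iter_partial_deriv is f x))"
      using assms unfolding schwartz_def by auto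
    then obtain B where "\<And>x. norm (norm x ^ k *\<^sub>R iter_partial_deriv is f x) \<le> B"
      unfolding bounded_iff by auto
    then have "norm (z * norm x ^ k *\<^sub>R iter_partial_deriv is f x) \<le> norm z * B" for x
      unfolding norm_mult by (intro mult_left_mono) auto
    then show "bounded (range (\<lambda>x. z * norm x ^ k *\<^sub>R iter_partial_deriv is f x))"
      unfolding bounded_iff by blast
  qed (use assms in \<open>auto simp: schwartz_def intro!: differentiable_mult\<close>)
qed

lemma schwartz_sum:
  fixes f :: "'k \<Rightarrow> real ^ 'n::finite \<Rightarrow> complex"
  assumes "finite A" "\<And>k. k \<in> A \<Longrightarrow> schwartz (f k)"
  shows "schwartz (\<lambda>x. \<Sum>k\<in>A. f k x)"
  using assms
proof (induction A rule: finite_induct)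
  case empty
  have "schwartz (\<lambda>x::real^'n. 0 * gauss_exp (\<lambda>_. 0) (\<lambda>_. 1) x)" by (rule schwartz_gauss_exp) simp
  then show ?case by simp
qed (auto intro: schwartz_add)

text \<open>Normalised on the Fourier side: for R > 0 the transform is a Gaussian of height 1 with
  centre N and width R.\<close>

definition gauss1 :: "real \<Rightarrow> real \<Rightarrow> real \<Rightarrow> complex" where
  "gauss1 N R y = complex_of_real (R / sqrt (2 * pi)) * (iexp (N * y) * complex_of_real (exp (-((R * y)\<^sup>2) / 2)))"

definition gauss_packet :: "real \<Rightarrow> ('n::finite \<Rightarrow> real) \<Rightarrow> real ^ 'n \<Rightarrow> complex" where
  "gauss_packet N R x = (\<Prod>j\<in>UNIV. gauss1 N (R j) (x $ j))"

lemma schwartz_gauss_packet: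
  assumes "\<And>j. R j > 0"
  shows "schwartz (gauss_packet N R)"
proof -
  have "gauss_packet N R = (\<lambda>x. (\<Prod>j\<in>UNIV. complex_of_real (R j / sqrt (2 * pi))) * gauss_exp (\<lambda>_. \<i> * complex_of_real N) (\<lambda>j. (R j)\<^sup>2 / 2) x)"
    unfolding gauss_packet_def gauss1_def gauss_exp_def exp_sum[OF finite] prod.distrib[symmetric]
    by (intro ext prod.cong refl) (simp add: exp_add[symmetric] exp_of_real[symmetric] power2_eq_square algebra_simps)
  moreover have "(R j)\<^sup>2 / 2 > 0" for j using assms[of j] by simp
  ultimately show ?thesis by (simp only:) (rule schwartz_gauss_exp)
qed

text \<open>Read off from the characteristic function of the standard normal distribution.\<close>

lemma std_gauss_integral:
  shows "integrable lborel (\<lambda>z. complex_of_real (exp (-(z\<^sup>2) / 2)) * iexp (t * z))"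
    and "(LINT z|lborel. complex_of_real (exp (-(z\<^sup>2) / 2)) * iexp (t * z)) = complex_of_real (sqrt (2 * pi) * exp (-(t\<^sup>2) / 2))"
proof -
  have int: "integrable lborel (\<lambda>z. complex_of_real (std_normal_density z))"
    using integrable_normal_moment[of 1 0 0] by simp
  then have int2: "integrable lborel (\<lambda>z. complex_of_real (std_normal_density z) * iexp (t * z))"
    by (rule Bochner_Integration.integrable_bound) (auto simp: norm_mult)
  have eq: "complex_of_real (exp (-(z\<^sup>2) / 2)) * iexp (t * z) =
     complex_of_real (sqrt (2 * pi)) * (complex_of_real (std_normal_density z) * iexp (t * z))" for z
    by (simp add: std_normal_density_def)
  show "integrable lborel (\<lambda>z. complex_of_real (exp (-(z\<^sup>2) / 2)) * iexp (t * z))"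
    unfolding eq by (rule integrable_mult_right[OF int2])
  have "complex_of_real (exp (-(t\<^sup>2) / 2)) = (LINT z|std_normal_distribution. iexp (t * z))"
    using fun_cong[OF char_std_normal_distribution, of t] by (simp add: char_def)
  also have "\<dots> = (LINT z|lborel. std_normal_density z *\<^sub>R iexp (t * z))"
    by (rule integral_density) (auto simp: normal_density_nonneg)
  finally show "(LINT z|lborel. complex_of_real (exp (-(z\<^sup>2) / 2)) * iexp (t * z)) = complex_of_real (sqrt (2 * pi) * exp (-(t\<^sup>2) / 2))"
    unfolding eq by (simp add: scaleR_conv_of_real)
qed

lemma gauss1_fourier:
  assumes R: "R > 0"
  shows "integrable lborel (\<lambda>y. exp (- \<i> * complex_of_real (y * \<xi>)) * gauss1 N R y)"
    and "(LINT y|lborel. exp (- \<i> * complex_of_real (y * \<xi>)) * gauss1 N R y) = complex_of_real (exp (-(((\<xi> - N) / R)\<^sup>2) / 2))"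
proof -
  define t where "t = (N - \<xi>) / R"
  define g where "g = (\<lambda>z. complex_of_real (exp (-(z\<^sup>2) / 2)) * iexp (t * z))"
  have g: "integrable lborel g" "(LINT z|lborel. g z) = complex_of_real (sqrt (2 * pi) * exp (-(t\<^sup>2) / 2))"
    unfolding g_def by (rule std_gauss_integral)+
  have eq: "exp (- \<i> * complex_of_real (y * \<xi>)) * gauss1 N R y = complex_of_real (R / sqrt (2 * pi)) * g (0 + R * y)" for y
  proof -
    have "exp (- \<i> * complex_of_real (y * \<xi>)) * iexp (N * y) = iexp (t * (R * y))"
    proof -
      have "t * R = N - \<xi>" using R by (simp add: t_def)
      moreover have "t * (R * y) = (t * R) * y" by simp
      ultimately have "t * (R * y) = (N - \<xi>) * y" by (simp only:)
      then have e: "t * (R * y) = N * y - y * \<xi>" by (simp add: algebra_simps)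
      show ?thesis unfolding exp_add[symmetric] e by (simp add: algebra_simps)
    qed
    then show ?thesis unfolding gauss1_def g_def by (simp add: mult_ac)
  qed
  show "integrable lborel (\<lambda>y. exp (- \<i> * complex_of_real (y * \<xi>)) * gauss1 N R y)"
    unfolding eq using R by (intro integrable_mult_right lborel_integrable_real_affine g) auto
  have "complex_of_real (sqrt (2 * pi) * exp (-(t\<^sup>2) / 2)) = R *\<^sub>R (LINT y|lborel. g (0 + R * y))"
    using lborel_integral_real_affine[of R g 0] R g(2) by simp
  then have "(LINT y|lborel. g (0 + R * y)) = complex_of_real (sqrt (2 * pi) * exp (-(t\<^sup>2) / 2) / R)"
    using R by (simp add: scaleR_conv_of_real field_simps)
  then have "(LINT y|lborel. exp (- \<i> * complex_of_real (y * \<xi>)) * gauss1 N R y) = complex_of_real (R / sqrt (2 * pi)) * complex_of_real (sqrt (2 * pi) * exp (-(t\<^sup>2) / 2) / R)"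
    unfolding eq by simp
  also have "\<dots> = complex_of_real (R / sqrt (2 * pi) * (sqrt (2 * pi) * exp (-(t\<^sup>2) / 2) / R))" by (simp only: of_real_mult)
  also have "R / sqrt (2 * pi) * (sqrt (2 * pi) * exp (-(t\<^sup>2) / 2) / R) = exp (-(t\<^sup>2) / 2)" using R by simp
  also have "t\<^sup>2 = ((\<xi> - N) / R)\<^sup>2" unfolding t_def power_divide by (simp add: power2_commute)
  finally show "(LINT y|lborel. exp (- \<i> * complex_of_real (y * \<xi>)) * gauss1 N R y) = complex_of_real (exp (-(((\<xi> - N) / R)\<^sup>2) / 2))" .
qed

lemma fourier_gauss_packet:
  assumes R: "\<And>j. R j > 0"
  shows "fourier (gauss_packet N R) \<xi> = (\<Prod>j\<in>UNIV. complex_of_real (exp (-(((\<xi> $ j - N) / R j)\<^sup>2) / 2)))"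
proof -
  have "exp (- \<i> * complex_of_real (x \<bullet> \<xi>)) * gauss_packet N R x = (\<Prod>j\<in>UNIV. exp (- \<i> * complex_of_real (x $ j * \<xi> $ j)) * gauss1 N (R j) (x $ j))" for x
    unfolding gauss_packet_def prod.distrib inner_vec_def exp_sum[OF finite, symmetric] by (simp add: sum_distrib_left)
  then have "fourier (gauss_packet N R) \<xi> = integral\<^sup>L lborel (\<lambda>x. \<Prod>j\<in>UNIV. exp (- \<i> * complex_of_real (x $ j * \<xi> $ j)) * gauss1 N (R j) (x $ j))"
    by (simp add: fourier_def)
  also have "\<dots> = (\<Prod>j\<in>UNIV. LINT y|lborel. exp (- \<i> * complex_of_real (y * \<xi> $ j)) * gauss1 N (R j) y)"
    by (rule integral_lborel_vec_prod) (rule gauss1_fourier[OF R])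
  finally show ?thesis by (simp only: gauss1_fourier(2)[OF R])
qed

section \<open>The maximal estimate by duality\<close>

text \<open>The kernel estimates exclude u = 0. With the value \<open>top\<close> at that point the
  pointwise majorant holds everywhere, while the diagonal, being a null set, does not affect the
  bilinear form.\<close>

lemma bilinear_bound_modify_zero:
  assumes "bilinear_bound p k C"
  shows "bilinear_bound p (\<lambda>u. if u = 0 then top else k u) C"
proof -
  have [measurable]: "k \<in> borel_measurable borel" using assms by (simp add: bilinear_bound_def)
  have "(\<integral>\<^sup>+x. \<integral>\<^sup>+y. f x * g y * (if x - y = 0 then top else k (x - y)) \<partial>lborel \<partial>lborel) =
     (\<integral>\<^sup>+x. \<integral>\<^sup>+y. f x * g y * k (x - y) \<partial>lborel \<partial>lborel)" for f g :: "real \<Rightarrow> ennreal"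
  proof (rule nn_integral_cong)
    fix x :: real
    have "AE y in lborel. f x * g y * (if x - y = 0 then top else k (x - y)) = f x * g y * k (x - y)"
      using AE_lborel_singleton[of x] by eventually_elim auto
    then show "(\<integral>\<^sup>+y. f x * g y * (if x - y = 0 then top else k (x - y)) \<partial>lborel) = (\<integral>\<^sup>+y. f x * g y * k (x - y) \<partial>lborel)"
      by (rule nn_integral_cong_AE)
  qed
  then show ?thesis using assms unfolding bilinear_bound_def by simp
qed

lemma tensor_bilinear_bound_vec:
  fixes F G :: "real ^ 'n::finite \<Rightarrow> ennreal"
  assumes p: "p > 0" and k: "\<And>i. bilinear_bound p (k i) (C i)"
    and [measurable]: "F \<in> borel_measurable borel" "G \<in> borel_measurable borel"
  shows "(\<integral>\<^sup>+x. \<integral>\<^sup>+y. F x * G y * (\<Prod>i\<in>UNIV. k i (x $ i - y $ i)) \<partial>lborel \<partial>lborel) \<le>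
    (\<Prod>i\<in>UNIV. ennreal (C i)) * ennreal_powr (\<integral>\<^sup>+x. ennreal_powr (F x) p \<partial>lborel) (1 / p) *
      ennreal_powr (\<integral>\<^sup>+x. ennreal_powr (G x) p \<partial>lborel) (1 / p)"
proof -
  have [measurable]: "k i \<in> borel_measurable borel" for i using k[of i] by (simp add: bilinear_bound_def)
  have FM: "(\<lambda>x. F (\<chi> i. x i)) \<in> borel_measurable (Pi\<^sub>M UNIV (\<lambda>_. lborel))"
    and GM: "(\<lambda>x. G (\<chi> i. x i)) \<in> borel_measurable (Pi\<^sub>M UNIV (\<lambda>_. lborel))"
    using measurable_compose[OF vec_lambda_measurable] by auto
  have "(\<integral>\<^sup>+x. \<integral>\<^sup>+y. F x * G y * (\<Prod>i\<in>UNIV. k i (x $ i - y $ i)) \<partial>lborel \<partial>lborel) =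
    (\<integral>\<^sup>+x. \<integral>\<^sup>+y. F (\<chi> i. x i) * G (\<chi> i. y i) * (\<Prod>i\<in>UNIV. k i (x i - y i)) \<partial>Pi\<^sub>M UNIV (\<lambda>_. lborel) \<partial>Pi\<^sub>M UNIV (\<lambda>_. lborel))"
    by (subst nn_integral_lborel_vec, measurable, subst nn_integral_lborel_vec, measurable)
  also have "\<dots> \<le> (\<Prod>i\<in>UNIV. ennreal (C i)) * ennreal_powr (\<integral>\<^sup>+x. ennreal_powr (F (\<chi> i. x i)) p \<partial>Pi\<^sub>M UNIV (\<lambda>_. lborel)) (1 / p) *
      ennreal_powr (\<integral>\<^sup>+x. ennreal_powr (G (\<chi> i. x i)) p \<partial>Pi\<^sub>M UNIV (\<lambda>_. lborel)) (1 / p)"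
    by (rule tensor_bilinear_bound) (use p k FM GM in auto)
  also have "(\<integral>\<^sup>+x. ennreal_powr (F (\<chi> i. x i)) p \<partial>Pi\<^sub>M UNIV (\<lambda>_. lborel)) = (\<integral>\<^sup>+x. ennreal_powr (F x) p \<partial>lborel)"
    by (subst nn_integral_lborel_vec[of "\<lambda>x. ennreal_powr (F x) p"]) auto
  also have "(\<integral>\<^sup>+x. ennreal_powr (G (\<chi> i. x i)) p \<partial>Pi\<^sub>M UNIV (\<lambda>_. lborel)) = (\<integral>\<^sup>+x. ennreal_powr (G x) p \<partial>lborel)"
    by (subst nn_integral_lborel_vec[of "\<lambda>x. ennreal_powr (G x) p"]) auto
  finally show ?thesis .
qed

lemma borel_measurable_cnj [measurable (raw)]:
  "f \<in> borel_measurable M \<Longrightarrow> (\<lambda>x. cnj (f x)) \<in> borel_measurable M"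
  by (rule measurable_compose[OF _ borel_measurable_continuous_onI]) (auto intro: continuous_on_cnj continuous_on_id)

definition osc_phase :: "real ^ 'n::finite \<Rightarrow> real ^ 'n \<Rightarrow> real ^ 'n \<Rightarrow> real ^ 'n \<Rightarrow> real" where
  "osc_phase a t x \<xi> = (\<Sum>j\<in>UNIV. x $ j * \<xi> $ j + t $ j * \<bar>\<xi> $ j\<bar> powr (a $ j))"

lemma osc_phase_measurable [measurable (raw)]:
  assumes [measurable]: "t \<in> borel_measurable M" "x \<in> borel_measurable M" "y \<in> borel_measurable M"
  shows "(\<lambda>z. osc_phase a (t z) (x z) (y z)) \<in> borel_measurable M"
proof -
  have [measurable]: "(\<lambda>z. f z $ j) \<in> borel_measurable M" if [measurable]: "f \<in> borel_measurable M" for f :: "_ \<Rightarrow> real ^ 'n" and j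
    by measurable
  show ?thesis unfolding osc_phase_def by measurable
qed

lemma S_op_eq: "S_op a t f x = (LINT \<xi>|lborel. iexp (osc_phase a t x \<xi>) * fourier f \<xi>)"
proof -
  have "iexp (x \<bullet> \<xi>) * iexp (\<Sum>j\<in>UNIV. t $ j * \<bar>\<xi> $ j\<bar> powr (a $ j)) =
     iexp (osc_phase a t x \<xi>)" for \<xi>
    unfolding exp_add[symmetric] osc_phase_def sum.distrib inner_vec_def by (simp add: distrib_left)
  then show ?thesis unfolding S_op_def by simp
qed

text \<open>The transpose of the linearised operator under the bilinear pairing without conjugation,
  which is why the phase has the same sign as in \<open>S_op\<close>.\<close>

definition adjoint_transform ::
  "real ^ 'n::finite \<Rightarrow> (real ^ 'n \<Rightarrow> real ^ 'n) \<Rightarrow> (real ^ 'n \<Rightarrow> complex) \<Rightarrow> real ^ 'n \<Rightarrow> complex" where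
  "adjoint_transform a t H \<xi> = (LINT x|lborel. iexp (osc_phase a (t x) x \<xi>) * H x)"

context
  fixes a :: "real ^ 'n::finite" and t :: "real ^ 'n \<Rightarrow> real ^ 'n" and H :: "real ^ 'n \<Rightarrow> complex"
    and s C Ck :: "'n \<Rightarrow> real" and k :: "'n \<Rightarrow> real \<Rightarrow> real" and p :: real
  assumes t [measurable]: "t \<in> borel_measurable borel" and t01: "\<And>x j. 0 < t x $ j \<and> t x $ j < 1"
    and H: "integrable lborel H"
    and s: "\<And>j. s j \<ge> 0"
    and p: "p > 0"
    and k: "\<And>j. bilinear_bound p (\<lambda>u. ennreal (k j u)) (C j)"
    and Ck: "\<And>j. Ck j > 0"
    and kernel: "\<And>j \<eta> u \<tau>. 0 < \<eta> \<Longrightarrow> \<eta> \<le> 1 \<Longrightarrow> u \<noteq> 0 \<Longrightarrow> \<bar>\<tau>\<bar> \<le> 1 \<Longrightarrow>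
      cmod (osc_kernel (a $ j) (s j) \<eta> u \<tau>) \<le> Ck j * k j u"
begin

lemma adjoint_transform_measurable: "adjoint_transform a t H \<in> borel_measurable borel"
proof -
  note [measurable] = borel_measurable_integrable[OF H, simplified]
  show ?thesis unfolding adjoint_transform_def[abs_def] by measurable
qed

text \<open>The squared modulus is a double integral in two space variables. Exchanging it with the
  integral in \<xi> produces the kernel \<open>K\<close>, a product over the coordinates because
  phase and weight both split. Only the modulus of \<open>K\<close> is used after that, so the
  arbitrary measurable function \<open>t\<close> disappears from the estimate.\<close>

lemma adjoint_transform_L2:
  assumes \<eta>: "0 < \<eta>" "\<eta> \<le> 1"
  shows "(\<integral>\<^sup>+\<xi>. ennreal ((cmod (adjoint_transform a t H \<xi>))\<^sup>2 * (\<Prod>j\<in>UNIV. bessel_weight (s j) \<eta> (\<xi> $ j))) \<partial>lborel) \<le>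
    (\<Prod>j\<in>UNIV. ennreal (Ck j)) * (\<Prod>j\<in>UNIV. ennreal (C j)) *
    (ennreal_powr (\<integral>\<^sup>+x. ennreal_powr (ennreal (cmod (H x))) p \<partial>lborel) (1 / p))\<^sup>2"
proof -
  note [measurable] = borel_measurable_integrable[OF H, simplified] adjoint_transform_measurable
  define m where "m = (\<lambda>\<xi> :: real ^ 'n. \<Prod>j\<in>UNIV. bessel_weight (s j) \<eta> (\<xi> $ j))"
  define E where "E = (\<lambda>x \<xi>. iexp (osc_phase a (t x) x \<xi>))"
  define \<Psi> where "\<Psi> = (\<lambda>\<xi> z. complex_of_real (m \<xi>) * (E (fst z) \<xi> * H (fst z)) * cnj (E (snd z) \<xi> * H (snd z)))"
  have m: "integrable lborel m"
    unfolding m_def using \<eta> s by (intro integrable_lborel_vec_prod bessel_weight_integrable)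
  have m0: "m \<xi> \<ge> 0" for \<xi> unfolding m_def using bessel_weight_pos[OF \<eta>(1)] by (intro prod_nonneg) (simp add: less_imp_le)
  have [measurable]: "m \<in> borel_measurable borel" using borel_measurable_integrable[OF m] by simp
  have E1: "cmod (E x \<xi>) = 1" for x \<xi> by (simp add: E_def)
  have [measurable]: "(\<lambda>(\<xi>, x). E x \<xi>) \<in> borel_measurable (borel \<Otimes>\<^sub>M borel)" unfolding E_def by measurable
  have [measurable]: "(\<lambda>z. E (f z) (g z)) \<in> borel_measurable M" if [measurable]: "f \<in> borel_measurable M" "g \<in> borel_measurable M" for f g and M :: "'z measure"
    unfolding E_def by measurable
  have \<Psi>M: "case_prod \<Psi> \<in> borel_measurable (lborel \<Otimes>\<^sub>M (lborel \<Otimes>\<^sub>M lborel))"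
    unfolding \<Psi>_def case_prod_beta' E_def by measurable
  have nH: "(\<integral>\<^sup>+x. ennreal (cmod (H x)) \<partial>lborel) < \<infinity>" using H by (simp add: integrable_iff_bounded)
  have nm: "(\<integral>\<^sup>+x. ennreal (m x) \<partial>lborel) < \<infinity>" using m m0 by (simp add: integrable_iff_bounded)
  have \<Psi>n: "cmod (\<Psi> \<xi> z) = m \<xi> * (cmod (H (fst z)) * cmod (H (snd z)))" for \<xi> z
    using m0[of \<xi>] by (simp add: \<Psi>_def norm_mult E1)
  interpret L3: pair_sigma_finite "lborel :: (real ^ 'n) measure" "lborel \<Otimes>\<^sub>M lborel :: ((real ^ 'n) \<times> (real ^ 'n)) measure"
    unfolding lborel_prod by standard
  have sf: "sigma_finite_measure (lborel \<Otimes>\<^sub>M lborel :: ((real ^ 'n) \<times> (real ^ 'n)) measure)"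
    unfolding lborel_prod by (rule sigma_finite_lborel)
  \<comment> \<open>The exchange is justified by \<eta> > 0, which makes the weight \<open>m\<close>
    integrable; the limiting weight need not be.\<close>
  have int\<Psi>: "integrable (lborel \<Otimes>\<^sub>M (lborel \<Otimes>\<^sub>M lborel)) (case_prod \<Psi>)"
  proof (rule integrableI_bounded[OF \<Psi>M])
    have "(\<integral>\<^sup>+w. ennreal (norm (case_prod \<Psi> w)) \<partial>(lborel \<Otimes>\<^sub>M (lborel \<Otimes>\<^sub>M lborel))) =
      (\<integral>\<^sup>+\<xi>. \<integral>\<^sup>+z. ennreal (norm (\<Psi> \<xi> z)) \<partial>(lborel \<Otimes>\<^sub>M lborel) \<partial>lborel)"
      using \<Psi>M by (subst sigma_finite_measure.nn_integral_fst[OF sf, symmetric]) auto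
    also have "\<dots> = (\<integral>\<^sup>+\<xi>. \<integral>\<^sup>+x. \<integral>\<^sup>+y. ennreal (m \<xi>) * (ennreal (cmod (H x)) * ennreal (cmod (H y))) \<partial>lborel \<partial>lborel \<partial>lborel)"
      unfolding \<Psi>n using m0 by (subst lborel.nn_integral_fst[symmetric]) (auto simp: ennreal_mult)
    also have "\<dots> = (\<integral>\<^sup>+\<xi>. ennreal (m \<xi>) \<partial>lborel) * ((\<integral>\<^sup>+x. ennreal (cmod (H x)) \<partial>lborel) * (\<integral>\<^sup>+x. ennreal (cmod (H x)) \<partial>lborel))"
      by (simp add: nn_integral_cmult nn_integral_multc)
    also have "\<dots> < \<infinity>" using nH nm by (simp add: ennreal_mult_less_top)
    finally show "(\<integral>\<^sup>+w. ennreal (norm (case_prod \<Psi> w)) \<partial>(lborel \<Otimes>\<^sub>M (lborel \<Otimes>\<^sub>M lborel))) < \<infinity>" .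
  qed
  have intEH: "integrable lborel (\<lambda>x. E x \<xi> * H x)" for \<xi>
    by (rule Bochner_Integration.integrable_bound[OF H]) (auto simp: norm_mult E1)
  have inner: "(LINT z|(lborel \<Otimes>\<^sub>M lborel). \<Psi> \<xi> z) = complex_of_real (m \<xi> * (cmod (adjoint_transform a t H \<xi>))\<^sup>2)" for \<xi>
  proof -
    define u where "u = (\<lambda>x. E x \<xi> * H x)"
    have u: "integrable lborel u" unfolding u_def by (rule intEH)
    have [measurable]: "u \<in> borel_measurable borel" using borel_measurable_integrable[OF u] by simp
    have nu: "(\<integral>\<^sup>+x. ennreal (cmod (u x)) \<partial>lborel) < \<infinity>" using u by (simp add: integrable_iff_bounded)
    have "integrable (lborel \<Otimes>\<^sub>M lborel) (\<lambda>(x, y). u x * cnj (u y))"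
    proof (rule integrableI_bounded)
      have "(\<integral>\<^sup>+w. ennreal (norm (case w of (x, y) \<Rightarrow> u x * cnj (u y))) \<partial>(lborel \<Otimes>\<^sub>M lborel)) =
        (\<integral>\<^sup>+x. \<integral>\<^sup>+y. ennreal (cmod (u x)) * ennreal (cmod (u y)) \<partial>lborel \<partial>lborel)"
        by (subst lborel.nn_integral_fst[symmetric]) (auto simp: norm_mult ennreal_mult)
      also have "\<dots> = (\<integral>\<^sup>+x. ennreal (cmod (u x)) \<partial>lborel) * (\<integral>\<^sup>+x. ennreal (cmod (u x)) \<partial>lborel)"
        by (simp add: nn_integral_cmult nn_integral_multc)
      also have "\<dots> < \<infinity>" using nu by (simp add: ennreal_mult_less_top)
      finally show "(\<integral>\<^sup>+w. ennreal (norm (case w of (x, y) \<Rightarrow> u x * cnj (u y))) \<partial>(lborel \<Otimes>\<^sub>M lborel)) < \<infinity>" .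
    qed measurable
    then have "(LINT w|(lborel \<Otimes>\<^sub>M lborel). (case w of (x, y) \<Rightarrow> u x * cnj (u y))) = (LINT x|lborel. LINT y|lborel. u x * cnj (u y))"
      by (rule lborel_pair.integral_fst[symmetric])
    also have "\<dots> = (LINT x|lborel. u x) * cnj (LINT x|lborel. u x)"
      by simp
    also have "\<dots> = complex_of_real ((cmod (adjoint_transform a t H \<xi>))\<^sup>2)"
      by (simp add: adjoint_transform_def u_def E_def complex_norm_square[symmetric] del: of_real_power)
    finally have "(LINT w|(lborel \<Otimes>\<^sub>M lborel). u (fst w) * cnj (u (snd w))) = complex_of_real ((cmod (adjoint_transform a t H \<xi>))\<^sup>2)"
      by (simp add: case_prod_beta')
    then show ?thesis unfolding \<Psi>_def u_def mult.assoc by simp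
  qed
  define K where "K = (\<lambda>z. LINT \<xi>|lborel. complex_of_real (m \<xi>) * (E (fst z) \<xi> * cnj (E (snd z) \<xi>)))"
  have K: "K z = (\<Prod>j\<in>UNIV. osc_kernel (a $ j) (s j) \<eta> (fst z $ j - snd z $ j) (t (fst z) $ j - t (snd z) $ j))" for z
  proof -
    define x y where "x = fst z" and "y = snd z"
    have EE: "E x \<xi> * cnj (E y \<xi>) = (\<Prod>j\<in>UNIV. iexp ((x $ j - y $ j) * \<xi> $ j + (t x $ j - t y $ j) * \<bar>\<xi> $ j\<bar> powr (a $ j)))" for \<xi>
    proof -
      have "E x \<xi> * cnj (E y \<xi>) = iexp (osc_phase a (t x) x \<xi> - osc_phase a (t y) y \<xi>)"
        unfolding E_def exp_cnj exp_add[symmetric] by (simp add: right_diff_distrib)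
      also have "osc_phase a (t x) x \<xi> - osc_phase a (t y) y \<xi> = (\<Sum>j\<in>UNIV. (x $ j - y $ j) * \<xi> $ j + (t x $ j - t y $ j) * \<bar>\<xi> $ j\<bar> powr (a $ j))"
        unfolding osc_phase_def sum_subtractf[symmetric] by (intro sum.cong refl) (simp add: algebra_simps)
      finally show ?thesis by (simp only: of_real_sum sum_distrib_left exp_sum[OF finite])
    qed
    have "K z = (LINT \<xi>|lborel. (\<Prod>j\<in>UNIV. iexp ((x $ j - y $ j) * \<xi> $ j + (t x $ j - t y $ j) * \<bar>\<xi> $ j\<bar> powr (a $ j)) * complex_of_real (bessel_weight (s j) \<eta> (\<xi> $ j))))"
      unfolding K_def x_def[symmetric] y_def[symmetric] EE m_def of_real_prod prod.distrib[symmetric] by (simp only: mult.commute)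
    also have "\<dots> = (\<Prod>j\<in>UNIV. osc_kernel (a $ j) (s j) \<eta> (x $ j - y $ j) (t x $ j - t y $ j))"
      unfolding osc_kernel_def using \<eta> s by (intro integral_lborel_vec_prod osc_integrable) auto
    finally show ?thesis by (simp add: x_def y_def)
  qed
  define k' where "k' = (\<lambda>j u. if u = 0 then top else ennreal (k j u))"
  have Kb: "ennreal (cmod (K (x, y))) \<le> (\<Prod>j\<in>UNIV. ennreal (Ck j)) * (\<Prod>j\<in>UNIV. k' j (x $ j - y $ j))" for x y
  proof -
    have "ennreal (cmod (K (x, y))) = (\<Prod>j\<in>UNIV. ennreal (cmod (osc_kernel (a $ j) (s j) \<eta> (x $ j - y $ j) (t x $ j - t y $ j))))"
      unfolding K prod_norm[symmetric] by (simp add: prod_ennreal)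
    also have "\<dots> \<le> (\<Prod>j\<in>UNIV. ennreal (Ck j) * k' j (x $ j - y $ j))"
    proof (rule prod_mono_ennreal)
      fix j
      show "ennreal (cmod (osc_kernel (a $ j) (s j) \<eta> (x $ j - y $ j) (t x $ j - t y $ j))) \<le> ennreal (Ck j) * k' j (x $ j - y $ j)"
      proof (cases "x $ j - y $ j = 0")
        case True then show ?thesis using Ck[of j] by (simp add: k'_def ennreal_mult_top)
      next
        case False
        \<comment> \<open>This is where the bounded range of times enters: differences of admissible
          times stay in the range covered by the kernel bounds.\<close>
        have "\<bar>t x $ j - t y $ j\<bar> \<le> 1" using t01[of x j] t01[of y j] by linarith
        from kernel[OF \<eta> False this, of j] False show ?thesis
          using Ck[of j] by (simp add: k'_def ennreal_mult'[symmetric] ennreal_leI)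
      qed
    qed
    also have "\<dots> = (\<Prod>j\<in>UNIV. ennreal (Ck j)) * (\<Prod>j\<in>UNIV. k' j (x $ j - y $ j))" by (rule prod.distrib)
    finally show ?thesis .
  qed
  have k'b: "bilinear_bound p (k' j) (C j)" for j
    unfolding k'_def by (rule bilinear_bound_modify_zero[OF k])
  have [measurable]: "k' j \<in> borel_measurable borel" for j using k'b[of j] by (simp add: bilinear_bound_def)
  have sw: "(LINT \<xi>|lborel. \<Psi> \<xi> z) = (H (fst z) * cnj (H (snd z))) * K z" for z
  proof -
    have "(LINT \<xi>|lborel. \<Psi> \<xi> z) = (LINT \<xi>|lborel. (H (fst z) * cnj (H (snd z))) * (complex_of_real (m \<xi>) * (E (fst z) \<xi> * cnj (E (snd z) \<xi>))))"
      by (intro Bochner_Integration.integral_cong refl) (simp add: \<Psi>_def mult_ac)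
    then show ?thesis by (simp add: K_def)
  qed
  have int1: "integrable lborel (\<lambda>\<xi>. m \<xi> * (cmod (adjoint_transform a t H \<xi>))\<^sup>2)"
    using L3.integrable_fst[OF int\<Psi>] unfolding inner by (simp only: complex_of_real_integrable_eq)
  have "(\<integral>\<^sup>+\<xi>. ennreal ((cmod (adjoint_transform a t H \<xi>))\<^sup>2 * m \<xi>) \<partial>lborel) = ennreal (LINT \<xi>|lborel. m \<xi> * (cmod (adjoint_transform a t H \<xi>))\<^sup>2)"
    using int1 m0 by (subst nn_integral_eq_integral[symmetric]) (auto simp: mult.commute)
  also have "(LINT \<xi>|lborel. m \<xi> * (cmod (adjoint_transform a t H \<xi>))\<^sup>2) \<le> cmod (complex_of_real (LINT \<xi>|lborel. m \<xi> * (cmod (adjoint_transform a t H \<xi>))\<^sup>2))"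
    by simp
  also have "complex_of_real (LINT \<xi>|lborel. m \<xi> * (cmod (adjoint_transform a t H \<xi>))\<^sup>2) = (LINT \<xi>|lborel. LINT z|(lborel \<Otimes>\<^sub>M lborel). \<Psi> \<xi> z)"
    unfolding inner by (rule integral_complex_of_real[symmetric])
  also have "\<dots> = (LINT z|(lborel \<Otimes>\<^sub>M lborel). LINT \<xi>|lborel. \<Psi> \<xi> z)"
    by (rule L3.Fubini_integral[OF int\<Psi>, symmetric])
  also have "ennreal (cmod (LINT z|(lborel \<Otimes>\<^sub>M lborel). LINT \<xi>|lborel. \<Psi> \<xi> z)) \<le> (\<integral>\<^sup>+z. ennreal (cmod (LINT \<xi>|lborel. \<Psi> \<xi> z)) \<partial>(lborel \<Otimes>\<^sub>M lborel))"
    by (rule integral_norm_bound_ennreal[OF L3.integrable_snd[OF int\<Psi>]])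
  also have "\<dots> \<le> (\<integral>\<^sup>+z. (\<Prod>j\<in>UNIV. ennreal (Ck j)) * (ennreal (cmod (H (fst z))) * ennreal (cmod (H (snd z))) * (\<Prod>j\<in>UNIV. k' j (fst z $ j - snd z $ j))) \<partial>(lborel \<Otimes>\<^sub>M lborel))"
  proof (intro nn_integral_mono)
    fix z :: "(real ^ 'n) \<times> (real ^ 'n)"
    have "ennreal (cmod (LINT \<xi>|lborel. \<Psi> \<xi> z)) = ennreal (cmod (H (fst z))) * ennreal (cmod (H (snd z))) * ennreal (cmod (K z))"
      unfolding sw by (simp add: norm_mult ennreal_mult)
    also have "\<dots> \<le> ennreal (cmod (H (fst z))) * ennreal (cmod (H (snd z))) * ((\<Prod>j\<in>UNIV. ennreal (Ck j)) * (\<Prod>j\<in>UNIV. k' j (fst z $ j - snd z $ j)))"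
      using Kb[of "fst z" "snd z"] by (intro mult_left_mono) auto
    finally show "ennreal (cmod (LINT \<xi>|lborel. \<Psi> \<xi> z)) \<le> (\<Prod>j\<in>UNIV. ennreal (Ck j)) * (ennreal (cmod (H (fst z))) * ennreal (cmod (H (snd z))) * (\<Prod>j\<in>UNIV. k' j (fst z $ j - snd z $ j)))"
      by (simp add: mult_ac)
  qed
  also have "\<dots> = (\<Prod>j\<in>UNIV. ennreal (Ck j)) * (\<integral>\<^sup>+x. \<integral>\<^sup>+y. ennreal (cmod (H x)) * ennreal (cmod (H y)) * (\<Prod>j\<in>UNIV. k' j (x $ j - y $ j)) \<partial>lborel \<partial>lborel)"
    by (subst nn_integral_cmult, measurable, subst lborel.nn_integral_fst[symmetric]) auto
  also have "\<dots> \<le> (\<Prod>j\<in>UNIV. ennreal (Ck j)) * ((\<Prod>j\<in>UNIV. ennreal (C j)) * ennreal_powr (\<integral>\<^sup>+x. ennreal_powr (ennreal (cmod (H x))) p \<partial>lborel) (1 / p) *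
      ennreal_powr (\<integral>\<^sup>+x. ennreal_powr (ennreal (cmod (H x))) p \<partial>lborel) (1 / p))"
    by (intro mult_left_mono tensor_bilinear_bound_vec p k'b) auto
  finally show ?thesis unfolding m_def by (simp add: mult.assoc power2_eq_square ennreal_leI)
qed

text \<open>Fatou's lemma as \<open>\<eta>\<close> decreases to 0, the bound being independent of
  \<open>\<eta>\<close>.\<close>

lemma adjoint_transform_L2_limit:
  shows "(\<integral>\<^sup>+\<xi>. ennreal ((cmod (adjoint_transform a t H \<xi>))\<^sup>2 * (\<Prod>j\<in>UNIV. (1 + (\<xi> $ j)\<^sup>2) powr (- s j))) \<partial>lborel) \<le>
    (\<Prod>j\<in>UNIV. ennreal (Ck j)) * (\<Prod>j\<in>UNIV. ennreal (C j)) *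
    (ennreal_powr (\<integral>\<^sup>+x. ennreal_powr (ennreal (cmod (H x))) p \<partial>lborel) (1 / p))\<^sup>2" (is "_ \<le> ?R")
proof -
  note [measurable] = adjoint_transform_measurable
  define \<eta> where "\<eta> = (\<lambda>i::nat. 1 / (real i + 1))"
  have \<eta>: "\<eta> i > 0" "\<eta> i \<le> 1" for i by (auto simp: \<eta>_def)
  have \<eta>lim: "\<eta> \<longlonglongrightarrow> 0" unfolding \<eta>_def using LIMSEQ_inverse_real_of_nat by (simp add: inverse_eq_divide add.commute)
  have [measurable]: "(\<lambda>\<xi>. \<Prod>j\<in>UNIV. bessel_weight (s j) c (\<xi> $ j)) \<in> borel_measurable borel" for c by measurable
  have lim: "(\<lambda>i. ennreal ((cmod (adjoint_transform a t H \<xi>))\<^sup>2 * (\<Prod>j\<in>UNIV. bessel_weight (s j) (\<eta> i) (\<xi> $ j)))) \<longlonglongrightarrow>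
     ennreal ((cmod (adjoint_transform a t H \<xi>))\<^sup>2 * (\<Prod>j\<in>UNIV. (1 + (\<xi> $ j)\<^sup>2) powr (- s j)))" for \<xi>
  proof (intro tendsto_ennrealI tendsto_mult_left tendsto_prod)
    fix j
    have "(\<lambda>i. (1 + (\<xi> $ j)\<^sup>2) powr (- s j) / (1 + \<eta> i * (\<xi> $ j)\<^sup>2)) \<longlonglongrightarrow> (1 + (\<xi> $ j)\<^sup>2) powr (- s j) / (1 + 0 * (\<xi> $ j)\<^sup>2)"
      by (intro tendsto_intros \<eta>lim) auto
    then show "(\<lambda>i. bessel_weight (s j) (\<eta> i) (\<xi> $ j)) \<longlonglongrightarrow> (1 + (\<xi> $ j)\<^sup>2) powr (- s j)"
      by (simp add: bessel_weight_def)
  qed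
  have "(\<integral>\<^sup>+\<xi>. ennreal ((cmod (adjoint_transform a t H \<xi>))\<^sup>2 * (\<Prod>j\<in>UNIV. (1 + (\<xi> $ j)\<^sup>2) powr (- s j))) \<partial>lborel) =
    (\<integral>\<^sup>+\<xi>. liminf (\<lambda>i. ennreal ((cmod (adjoint_transform a t H \<xi>))\<^sup>2 * (\<Prod>j\<in>UNIV. bessel_weight (s j) (\<eta> i) (\<xi> $ j)))) \<partial>lborel)"
    by (intro nn_integral_cong lim_imp_Liminf[symmetric] lim) auto
  also have "\<dots> \<le> liminf (\<lambda>i. \<integral>\<^sup>+\<xi>. ennreal ((cmod (adjoint_transform a t H \<xi>))\<^sup>2 * (\<Prod>j\<in>UNIV. bessel_weight (s j) (\<eta> i) (\<xi> $ j))) \<partial>lborel)"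
    by (rule nn_integral_liminf) measurable
  also have "\<dots> \<le> liminf (\<lambda>i. ?R)"
    by (intro Liminf_mono always_eventually allI adjoint_transform_L2 \<eta>)
  also have "\<dots> = ?R" by (simp add: Liminf_const)
  finally show ?thesis .
qed

end

text \<open>Duality against the extremal function conj(G) |G|^(q-2). Its p-norm reproduces the
  q-norm of G, so the resulting inequality has the unknown integral on both sides. On a ball, where
  the bounded function G has a finite q-norm, one side can be divided out; Fatou's lemma then
  removes the ball.\<close>

lemma linearized_maximal_bound:
  fixes a :: "real ^ 'n::finite" and t :: "real ^ 'n \<Rightarrow> real ^ 'n" and F :: "real ^ 'n \<Rightarrow> complex"
    and s C Ck :: "'n \<Rightarrow> real" and k :: "'n \<Rightarrow> real \<Rightarrow> real" and q :: real
  assumes q: "q \<ge> 2"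
    and t [measurable]: "t \<in> borel_measurable borel" and t01: "\<And>x j. 0 < t x $ j \<and> t x $ j < 1"
    and s: "\<And>j. s j \<ge> 0"
    and k: "\<And>j. bilinear_bound (q / (q - 1)) (\<lambda>u. ennreal (k j u)) (C j)"
    and Ck: "\<And>j. Ck j > 0"
    and kernel: "\<And>j \<eta> u \<tau>. 0 < \<eta> \<Longrightarrow> \<eta> \<le> 1 \<Longrightarrow> u \<noteq> 0 \<Longrightarrow> \<bar>\<tau>\<bar> \<le> 1 \<Longrightarrow>
      cmod (osc_kernel (a $ j) (s j) \<eta> u \<tau>) \<le> Ck j * k j u"
    and F: "integrable lborel F"
  defines "G \<equiv> \<lambda>x. LINT \<xi>|lborel. iexp (osc_phase a (t x) x \<xi>) * F \<xi>"
  defines "D \<equiv> (\<Prod>j\<in>UNIV. ennreal (Ck j)) * (\<Prod>j\<in>UNIV. ennreal (C j))"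
  defines "A \<equiv> \<integral>\<^sup>+\<xi>. ennreal ((cmod (F \<xi>))\<^sup>2 * (\<Prod>j\<in>UNIV. (1 + (\<xi> $ j)\<^sup>2) powr s j)) \<partial>lborel"
  shows "(\<integral>\<^sup>+x. ennreal (cmod (G x) powr q) \<partial>lborel) \<le> ennreal_powr (D * A) (q / 2)"
proof -
  define p where "p = q / (q - 1)"
  have p: "p > 0" "(q - 1) * p = q" using q by (auto simp: p_def)
  have [measurable]: "F \<in> borel_measurable borel" using borel_measurable_integrable[OF F] by simp
  have [measurable]: "G \<in> borel_measurable borel" unfolding G_def by measurable
  define L where "L = (LINT \<xi>|lborel. cmod (F \<xi>))"
  have GL: "cmod (G x) \<le> L" for x
  proof -
    have "cmod (G x) \<le> (LINT \<xi>|lborel. cmod (iexp (osc_phase a (t x) x \<xi>) * F \<xi>))"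
      unfolding G_def by (rule integral_norm_bound)
    then show ?thesis by (simp add: norm_mult L_def)
  qed
  have ball: "(\<integral>\<^sup>+x. ennreal (indicator (cball 0 (real M)) x * cmod (G x) powr q) \<partial>lborel) \<le> ennreal_powr (D * A) (q / 2)" for M
  proof -
    define B :: "(real ^ 'n) set" where "B = cball 0 (real M)"
    have B [measurable]: "B \<in> sets borel" by (simp add: B_def)
    have intB: "integrable lborel (\<lambda>x. indicator B x :: real)"
      unfolding B_def using emeasure_lborel_cball_finite[of 0 "real M"] by (simp add: integrable_indicator_iff)
    \<comment> \<open>On the ball |H|^p = |G|^q and G H = |G|^q, the case of equality in Hoelder's
      inequality.\<close>
    define H where "H = (\<lambda>x. complex_of_real (indicator B x) * (cnj (G x) * complex_of_real (cmod (G x) powr (q - 2))))"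
    have HM [measurable]: "H \<in> borel_measurable borel" unfolding H_def by measurable
    have nH: "cmod (H x) = indicator B x * cmod (G x) powr (q - 1)" for x
    proof (cases "G x = 0")
      case False
      then have "cmod (G x) * cmod (G x) powr (q - 2) = cmod (G x) powr 1 * cmod (G x) powr (q - 2)" by simp
      also have "\<dots> = cmod (G x) powr (q - 1)" unfolding powr_add[symmetric] by simp
      finally show ?thesis by (simp add: H_def norm_mult)
    qed (simp add: H_def)
    have GH: "G x * H x = complex_of_real (indicator B x * cmod (G x) powr q)" for x
    proof (cases "G x = 0")
      case False
      have "G x * H x = complex_of_real (indicator B x) * (G x * cnj (G x)) * complex_of_real (cmod (G x) powr (q - 2))"
        by (simp add: H_def mult_ac)
      also have "G x * cnj (G x) = complex_of_real (cmod (G x) powr 2)"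
        using False by (simp add: complex_norm_square[symmetric] powr_numeral)
      also have "complex_of_real (indicator B x) * complex_of_real (cmod (G x) powr 2) * complex_of_real (cmod (G x) powr (q - 2)) =
         complex_of_real (indicator B x * (cmod (G x) powr 2 * cmod (G x) powr (q - 2)))" by simp
      also have "cmod (G x) powr 2 * cmod (G x) powr (q - 2) = cmod (G x) powr q" unfolding powr_add[symmetric] by simp
      finally show ?thesis .
    qed (simp add: H_def)
    have H: "integrable lborel H"
    proof (rule Bochner_Integration.integrable_bound[OF integrable_mult_left[OF intB, of "L powr (q - 1)"]])
      show "AE x in lborel. norm (H x) \<le> norm (indicator B x * L powr (q - 1))"
        unfolding nH using GL q by (intro AE_I2) (auto split: split_indicator intro!: powr_mono2)
    qed measurable
    have intGq: "integrable lborel (\<lambda>x. indicator B x * cmod (G x) powr q)"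
    proof (rule Bochner_Integration.integrable_bound[OF integrable_mult_left[OF intB, of "L powr q"]])
      show "AE x in lborel. norm (indicator B x * cmod (G x) powr q) \<le> norm (indicator B x * L powr q)"
        using GL q by (intro AE_I2) (auto split: split_indicator intro!: powr_mono2)
    qed measurable
    define T where "T = adjoint_transform a t H"
    have TM [measurable]: "T \<in> borel_measurable borel"
      unfolding T_def by (rule adjoint_transform_measurable[OF t t01 H s p(1) k[folded p_def] Ck kernel])
    have T2: "(\<integral>\<^sup>+\<xi>. ennreal ((cmod (T \<xi>))\<^sup>2 * (\<Prod>j\<in>UNIV. (1 + (\<xi> $ j)\<^sup>2) powr (- s j))) \<partial>lborel) \<le>
       D * (ennreal_powr (\<integral>\<^sup>+x. ennreal_powr (ennreal (cmod (H x))) p \<partial>lborel) (1 / p))\<^sup>2"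
      unfolding T_def D_def
      by (rule adjoint_transform_L2_limit[OF t t01 H s p(1) k[folded p_def] Ck kernel])
    define I where "I = (LINT x|lborel. indicator B x * cmod (G x) powr q)"
    have I0: "I \<ge> 0" unfolding I_def by (intro Bochner_Integration.integral_nonneg) auto
    have nnI: "(\<integral>\<^sup>+x. ennreal (indicator B x * cmod (G x) powr q) \<partial>lborel) = ennreal I"
      unfolding I_def by (rule nn_integral_eq_integral[OF intGq]) auto
    have J: "(\<integral>\<^sup>+x. ennreal_powr (ennreal (cmod (H x))) p \<partial>lborel) = ennreal I"
      unfolding nnI[symmetric]
    proof (intro nn_integral_cong)
      fix x
      have "(indicator B x * cmod (G x) powr (q - 1)) powr p = indicator B x * cmod (G x) powr q"
        using p by (auto split: split_indicator simp: powr_powr)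
      then show "ennreal_powr (ennreal (cmod (H x))) p = ennreal (indicator B x * cmod (G x) powr q)"
        unfolding nH by (subst ennreal_powr_ennreal) auto
    qed
    define E where "E = (\<lambda>x \<xi>. iexp (osc_phase a (t x) x \<xi>))"
    have E1: "cmod (E x \<xi>) = 1" for x \<xi> by (simp add: E_def)
    have "complex_of_real I = (LINT x|lborel. G x * H x)"
      unfolding GH I_def by (rule integral_complex_of_real[symmetric])
    also have "\<dots> = (LINT x|lborel. LINT \<xi>|lborel. E x \<xi> * F \<xi> * H x)"
      unfolding G_def E_def by simp
    also have "\<dots> = (LINT \<xi>|lborel. LINT x|lborel. E x \<xi> * F \<xi> * H x)"
    proof (rule lborel_pair.Fubini_integral[symmetric])
      show "integrable (lborel \<Otimes>\<^sub>M lborel) (\<lambda>(x, \<xi>). E x \<xi> * F \<xi> * H x)"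
      proof (rule integrableI_bounded)
        show "(\<lambda>(x, \<xi>). E x \<xi> * F \<xi> * H x) \<in> borel_measurable (lborel \<Otimes>\<^sub>M lborel)"
          unfolding E_def by measurable
        then have "(\<integral>\<^sup>+w. ennreal (norm (case w of (x, \<xi>) \<Rightarrow> E x \<xi> * F \<xi> * H x)) \<partial>(lborel \<Otimes>\<^sub>M lborel)) =
          (\<integral>\<^sup>+x. \<integral>\<^sup>+\<xi>. ennreal (cmod (F \<xi>)) * ennreal (cmod (H x)) \<partial>lborel \<partial>lborel)"
          by (subst lborel.nn_integral_fst[symmetric]) (auto simp: norm_mult ennreal_mult E1)
        also have "\<dots> = (\<integral>\<^sup>+\<xi>. ennreal (cmod (F \<xi>)) \<partial>lborel) * (\<integral>\<^sup>+x. ennreal (cmod (H x)) \<partial>lborel)"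
          by (simp add: nn_integral_cmult nn_integral_multc)
        also have "\<dots> < \<infinity>" using F H by (simp add: integrable_iff_bounded ennreal_mult_less_top)
        finally show "(\<integral>\<^sup>+w. ennreal (norm (case w of (x, \<xi>) \<Rightarrow> E x \<xi> * F \<xi> * H x)) \<partial>(lborel \<Otimes>\<^sub>M lborel)) < \<infinity>" .
      qed
    qed
    also have "\<dots> = (LINT \<xi>|lborel. F \<xi> * T \<xi>)"
    proof (intro Bochner_Integration.integral_cong refl)
      fix \<xi>
      have "(LINT x|lborel. E x \<xi> * F \<xi> * H x) = (LINT x|lborel. F \<xi> * (E x \<xi> * H x))"
        by (intro Bochner_Integration.integral_cong refl) (simp add: mult_ac)
      then show "(LINT x|lborel. E x \<xi> * F \<xi> * H x) = F \<xi> * T \<xi>"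
        by (simp add: T_def E_def adjoint_transform_def)
    qed
    finally have IFT: "complex_of_real I = (LINT \<xi>|lborel. F \<xi> * T \<xi>)" .
    define W where "W = (\<lambda>\<xi> :: real ^ 'n. \<Prod>j\<in>UNIV. (1 + (\<xi> $ j)\<^sup>2) powr s j)"
    define V where "V = (\<lambda>\<xi> :: real ^ 'n. \<Prod>j\<in>UNIV. (1 + (\<xi> $ j)\<^sup>2) powr (- s j))"
    have [measurable]: "W \<in> borel_measurable borel" "V \<in> borel_measurable borel" unfolding W_def V_def by measurable
    have WV: "W \<xi> * V \<xi> = 1" "W \<xi> \<ge> 0" "V \<xi> \<ge> 0" for \<xi>
    proof -
      have "(1 + y\<^sup>2) powr e * (1 + y\<^sup>2) powr (- e) = 1" for y e :: real
        unfolding powr_add[symmetric] using one_plus_sq_pos[of y] by simp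
      then show "W \<xi> * V \<xi> = 1" unfolding W_def V_def prod.distrib[symmetric] by simp
    qed (auto simp: W_def V_def intro: prod_nonneg)
    have "ennreal I = ennreal (cmod (complex_of_real I))" using I0 by simp
    \<comment> \<open>If the product is not integrable, its Bochner integral is 0 and the inequality
      is trivial.\<close>
    also have "\<dots> \<le> (\<integral>\<^sup>+\<xi>. ennreal (cmod (F \<xi> * T \<xi>)) \<partial>lborel)"
      unfolding IFT by (cases "integrable lborel (\<lambda>\<xi>. F \<xi> * T \<xi>)")
        (simp_all add: integral_norm_bound_ennreal not_integrable_integral_eq)
    \<comment> \<open>The weight is distributed so that F receives the square root of
      \<open>W\<close> and T that of its inverse \<open>V\<close>, the weight in the bound for the
      transpose.\<close>
    also have "\<dots> = (\<integral>\<^sup>+\<xi>. ennreal (cmod (F \<xi>) * sqrt (W \<xi>)) * ennreal (cmod (T \<xi>) * sqrt (V \<xi>)) \<partial>lborel)"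
    proof (intro nn_integral_cong)
      fix \<xi>
      have "cmod (F \<xi> * T \<xi>) = (cmod (F \<xi>) * sqrt (W \<xi>)) * (cmod (T \<xi>) * sqrt (V \<xi>))"
      proof -
        have "sqrt (W \<xi>) * sqrt (V \<xi>) = 1" using WV by (simp add: real_sqrt_mult[symmetric])
        moreover have "(cmod (F \<xi>) * sqrt (W \<xi>)) * (cmod (T \<xi>) * sqrt (V \<xi>)) = cmod (F \<xi>) * cmod (T \<xi>) * (sqrt (W \<xi>) * sqrt (V \<xi>))"
          by (simp only: mult_ac)
        ultimately show ?thesis by (simp add: norm_mult)
      qed
      then show "ennreal (cmod (F \<xi> * T \<xi>)) = ennreal (cmod (F \<xi>) * sqrt (W \<xi>)) * ennreal (cmod (T \<xi>) * sqrt (V \<xi>))"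
        using WV by (simp add: ennreal_mult)
    qed
    finally have "(ennreal I)\<^sup>2 \<le> (\<integral>\<^sup>+\<xi>. ennreal (cmod (F \<xi>) * sqrt (W \<xi>)) * ennreal (cmod (T \<xi>) * sqrt (V \<xi>)) \<partial>lborel)\<^sup>2"
      by (intro power_mono) auto
    also have "\<dots> \<le> (\<integral>\<^sup>+\<xi>. (ennreal (cmod (F \<xi>) * sqrt (W \<xi>)))\<^sup>2 \<partial>lborel) * (\<integral>\<^sup>+\<xi>. (ennreal (cmod (T \<xi>) * sqrt (V \<xi>)))\<^sup>2 \<partial>lborel)"
      by (rule Cauchy_Schwarz_nn_integral) measurable
    also have "(\<integral>\<^sup>+\<xi>. (ennreal (cmod (F \<xi>) * sqrt (W \<xi>)))\<^sup>2 \<partial>lborel) = (\<integral>\<^sup>+\<xi>. ennreal ((cmod (F \<xi>))\<^sup>2 * W \<xi>) \<partial>lborel)"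
      using WV by (intro nn_integral_cong) (simp add: ennreal_power power_mult_distrib)
    also have "\<dots> = A" by (simp add: A_def W_def)
    also have "(\<integral>\<^sup>+\<xi>. (ennreal (cmod (T \<xi>) * sqrt (V \<xi>)))\<^sup>2 \<partial>lborel) = (\<integral>\<^sup>+\<xi>. ennreal ((cmod (T \<xi>))\<^sup>2 * V \<xi>) \<partial>lborel)"
      using WV by (intro nn_integral_cong) (simp add: ennreal_power power_mult_distrib)
    also have "A * \<dots> \<le> A * (D * (ennreal_powr (ennreal I) (1 / p))\<^sup>2)"
      using T2 unfolding V_def J by (intro mult_left_mono) auto
    \<comment> \<open>Since 2 - 2/p = 2/q, cancelling I^(2/p) from this inequality leaves I^(2/q)
      \<le> D A.\<close>
    finally have main: "(ennreal I)\<^sup>2 \<le> D * A * (ennreal_powr (ennreal I) (1 / p))\<^sup>2" by (simp add: mult_ac)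
    have "ennreal I \<le> ennreal_powr (D * A) (q / 2)"
    proof (cases "D * A" rule: ennreal_cases)
      case top then show ?thesis by simp
    next
      case (real y)
      have "I\<^sup>2 \<le> y * (I powr (1 / p))\<^sup>2"
        using main I0 real by (simp add: ennreal_power ennreal_mult[symmetric])
      show ?thesis
      proof (cases "I = 0")
        case False
        then have Ip: "I > 0" using I0 by simp
        have "I powr (2 / q) * (I powr (1 / p))\<^sup>2 = I\<^sup>2"
        proof -
          have "(I powr (1 / p))\<^sup>2 = I powr (1 / p) * I powr (1 / p)" by (simp add: power2_eq_square)
          then have "I powr (2 / q) * (I powr (1 / p))\<^sup>2 = I powr (2 / q + (1 / p + 1 / p))" by (simp only: powr_add)
          also have "2 / q + (1 / p + 1 / p) = 2" using q by (simp add: p_def field_simps)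
          also have "I powr 2 = I\<^sup>2" using Ip by (simp add: powr_numeral)
          finally show ?thesis .
        qed
        then have "I powr (2 / q) * (I powr (1 / p))\<^sup>2 \<le> y * (I powr (1 / p))\<^sup>2" using \<open>I\<^sup>2 \<le> y * (I powr (1 / p))\<^sup>2\<close> by simp
        then have "I powr (2 / q) \<le> y" using Ip by simp
        then have "(I powr (2 / q)) powr (q / 2) \<le> y powr (q / 2)" using q by (intro powr_mono2) auto
        then have "I \<le> y powr (q / 2)" using q Ip by (simp add: powr_powr)
        then show ?thesis using real by (simp add: ennreal_leI)
      qed simp
    qed
    then show ?thesis unfolding nnI[symmetric] B_def .
  qed
  have "(\<integral>\<^sup>+x. ennreal (cmod (G x) powr q) \<partial>lborel) =
      (\<integral>\<^sup>+x. liminf (\<lambda>M. ennreal (indicator (cball 0 (real M)) x * cmod (G x) powr q)) \<partial>lborel)"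
  proof (intro nn_integral_cong lim_imp_Liminf[symmetric])
    fix x :: "real ^ 'n"
    have "eventually (\<lambda>M. norm x \<le> real M) sequentially" by (rule eventually_sequentiallyI[of "nat \<lceil>norm x\<rceil>"]) linarith
    then have "eventually (\<lambda>M. ennreal (indicator (cball 0 (real M)) x * cmod (G x) powr q) = ennreal (cmod (G x) powr q)) sequentially"
      by eventually_elim simp
    then show "(\<lambda>M. ennreal (indicator (cball 0 (real M)) x * cmod (G x) powr q)) \<longlonglongrightarrow> ennreal (cmod (G x) powr q)"
      by (rule tendsto_eventually)
  qed simp
  also have "\<dots> \<le> liminf (\<lambda>M. \<integral>\<^sup>+x. ennreal (indicator (cball 0 (real M)) x * cmod (G x) powr q) \<partial>lborel)"
  proof (rule nn_integral_liminf)
    fix M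
    have [measurable]: "cball 0 (real M) \<in> sets (borel :: (real ^ 'n) measure)" by simp
    have "(\<lambda>x. ennreal (indicator (cball 0 (real M)) x * cmod (G x) powr q)) \<in> borel_measurable borel" by measurable
    then show "(\<lambda>x. ennreal (indicator (cball 0 (real M)) x * cmod (G x) powr q)) \<in> borel_measurable lborel" by simp
  qed
  also have "\<dots> \<le> liminf (\<lambda>M::nat. ennreal_powr (D * A) (q / 2))"
    by (intro Liminf_mono always_eventually allI ball)
  finally show ?thesis by (simp add: Liminf_const)
qed

section \<open>Measurability and the choice of times\<close>

lemma S_op_continuous:
  fixes a :: "real ^ 'n::finite"
  assumes "integrable lborel (fourier f)"
  shows "continuous_on UNIV (\<lambda>t. S_op a t f x)"
proof (rule continuous_at_imp_continuous_on, rule ballI)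
  fix t :: "real ^ 'n"
  have [measurable]: "fourier f \<in> borel_measurable borel" using borel_measurable_integrable[OF assms] by simp
  have "(\<lambda>i. S_op a (u i) f x) \<longlonglongrightarrow> S_op a t f x" if u: "u \<longlonglongrightarrow> t" for u :: "nat \<Rightarrow> real ^ 'n"
    unfolding S_op_eq
  proof (rule integral_dominated_convergence[where w="\<lambda>\<xi>. cmod (fourier f \<xi>)"])
    show "AE \<xi> in lborel. (\<lambda>i. iexp (osc_phase a (u i) x \<xi>) * fourier f \<xi>) \<longlonglongrightarrow>
        iexp (osc_phase a t x \<xi>) * fourier f \<xi>"
    proof (rule AE_I2)
      fix \<xi>
      have "(\<lambda>i. osc_phase a (u i) x \<xi>) \<longlonglongrightarrow> osc_phase a t x \<xi>"
        unfolding osc_phase_def by (rule tendsto_sum, rule tendsto_add[OF tendsto_const], rule tendsto_mult[OF tendsto_vec_nth[OF u] tendsto_const])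
      then show "(\<lambda>i. iexp (osc_phase a (u i) x \<xi>) * fourier f \<xi>) \<longlonglongrightarrow>
        iexp (osc_phase a t x \<xi>) * fourier f \<xi>"
        by (intro tendsto_mult_right tendsto_exp tendsto_mult_left tendsto_of_real)
    qed
    show "integrable lborel (\<lambda>\<xi>. cmod (fourier f \<xi>))" using assms by (rule integrable_norm)
  qed (simp_all add: norm_mult)
  then show "isCont (\<lambda>t. S_op a t f x) t"
    unfolding continuous_at_sequentially o_def by blast
qed

text \<open>Continuity in the time variable lets a dense sequence replace the open cube. This makes
  the maximal function measurable and reduces the choice of a nearly optimal time to finitely many
  candidates at each stage.\<close>

lemma maximal_op_countable:
  fixes a :: "real ^ 'n::finite"
  assumes "integrable lborel (fourier f)"
  shows "\<exists>\<tau> :: nat \<Rightarrow> real ^ 'n. (\<forall>i j. 0 < \<tau> i $ j \<and> \<tau> i $ j < 1) \<and>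
    (\<forall>x. maximal_op a f x = (SUP i. ennreal (cmod (S_op a (\<tau> i) f x))))"
proof -
  define U :: "(real ^ 'n) set" where "U = {t. \<forall>i. 0 < t $ i \<and> t $ i < 1}"
  have U: "open U"
  proof -
    have "U = box (\<chi> i. 0) (\<chi> i. 1)" by (auto simp: U_def mem_box_cart)
    then show ?thesis by (simp only: open_box)
  qed
  have ne: "(\<chi> i. 1/2) \<in> U" by (simp add: U_def)
  obtain D :: "(real ^ 'n) set" where D: "countable D" "\<And>X. open X \<Longrightarrow> X \<noteq> {} \<Longrightarrow> \<exists>d\<in>D. d \<in> X"
    by (rule countable_dense_setE) (rule that)
  have DU: "D \<inter> U \<noteq> {}" "countable (D \<inter> U)" using D(2)[OF U] ne D(1) by auto
  define \<tau> where "\<tau> = from_nat_into (D \<inter> U)"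
  have range: "range \<tau> = D \<inter> U" unfolding \<tau>_def by (rule range_from_nat_into[OF DU])
  have \<tau>U: "\<tau> i \<in> U" for i using range by auto
  have "maximal_op a f x = (SUP i. ennreal (cmod (S_op a (\<tau> i) f x)))" for x
    unfolding maximal_op_def U_def[symmetric]
  proof (rule antisym)
    show "(SUP t\<in>U. ennreal (cmod (S_op a t f x))) \<le> (SUP i. ennreal (cmod (S_op a (\<tau> i) f x)))"
    proof (rule SUP_least)
      fix t assume t: "t \<in> U"
      show "ennreal (cmod (S_op a t f x)) \<le> (SUP i. ennreal (cmod (S_op a (\<tau> i) f x)))"
      proof (rule ennreal_le_epsilon)
        fix e :: real assume e: "e > 0"
        define X where "X = U \<inter> {t'. cmod (S_op a t' f x) > cmod (S_op a t f x) - e}"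
        have "open {t'. cmod (S_op a t' f x) > cmod (S_op a t f x) - e}"
          by (intro open_Collect_less continuous_intros S_op_continuous[OF assms])
        then have "open X" unfolding X_def using U by auto
        moreover have "t \<in> X" using t e by (simp add: X_def)
        ultimately obtain d where "d \<in> D" "d \<in> X" using D(2) by blast
        then obtain i where i: "d = \<tau> i" using range by (auto simp: X_def)
        have "ennreal (cmod (S_op a t f x)) \<le> ennreal (cmod (S_op a (\<tau> i) f x) + e)"
          using \<open>d \<in> X\<close> i by (intro ennreal_leI) (auto simp: X_def)
        also have "\<dots> = ennreal (cmod (S_op a (\<tau> i) f x)) + ennreal e" using e by simp
        also have "\<dots> \<le> (SUP i. ennreal (cmod (S_op a (\<tau> i) f x))) + ennreal e"
          by (intro add_right_mono SUP_upper) auto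
        finally show "ennreal (cmod (S_op a t f x)) \<le> (SUP i. ennreal (cmod (S_op a (\<tau> i) f x))) + ennreal e" .
      qed
    qed
    show "(SUP i. ennreal (cmod (S_op a (\<tau> i) f x))) \<le> (SUP t\<in>U. ennreal (cmod (S_op a t f x)))"
      by (intro SUP_least SUP_upper \<tau>U)
  qed
  then show ?thesis using \<tau>U by (intro exI[of _ \<tau>]) (auto simp: U_def)
qed

lemma S_op_measurable [measurable]:
  assumes "fourier f \<in> borel_measurable borel" "t \<in> borel_measurable borel"
  shows "(\<lambda>x. S_op a (t x) f x) \<in> borel_measurable borel"
proof -
  note [measurable] = assms
  show ?thesis unfolding S_op_eq by measurable
qed

lemma maximal_op_measurable:
  assumes "schwartz f"
  shows "maximal_op a f \<in> borel_measurable borel"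
proof -
  have int: "integrable lborel (fourier f)" by (rule fourier_integrable[OF assms])
  have M: "fourier f \<in> borel_measurable borel" using borel_measurable_integrable[OF int] by simp
  obtain \<tau> where "\<And>x. maximal_op a f x = (SUP i::nat. ennreal (cmod (S_op a (\<tau> i) f x)))"
    using maximal_op_countable[OF int] by metis
  then have "maximal_op a f = (\<lambda>x. SUP i::nat. ennreal (cmod (S_op a (\<tau> i) f x)))" by auto
  also have "\<dots> \<in> borel_measurable borel"
    using S_op_measurable[OF M, of "\<lambda>_. \<tau> _"] by (intro borel_measurable_SUP) auto
  finally show ?thesis .
qed

lemma ennreal_powr_SUP_le:
  assumes "p > 0" "\<And>i. ennreal_powr (g i) p \<le> S"
  shows "ennreal_powr (SUP i. g i) p \<le> S"
proof -
  have "(SUP i. g i) \<le> ennreal_powr S (1 / p)"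
  proof (rule SUP_least)
    fix i
    have "g i = ennreal_powr (ennreal_powr (g i) p) (1 / p)" using assms(1) by (simp add: ennreal_powr_powr)
    also have "\<dots> \<le> ennreal_powr S (1 / p)" using assms by (intro ennreal_powr_mono) auto
    finally show "g i \<le> ennreal_powr S (1 / p)" .
  qed
  then have "ennreal_powr (SUP i. g i) p \<le> ennreal_powr (ennreal_powr S (1 / p)) p" using assms by (intro ennreal_powr_mono) auto
  then show ?thesis using assms(1) by (simp add: ennreal_powr_powr)
qed

text \<open>At stage i the best of the first i + 1 times of a dense sequence is a measurable
  function of x, and the linearised bound does not depend on i. The corresponding values increase to
  the maximal function, so monotone convergence concludes.\<close>

lemma maximal_estimate_of_kernel_bounds:
  fixes a :: "real ^ 'n::finite" and s C Ck :: "'n \<Rightarrow> real" and k :: "'n \<Rightarrow> real \<Rightarrow> real" and q :: real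
  assumes q: "q \<ge> 2"
    and s: "\<And>j. s j \<ge> 0"
    and k: "\<And>j. bilinear_bound (q / (q - 1)) (\<lambda>u. ennreal (k j u)) (C j)"
    and Ck: "\<And>j. Ck j > 0"
    and kernel: "\<And>j \<eta> u \<tau>. 0 < \<eta> \<Longrightarrow> \<eta> \<le> 1 \<Longrightarrow> u \<noteq> 0 \<Longrightarrow> \<bar>\<tau>\<bar> \<le> 1 \<Longrightarrow>
      cmod (osc_kernel (a $ j) (s j) \<eta> u \<tau>) \<le> Ck j * k j u"
  shows "maximal_estimate a (ennreal q) (\<Sum>j\<in>UNIV. s j)"
  unfolding maximal_estimate_def
proof (intro exI allI impI)
  fix f :: "real ^ 'n \<Rightarrow> complex"
  assume f: "schwartz f"
  have C: "C j > 0" for j using k[of j] by (simp add: bilinear_bound_def)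
  define d where "d = (\<Prod>j\<in>UNIV. Ck j) * (\<Prod>j\<in>UNIV. C j)"
  have d: "d \<ge> 0" unfolding d_def using C Ck by (intro mult_nonneg_nonneg prod_nonneg) (auto simp: less_imp_le)
  define S where "S = sobolev_norm (\<Sum>j\<in>UNIV. s j) f"
  have S: "S \<ge> 0" "S\<^sup>2 = (LINT \<xi>|lborel. (1 + (norm \<xi>)\<^sup>2) powr (\<Sum>j\<in>UNIV. s j) * (cmod (fourier f \<xi>))\<^sup>2)"
    unfolding S_def sobolev_norm_def by (auto intro!: Bochner_Integration.integral_nonneg)
  have int: "integrable lborel (fourier f)" by (rule fourier_integrable[OF f])
  have FM [measurable]: "fourier f \<in> borel_measurable borel" using borel_measurable_integrable[OF int] by simp
  define A where "A = (\<integral>\<^sup>+\<xi>. ennreal ((cmod (fourier f \<xi>))\<^sup>2 * (\<Prod>j\<in>UNIV. (1 + (\<xi> $ j)\<^sup>2) powr s j)) \<partial>lborel)"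
  \<comment> \<open>The product weight is exchanged for the isotropic one at no cost in the
    constant.\<close>
  have "A \<le> (\<integral>\<^sup>+\<xi>. ennreal ((1 + (norm \<xi>)\<^sup>2) powr (\<Sum>j\<in>UNIV. s j) * (cmod (fourier f \<xi>))\<^sup>2) \<partial>lborel)"
    unfolding A_def using s
    by (intro nn_integral_mono ennreal_leI) (subst mult.commute, intro mult_right_mono one_plus_norm_sq_ge_prod, auto)
  also have "\<dots> = ennreal (S\<^sup>2)" unfolding S(2) by (intro nn_integral_eq_integral sobolev_integrable f) auto
  finally have A: "A \<le> ennreal (S\<^sup>2)" .
  define D where "D = (\<Prod>j\<in>UNIV. ennreal (Ck j)) * (\<Prod>j\<in>UNIV. ennreal (C j))"
  have D: "D = ennreal d" unfolding D_def d_def using C Ck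
    by (subst (1 2) prod_ennreal) (auto simp: less_imp_le ennreal_mult[symmetric] intro!: prod_nonneg ennreal_mult[symmetric])
  obtain \<tau> :: "nat \<Rightarrow> real ^ 'n" where \<tau>': "(\<forall>i j. 0 < \<tau> i $ j \<and> \<tau> i $ j < 1) \<and>
    (\<forall>x. maximal_op a f x = (SUP i. ennreal (cmod (S_op a (\<tau> i) f x))))"
    using maximal_op_countable[OF int, of a] by (rule exE)
  have \<tau>: "\<And>i j. 0 < \<tau> i $ j \<and> \<tau> i $ j < 1"
    "\<And>x. maximal_op a f x = (SUP i. ennreal (cmod (S_op a (\<tau> i) f x)))"
    using \<tau>' by auto
  \<comment> \<open>A running maximiser, replaced only on strict improvement, so that each stage is
    a case distinction along a measurable set.\<close>
  define t where "t = rec_nat (\<lambda>x. \<tau> 0) (\<lambda>i t x. if cmod (S_op a (\<tau> (Suc i)) f x) > cmod (S_op a (t x) f x) then \<tau> (Suc i) else t x)"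
  have t0: "t 0 = (\<lambda>x. \<tau> 0)" and tS: "t (Suc i) = (\<lambda>x. if cmod (S_op a (\<tau> (Suc i)) f x) > cmod (S_op a (t i x) f x) then \<tau> (Suc i) else t i x)" for i
    unfolding t_def by simp_all
  have tM: "t i \<in> borel_measurable borel" for i
  proof (induction i)
    case (Suc i)
    note [measurable] = Suc S_op_measurable[OF FM Suc, of a] S_op_measurable[OF FM, of "\<lambda>_. \<tau> (Suc i)" a]
    show ?case unfolding tS by measurable
  qed (simp add: t0)
  have t01: "0 < t i x $ j \<and> t i x $ j < 1" for i x j
    by (induction i) (use \<tau>(1) in \<open>auto simp: t0 tS\<close>)
  have tmono: "incseq (\<lambda>i. cmod (S_op a (t i x) f x))" for x
    by (rule incseq_SucI) (simp add: tS)
  have tge: "cmod (S_op a (\<tau> i) f x) \<le> cmod (S_op a (t i x) f x)" for i x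
    by (cases i) (auto simp: t0 tS)
  have lin: "(\<integral>\<^sup>+x. ennreal (cmod (S_op a (t i x) f x) powr q) \<partial>lborel) \<le> ennreal_powr (D * A) (q / 2)" for i
    unfolding S_op_eq D_def A_def
    by (rule linearized_maximal_bound[OF q tM _ s k Ck kernel int]) (use t01 in auto)
  have "(\<integral>\<^sup>+x. ennreal_powr (maximal_op a f x) q \<partial>lborel) \<le> (\<integral>\<^sup>+x. (SUP i. ennreal (cmod (S_op a (t i x) f x) powr q)) \<partial>lborel)"
  proof (intro nn_integral_mono)
    fix x
    show "ennreal_powr (maximal_op a f x) q \<le> (SUP i. ennreal (cmod (S_op a (t i x) f x) powr q))"
      unfolding \<tau>(2)
    proof (rule ennreal_powr_SUP_le)
      fix i
      have "ennreal_powr (ennreal (cmod (S_op a (\<tau> i) f x))) q \<le> ennreal (cmod (S_op a (t i x) f x) powr q)"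
        using tge[of i x] q by (auto intro!: ennreal_leI powr_mono2)
      also have "\<dots> \<le> (SUP i. ennreal (cmod (S_op a (t i x) f x) powr q))" by (rule SUP_upper) simp
      finally show "ennreal_powr (ennreal (cmod (S_op a (\<tau> i) f x))) q \<le> (SUP i. ennreal (cmod (S_op a (t i x) f x) powr q))" .
    qed (use q in simp)
  qed
  also have "\<dots> = (SUP i. \<integral>\<^sup>+x. ennreal (cmod (S_op a (t i x) f x) powr q) \<partial>lborel)"
  proof (rule nn_integral_monotone_convergence_SUP)
    show "incseq (\<lambda>i x. ennreal (cmod (S_op a (t i x) f x) powr q))"
      using tmono q unfolding incseq_def le_fun_def by (auto intro!: ennreal_leI powr_mono2)
    show "(\<lambda>x. ennreal (cmod (S_op a (t i x) f x) powr q)) \<in> borel_measurable lborel" for i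
      using S_op_measurable[OF FM tM, of a i] by measurable
  qed
  also have "\<dots> \<le> ennreal_powr (D * A) (q / 2)" by (intro SUP_least lin)
  finally have "ennreal_powr (\<integral>\<^sup>+x. ennreal_powr (maximal_op a f x) q \<partial>lborel) (1 / q) \<le> ennreal_powr (ennreal_powr (D * A) (q / 2)) (1 / q)"
    using q by (intro ennreal_powr_mono) auto
  also have "\<dots> = ennreal_powr (D * A) (1 / 2)" using q by (simp add: ennreal_powr_powr)
  also have "\<dots> \<le> ennreal_powr (ennreal (d * S\<^sup>2)) (1 / 2)"
    using A d unfolding D by (intro ennreal_powr_mono) (auto simp: ennreal_mult intro: mult_left_mono)
  also have "\<dots> = ennreal (sqrt d * S)"
    using d S(1) by (simp add: powr_half_sqrt real_sqrt_mult)
  finally show "Lq_norm (ennreal q) (maximal_op a f) \<le> ennreal (sqrt ((\<Prod>j\<in>UNIV. Ck j) * (\<Prod>j\<in>UNIV. C j)) * sobolev_norm (\<Sum>j\<in>UNIV. s j) f)"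
    using q by (simp add: Lq_norm_def d_def S_def)
qed

section \<open>Sufficiency in the ranges of q\<close>

lemma maximal_estimate_pos_ge_4:
  fixes a :: "real ^ 'n::finite"
  assumes "\<And>j. a $ j > 1" "q \<ge> 4"
  shows "maximal_estimate a (ennreal q) (real CARD('n) * (1 / 2 - 1 / q))"
proof -
  obtain C where C: "bilinear_bound (q / (q - 1)) (\<lambda>u. ennreal (\<bar>u\<bar> powr (-(2/q)))) C"
    using bilinear_bound_Riesz[of q] assms(2) by auto
  have "\<forall>j. \<exists>C>0. \<forall>\<eta> u \<tau>. 0 < \<eta> \<longrightarrow> \<eta> \<le> 1 \<longrightarrow> u \<noteq> 0 \<longrightarrow> \<bar>\<tau>\<bar> \<le> 1 \<longrightarrow>
    cmod (osc_kernel (a $ j) (1/2 - 1/q) \<eta> u \<tau>) \<le> C * \<bar>u\<bar> powr (-(2/q))"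
    using osc_kernel_bound_ge_4[OF assms] by blast
  then obtain Ck where Ck: "\<And>j. Ck j > 0" "\<And>j \<eta> u \<tau>. 0 < \<eta> \<Longrightarrow> \<eta> \<le> 1 \<Longrightarrow> u \<noteq> 0 \<Longrightarrow> \<bar>\<tau>\<bar> \<le> 1 \<Longrightarrow>
    cmod (osc_kernel (a $ j) (1/2 - 1/q) \<eta> u \<tau>) \<le> Ck j * \<bar>u\<bar> powr (-(2/q))" by metis
  have "1/2 - 1/q \<ge> 0" using assms(2) by (simp add: field_simps)
  then have "maximal_estimate a (ennreal q) (\<Sum>j\<in>(UNIV::'n set). 1/2 - 1/q)"
    using assms(2) by (intro maximal_estimate_of_kernel_bounds[OF _ _ C Ck]) simp_all
  then show ?thesis by simp
qed

lemma maximal_estimate_pos_between: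
  fixes a :: "real ^ 'n::finite"
  assumes "\<And>j. a $ j > 1" "2 < q" "q < 4"
  shows "maximal_estimate a (ennreal q) (\<Sum>j\<in>UNIV. 1/2 - a $ j/4 + (a $ j - 1)/q)"
proof -
  obtain C where C: "bilinear_bound (q / (q - 1)) (\<lambda>u. ennreal (\<bar>u\<bar> powr (-(2/q)))) C"
    using bilinear_bound_Riesz[of q] assms(2) by auto
  have "\<forall>j. \<exists>C>0. \<forall>\<eta> u \<tau>. 0 < \<eta> \<longrightarrow> \<eta> \<le> 1 \<longrightarrow> u \<noteq> 0 \<longrightarrow> \<bar>\<tau>\<bar> \<le> 1 \<longrightarrow>
    cmod (osc_kernel (a $ j) (1/2 - a $ j/4 + (a $ j - 1)/q) \<eta> u \<tau>) \<le> C * \<bar>u\<bar> powr (-(2/q))"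
    using osc_kernel_bound_between[OF assms] by blast
  then obtain Ck where Ck: "\<And>j. Ck j > 0" "\<And>j \<eta> u \<tau>. 0 < \<eta> \<Longrightarrow> \<eta> \<le> 1 \<Longrightarrow> u \<noteq> 0 \<Longrightarrow> \<bar>\<tau>\<bar> \<le> 1 \<Longrightarrow>
    cmod (osc_kernel (a $ j) (1/2 - a $ j/4 + (a $ j - 1)/q) \<eta> u \<tau>) \<le> Ck j * \<bar>u\<bar> powr (-(2/q))" by metis
  have s0: "0 \<le> 1/2 - a $ j/4 + (a $ j - 1)/q" for j
  proof -
    have "1 / 4 \<le> 1 / q" using assms by (simp add: field_simps)
    then have "(a $ j - 1) * (1 / 4) \<le> (a $ j - 1) * (1 / q)" using assms(1)[of j] by (intro mult_left_mono) auto
    then show ?thesis by (simp add: field_simps)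
  qed
  show ?thesis
    using assms(2) by (intro maximal_estimate_of_kernel_bounds[OF _ s0 C Ck]) simp_all
qed

lemma maximal_estimate_pos_2:
  fixes a :: "real ^ 'n::finite"
  assumes "\<And>j. a $ j > 1" "s > (\<Sum>j\<in>UNIV. a $ j) / 4"
  shows "maximal_estimate a 2 s"
proof -
  \<comment> \<open>The surplus over the threshold, shared equally so that every coordinate lies
    strictly above a_j/4.\<close>
  define e where "e = (s - (\<Sum>j\<in>UNIV. a $ j) / 4) / real CARD('n)"
  have e: "e > 0" unfolding e_def using assms(2) by simp
  have "\<forall>j. \<exists>\<beta>>1. \<exists>C>0. \<forall>\<eta> u \<tau>. 0 < \<eta> \<longrightarrow> \<eta> \<le> 1 \<longrightarrow> u \<noteq> 0 \<longrightarrow> \<bar>\<tau>\<bar> \<le> 1 \<longrightarrow>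
    cmod (osc_kernel (a $ j) (a $ j / 4 + e) \<eta> u \<tau>) \<le> C * (if \<bar>u\<bar> \<le> 1 then \<bar>u\<bar> powr (-(1/2)) else \<bar>u\<bar> powr (-\<beta>))"
    using osc_kernel_bound_2[OF assms(1)] e by simp
  then obtain \<beta> Ck where Ck: "\<And>j. \<beta> j > 1" "\<And>j. Ck j > 0" "\<And>j \<eta> u \<tau>. 0 < \<eta> \<Longrightarrow> \<eta> \<le> 1 \<Longrightarrow> u \<noteq> 0 \<Longrightarrow> \<bar>\<tau>\<bar> \<le> 1 \<Longrightarrow>
    cmod (osc_kernel (a $ j) (a $ j / 4 + e) \<eta> u \<tau>) \<le> Ck j * (if \<bar>u\<bar> \<le> 1 then \<bar>u\<bar> powr (-(1/2)) else \<bar>u\<bar> powr (-\<beta> j))" by metis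
  have "\<forall>j. \<exists>C. bilinear_bound 2 (\<lambda>u. ennreal (if \<bar>u\<bar> \<le> 1 then \<bar>u\<bar> powr (-(1/2)) else \<bar>u\<bar> powr (-\<beta> j))) C"
    using bilinear_bound_integrable_kernel[OF Ck(1)] by blast
  then obtain C where C: "\<And>j. bilinear_bound 2 (\<lambda>u. ennreal (if \<bar>u\<bar> \<le> 1 then \<bar>u\<bar> powr (-(1/2)) else \<bar>u\<bar> powr (-\<beta> j))) (C j)"
    by metis
  have s0: "a $ j / 4 + e \<ge> 0" for j using assms(1)[of j] e by simp
  have C': "bilinear_bound (2 / (2 - 1)) (\<lambda>u. ennreal (if \<bar>u\<bar> \<le> 1 then \<bar>u\<bar> powr (-(1/2)) else \<bar>u\<bar> powr (-\<beta> j))) (C j)" for j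
    using C[of j] by simp
  have "maximal_estimate a (ennreal 2) (\<Sum>j\<in>UNIV. a $ j / 4 + e)"
    by (rule maximal_estimate_of_kernel_bounds[OF order_refl s0 C' Ck(2,3)])
  moreover have "(\<Sum>j\<in>UNIV. a $ j / 4 + e) = s"
    by (simp add: sum.distrib sum_divide_distrib[symmetric] e_def)
  ultimately show ?thesis by simp
qed

lemma maximal_estimate_pos_infinity:
  fixes a :: "real ^ 'n::finite"
  assumes s: "s > real CARD('n) / 2"
  shows "maximal_estimate a \<infinity> s"
  unfolding maximal_estimate_def
proof (intro exI allI impI)
  fix f :: "real ^ 'n \<Rightarrow> complex"
  assume f: "schwartz f"
  have int: "integrable lborel (fourier f)" by (rule fourier_integrable[OF f])
  have FM [measurable]: "fourier f \<in> borel_measurable borel" using borel_measurable_integrable[OF int] by simp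
  define w where "w = (\<lambda>\<xi> :: real ^ 'n. 1 + (norm \<xi>)\<^sup>2)"
  have w: "w \<xi> > 0" for \<xi> by (simp add: w_def add_pos_nonneg)
  have [measurable]: "w \<in> borel_measurable borel" unfolding w_def by measurable
  define Cw where "Cw = (LINT \<xi> | lborel. w \<xi> powr (-s))"
  have Cw: "(\<integral>\<^sup>+\<xi>. ennreal (w \<xi> powr (-s)) \<partial>lborel) = ennreal Cw" "Cw \<ge> 0"
    unfolding Cw_def w_def using nn_integral_eq_integral[OF integrable_japanese_powr_vec[OF s]]
    by (auto intro: Bochner_Integration.integral_nonneg)
  define S where "S = sobolev_norm s f"
  have S: "S \<ge> 0" "S\<^sup>2 = (LINT \<xi>|lborel. w \<xi> powr s * (cmod (fourier f \<xi>))\<^sup>2)"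
    unfolding S_def sobolev_norm_def w_def by (auto intro!: Bochner_Integration.integral_nonneg)
  have S2: "(\<integral>\<^sup>+\<xi>. ennreal (w \<xi> powr s * (cmod (fourier f \<xi>))\<^sup>2) \<partial>lborel) = ennreal (S\<^sup>2)"
    unfolding S(2) w_def by (intro nn_integral_eq_integral sobolev_integrable f) auto
  define X where "X = (\<integral>\<^sup>+\<xi>. ennreal (cmod (fourier f \<xi>)) \<partial>lborel)"
  have Xeq: "X = (\<integral>\<^sup>+\<xi>. ennreal (w \<xi> powr (s/2) * cmod (fourier f \<xi>)) * ennreal (w \<xi> powr (-s/2)) \<partial>lborel)"
    unfolding X_def
  proof (intro nn_integral_cong)
    fix \<xi>
    have "w \<xi> powr (s/2) * w \<xi> powr (-s/2) = 1" unfolding powr_add[symmetric] using w[of \<xi>] by simp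
    then have "cmod (fourier f \<xi>) = w \<xi> powr (s/2) * cmod (fourier f \<xi>) * w \<xi> powr (-s/2)" by (simp add: mult_ac)
    then show "ennreal (cmod (fourier f \<xi>)) = ennreal (w \<xi> powr (s/2) * cmod (fourier f \<xi>)) * ennreal (w \<xi> powr (-s/2))"
      by (metis ennreal_mult mult_nonneg_nonneg norm_ge_zero powr_ge_zero)
  qed
  have sq: "(w \<xi> powr e)\<^sup>2 = w \<xi> powr (2 * e)" for \<xi> e
    by (simp add: power2_eq_square powr_add[symmetric])
  have "X\<^sup>2 \<le> (\<integral>\<^sup>+\<xi>. (ennreal (w \<xi> powr (s/2) * cmod (fourier f \<xi>)))\<^sup>2 \<partial>lborel) * (\<integral>\<^sup>+\<xi>. (ennreal (w \<xi> powr (-s/2)))\<^sup>2 \<partial>lborel)"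
    unfolding Xeq by (rule Cauchy_Schwarz_nn_integral) measurable
  also have "(\<integral>\<^sup>+\<xi>. (ennreal (w \<xi> powr (s/2) * cmod (fourier f \<xi>)))\<^sup>2 \<partial>lborel) = ennreal (S\<^sup>2)"
    unfolding S2[symmetric] by (intro nn_integral_cong) (simp add: ennreal_power power_mult_distrib sq)
  also have "(\<integral>\<^sup>+\<xi>. (ennreal (w \<xi> powr (-s/2)))\<^sup>2 \<partial>lborel) = ennreal Cw"
    unfolding Cw(1)[symmetric] by (intro nn_integral_cong) (simp add: ennreal_power sq)
  finally have X2: "X\<^sup>2 \<le> ennreal (S\<^sup>2 * Cw)" using Cw by (simp add: ennreal_mult)
  have Xb: "X \<le> ennreal (sqrt Cw * S)"
  proof (cases X rule: ennreal_cases)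
    case (real x)
    then have "x\<^sup>2 \<le> S\<^sup>2 * Cw" using X2 Cw by (simp add: ennreal_power ennreal_le_iff)
    then have "x \<le> sqrt (S\<^sup>2 * Cw)" by (rule real_le_rsqrt)
    then show ?thesis using real(2) S(1) by (simp add: real_sqrt_mult mult.commute ennreal_leI)
  next
    case top then show ?thesis using X2 by (simp add: top_unique)
  qed
  have "maximal_op a f x \<le> X" for x
    unfolding maximal_op_def
  proof (rule SUP_least)
    fix t
    have "cmod (S_op a t f x) \<le> (LINT \<xi>|lborel. cmod (iexp (osc_phase a t x \<xi>) * fourier f \<xi>))"
      unfolding S_op_eq by (rule integral_norm_bound)
    then have "ennreal (cmod (S_op a t f x)) \<le> ennreal (LINT \<xi>|lborel. cmod (fourier f \<xi>))"
      by (intro ennreal_leI) (simp add: norm_mult)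
    also have "\<dots> = X" unfolding X_def by (rule nn_integral_eq_integral[symmetric]) (use int in auto)
    finally show "ennreal (cmod (S_op a t f x)) \<le> X" .
  qed
  then have "esssup lborel (maximal_op a f) \<le> ennreal (sqrt Cw * S)"
    using maximal_op_measurable[OF f, of a] Xb by (intro esssup_I) (auto intro: order_trans)
  then show "Lq_norm \<infinity> (maximal_op a f) \<le> ennreal (sqrt (integral\<^sup>L lborel (\<lambda>\<xi> :: real ^ 'n. (1 + (norm \<xi>)\<^sup>2) powr (-s))) * sobolev_norm s f)"
    by (simp add: Lq_norm_def Cw_def S_def w_def)
qed

section \<open>Necessary conditions\<close>

lemma integrable_japanese_gauss:
  fixes r :: real
  assumes r: "r \<ge> 0"
  shows "integrable lborel (\<lambda>x::real. (1 + x\<^sup>2) powr r * exp (-(x\<^sup>2) / 2))"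
proof (rule Bochner_Integration.integrable_bound)
  \<comment> \<open>The inequality z \<le> exp z at z = y/(2 m), raised to the power m, shows that
    the Gaussian compensates y^m up to a constant. The one extra power of y leaves the integrable
    function 1/y.\<close>
  define m where "m = r + 1"
  define B where "B = (2 * m) powr m * exp (1/2)"
  show "integrable lborel (\<lambda>x::real. B * (1 + x\<^sup>2) powr (-1))"
    by (intro integrable_mult_right integrable_japanese_powr) auto
  show "AE x in lborel. norm ((1 + x\<^sup>2) powr r * exp (-(x\<^sup>2) / 2)) \<le> norm (B * (1 + x\<^sup>2) powr (-1))"
  proof (rule AE_I2)
    fix x :: real
    define y where "y = 1 + x\<^sup>2"
    have y: "y > 0" unfolding y_def by (rule one_plus_sq_pos)
    have m: "m > 0" using r by (simp add: m_def)
    have "y / (2 * m) \<le> exp (y / (2 * m))" using exp_ge_add_one_self[of "y / (2 * m)"] by linarith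
    then have "(y / (2 * m)) powr m \<le> exp (y / (2 * m)) powr m" using y m by (intro powr_mono2) auto
    also have "\<dots> = exp (y / 2)" using m by (simp add: powr_def)
    finally have "y powr m / (2 * m) powr m \<le> exp (y / 2)" unfolding powr_divide .
    then have "y powr m \<le> (2 * m) powr m * exp (y / 2)" using m by (simp add: pos_divide_le_eq mult.commute)
    then have "y powr m * y powr (-1) * exp (-(x\<^sup>2) / 2) \<le> ((2 * m) powr m * exp (y / 2)) * y powr (-1) * exp (-(x\<^sup>2) / 2)"
      by (intro mult_right_mono) auto
    also have "\<dots> = (2 * m) powr m * (exp (y / 2) * exp (-(x\<^sup>2) / 2)) * y powr (-1)" by (simp only: mult_ac)
    also have "exp (y / 2) * exp (-(x\<^sup>2) / 2) = exp (1/2)" unfolding exp_add[symmetric] y_def by (simp add: add_divide_distrib)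
    also have "y powr m * y powr (-1) = y powr r" unfolding powr_add[symmetric] m_def by simp
    finally show "norm ((1 + x\<^sup>2) powr r * exp (-(x\<^sup>2) / 2)) \<le> norm (B * (1 + x\<^sup>2) powr (-1))"
      unfolding B_def y_def by (simp add: abs_mult)
  qed
qed measurable

lemma one_plus_sum_le_prod:
  fixes u :: "'i \<Rightarrow> real"
  assumes "\<And>i. u i \<ge> 0"
  shows "1 + (\<Sum>i\<in>A. u i) \<le> (\<Prod>i\<in>A. 1 + u i)"
proof (induction A rule: infinite_finite_induct)
  case (insert i A)
  have "1 + (\<Sum>i\<in>insert i A. u i) = u i * 1 + (1 + (\<Sum>i\<in>A. u i))" using insert by simp
  also have "\<dots> \<le> u i * (\<Prod>i\<in>A. 1 + u i) + (\<Prod>i\<in>A. 1 + u i)"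
    using insert.IH assms sum_nonneg[of A u] by (intro add_mono mult_left_mono) (auto intro: order_trans[OF _ insert.IH])
  also have "\<dots> = (\<Prod>i\<in>insert i A. 1 + u i)" using insert by (simp add: algebra_simps)
  finally show ?case .
qed auto

lemma norm_sq_eq_sum: "(norm x)\<^sup>2 = (\<Sum>j\<in>UNIV. (x $ j)\<^sup>2)" for x :: "real ^ 'n::finite"
  unfolding norm_vec_def L2_set_def by (subst real_sqrt_pow2) (auto intro: sum_nonneg)

text \<open>\<open>\<Lambda>\<close> bounds both the centre and the widths. In the variable e_j =
  (\<xi>_j - N)/R_j each coordinate is at most \<Lambda> (1 + |e_j|), and the sum in 1 + |\<xi>|^2
  is dominated by a product of factors 3 (1 + e_j^2). Hence the weight costs \<Lambda>^(2 s) and the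
  remaining integral factorises.\<close>

lemma weighted_gauss_bound:
  fixes s :: real
  assumes s: "s \<ge> 0"
  shows "\<exists>C>0. \<forall>N (R :: 'n::finite \<Rightarrow> real) \<Lambda>. 0 \<le> N \<longrightarrow> (\<forall>j. 0 < R j \<and> R j \<le> \<Lambda>) \<longrightarrow> N \<le> \<Lambda> \<longrightarrow> 1 \<le> \<Lambda> \<longrightarrow>
    (\<integral>\<^sup>+\<xi>. ennreal ((1 + (norm \<xi>)\<^sup>2) powr s * (\<Prod>j\<in>UNIV. exp (-(((\<xi> $ j - N) / R j)\<^sup>2)))) \<partial>lborel) \<le>
      ennreal (C * \<Lambda> powr (2 * s) * (\<Prod>j\<in>UNIV. R j))"
proof -
  define g where "g = (\<lambda>x::real. (3 * (1 + x\<^sup>2)) powr s * exp (-(x\<^sup>2)))"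
  have g0: "g x \<ge> 0" for x by (simp add: g_def)
  have [measurable]: "g \<in> borel_measurable borel" unfolding g_def by measurable
  have "integrable lborel g"
  proof (rule Bochner_Integration.integrable_bound[OF integrable_mult_right[OF integrable_japanese_gauss[OF s], of "3 powr s"]])
    show "AE x in lborel. norm (g x) \<le> norm (3 powr s * ((1 + x\<^sup>2) powr s * exp (-(x\<^sup>2) / 2)))"
      unfolding g_def powr_mult by (intro AE_I2) (simp add: abs_mult mult_left_mono mult.assoc)
  qed measurable
  define c where "c = (LINT x|lborel. g x) + 1"
  have c: "c > 0" unfolding c_def using g0 by (intro add_nonneg_pos Bochner_Integration.integral_nonneg) auto
  have gi: "(\<integral>\<^sup>+x. ennreal (g x) \<partial>lborel) \<le> ennreal c"
    unfolding c_def nn_integral_eq_integral[OF \<open>integrable lborel g\<close> AE_I2[OF g0]] by (intro ennreal_leI) simp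
  have "(\<integral>\<^sup>+\<xi>. ennreal ((1 + (norm \<xi>)\<^sup>2) powr s * (\<Prod>j\<in>UNIV. exp (-(((\<xi> $ j - N) / R j)\<^sup>2)))) \<partial>lborel) \<le>
      ennreal (c ^ CARD('n) * \<Lambda> powr (2 * s) * (\<Prod>j\<in>UNIV. R j))"
    if N: "0 \<le> N" "N \<le> \<Lambda>" and R: "\<And>j. 0 < R j \<and> R j \<le> \<Lambda>" and \<Lambda>: "1 \<le> \<Lambda>" for N \<Lambda> and R :: "'n \<Rightarrow> real"
  proof -
    have pt: "(1 + (norm \<xi>)\<^sup>2) powr s * (\<Prod>j\<in>UNIV. exp (-(((\<xi> $ j - N) / R j)\<^sup>2))) \<le>
       \<Lambda> powr (2 * s) * (\<Prod>j\<in>UNIV. g ((\<xi> $ j - N) / R j))" for \<xi> :: "real ^ 'n"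
    proof -
      define e where "e = (\<lambda>j. (\<xi> $ j - N) / R j)"
      have xj: "(\<xi> $ j)\<^sup>2 \<le> \<Lambda>\<^sup>2 * (2 + 2 * (e j)\<^sup>2)" for j
      proof -
        have "\<xi> $ j = N + R j * e j" using R[of j] by (simp add: e_def)
        then have "\<bar>\<xi> $ j\<bar> \<le> \<bar>N\<bar> + \<bar>R j * e j\<bar>" by simp
        also have "\<dots> \<le> \<Lambda> + \<Lambda> * \<bar>e j\<bar>" using N R[of j] by (intro add_mono) (auto simp: abs_mult intro: mult_right_mono)
        finally have "\<bar>\<xi> $ j\<bar>\<^sup>2 \<le> (\<Lambda> * (1 + \<bar>e j\<bar>))\<^sup>2" by (intro power_mono) (auto simp: distrib_left)
        also have "\<dots> = \<Lambda>\<^sup>2 * (1 + \<bar>e j\<bar>)\<^sup>2" by (simp add: power_mult_distrib)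
        also have "\<dots> \<le> \<Lambda>\<^sup>2 * (2 + 2 * (e j)\<^sup>2)"
        proof (intro mult_left_mono)
          have "0 \<le> (1 - \<bar>e j\<bar>)\<^sup>2" by simp
          then show "(1 + \<bar>e j\<bar>)\<^sup>2 \<le> 2 + 2 * (e j)\<^sup>2" unfolding power2_sum power2_diff by simp
        qed simp
        finally show ?thesis by simp
      qed
      have "1 + (norm \<xi>)\<^sup>2 \<le> \<Lambda>\<^sup>2 * 1 + (\<Sum>j\<in>UNIV. \<Lambda>\<^sup>2 * (2 + 2 * (e j)\<^sup>2))"
        unfolding norm_sq_eq_sum using \<Lambda> by (intro add_mono sum_mono xj) (auto simp: one_le_power)
      also have "\<dots> = \<Lambda>\<^sup>2 * (1 + (\<Sum>j\<in>UNIV. 2 + 2 * (e j)\<^sup>2))" by (simp only: sum_distrib_left distrib_left)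
      also have "\<dots> \<le> \<Lambda>\<^sup>2 * (\<Prod>j\<in>UNIV. 1 + (2 + 2 * (e j)\<^sup>2))"
        by (intro mult_left_mono one_plus_sum_le_prod) auto
      also have "\<dots> \<le> \<Lambda>\<^sup>2 * (\<Prod>j\<in>UNIV. 3 * (1 + (e j)\<^sup>2))"
        by (intro mult_left_mono prod_mono) auto
      finally have "(1 + (norm \<xi>)\<^sup>2) powr s \<le> (\<Lambda>\<^sup>2 * (\<Prod>j\<in>UNIV. 3 * (1 + (e j)\<^sup>2))) powr s"
        using s by (intro powr_mono2) auto
      also have "\<dots> = (\<Lambda>\<^sup>2) powr s * (\<Prod>j\<in>UNIV. 3 * (1 + (e j)\<^sup>2)) powr s"
        by (rule powr_mult)
      also have "(\<Lambda>\<^sup>2) powr s = \<Lambda> powr (2 * s)" using \<Lambda> by (simp add: powr_powr[symmetric] powr_numeral)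
      also have "(\<Prod>j\<in>UNIV. 3 * (1 + (e j)\<^sup>2)) powr s = (\<Prod>j\<in>UNIV. (3 * (1 + (e j)\<^sup>2)) powr s)"
        by (rule prod_powr_distrib)
      finally have "(1 + (norm \<xi>)\<^sup>2) powr s * (\<Prod>j\<in>UNIV. exp (-((e j)\<^sup>2))) \<le> \<Lambda> powr (2 * s) * (\<Prod>j\<in>UNIV. (3 * (1 + (e j)\<^sup>2)) powr s) * (\<Prod>j\<in>UNIV. exp (-((e j)\<^sup>2)))"
        by (intro mult_right_mono prod_nonneg) auto
      also have "\<dots> = \<Lambda> powr (2 * s) * (\<Prod>j\<in>UNIV. g (e j))" unfolding g_def prod.distrib by (simp only: mult.assoc)
      finally show ?thesis unfolding e_def .
    qed
    have one: "(\<integral>\<^sup>+x. ennreal (g ((x - N) / R j)) \<partial>lborel) \<le> ennreal (R j * c)" for j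
    proof -
      have Rj: "R j > 0" using R by simp
      have "(\<integral>\<^sup>+x. ennreal (g ((x - N) / R j)) \<partial>lborel) = ennreal \<bar>R j\<bar> * (\<integral>\<^sup>+x. ennreal (g ((N + R j * x - N) / R j)) \<partial>lborel)"
        using Rj by (subst nn_integral_real_affine[where c="R j" and t=N]) auto
      also have "\<dots> = ennreal (R j) * (\<integral>\<^sup>+x. ennreal (g x) \<partial>lborel)" using Rj by simp
      also have "\<dots> \<le> ennreal (R j) * ennreal c" using gi by (intro mult_left_mono) auto
      finally show ?thesis using Rj c by (simp add: ennreal_mult)
    qed
    have "(\<integral>\<^sup>+\<xi>. ennreal ((1 + (norm \<xi>)\<^sup>2) powr s * (\<Prod>j\<in>UNIV. exp (-(((\<xi> $ j - N) / R j)\<^sup>2)))) \<partial>lborel) \<le>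
      (\<integral>\<^sup>+\<xi>. ennreal (\<Lambda> powr (2 * s)) * (\<Prod>j\<in>UNIV. ennreal (g ((\<xi> $ j - N) / R j))) \<partial>lborel)"
    proof (intro nn_integral_mono)
      fix \<xi> :: "real ^ 'n"
      have "ennreal (\<Lambda> powr (2 * s)) * (\<Prod>j\<in>UNIV. ennreal (g ((\<xi> $ j - N) / R j))) = ennreal (\<Lambda> powr (2 * s) * (\<Prod>j\<in>UNIV. g ((\<xi> $ j - N) / R j)))"
        using g0 by (simp add: prod_ennreal ennreal_mult prod_nonneg)
      then show "ennreal ((1 + (norm \<xi>)\<^sup>2) powr s * (\<Prod>j\<in>UNIV. exp (-(((\<xi> $ j - N) / R j)\<^sup>2)))) \<le> ennreal (\<Lambda> powr (2 * s)) * (\<Prod>j\<in>UNIV. ennreal (g ((\<xi> $ j - N) / R j)))"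
        using pt[of \<xi>] by (simp add: ennreal_leI)
    qed
    also have "\<dots> = ennreal (\<Lambda> powr (2 * s)) * (\<integral>\<^sup>+\<xi>. (\<Prod>j\<in>UNIV. ennreal (g ((\<xi> $ j - N) / R j))) \<partial>lborel)"
      by (rule nn_integral_cmult) measurable
    also have "(\<integral>\<^sup>+\<xi>. (\<Prod>j\<in>UNIV. ennreal (g ((\<xi> $ j - N) / R j))) \<partial>lborel) = (\<Prod>j\<in>UNIV. \<integral>\<^sup>+x. ennreal (g ((x - N) / R j)) \<partial>lborel)"
      by (rule nn_integral_lborel_vec_prod[of "\<lambda>j x. ennreal (g ((x - N) / R j))"]) measurable
    also have "\<dots> \<le> (\<Prod>j\<in>UNIV. ennreal (R j * c))" by (intro prod_mono_ennreal one)
    also have "\<dots> = ennreal (\<Prod>j\<in>UNIV. R j * c)" using R c by (intro prod_ennreal) (simp add: less_imp_le)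
    also have "(\<Prod>j\<in>UNIV. R j * c) = c ^ CARD('n) * (\<Prod>j\<in>UNIV. R j)" by (simp add: prod.distrib)
    also have "ennreal (\<Lambda> powr (2 * s)) * ennreal (c ^ CARD('n) * (\<Prod>j\<in>UNIV. R j)) = ennreal (c ^ CARD('n) * \<Lambda> powr (2 * s) * (\<Prod>j\<in>UNIV. R j))"
      using R c by (subst ennreal_mult[symmetric]) (auto intro!: prod_nonneg mult_nonneg_nonneg simp: less_imp_le mult_ac)
    finally show ?thesis by (meson mult_left_mono order_trans zero_le)
  qed
  then show ?thesis using c by (intro exI[of _ "c ^ CARD('n)"]) auto
qed

lemma sobolev_gauss_packet_bound:
  fixes s :: real
  assumes s: "s \<ge> 0"
  shows "\<exists>C>0. \<forall>N (R :: 'n::finite \<Rightarrow> real) \<Lambda>. 0 \<le> N \<longrightarrow> (\<forall>j. 0 < R j \<and> R j \<le> \<Lambda>) \<longrightarrow> N \<le> \<Lambda> \<longrightarrow> 1 \<le> \<Lambda> \<longrightarrow>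
    sobolev_norm s (gauss_packet N R) \<le> C * \<Lambda> powr s * sqrt (\<Prod>j\<in>UNIV. R j)"
proof -
  obtain C where C: "C > 0" "\<And>N (R :: 'n \<Rightarrow> real) \<Lambda>. 0 \<le> N \<Longrightarrow> (\<forall>j. 0 < R j \<and> R j \<le> \<Lambda>) \<Longrightarrow> N \<le> \<Lambda> \<Longrightarrow> 1 \<le> \<Lambda> \<Longrightarrow>
    (\<integral>\<^sup>+\<xi>. ennreal ((1 + (norm \<xi>)\<^sup>2) powr s * (\<Prod>j\<in>UNIV. exp (-(((\<xi> $ j - N) / R j)\<^sup>2)))) \<partial>lborel) \<le>
      ennreal (C * \<Lambda> powr (2 * s) * (\<Prod>j\<in>UNIV. R j))"
    using weighted_gauss_bound[OF s, where 'n='n] by blast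
  have "sobolev_norm s (gauss_packet N R) \<le> sqrt C * \<Lambda> powr s * sqrt (\<Prod>j\<in>UNIV. R j)"
    if N: "0 \<le> N" "N \<le> \<Lambda>" and R: "\<forall>j. 0 < R j \<and> R j \<le> \<Lambda>" and \<Lambda>: "1 \<le> \<Lambda>" for N \<Lambda> and R :: "'n \<Rightarrow> real"
  proof -
    have R0: "\<And>j. R j > 0" using R by simp
    \<comment> \<open>Squaring cancels the 1/2 in the exponent and brings the transform into the
      form used in \<open>weighted_gauss_bound\<close>.\<close>
    have sq: "(cmod (fourier (gauss_packet N R) \<xi>))\<^sup>2 = (\<Prod>j\<in>UNIV. exp (-(((\<xi> $ j - N) / R j)\<^sup>2)))" for \<xi>
      unfolding fourier_gauss_packet[OF R0] prod_norm[symmetric] prod_power_distrib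
      by (intro prod.cong refl) (simp add: exp_of_nat_mult[symmetric] power2_eq_square[of "exp _"] exp_add[symmetric])
    have "ennreal (LINT \<xi>|lborel. (1 + (norm \<xi>)\<^sup>2) powr s * (cmod (fourier (gauss_packet N R) \<xi>))\<^sup>2) =
      (\<integral>\<^sup>+\<xi>. ennreal ((1 + (norm \<xi>)\<^sup>2) powr s * (cmod (fourier (gauss_packet N R) \<xi>))\<^sup>2) \<partial>lborel)"
      by (intro nn_integral_eq_integral[symmetric] sobolev_integrable schwartz_gauss_packet R0) auto
    also have "\<dots> \<le> ennreal (C * \<Lambda> powr (2 * s) * (\<Prod>j\<in>UNIV. R j))"
      unfolding sq by (rule C(2)[OF N(1) R N(2) \<Lambda>])
    finally have "(LINT \<xi>|lborel. (1 + (norm \<xi>)\<^sup>2) powr s * (cmod (fourier (gauss_packet N R) \<xi>))\<^sup>2) \<le> C * \<Lambda> powr (2 * s) * (\<Prod>j\<in>UNIV. R j)"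
      using C(1) R0 by (subst (asm) ennreal_le_iff) (auto intro!: mult_nonneg_nonneg prod_nonneg simp: less_imp_le)
    then have "sobolev_norm s (gauss_packet N R) \<le> sqrt (C * \<Lambda> powr (2 * s) * (\<Prod>j\<in>UNIV. R j))"
      unfolding sobolev_norm_def by (rule real_sqrt_le_mono)
    also have "\<dots> = sqrt C * sqrt (\<Lambda> powr (2 * s)) * sqrt (\<Prod>j\<in>UNIV. R j)" by (simp add: real_sqrt_mult)
    also have "sqrt (\<Lambda> powr (2 * s)) = \<Lambda> powr s"
      by (subst powr_half_sqrt[symmetric]) (simp_all add: powr_powr)
    finally show ?thesis .
  qed
  then show ?thesis using C(1) by (intro exI[of _ "sqrt C"]) auto
qed

lemma maximal_op_ge: "(\<And>j. 0 < t $ j \<and> t $ j < 1) \<Longrightarrow> ennreal (cmod (S_op a t f x)) \<le> maximal_op a f x"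
  unfolding maximal_op_def by (rule SUP_upper) simp

text \<open>Time 0 is not admissible but is a limit of admissible times. It is worth including
  because there the evolution of a Gaussian centred at frequency 0 is explicit.\<close>

lemma maximal_op_ge_zero_time:
  fixes a :: "real ^ 'n::finite"
  assumes "integrable lborel (fourier f)"
  shows "ennreal (cmod (S_op a 0 f x)) \<le> maximal_op a f x"
proof (rule tendsto_upperbound)
  define t :: "nat \<Rightarrow> real ^ 'n" where "t = (\<lambda>k. \<chi> j. 1 / (real k + 2))"
  have "(\<lambda>k. 1 / (real k + 2)) \<longlonglongrightarrow> 0" by real_asymp
  then have "t \<longlonglongrightarrow> 0" unfolding t_def by (intro vec_tendstoI) simp
  then have "(\<lambda>k. S_op a (t k) f x) \<longlonglongrightarrow> S_op a 0 f x"
    using S_op_continuous[OF assms, of a x] by (auto simp: continuous_on_eq_continuous_at isCont_def intro: isCont_tendsto_compose)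
  then show "(\<lambda>k. ennreal (cmod (S_op a (t k) f x))) \<longlonglongrightarrow> ennreal (cmod (S_op a 0 f x))"
    by (intro tendsto_ennrealI tendsto_norm)
  show "eventually (\<lambda>k. ennreal (cmod (S_op a (t k) f x)) \<le> maximal_op a f x) sequentially"
    by (intro always_eventually allI maximal_op_ge) (simp add: t_def)
qed simp

lemma S_op_gauss_packet:
  fixes R :: "'n::finite \<Rightarrow> real"
  assumes R: "\<And>j. R j > 0"
  shows "S_op a t (gauss_packet N R) x = (\<Prod>j\<in>UNIV. LINT y|lborel.
    iexp (x $ j * y + t $ j * \<bar>y\<bar> powr (a $ j)) * complex_of_real (exp (-(((y - N) / R j)\<^sup>2) / 2)))"
proof -
  have int: "integrable lborel (\<lambda>y. iexp (x $ j * y + t $ j * \<bar>y\<bar> powr (a $ j)) * complex_of_real (exp (-(((y - N) / R j)\<^sup>2) / 2)))" for j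
  proof (rule Bochner_Integration.integrable_bound)
    have "integrable lborel (\<lambda>z::real. complex_of_real (exp (-(z\<^sup>2) / 2)))"
      using std_gauss_integral(1)[of 0] by simp
    from lborel_integrable_real_affine[OF this, of "1 / R j" "- N / R j"] R[of j]
    show "integrable lborel (\<lambda>y. complex_of_real (exp (-(((y - N) / R j)\<^sup>2) / 2)))" by (simp add: diff_divide_distrib)
  qed (auto simp: norm_mult)
  have "S_op a t (gauss_packet N R) x = integral\<^sup>L lborel (\<lambda>\<xi>. \<Prod>j\<in>UNIV.
    iexp (x $ j * \<xi> $ j + t $ j * \<bar>\<xi> $ j\<bar> powr (a $ j)) * complex_of_real (exp (-(((\<xi> $ j - N) / R j)\<^sup>2) / 2)))"
    unfolding S_op_eq fourier_gauss_packet[OF R] prod.distrib osc_phase_def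
    by (simp only: of_real_sum sum_distrib_left exp_sum[OF finite])
  also have "\<dots> = (\<Prod>j\<in>UNIV. LINT y|lborel.
    iexp (x $ j * y + t $ j * \<bar>y\<bar> powr (a $ j)) * complex_of_real (exp (-(((y - N) / R j)\<^sup>2) / 2)))"
    by (rule integral_lborel_vec_prod[OF int])
  finally show ?thesis .
qed

lemma S_op_gauss_packet_zero:
  fixes R :: "'n::finite \<Rightarrow> real"
  assumes R: "\<And>j. R j > 0"
  shows "S_op a 0 (gauss_packet 0 R) x = complex_of_real (\<Prod>j\<in>UNIV. sqrt (2 * pi) * R j * exp (-((R j * x $ j)\<^sup>2) / 2))"
proof -
  have "(LINT y|lborel. iexp (z * y + 0 * \<bar>y\<bar> powr b) * complex_of_real (exp (-(((y - 0) / r)\<^sup>2) / 2))) =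
    complex_of_real (sqrt (2 * pi) * r * exp (-((r * z)\<^sup>2) / 2))" if "r > 0" for r z b :: real
  proof -
    have "(LINT y|lborel. iexp (z * y + 0 * \<bar>y\<bar> powr b) * complex_of_real (exp (-(((y - 0) / r)\<^sup>2) / 2))) =
      r *\<^sub>R (LINT y|lborel. iexp (z * (0 + r * y) + 0 * \<bar>0 + r * y\<bar> powr b) * complex_of_real (exp (-(((0 + r * y - 0) / r)\<^sup>2) / 2)))"
      using that by (subst lborel_integral_real_affine[where c=r and t=0]) auto
    also have "(LINT y|lborel. iexp (z * (0 + r * y) + 0 * \<bar>0 + r * y\<bar> powr b) * complex_of_real (exp (-(((0 + r * y - 0) / r)\<^sup>2) / 2))) =
      (LINT y|lborel. complex_of_real (exp (-(y\<^sup>2) / 2)) * iexp (r * z * y))"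
      using that by (intro Bochner_Integration.integral_cong refl) (simp add: mult_ac)
    also have "\<dots> = complex_of_real (sqrt (2 * pi) * exp (-((r * z)\<^sup>2) / 2))" by (rule std_gauss_integral(2))
    finally show ?thesis by (simp add: scaleR_conv_of_real mult_ac)
  qed
  then show ?thesis unfolding S_op_gauss_packet[OF R] using R by simp
qed

lemma emeasure_lborel_cbox_vec:
  fixes l u :: "real ^ 'n::finite"
  assumes lu: "\<And>j. l $ j \<le> u $ j"
  shows "emeasure lborel (cbox l u) = ennreal (\<Prod>j\<in>UNIV. u $ j - l $ j)"
proof -
  have inj: "inj (\<lambda>i::'n. axis i (1::real))" by (auto simp: inj_on_def axis_eq_axis)
  have *: "(Basis :: (real^'n) set) = range (\<lambda>i. axis i 1)" by (auto simp: Basis_vec_def)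
  have "emeasure lborel (cbox l u) = (\<Prod>b\<in>Basis. (u - l) \<bullet> b)"
    using lu by (subst emeasure_lborel_cbox) (auto simp: Basis_vec_def inner_axis)
  then show ?thesis unfolding * prod.reindex[OF inj] by (simp add: inner_axis)
qed

lemma Lq_norm_lower:
  fixes g :: "real ^ 'n::finite \<Rightarrow> ennreal"
  assumes q: "q > 0" and c: "c \<ge> 0" and lu: "\<And>j. l $ j \<le> u $ j"
    and g: "\<And>x. x \<in> cbox l u \<Longrightarrow> ennreal c \<le> g x"
  shows "ennreal (c * (\<Prod>j\<in>UNIV. u $ j - l $ j) powr (1 / q)) \<le> Lq_norm (ennreal q) g"
proof -
  define v where "v = (\<Prod>j\<in>UNIV. u $ j - l $ j)"
  have v: "v \<ge> 0" unfolding v_def using lu by (intro prod_nonneg) auto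
  have m: "emeasure lborel (cbox l u) = ennreal v" unfolding v_def by (rule emeasure_lborel_cbox_vec[OF lu])
  have "ennreal (c powr q * v) = (\<integral>\<^sup>+x. ennreal (c powr q) * indicator (cbox l u) x \<partial>lborel)"
    using v by (simp add: nn_integral_cmult m ennreal_mult)
  also have "\<dots> \<le> (\<integral>\<^sup>+x. ennreal_powr (g x) q \<partial>lborel)"
  proof (intro nn_integral_mono)
    fix x
    have "ennreal (c powr q) \<le> ennreal_powr (g x) q" if "x \<in> cbox l u"
      using ennreal_powr_mono[OF g[OF that], of q] q c by simp
    then show "ennreal (c powr q) * indicator (cbox l u) x \<le> ennreal_powr (g x) q"
      by (auto split: split_indicator)
  qed
  finally have "ennreal_powr (ennreal (c powr q * v)) (1 / q) \<le> ennreal_powr (\<integral>\<^sup>+x. ennreal_powr (g x) q \<partial>lborel) (1 / q)"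
    using q by (intro ennreal_powr_mono) auto
  moreover have "ennreal_powr (ennreal (c powr q * v)) (1 / q) = ennreal (c * v powr (1 / q))"
    using q c v by (simp add: powr_mult powr_powr)
  ultimately show ?thesis using q by (simp add: Lq_norm_def v_def)
qed

lemma powr_le_imp_exponent_le:
  fixes p s :: real
  assumes "\<And>x. x \<ge> 1 \<Longrightarrow> x powr p \<le> C * x powr s"
  shows "p \<le> s"
proof (rule ccontr)
  assume "\<not> p \<le> s"
  define d where "d = p - s"
  have d: "d > 0" using \<open>\<not> p \<le> s\<close> by (simp add: d_def)
  \<comment> \<open>Chosen so that x^(p - s) exceeds C.\<close>
  define x where "x = (max 1 (C + 1)) powr (1 / d)"
  have x: "x \<ge> 1" unfolding x_def using d by (intro ge_one_powr_ge_zero) auto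
  have "x powr d = max 1 (C + 1)" unfolding x_def powr_powr using d by simp
  then have big: "C < x powr d" by simp
  have pos: "x powr s > 0" using x by simp
  have "x powr d * x powr s = x powr p" unfolding powr_add[symmetric] d_def by simp
  also have "\<dots> \<le> C * x powr s" by (rule assms[OF x])
  finally have "x powr d \<le> C" using pos by simp
  then show False using big by simp
qed

text \<open>The common test inequality: a lower bound for the maximal function on a box, times the
  volume to the power 1/q, against an upper bound for the norm. One constant serves all packets and
  boxes, so the parameters can be sent to their limits afterwards.\<close>

lemma maximal_estimate_packet:
  fixes a :: "real ^ 'n::finite"
  assumes est: "maximal_estimate a (ennreal q) s" and s: "s \<ge> 0" and q: "q > 0"
  shows "\<exists>C. \<forall>N (R :: 'n \<Rightarrow> real) \<Lambda> c l u. 0 \<le> N \<longrightarrow> (\<forall>j. 0 < R j \<and> R j \<le> \<Lambda>) \<longrightarrow> N \<le> \<Lambda> \<longrightarrow> 1 \<le> \<Lambda> \<longrightarrow>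
     0 \<le> c \<longrightarrow> (\<forall>j. l $ j \<le> u $ j) \<longrightarrow> (\<forall>x\<in>cbox l u. ennreal c \<le> maximal_op a (gauss_packet N R) x) \<longrightarrow>
     c * (\<Prod>j\<in>UNIV. u $ j - l $ j) powr (1 / q) \<le> C * \<Lambda> powr s * sqrt (\<Prod>j\<in>UNIV. R j)"
proof -
  obtain C0 where C0: "\<And>f. schwartz f \<Longrightarrow> Lq_norm (ennreal q) (maximal_op a f) \<le> ennreal (C0 * sobolev_norm s f)"
    using est unfolding maximal_estimate_def by blast
  obtain C1 where C1: "C1 > 0" "\<And>N (R :: 'n \<Rightarrow> real) \<Lambda>. 0 \<le> N \<Longrightarrow> (\<forall>j. 0 < R j \<and> R j \<le> \<Lambda>) \<Longrightarrow> N \<le> \<Lambda> \<Longrightarrow> 1 \<le> \<Lambda> \<Longrightarrow>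
    sobolev_norm s (gauss_packet N R) \<le> C1 * \<Lambda> powr s * sqrt (\<Prod>j\<in>UNIV. R j)"
    using sobolev_gauss_packet_bound[OF s, where 'n='n] by blast
  show ?thesis
  proof (rule exI[of _ "\<bar>C0\<bar> * C1"], intro allI impI)
    fix N :: real and R :: "'n \<Rightarrow> real" and \<Lambda> c l u
    assume N: "0 \<le> N" "N \<le> \<Lambda>" and R: "\<forall>j. 0 < R j \<and> R j \<le> \<Lambda>" and \<Lambda>: "1 \<le> \<Lambda>" and c: "0 \<le> c"
      and lu: "\<forall>j. l $ j \<le> u $ j" and low: "\<forall>x\<in>cbox l u. ennreal c \<le> maximal_op a (gauss_packet N R) x"
    have "ennreal (c * (\<Prod>j\<in>UNIV. u $ j - l $ j) powr (1 / q)) \<le> Lq_norm (ennreal q) (maximal_op a (gauss_packet N R))"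
      using lu low by (intro Lq_norm_lower q c) auto
    also have "\<dots> \<le> ennreal (C0 * sobolev_norm s (gauss_packet N R))"
      using R by (intro C0 schwartz_gauss_packet) auto
    also have "\<dots> \<le> ennreal (\<bar>C0\<bar> * (C1 * \<Lambda> powr s * sqrt (\<Prod>j\<in>UNIV. R j)))"
      using C1(2)[OF N(1) R N(2) \<Lambda>] by (intro ennreal_leI mult_mono) (auto simp: sobolev_norm_def)
    finally show "c * (\<Prod>j\<in>UNIV. u $ j - l $ j) powr (1 / q) \<le> \<bar>C0\<bar> * C1 * \<Lambda> powr s * sqrt (\<Prod>j\<in>UNIV. R j)"
      using C1(1) R by (subst (asm) ennreal_le_iff) (auto intro!: mult_nonneg_nonneg prod_nonneg simp: less_imp_le mult.assoc)
  qed
qed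

text \<open>A bound for the real part rather than the modulus, so that packets of different scales
  can later be added without cancellation.\<close>

lemma gauss_packet_zero_time_lower:
  fixes a :: "real ^ 'n::finite"
  assumes \<rho>: "\<rho> > 0" and x: "\<And>j. 0 \<le> x $ j \<and> x $ j \<le> 1 / \<rho>"
  shows "(sqrt (2 * pi) * \<rho> * exp (-1/2)) ^ CARD('n) \<le> Re (S_op a 0 (gauss_packet 0 (\<lambda>_. \<rho>)) x)"
proof -
  have "(sqrt (2 * pi) * \<rho> * exp (-1/2)) ^ CARD('n) = (\<Prod>j\<in>(UNIV :: 'n set). sqrt (2 * pi) * \<rho> * exp (-1/2))" by simp
  also have "\<dots> \<le> (\<Prod>j\<in>UNIV. sqrt (2 * pi) * \<rho> * exp (-((\<rho> * x $ j)\<^sup>2) / 2))"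
  proof (intro prod_mono conjI)
    fix j
    have "0 \<le> \<rho> * x $ j" "\<rho> * x $ j \<le> 1" using x[of j] \<rho> by (auto simp: field_simps)
    then have "(\<rho> * x $ j)\<^sup>2 \<le> 1" by (intro power_le_one) auto
    then show "sqrt (2 * pi) * \<rho> * exp (-1/2) \<le> sqrt (2 * pi) * \<rho> * exp (-((\<rho> * x $ j)\<^sup>2) / 2)"
      using \<rho> by (intro mult_left_mono) auto
  qed (use \<rho> in auto)
  finally show ?thesis unfolding S_op_gauss_packet_zero[of "\<lambda>_. \<rho>", OF \<rho>] Re_complex_of_real .
qed

text \<open>Up to constants, the packet of frequency width \<rho> has height \<rho>^n on a cube of
  side 1/\<rho> and norm at most \<rho>^(n/2) max(1, \<rho>)^s. Keeping both ends of the scale in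
  one inequality yields the condition on q from \<rho> \<rightarrow> 0 and the condition on s from
  \<rho> \<rightarrow> \<infinity>.\<close>

lemma maximal_estimate_scaling:
  fixes a :: "real ^ 'n::finite"
  assumes est: "maximal_estimate a (ennreal q) s" and s: "s \<ge> 0" and q: "q > 0"
  shows "\<exists>C. \<forall>\<rho>>0. \<rho> powr (CARD('n) * (1/2 - 1/q)) \<le> C * max 1 \<rho> powr s"
proof -
  obtain C where C: "\<And>N (R :: 'n \<Rightarrow> real) \<Lambda> c l u. 0 \<le> N \<Longrightarrow> (\<forall>j. 0 < R j \<and> R j \<le> \<Lambda>) \<Longrightarrow> N \<le> \<Lambda> \<Longrightarrow> 1 \<le> \<Lambda> \<Longrightarrow>
     0 \<le> c \<Longrightarrow> (\<forall>j. l $ j \<le> u $ j) \<Longrightarrow> (\<forall>x\<in>cbox l u. ennreal c \<le> maximal_op a (gauss_packet N R) x) \<Longrightarrow>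
     c * (\<Prod>j\<in>UNIV. u $ j - l $ j) powr (1 / q) \<le> C * \<Lambda> powr s * sqrt (\<Prod>j\<in>UNIV. R j)"
    using maximal_estimate_packet[OF est s q] by blast
  define k where "k = (sqrt (2 * pi) * exp (-1/2)) ^ CARD('n)"
  have k: "k > 0" by (simp add: k_def)
  have "\<rho> powr (CARD('n) * (1/2 - 1/q)) \<le> C / k * max 1 \<rho> powr s" if \<rho>: "\<rho> > 0" for \<rho>
  proof -
    define c where "c = (sqrt (2 * pi) * \<rho> * exp (-1/2)) ^ CARD('n)"
    have c: "c \<ge> 0" using \<rho> by (simp add: c_def)
    have ck: "c = k * \<rho> powr CARD('n)" using \<rho> by (simp add: c_def k_def power_mult_distrib powr_realpow)
    have low: "\<forall>x\<in>cbox 0 (\<chi> j. 1 / \<rho>). ennreal c \<le> maximal_op a (gauss_packet 0 (\<lambda>_. \<rho>)) x"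
    proof
      fix x :: "real ^ 'n" assume "x \<in> cbox 0 (\<chi> j. 1 / \<rho>)"
      then have "c \<le> Re (S_op a 0 (gauss_packet 0 (\<lambda>_. \<rho>)) x)"
        unfolding c_def by (intro gauss_packet_zero_time_lower \<rho>) (auto simp: mem_box_cart)
      also have "\<dots> \<le> cmod (S_op a 0 (gauss_packet 0 (\<lambda>_. \<rho>)) x)" by (rule complex_Re_le_cmod)
      finally have "ennreal c \<le> ennreal (cmod (S_op a 0 (gauss_packet 0 (\<lambda>_. \<rho>)) x))" by (rule ennreal_leI)
      also have "\<dots> \<le> maximal_op a (gauss_packet 0 (\<lambda>_. \<rho>)) x"
        by (intro maximal_op_ge_zero_time fourier_integrable schwartz_gauss_packet \<rho>)
      finally show "ennreal c \<le> maximal_op a (gauss_packet 0 (\<lambda>_. \<rho>)) x" .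
    qed
    have "c * (\<Prod>j\<in>(UNIV::'n set). (\<chi> j. 1 / \<rho>) $ j - 0 $ j) powr (1 / q) \<le> C * max 1 \<rho> powr s * sqrt (\<Prod>j\<in>(UNIV::'n set). \<rho>)"
      using \<rho> by (intro C[OF _ _ _ _ c _ low]) auto
    moreover have "(\<Prod>j\<in>(UNIV::'n set). (\<chi> j. 1 / \<rho>) $ j - 0 $ j) powr (1 / q) = \<rho> powr (- (CARD('n) / q))"
    proof -
      have "(\<Prod>j\<in>(UNIV::'n set). (\<chi> j. 1 / \<rho>) $ j - 0 $ j) = \<rho> powr (- real CARD('n))"
        using \<rho> by (simp add: powr_minus powr_realpow power_one_over inverse_eq_divide)
      then show ?thesis by (simp add: powr_powr)
    qed
    moreover have "sqrt (\<Prod>j\<in>(UNIV::'n set). \<rho>) = \<rho> powr (CARD('n) / 2)"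
    proof -
      have "sqrt (\<Prod>j\<in>(UNIV::'n set). \<rho>) = (\<rho> powr CARD('n)) powr (1/2)"
        using \<rho> by (simp add: powr_half_sqrt powr_realpow)
      then show ?thesis by (simp add: powr_powr)
    qed
    ultimately have "k * \<rho> powr CARD('n) * \<rho> powr (- (CARD('n) / q)) \<le> C * max 1 \<rho> powr s * \<rho> powr (CARD('n) / 2)"
      unfolding ck by (simp only:)
    then have "k * \<rho> powr CARD('n) * \<rho> powr (- (CARD('n) / q)) * \<rho> powr (- (CARD('n) / 2)) \<le> C * max 1 \<rho> powr s * \<rho> powr (CARD('n) / 2) * \<rho> powr (- (CARD('n) / 2))"
      by (rule mult_right_mono) simp
    moreover have "k * \<rho> powr CARD('n) * \<rho> powr (- (CARD('n) / q)) * \<rho> powr (- (CARD('n) / 2)) = k * \<rho> powr (CARD('n) * (1/2 - 1/q))"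
      unfolding mult.assoc powr_add[symmetric] by (simp add: algebra_simps)
    moreover have "C * max 1 \<rho> powr s * \<rho> powr (CARD('n) / 2) * \<rho> powr (- (CARD('n) / 2)) = C * max 1 \<rho> powr s"
      unfolding mult.assoc powr_add[symmetric] using \<rho> by simp
    ultimately have "k * \<rho> powr (CARD('n) * (1/2 - 1/q)) \<le> C * max 1 \<rho> powr s" by (simp only:)
    then show ?thesis using k by (simp add: pos_le_divide_eq mult.commute)
  qed
  then show ?thesis by blast
qed

lemma maximal_estimate_imp_q_ge_2:
  fixes a :: "real ^ 'n::finite"
  assumes est: "maximal_estimate a (ennreal q) s" and q: "q > 0"
  shows "q \<ge> 2"
proof -
  \<comment> \<open>The norm bounds for packets are for s \<ge> 0; raising s only weakens the
    estimate.\<close>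
  have est': "maximal_estimate a (ennreal q) (max s 0)" by (rule maximal_estimate_mono[OF est]) simp
  obtain C where C: "\<And>\<rho>. \<rho> > 0 \<Longrightarrow> \<rho> powr (CARD('n) * (1/2 - 1/q)) \<le> C * max 1 \<rho> powr (max s 0)"
    using maximal_estimate_scaling[OF est' _ q] by auto
  have "- (CARD('n) * (1/2 - 1/q)) \<le> 0"
  proof (rule powr_le_imp_exponent_le)
    fix x :: real assume x: "x \<ge> 1"
    have "(1 / x) powr (CARD('n) * (1/2 - 1/q)) \<le> C * max 1 (1 / x) powr (max s 0)"
      using x by (intro C) simp
    moreover have "max 1 (1 / x) = 1" using x by (simp add: max_def)
    moreover have "(1 / x) powr e = x powr (- e)" for e
      using x by (simp add: powr_minus_divide powr_divide)
    ultimately show "x powr - (CARD('n) * (1/2 - 1/q)) \<le> C * x powr 0" using x by simp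
  qed
  then have "0 \<le> 1/2 - 1/q" by (simp add: zero_le_mult_iff)
  then show ?thesis using q by (simp add: field_simps)
qed

lemma maximal_estimate_imp_ge_scaling:
  fixes a :: "real ^ 'n::finite"
  assumes est: "maximal_estimate a (ennreal q) s" and q: "q > 2"
  shows "s \<ge> CARD('n) * (1/2 - 1/q)"
proof -
  have est': "maximal_estimate a (ennreal q) (max s 0)" by (rule maximal_estimate_mono[OF est]) simp
  obtain C where C: "\<And>\<rho>. \<rho> > 0 \<Longrightarrow> \<rho> powr (CARD('n) * (1/2 - 1/q)) \<le> C * max 1 \<rho> powr (max s 0)"
    using maximal_estimate_scaling[OF est'] q by auto
  have "CARD('n) * (1/2 - 1/q) \<le> max s 0"
  proof (rule powr_le_imp_exponent_le)
    fix x :: real assume x: "x \<ge> 1"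
    then have "max 1 x = x" by simp
    then show "x powr (CARD('n) * (1/2 - 1/q)) \<le> C * x powr (max s 0)" using C[of x] x by simp
  qed
  moreover have "CARD('n) * (1/2 - 1/q) > 0" using q by (simp add: field_simps)
  ultimately show ?thesis by linarith
qed

text \<open>For |h| \<le> 1/2 this is Taylor's formula. For larger h the point 1 + h may be zero or
  negative, but h^2 is then bounded below and each term is crudely at most a multiple of the
  right-hand side. The polynomial growth is affordable because the bound is integrated against a
  Gaussian.\<close>

lemma powr_taylor_bound:
  fixes a :: real
  assumes a: "a > 1"
  shows "\<exists>C>0. \<forall>h. \<bar>\<bar>1 + h\<bar> powr a - 1 - a * h\<bar> \<le> C * (h\<^sup>2 * (1 + h\<^sup>2) powr a)"
proof -
  define C where "C = a * (a - 1) * 2 powr \<bar>a - 2\<bar> + (4 * 2 powr a + 4 + 2 * a)"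
  have C: "C > 0" unfolding C_def using a by (intro add_nonneg_pos mult_nonneg_nonneg) (auto intro!: add_pos_pos)
  have "\<bar>\<bar>1 + h\<bar> powr a - 1 - a * h\<bar> \<le> C * (h\<^sup>2 * (1 + h\<^sup>2) powr a)" for h :: real
  proof -
    have ge1: "(1 + h\<^sup>2) powr a \<ge> 1" using a by (intro ge_one_powr_ge_zero) auto
    show ?thesis
    proof (cases "\<bar>h\<bar> \<le> 1/2")
      case True
      define D where "D = (\<lambda>m::nat. \<lambda>y::real. if m = 0 then (1 + y) powr a else if m = 1 then a * (1 + y) powr (a - 1) else a * ((a - 1) * (1 + y) powr (a - 2)))"
      have "\<exists>t. \<bar>t\<bar> \<le> \<bar>h\<bar> \<and> (1 + h) powr a = (\<Sum>m<2. D m 0 / fact m * h ^ m) + D 2 t / fact 2 * h ^ 2"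
      proof (rule Maclaurin_bi_le)
        show "D 0 = (\<lambda>y. (1 + y) powr a)" by (simp add: D_def)
        show "\<forall>m t. m < 2 \<and> \<bar>t\<bar> \<le> \<bar>h\<bar> \<longrightarrow> DERIV (D m) t :> D (Suc m) t"
        proof (intro allI impI, elim conjE)
          fix m :: nat and t :: real assume m: "m < 2" and t: "\<bar>t\<bar> \<le> \<bar>h\<bar>"
          have pos: "1 + t > 0" using t True by linarith
          have e: "a - 1 - 1 = a - 2" by simp
          have "m = 0 \<or> m = 1" using m by linarith
          then show "DERIV (D m) t :> D (Suc m) t"
            unfolding D_def using pos by (auto intro!: derivative_eq_intros simp: e)
        qed
      qed
      then obtain t where t: "\<bar>t\<bar> \<le> \<bar>h\<bar>" "(1 + h) powr a = (\<Sum>m<2. D m 0 / fact m * h ^ m) + D 2 t / fact 2 * h ^ 2" by blast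
      have "(1 + h) powr a - 1 - a * h = a * (a - 1) * (1 + t) powr (a - 2) / 2 * h\<^sup>2"
        unfolding t(2) by (simp add: D_def numeral_2_eq_2 lessThan_Suc)
      moreover have "(1 + t) powr (a - 2) \<le> 2 powr \<bar>a - 2\<bar>"
      proof (cases "a \<ge> 2")
        case a2: True
        then have "(1 + t) powr (a - 2) \<le> 2 powr (a - 2)" using t(1) True by (intro powr_mono2) auto
        then show ?thesis using a2 by simp
      next
        case False
        then have "(1 + t) powr (a - 2) \<le> (1/2) powr (a - 2)" using t(1) True by (intro powr_mono2') auto
        also have "\<dots> = 2 powr (- (a - 2))" by (simp only: powr_divide powr_one_eq_one powr_minus_divide)
        finally show ?thesis using False by simp
      qed
      then have "a * (a - 1) * (1 + t) powr (a - 2) / 2 * h\<^sup>2 \<le> a * (a - 1) * 2 powr \<bar>a - 2\<bar> * h\<^sup>2"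
      proof (intro mult_right_mono)
        assume *: "(1 + t) powr (a - 2) \<le> 2 powr \<bar>a - 2\<bar>"
        have "a * (a - 1) * (1 + t) powr (a - 2) / 2 \<le> a * (a - 1) * (1 + t) powr (a - 2)" using a by simp
        also have "\<dots> \<le> a * (a - 1) * 2 powr \<bar>a - 2\<bar>" using a * by (intro mult_left_mono) auto
        finally show "a * (a - 1) * (1 + t) powr (a - 2) / 2 \<le> a * (a - 1) * 2 powr \<bar>a - 2\<bar>" .
      qed simp
      moreover have "\<bar>1 + h\<bar> = 1 + h" using True by linarith
      moreover have "0 \<le> a * (a - 1) * (1 + t) powr (a - 2) / 2 * h\<^sup>2" using a by simp
      ultimately have "\<bar>\<bar>1 + h\<bar> powr a - 1 - a * h\<bar> \<le> a * (a - 1) * 2 powr \<bar>a - 2\<bar> * h\<^sup>2" by simp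
      also have "\<dots> \<le> C * h\<^sup>2" unfolding C_def using a by (intro mult_right_mono) auto
      also have "\<dots> \<le> C * (h\<^sup>2 * (1 + h\<^sup>2) powr a)"
        using C ge1 mult_left_mono[OF ge1, of "h\<^sup>2"] by (intro mult_left_mono) auto
      finally show ?thesis .
    next
      case False
      define Q where "Q = h\<^sup>2 * (1 + h\<^sup>2) powr a"
      have "(1/2)\<^sup>2 \<le> \<bar>h\<bar>\<^sup>2" using False by (intro power_mono) auto
      then have h2: "1 \<le> 4 * h\<^sup>2" by (simp add: power2_eq_square)
      have Q1: "h\<^sup>2 \<le> Q" unfolding Q_def using mult_left_mono[OF ge1, of "h\<^sup>2"] by simp
      have Q2: "(1 + h\<^sup>2) powr a \<le> 4 * Q" unfolding Q_def using mult_right_mono[OF h2, of "(1 + h\<^sup>2) powr a"] by simp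
      have "0 \<le> (\<bar>h\<bar> - 1/2)\<^sup>2" by simp
      then have "\<bar>h\<bar> \<le> h\<^sup>2 + 1/4" unfolding power2_diff by (simp add: power2_eq_square)
      moreover have "\<bar>1 + h\<bar> \<le> 1 + \<bar>h\<bar>" by simp
      moreover have "h\<^sup>2 \<ge> 0" by simp
      ultimately have "\<bar>1 + h\<bar> \<le> 2 * (1 + h\<^sup>2)" by argo
      then have "\<bar>1 + h\<bar> powr a \<le> (2 * (1 + h\<^sup>2)) powr a" using a by (intro powr_mono2) auto
      also have "\<dots> = 2 powr a * (1 + h\<^sup>2) powr a" by (rule powr_mult)
      also have "\<dots> \<le> 2 powr a * (4 * Q)" by (intro mult_left_mono Q2) simp
      finally have A: "\<bar>1 + h\<bar> powr a \<le> 4 * 2 powr a * Q" by simp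
      have "\<bar>h\<bar> \<le> 2 * \<bar>h\<bar>\<^sup>2" using mult_right_mono[of "1/2" "\<bar>h\<bar>" "\<bar>h\<bar>"] False unfolding power2_eq_square by simp
      then have "\<bar>h\<bar> \<le> 2 * Q" using Q1 by simp
      then have B: "a * \<bar>h\<bar> \<le> a * (2 * Q)" using a by (intro mult_left_mono) auto
      have "\<bar>a * h\<bar> = a * \<bar>h\<bar>" using a by (simp add: abs_mult)
      moreover have "0 \<le> \<bar>1 + h\<bar> powr a" by simp
      ultimately have "\<bar>\<bar>1 + h\<bar> powr a - 1 - a * h\<bar> \<le> 4 * 2 powr a * Q + 4 * Q + a * (2 * Q)"
        using A B h2 Q1 by linarith
      also have "\<dots> = (4 * 2 powr a + 4 + 2 * a) * Q" by (simp add: algebra_simps)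
      also have "\<dots> \<le> C * Q"
        unfolding C_def Q_def using a by (intro mult_right_mono) auto
      finally show ?thesis unfolding Q_def .
    qed
  qed
  then show ?thesis using C by blast
qed

text \<open>The substitution \<open>y = N + R \<eta>\<close> with \<open>R = \<delta> N powr (1 - a/2)\<close> cancels the linear part of the phase and
  leaves a remainder of size \<open>\<delta>\<^sup>2\<close>.\<close>

lemma packet_integral_lower:
  fixes a :: real
  assumes a: "a > 1"
  shows "\<exists>\<delta>. 0 < \<delta> \<and> \<delta> \<le> 1 \<and> (\<forall>N\<ge>1. \<forall>t. 0 \<le> t \<longrightarrow> t \<le> 1 \<longrightarrow> \<delta> * N powr (1 - a/2) \<le>
     cmod (LINT y|lborel. iexp (- (t * (a * N powr (a - 1))) * y + t * \<bar>y\<bar> powr a) *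
        complex_of_real (exp (-(((y - N) / (\<delta> * N powr (1 - a/2)))\<^sup>2) / 2))))"
proof -
  obtain C where C: "C > 0" "\<And>h. \<bar>\<bar>1 + h\<bar> powr a - 1 - a * h\<bar> \<le> C * (h\<^sup>2 * (1 + h\<^sup>2) powr a)"
    using powr_taylor_bound[OF a] by blast
  define H where "H = (\<lambda>x::real. (1 + x\<^sup>2) powr (a + 1) * exp (-(x\<^sup>2) / 2))"
  have H: "integrable lborel H" unfolding H_def using a by (intro integrable_japanese_gauss) simp
  define D where "D = C * (LINT x|lborel. H x)"
  have D: "D \<ge> 0" unfolding D_def using C(1) by (intro mult_nonneg_nonneg Bochner_Integration.integral_nonneg) (auto simp: H_def)
  \<comment> \<open>Small enough that the total phase error D \<delta>^2 is at most 1, while the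
    unperturbed Gaussian integral sqrt(2 pi) is at least 2.\<close>
  define \<delta> where "\<delta> = 1 / (1 + D)"
  have \<delta>: "\<delta> > 0" "\<delta> \<le> 1" using D by (auto simp: \<delta>_def)
  have \<delta>D: "D * \<delta>\<^sup>2 \<le> 1"
  proof -
    have "D * \<delta> \<le> 1" using D by (simp add: \<delta>_def)
    then have "D * \<delta> * \<delta> \<le> 1 * 1" using \<delta> D by (intro mult_mono) auto
    then show ?thesis by (simp add: power2_eq_square)
  qed
  have "\<delta> * N powr (1 - a/2) \<le>
     cmod (LINT y|lborel. iexp (- (t * (a * N powr (a - 1))) * y + t * \<bar>y\<bar> powr a) *
        complex_of_real (exp (-(((y - N) / (\<delta> * N powr (1 - a/2)))\<^sup>2) / 2)))" if N: "N \<ge> 1" and t: "0 \<le> t" "t \<le> 1" for N t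
  proof -
    define R where "R = \<delta> * N powr (1 - a/2)"
    have R: "R > 0" using \<delta> N by (simp add: R_def)
    define \<epsilon> where "\<epsilon> = R / N"
    have \<epsilon>0: "\<epsilon> > 0" using R N by (simp add: \<epsilon>_def)
    have Re: "R = N * \<epsilon>" using N by (simp add: \<epsilon>_def)
    have N1: "N powr (1 - a/2) = N * N powr (-(a/2))" using N by (simp add: powr_diff powr_minus_divide)
    have \<epsilon>: "\<epsilon> = \<delta> * N powr (-(a/2))" unfolding \<epsilon>_def R_def N1 using N by simp
    have "N powr (-(a/2)) \<le> N powr 0" using N a by (intro powr_mono) auto
    then have \<epsilon>1: "\<epsilon> \<le> 1" unfolding \<epsilon> using \<delta> N by (intro mult_le_one) auto
    \<comment> \<open>The width is chosen for this cancellation: N^a \<epsilon>^2 is free of N, so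
      the quadratic phase error is uniform in the frequency.\<close>
    have "N powr (-(a/2)) * N powr (-(a/2)) = N powr (-a)" unfolding powr_add[symmetric] by simp
    then have N\<epsilon>: "N powr a * \<epsilon>\<^sup>2 = \<delta>\<^sup>2" unfolding \<epsilon> power_mult_distrib power2_eq_square[of "N powr _"]
      using N by (simp add: powr_minus field_simps)
    define \<psi> where "\<psi> = (\<lambda>\<eta>. t * N powr a * (\<bar>1 + \<epsilon> * \<eta>\<bar> powr a - 1 - a * (\<epsilon> * \<eta>)))"
    have [measurable]: "\<psi> \<in> borel_measurable borel" unfolding \<psi>_def by measurable
    have \<psi>: "\<bar>\<psi> \<eta>\<bar> \<le> C * \<delta>\<^sup>2 * (1 + \<eta>\<^sup>2) powr (a + 1)" for \<eta>
    proof -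
      have e2: "(\<epsilon> * \<eta>)\<^sup>2 \<le> 1 * \<eta>\<^sup>2" unfolding power_mult_distrib using \<epsilon>0 \<epsilon>1 by (intro mult_right_mono power_le_one) auto
      have "(\<epsilon> * \<eta>)\<^sup>2 * (1 + (\<epsilon> * \<eta>)\<^sup>2) powr a \<le> (\<epsilon> * \<eta>)\<^sup>2 * (1 + \<eta>\<^sup>2) powr a"
        using e2 a by (intro mult_left_mono powr_mono2) auto
      also have "\<dots> = \<epsilon>\<^sup>2 * (\<eta>\<^sup>2 * (1 + \<eta>\<^sup>2) powr a)" by (simp only: power_mult_distrib mult.assoc)
      also have "\<dots> \<le> \<epsilon>\<^sup>2 * ((1 + \<eta>\<^sup>2) * (1 + \<eta>\<^sup>2) powr a)" by (intro mult_left_mono mult_right_mono) auto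
      also have "(1 + \<eta>\<^sup>2) * (1 + \<eta>\<^sup>2) powr a = (1 + \<eta>\<^sup>2) powr (a + 1)" using one_plus_sq_pos[of \<eta>] by (simp add: powr_add)
      finally have le: "C * ((\<epsilon> * \<eta>)\<^sup>2 * (1 + (\<epsilon> * \<eta>)\<^sup>2) powr a) \<le> C * (\<epsilon>\<^sup>2 * (1 + \<eta>\<^sup>2) powr (a + 1))"
        using C(1) by (intro mult_left_mono) auto
      have "\<bar>\<psi> \<eta>\<bar> = t * (N powr a * \<bar>\<bar>1 + \<epsilon> * \<eta>\<bar> powr a - 1 - a * (\<epsilon> * \<eta>)\<bar>)"
        unfolding \<psi>_def abs_mult using t by simp
      also have "\<dots> \<le> 1 * (N powr a * (C * (\<epsilon>\<^sup>2 * (1 + \<eta>\<^sup>2) powr (a + 1))))"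
        using t order_trans[OF C(2) le] by (intro mult_mono) auto
      also have "\<dots> = C * (N powr a * \<epsilon>\<^sup>2) * (1 + \<eta>\<^sup>2) powr (a + 1)" by (simp only: mult_ac mult_1)
      finally show ?thesis unfolding N\<epsilon> .
    qed
    define G where "G = (\<lambda>x::real. complex_of_real (exp (-(x\<^sup>2) / 2)))"
    have G: "integrable lborel G" "(LINT x|lborel. G x) = complex_of_real (sqrt (2 * pi))"
      using std_gauss_integral[of 0] by (simp_all add: G_def)
    have [measurable]: "G \<in> borel_measurable borel" unfolding G_def by measurable
    have nG: "cmod (G x) = exp (-(x\<^sup>2) / 2)" for x by (simp add: G_def)
    have iG: "integrable lborel (\<lambda>\<eta>. iexp (\<psi> \<eta>) * G \<eta>)"
      by (rule Bochner_Integration.integrable_bound[OF G(1)]) (auto simp: norm_mult)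
    have diff: "cmod (LINT \<eta>|lborel. iexp (\<psi> \<eta>) * G \<eta> - G \<eta>) \<le> 1"
    proof -
      have "cmod (LINT \<eta>|lborel. iexp (\<psi> \<eta>) * G \<eta> - G \<eta>) \<le> (LINT \<eta>|lborel. cmod (iexp (\<psi> \<eta>) * G \<eta> - G \<eta>))"
        by (rule integral_norm_bound)
      also have "\<dots> \<le> (LINT \<eta>|lborel. C * \<delta>\<^sup>2 * H \<eta>)"
      proof (intro integral_mono integrable_norm Bochner_Integration.integrable_diff iG G integrable_mult_right H)
        fix \<eta>
        have "cmod (iexp (\<psi> \<eta>) - 1) \<le> \<bar>\<psi> \<eta>\<bar>"
          using iexp_approx1[of "\<psi> \<eta>" 0] by simp
        then have "cmod (iexp (\<psi> \<eta>) - 1) * cmod (G \<eta>) \<le> C * \<delta>\<^sup>2 * (1 + \<eta>\<^sup>2) powr (a + 1) * cmod (G \<eta>)"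
          using \<psi>[of \<eta>] by (intro mult_right_mono) auto
        moreover have "iexp (\<psi> \<eta>) * G \<eta> - G \<eta> = (iexp (\<psi> \<eta>) - 1) * G \<eta>"
          by (simp add: algebra_simps)
        ultimately show "cmod (iexp (\<psi> \<eta>) * G \<eta> - G \<eta>) \<le> C * \<delta>\<^sup>2 * H \<eta>"
          by (simp only: norm_mult[of _ "G \<eta>"] nG H_def mult.assoc)
      qed
      also have "\<dots> = D * \<delta>\<^sup>2" unfolding D_def by simp
      finally show ?thesis using \<delta>D by linarith
    qed
    have s2: "sqrt (2 * pi) \<ge> 2"
    proof (rule real_le_rsqrt)
      show "2\<^sup>2 \<le> 2 * pi" using pi_gt3 by simp
    qed
    have "(LINT \<eta>|lborel. iexp (\<psi> \<eta>) * G \<eta>) = (LINT \<eta>|lborel. iexp (\<psi> \<eta>) * G \<eta> - G \<eta>) + (LINT \<eta>|lborel. G \<eta>)"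
      by (simp add: Bochner_Integration.integral_diff[OF iG G(1)])
    moreover have "cmod (LINT \<eta>|lborel. G \<eta>) = sqrt (2 * pi)" unfolding G(2) by simp
    ultimately have low: "1 \<le> cmod (LINT \<eta>|lborel. iexp (\<psi> \<eta>) * G \<eta>)"
      using diff s2 norm_diff_ineq[of "LINT \<eta>|lborel. G \<eta>" "LINT \<eta>|lborel. iexp (\<psi> \<eta>) * G \<eta> - G \<eta>"]
      by (simp add: add.commute)
    \<comment> \<open>Minus t times the derivative of y^a at N: at this position the phase is
      stationary at the centre of the packet. What remains is the constant \<open>c0\<close>,
      invisible to the modulus, and the remainder \<open>\<psi>\<close>.\<close>
    define X where "X = - (t * (a * N powr (a - 1)))"
    define c0 where "c0 = X * N + t * N powr a"
    have phase: "X * (N + R * \<eta>) + t * \<bar>N + R * \<eta>\<bar> powr a = c0 + \<psi> \<eta>" for \<eta>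
    proof -
      have "N + R * \<eta> = N * (1 + \<epsilon> * \<eta>)" unfolding Re by (simp add: algebra_simps)
      then have "\<bar>N + R * \<eta>\<bar> powr a = N powr a * \<bar>1 + \<epsilon> * \<eta>\<bar> powr a" using N by (simp add: abs_mult powr_mult)
      moreover have "N powr (a - 1) * N = N powr a" using N by (simp add: powr_diff)
      then have "X * (R * \<eta>) = - (t * N powr a * (a * (\<epsilon> * \<eta>)))" unfolding X_def Re by (metis (no_types, opaque_lifting) mult.assoc mult.commute mult_minus_left)
      ultimately show ?thesis unfolding c0_def \<psi>_def by (simp add: algebra_simps)
    qed
    have "(LINT y|lborel. iexp (X * y + t * \<bar>y\<bar> powr a) * complex_of_real (exp (-(((y - N) / R)\<^sup>2) / 2))) =
       R *\<^sub>R (LINT \<eta>|lborel. iexp (X * (N + R * \<eta>) + t * \<bar>N + R * \<eta>\<bar> powr a) * complex_of_real (exp (-(((N + R * \<eta> - N) / R)\<^sup>2) / 2)))"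
      using R by (subst lborel_integral_real_affine[where c=R and t=N]) auto
    also have "(LINT \<eta>|lborel. iexp (X * (N + R * \<eta>) + t * \<bar>N + R * \<eta>\<bar> powr a) * complex_of_real (exp (-(((N + R * \<eta> - N) / R)\<^sup>2) / 2))) =
       (LINT \<eta>|lborel. iexp c0 * (iexp (\<psi> \<eta>) * G \<eta>))"
      unfolding phase G_def using R by (intro Bochner_Integration.integral_cong refl) (simp add: exp_add distrib_left)
    also have "\<dots> = iexp c0 * (LINT \<eta>|lborel. iexp (\<psi> \<eta>) * G \<eta>)"
      by (rule integral_mult_right_zero)
    finally have "cmod (LINT y|lborel. iexp (X * y + t * \<bar>y\<bar> powr a) * complex_of_real (exp (-(((y - N) / R)\<^sup>2) / 2))) =
       R * cmod (LINT \<eta>|lborel. iexp (\<psi> \<eta>) * G \<eta>)"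
      using R by (simp add: norm_mult)
    also have "\<dots> \<ge> R * 1" using low R by (intro mult_left_mono) auto
    finally show ?thesis unfolding X_def R_def by simp
  qed
  then show ?thesis using \<delta> by (intro exI[of _ \<delta>]) auto
qed

text \<open>In each variable the packet has frequency width R_j, hence height of that order, and its
  peak sweeps an interval of length comparable to N^(a_j - 1) as t_j varies. On the resulting box
  the maximal function is at least the product of the R_j, whereas the norm is at most N^s times the
  square root of this product. Comparing powers of N gives the threshold.\<close>

lemma maximal_estimate_imp_ge_wave_packet:
  fixes a :: "real ^ 'n::finite"
  assumes a: "\<And>j. a $ j > 1" and est: "maximal_estimate a (ennreal q) s" and q: "q > 0"
  shows "(\<Sum>j\<in>UNIV. 1/2 - a $ j/4 + (a $ j - 1)/q) \<le> max s 0"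
proof -
  have est': "maximal_estimate a (ennreal q) (max s 0)" by (rule maximal_estimate_mono[OF est]) simp
  obtain C where C: "\<And>N (R :: 'n \<Rightarrow> real) \<Lambda> c l u. 0 \<le> N \<Longrightarrow> (\<forall>j. 0 < R j \<and> R j \<le> \<Lambda>) \<Longrightarrow> N \<le> \<Lambda> \<Longrightarrow> 1 \<le> \<Lambda> \<Longrightarrow>
     0 \<le> c \<Longrightarrow> (\<forall>j. l $ j \<le> u $ j) \<Longrightarrow> (\<forall>x\<in>cbox l u. ennreal c \<le> maximal_op a (gauss_packet N R) x) \<Longrightarrow>
     c * (\<Prod>j\<in>UNIV. u $ j - l $ j) powr (1 / q) \<le> C * \<Lambda> powr (max s 0) * sqrt (\<Prod>j\<in>UNIV. R j)"
    using maximal_estimate_packet[OF est' max.cobounded2 q] by blast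
  have "\<forall>j. \<exists>\<delta>. 0 < \<delta> \<and> \<delta> \<le> 1 \<and> (\<forall>N\<ge>1. \<forall>t. 0 \<le> t \<longrightarrow> t \<le> 1 \<longrightarrow> \<delta> * N powr (1 - a $ j/2) \<le>
     cmod (LINT y|lborel. iexp (- (t * (a $ j * N powr (a $ j - 1))) * y + t * \<bar>y\<bar> powr (a $ j)) *
        complex_of_real (exp (-(((y - N) / (\<delta> * N powr (1 - a $ j/2)))\<^sup>2) / 2))))"
    using packet_integral_lower[OF a] by blast
  then obtain \<delta> where \<delta>: "\<And>j. 0 < \<delta> j" "\<And>j. \<delta> j \<le> 1" and low: "\<And>j N t. N \<ge> 1 \<Longrightarrow> 0 \<le> t \<Longrightarrow> t \<le> 1 \<Longrightarrow> \<delta> j * N powr (1 - a $ j/2) \<le>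
     cmod (LINT y|lborel. iexp (- (t * (a $ j * N powr (a $ j - 1))) * y + t * \<bar>y\<bar> powr (a $ j)) *
        complex_of_real (exp (-(((y - N) / (\<delta> j * N powr (1 - a $ j/2)))\<^sup>2) / 2)))"
    by (auto dest!: choice)
  define P where "P = (\<Prod>j\<in>UNIV. \<delta> j)"
  define \<alpha> where "\<alpha> = (\<Prod>j\<in>UNIV. a $ j / 2)"
  have a0: "a $ j > 0" for j using a[of j] by simp
  have P: "P > 0" unfolding P_def using \<delta> by (intro prod_pos) auto
  have \<alpha>: "\<alpha> > 0" unfolding \<alpha>_def using a0 by (intro prod_pos) auto
  define E1 where "E1 = (\<Sum>j\<in>UNIV. 1 - a $ j / 2)"
  define E2 where "E2 = (\<Sum>j\<in>UNIV. a $ j - 1)"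
  have "E1 / 2 + E2 / q \<le> max s 0"
  proof (rule powr_le_imp_exponent_le)
    fix N :: real assume N: "N \<ge> 1"
    define R where "R = (\<lambda>j. \<delta> j * N powr (1 - a $ j / 2))"
    define w where "w = (\<lambda>j. a $ j * N powr (a $ j - 1))"
    \<comment> \<open>The quarter points keep the times t_j = -x_j/w_j well inside (0, 1).\<close>
    define l :: "real ^ 'n" where "l = (\<chi> j. - (3/4 * w j))"
    define u :: "real ^ 'n" where "u = (\<chi> j. - (1/4 * w j))"
    have w: "w j > 0" for j unfolding w_def using a0 N by simp
    have R0: "R j > 0" for j unfolding R_def using \<delta> N by simp
    \<comment> \<open>The widths stay below the frequency since 1 - a_j/2 < 1, so N itself can serve
      as \<Lambda>.\<close>
    have RN: "R j \<le> N" for j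
    proof -
      have "R j \<le> 1 * N powr 1" unfolding R_def using \<delta> N a0[of j] by (intro mult_mono powr_mono) (auto simp: less_imp_le)
      then show ?thesis using N by simp
    qed
    have lower: "\<forall>x\<in>cbox l u. ennreal (\<Prod>j\<in>UNIV. R j) \<le> maximal_op a (gauss_packet N R) x"
    proof
      fix x assume "x \<in> cbox l u"
      then have x: "- (3/4 * w j) \<le> x $ j" "x $ j \<le> - (1/4 * w j)" for j by (auto simp: mem_box_cart l_def u_def)
      define t :: "real ^ 'n" where "t = (\<chi> j. - x $ j / w j)"
      have t: "1/4 \<le> t $ j" "t $ j \<le> 3/4" for j
        using x[of j] w[of j] by (auto simp: t_def field_simps)
      have xt: "x $ j = - (t $ j * w j)" for j using w[of j] by (simp add: t_def)
      have "(\<Prod>j\<in>UNIV. R j) \<le> (\<Prod>j\<in>UNIV. cmod (LINT y|lborel.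
          iexp (x $ j * y + t $ j * \<bar>y\<bar> powr (a $ j)) * complex_of_real (exp (-(((y - N) / R j)\<^sup>2) / 2))))"
      proof (intro prod_mono conjI)
        fix j
        show "0 \<le> R j" using R0[of j] by simp
        have "0 \<le> t $ j" "t $ j \<le> 1" using t[of j] by auto
        from low[OF N this, of j] show "R j \<le> cmod (LINT y|lborel.
          iexp (x $ j * y + t $ j * \<bar>y\<bar> powr (a $ j)) * complex_of_real (exp (-(((y - N) / R j)\<^sup>2) / 2)))"
          unfolding xt R_def w_def .
      qed
      also have "\<dots> = cmod (S_op a t (gauss_packet N R) x)"
        unfolding S_op_gauss_packet[OF R0] by (rule prod_norm)
      finally have "ennreal (\<Prod>j\<in>UNIV. R j) \<le> ennreal (cmod (S_op a t (gauss_packet N R) x))" by (rule ennreal_leI)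
      also have "\<dots> \<le> maximal_op a (gauss_packet N R) x"
      proof (rule maximal_op_ge)
        show "0 < t $ j \<and> t $ j < 1" for j using t[of j] by linarith
      qed
      finally show "ennreal (\<Prod>j\<in>UNIV. R j) \<le> maximal_op a (gauss_packet N R) x" .
    qed
    have "(\<Prod>j\<in>UNIV. R j) * (\<Prod>j\<in>UNIV. u $ j - l $ j) powr (1 / q) \<le> C * N powr (max s 0) * sqrt (\<Prod>j\<in>UNIV. R j)"
    proof (rule C[OF _ _ _ N _ _ lower])
      show "\<forall>j. l $ j \<le> u $ j" using w by (auto simp: l_def u_def less_imp_le)
      show "0 \<le> (\<Prod>j\<in>UNIV. R j)" using R0 by (intro prod_nonneg) (auto simp: less_imp_le)
    qed (use N R0 RN in auto)
    moreover have PR: "(\<Prod>j\<in>UNIV. R j) = P * N powr E1"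
      unfolding R_def prod.distrib P_def E1_def using N by (subst powr_sum) auto
    moreover have "(\<Prod>j\<in>UNIV. u $ j - l $ j) = \<alpha> * N powr E2"
    proof -
      have "(\<Prod>j\<in>UNIV. u $ j - l $ j) = (\<Prod>j\<in>UNIV. a $ j / 2 * N powr (a $ j - 1))"
        by (intro prod.cong refl) (simp add: u_def l_def w_def)
      then show ?thesis unfolding prod.distrib \<alpha>_def E2_def using N by (subst powr_sum) auto
    qed
    moreover have "(\<alpha> * N powr E2) powr (1 / q) = \<alpha> powr (1 / q) * N powr (E2 / q)"
      by (simp add: powr_mult powr_powr)
    moreover have "sqrt (P * N powr E1) = sqrt P * N powr (E1 / 2)"
      by (simp add: real_sqrt_mult powr_half_sqrt[symmetric] powr_powr)
    ultimately have "P * N powr E1 * (\<alpha> powr (1 / q) * N powr (E2 / q)) \<le> C * N powr (max s 0) * (sqrt P * N powr (E1 / 2))"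
      by (simp only:)
    then have "P * N powr E1 * (\<alpha> powr (1 / q) * N powr (E2 / q)) * N powr (-(E1 / 2)) \<le> C * N powr (max s 0) * (sqrt P * N powr (E1 / 2)) * N powr (-(E1 / 2))"
      by (rule mult_right_mono) simp
    moreover have "P * N powr E1 * (\<alpha> powr (1 / q) * N powr (E2 / q)) * N powr (-(E1 / 2)) = (P * \<alpha> powr (1 / q)) * (N powr E1 * N powr (E2 / q) * N powr (-(E1 / 2)))"
      by (simp only: mult_ac)
    moreover have "N powr E1 * N powr (E2 / q) * N powr (-(E1 / 2)) = N powr (E1 / 2 + E2 / q)"
      unfolding powr_add[symmetric] by (simp add: field_simps)
    moreover have "C * N powr (max s 0) * (sqrt P * N powr (E1 / 2)) * N powr (-(E1 / 2)) = C * sqrt P * N powr (max s 0) * (N powr (E1 / 2) * N powr (-(E1 / 2)))"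
      by (simp only: mult_ac)
    moreover have "N powr (E1 / 2) * N powr (-(E1 / 2)) = 1" unfolding powr_add[symmetric] using N by simp
    ultimately have "(P * \<alpha> powr (1 / q)) * N powr (E1 / 2 + E2 / q) \<le> C * sqrt P * N powr (max s 0)"
      by (simp only: mult_1_right)
    then show "N powr (E1 / 2 + E2 / q) \<le> C * sqrt P / (P * \<alpha> powr (1 / q)) * N powr (max s 0)"
      using P \<alpha> by (simp add: pos_le_divide_eq mult.commute)
  qed
  moreover have "(\<Sum>j\<in>UNIV. 1/2 - a $ j/4 + (a $ j - 1)/q) = E1 / 2 + E2 / q"
    unfolding E1_def E2_def sum_divide_distrib sum.distrib[symmetric]
    by (intro sum.cong refl) (simp add: diff_divide_distrib)
  ultimately show ?thesis by (simp only:)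
qed

text \<open>Disposes of the cross terms in the square of a dyadic sum, in the absence of orthogonality.\<close>

lemma sum_square_le_geometric:
  fixes b :: "nat \<Rightarrow> real"
  assumes \<beta>: "0 \<le> \<beta>" "\<beta> \<le> 1/2" and B: "B \<ge> 0" and b: "\<And>k. 0 \<le> b k" "\<And>k. b k \<le> B * \<beta> ^ k"
  shows "(\<Sum>k<K. b k)\<^sup>2 \<le> 3 * B * (\<Sum>k<K. \<beta> ^ k * b k)"
  using B b
proof (induction K arbitrary: b B)
  case (Suc K)
  define S where "S = (\<Sum>k<K. b (Suc k))"
  \<comment> \<open>The tail is again such a sequence with B \<beta> in place of B; the extra
    \<beta> is exactly what the shift of the weights \<beta>^k requires.\<close>
  have IH: "S\<^sup>2 \<le> 3 * (B * \<beta>) * (\<Sum>k<K. \<beta> ^ k * b (Suc k))"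
    unfolding S_def
  proof (rule Suc.IH)
    show "0 \<le> B * \<beta>" using Suc.prems \<beta> by simp
    show "b (Suc k) \<le> B * \<beta> * \<beta> ^ k" for k using Suc.prems(3)[of "Suc k"] by (simp add: mult.assoc)
  qed (rule Suc.prems(2))
  have S0: "S \<ge> 0" unfolding S_def by (intro sum_nonneg Suc.prems)
  have half: "(\<Sum>k<K. (1/2::real) ^ Suc k) = 1 - (1/2) ^ K" by (induction K) auto
  have "S \<le> (\<Sum>k<K. B * (1/2) ^ Suc k)"
    unfolding S_def using \<beta> Suc.prems(1) by (intro sum_mono order_trans[OF Suc.prems(3)] mult_left_mono power_mono)
  also have "\<dots> = B * (1 - (1/2) ^ K)" unfolding sum_distrib_left[symmetric] half ..
  also have "\<dots> \<le> B * 1" using Suc.prems(1) by (intro mult_left_mono) auto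
  finally have SB: "S \<le> B" by simp
  have "b 0 \<le> B" using Suc.prems(3)[of 0] by simp
  have sh: "(\<Sum>k<Suc K. f k) = f 0 + (\<Sum>k<K. f (Suc k))" for f :: "nat \<Rightarrow> real" by (rule sum.lessThan_Suc_shift)
  \<comment> \<open>The tail S is at most B because \<beta> \<le> 1/2, so b 0 + 2 S \<le> 3 B pays
    for the square of b 0 and all its cross terms.\<close>
  have "(\<Sum>k<Suc K. b k)\<^sup>2 = b 0 * (b 0 + 2 * S) + S\<^sup>2"
    unfolding sh S_def[symmetric] by (simp add: power2_eq_square algebra_simps)
  also have "\<dots> \<le> b 0 * (3 * B) + 3 * (B * \<beta>) * (\<Sum>k<K. \<beta> ^ k * b (Suc k))"
    using SB \<open>b 0 \<le> B\<close> Suc.prems(2)[of 0] by (intro add_mono mult_left_mono IH) auto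
  also have "\<dots> = 3 * B * (\<Sum>k<Suc K. \<beta> ^ k * b k)"
    unfolding sh by (simp add: distrib_left sum_distrib_left mult_ac)
  finally show ?case .
qed simp

section \<open>A dyadic sum at the endpoint s = n/2\<close>

lemma fourier_sum:
  fixes f :: "'k \<Rightarrow> real ^ 'n::finite \<Rightarrow> complex"
  assumes f: "\<And>k. schwartz (f k)"
  shows "fourier (\<lambda>x. \<Sum>k\<in>A. z k * f k x) \<xi> = (\<Sum>k\<in>A. z k * fourier (f k) \<xi>)"
proof -
  have i: "integrable lborel (\<lambda>x. exp (- \<i> * complex_of_real (x \<bullet> \<xi>)) * f k x)" for k
  proof (rule Bochner_Integration.integrable_bound[OF schwartz_integrable[OF f[of k]]])
    have [measurable]: "f k \<in> borel_measurable borel" by (rule schwartz_measurable[OF f])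
    show "(\<lambda>x. exp (- \<i> * complex_of_real (x \<bullet> \<xi>)) * f k x) \<in> borel_measurable lborel" by measurable
  qed (simp add: norm_mult)
  have "fourier (\<lambda>x. \<Sum>k\<in>A. z k * f k x) \<xi> = (LINT x|lborel. (\<Sum>k\<in>A. z k * (exp (- \<i> * complex_of_real (x \<bullet> \<xi>)) * f k x)))"
    unfolding fourier_def by (simp add: sum_distrib_left mult_ac)
  also have "\<dots> = (\<Sum>k\<in>A. LINT x|lborel. z k * (exp (- \<i> * complex_of_real (x \<bullet> \<xi>)) * f k x))"
    by (intro Bochner_Integration.integral_sum integrable_mult_right i)
  also have "\<dots> = (\<Sum>k\<in>A. z k * fourier (f k) \<xi>)"
    unfolding fourier_def by (simp only: integral_mult_right_zero)
  finally show ?thesis .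
qed

lemma S_op_sum:
  fixes f :: "'k \<Rightarrow> real ^ 'n::finite \<Rightarrow> complex"
  assumes f: "\<And>k. schwartz (f k)"
  shows "S_op a t (\<lambda>x. \<Sum>k\<in>A. z k * f k x) x = (\<Sum>k\<in>A. z k * S_op a t (f k) x)"
proof -
  have i: "integrable lborel (\<lambda>\<xi>. iexp (osc_phase a t x \<xi>) * fourier (f k) \<xi>)" for k
  proof (rule Bochner_Integration.integrable_bound[OF fourier_integrable[OF f[of k]]])
    have [measurable]: "f k \<in> borel_measurable borel" by (rule schwartz_measurable[OF f])
    show "(\<lambda>\<xi>. iexp (osc_phase a t x \<xi>) * fourier (f k) \<xi>) \<in> borel_measurable lborel" by measurable
  qed (simp add: norm_mult)
  have "S_op a t (\<lambda>x. \<Sum>k\<in>A. z k * f k x) x = (LINT \<xi>|lborel. (\<Sum>k\<in>A. z k * (iexp (osc_phase a t x \<xi>) * fourier (f k) \<xi>)))"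
    unfolding S_op_eq fourier_sum[OF f] by (simp add: sum_distrib_left mult_ac)
  also have "\<dots> = (\<Sum>k\<in>A. z k * S_op a t (f k) x)"
    unfolding S_op_eq by (subst Bochner_Integration.integral_sum) (auto intro!: integrable_mult_right i)
  finally show ?thesis .
qed

text \<open>On the Fourier side a smooth truncation of |\<xi>|^(-n) to 1 \<le> |\<xi>| \<le> 2^K:
  the coefficient 2^(-n k) compensates the volume of the k-th frequency ball. At s = n/2 this
  profile is borderline, since its squared norm and its value at the origin diverge at the same
  logarithmic rate.\<close>

definition dyadic_packet_sum :: "nat \<Rightarrow> real ^ 'n::finite \<Rightarrow> complex" where
  "dyadic_packet_sum K x = (\<Sum>k<K. complex_of_real (((1/2) ^ CARD('n)) ^ k) * gauss_packet 0 (\<lambda>_. 2 ^ k) x)"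

lemma schwartz_dyadic_packet_sum: "schwartz (dyadic_packet_sum K)"
  unfolding dyadic_packet_sum_def [abs_def]
  by (intro schwartz_sum schwartz_cmult schwartz_gauss_packet) auto

text \<open>Once the square is linearised, scale k contributes 2^(-2 n k) from the coefficients,
  2^(n k) from the weight at s = n/2 and 2^(n k) from the volume, so each of the K scales costs a
  constant.\<close>

lemma sobolev_dyadic_packet_sum:
  "\<exists>C>0. \<forall>K. (sobolev_norm (real CARD('n) / 2) (dyadic_packet_sum K :: real ^ 'n::finite \<Rightarrow> complex))\<^sup>2 \<le> C * real K"
proof -
  define n where "n = CARD('n)"
  define s where "s = real n / 2"
  have s: "s \<ge> 0" by (simp add: s_def)
  obtain C where C: "C > 0" "\<And>N (R :: 'n \<Rightarrow> real) \<Lambda>. 0 \<le> N \<Longrightarrow> (\<forall>j. 0 < R j \<and> R j \<le> \<Lambda>) \<Longrightarrow> N \<le> \<Lambda> \<Longrightarrow> 1 \<le> \<Lambda> \<Longrightarrow>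
    (\<integral>\<^sup>+\<xi>. ennreal ((1 + (norm \<xi>)\<^sup>2) powr s * (\<Prod>j\<in>UNIV. exp (-(((\<xi> $ j - N) / R j)\<^sup>2)))) \<partial>lborel) \<le>
      ennreal (C * \<Lambda> powr (2 * s) * (\<Prod>j\<in>UNIV. R j))"
    using weighted_gauss_bound[OF s, where 'n='n] by blast
  define \<beta> :: real where "\<beta> = (1/2) ^ n"
  have n: "n \<ge> 1" unfolding n_def by (simp add: Suc_leI)
  have \<beta>: "0 \<le> \<beta>" "\<beta> \<le> 1/2" unfolding \<beta>_def using power_decreasing[OF n, of "1/2::real"] by auto
  \<comment> \<open>The transform of the k-th packet itself, not its square; the sqrt 2 adjusts its
    width to the form exp(-x^2) of \<open>weighted_gauss_bound\<close>.\<close>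
  define G where "G = (\<lambda>(k::nat) (\<xi>::real^'n). \<Prod>j\<in>UNIV. exp (-(((\<xi> $ j - 0) / (sqrt 2 * 2 ^ k))\<^sup>2)))"
  have G: "0 \<le> G k \<xi>" "G k \<xi> \<le> 1" for k \<xi> unfolding G_def by (auto intro!: prod_nonneg prod_le_1)
  have [measurable]: "G k \<in> borel_measurable borel" for k unfolding G_def by measurable
  have "(sobolev_norm s (dyadic_packet_sum K :: real ^ 'n \<Rightarrow> complex))\<^sup>2 \<le> (3 * C * 2 ^ n) * real K" for K
  proof -
    let ?f = "dyadic_packet_sum K :: real ^ 'n \<Rightarrow> complex"
    have ff: "fourier ?f \<xi> = complex_of_real (\<Sum>k<K. \<beta> ^ k * G k \<xi>)" for \<xi>
    proof -
      have "fourier ?f \<xi> = (\<Sum>k<K. complex_of_real (((1/2) ^ CARD('n)) ^ k) * fourier (gauss_packet 0 (\<lambda>_. 2 ^ k)) \<xi>)"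
        unfolding dyadic_packet_sum_def [abs_def] by (intro fourier_sum schwartz_gauss_packet) simp
      also have "\<dots> = (\<Sum>k<K. complex_of_real (\<beta> ^ k * G k \<xi>))"
      proof (intro sum.cong refl)
        fix k
        have "fourier (gauss_packet 0 (\<lambda>_. 2 ^ k)) \<xi> = complex_of_real (\<Prod>j\<in>UNIV. exp (-(((\<xi> $ j - 0) / 2 ^ k)\<^sup>2) / 2))"
          by (subst fourier_gauss_packet) (simp_all only: of_real_prod, simp)
        also have "(\<Prod>j\<in>UNIV. exp (-(((\<xi> $ j - 0) / 2 ^ k)\<^sup>2) / 2)) = G k \<xi>"
          unfolding G_def by (intro prod.cong refl) (simp add: power_divide power_mult_distrib)
        finally show "complex_of_real (((1/2) ^ CARD('n)) ^ k) * fourier (gauss_packet 0 (\<lambda>_. 2 ^ k)) \<xi> = complex_of_real (\<beta> ^ k * G k \<xi>)"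
          unfolding \<beta>_def n_def by (simp only: of_real_mult)
      qed
      finally show ?thesis by (simp only: of_real_sum)
    qed
    have pt: "(cmod (fourier ?f \<xi>))\<^sup>2 \<le> (\<Sum>k<K. 3 * (\<beta> ^ k * \<beta> ^ k) * G k \<xi>)" for \<xi>
    proof -
      have "(\<Sum>k<K. \<beta> ^ k * G k \<xi>)\<^sup>2 \<le> 3 * 1 * (\<Sum>k<K. \<beta> ^ k * (\<beta> ^ k * G k \<xi>))"
        using \<beta> G by (intro sum_square_le_geometric) (auto intro: mult_left_le)
      then show ?thesis unfolding ff norm_of_real power2_abs by (simp add: sum_distrib_left mult_ac)
    qed
    have term_le: "(\<integral>\<^sup>+\<xi>. ennreal ((1 + (norm \<xi>)\<^sup>2) powr s * G k \<xi>) \<partial>lborel) \<le> ennreal (C * (2 * 4 ^ k) ^ n)" for k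
    proof -
      define \<Lambda> :: real where "\<Lambda> = sqrt 2 * 2 ^ k"
      have "1 * 1 \<le> sqrt 2 * (2::real) ^ k" by (intro mult_mono) auto
      then have \<Lambda>: "\<Lambda> \<ge> 1" by (simp add: \<Lambda>_def)
      have "(\<integral>\<^sup>+\<xi>. ennreal ((1 + (norm \<xi>)\<^sup>2) powr s * G k \<xi>) \<partial>lborel) \<le> ennreal (C * \<Lambda> powr (2 * s) * (\<Prod>j\<in>(UNIV::'n set). \<Lambda>))"
        unfolding G_def \<Lambda>_def[symmetric] using \<Lambda> by (intro C(2)) auto
      also have "\<Lambda> powr (2 * s) = \<Lambda> ^ n" unfolding s_def using \<Lambda> by (simp add: powr_realpow)
      also have "(\<Prod>j\<in>(UNIV::'n set). \<Lambda>) = \<Lambda> ^ n" by (simp add: n_def)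
      also have "C * \<Lambda> ^ n * \<Lambda> ^ n = C * (2 * 4 ^ k) ^ n"
      proof -
        have "\<Lambda> * \<Lambda> = 2 * 4 ^ k" unfolding \<Lambda>_def by (simp add: mult_ac power_mult_distrib[symmetric])
        then show ?thesis unfolding mult.assoc power_mult_distrib[symmetric] by simp
      qed
      finally show ?thesis .
    qed
    have b4: "\<beta> ^ k * \<beta> ^ k * (2 * 4 ^ k) ^ n = 2 ^ n" for k
    proof -
      have "\<beta> ^ k * \<beta> ^ k = ((1/4) ^ k) ^ n"
        unfolding \<beta>_def power_mult[symmetric] power_mult_distrib[symmetric] by (simp add: mult.commute power_mult_distrib[symmetric] power_divide)
      then have "\<beta> ^ k * \<beta> ^ k * (2 * 4 ^ k) ^ n = ((1/4) ^ k * (2 * 4 ^ k)) ^ n" by (simp only: power_mult_distrib)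
      also have "(1/4::real) ^ k * (2 * 4 ^ k) = 2" by (simp add: power_one_over)
      finally show ?thesis .
    qed
    have "ennreal (LINT \<xi>|lborel. (1 + (norm \<xi>)\<^sup>2) powr s * (cmod (fourier ?f \<xi>))\<^sup>2) =
      (\<integral>\<^sup>+\<xi>. ennreal ((1 + (norm \<xi>)\<^sup>2) powr s * (cmod (fourier ?f \<xi>))\<^sup>2) \<partial>lborel)"
      by (intro nn_integral_eq_integral[symmetric] sobolev_integrable schwartz_dyadic_packet_sum) auto
    also have "\<dots> \<le> (\<integral>\<^sup>+\<xi>. (\<Sum>k<K. ennreal (3 * (\<beta> ^ k * \<beta> ^ k)) * ennreal ((1 + (norm \<xi>)\<^sup>2) powr s * G k \<xi>)) \<partial>lborel)"
    proof (intro nn_integral_mono)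
      fix \<xi>
      have "(1 + (norm \<xi>)\<^sup>2) powr s * (cmod (fourier ?f \<xi>))\<^sup>2 \<le> (1 + (norm \<xi>)\<^sup>2) powr s * (\<Sum>k<K. 3 * (\<beta> ^ k * \<beta> ^ k) * G k \<xi>)"
        by (intro mult_left_mono pt) simp
      also have "\<dots> = (\<Sum>k<K. (3 * (\<beta> ^ k * \<beta> ^ k)) * ((1 + (norm \<xi>)\<^sup>2) powr s * G k \<xi>))"
        unfolding sum_distrib_left by (simp only: mult_ac)
      finally have "ennreal ((1 + (norm \<xi>)\<^sup>2) powr s * (cmod (fourier ?f \<xi>))\<^sup>2) \<le> ennreal (\<Sum>k<K. (3 * (\<beta> ^ k * \<beta> ^ k)) * ((1 + (norm \<xi>)\<^sup>2) powr s * G k \<xi>))"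
        by (rule ennreal_leI)
      also have "\<dots> = (\<Sum>k<K. ennreal (3 * (\<beta> ^ k * \<beta> ^ k)) * ennreal ((1 + (norm \<xi>)\<^sup>2) powr s * G k \<xi>))"
        using \<beta> G by (subst sum_ennreal[symmetric]) (auto simp: ennreal_mult)
      finally show "ennreal ((1 + (norm \<xi>)\<^sup>2) powr s * (cmod (fourier ?f \<xi>))\<^sup>2) \<le> (\<Sum>k<K. ennreal (3 * (\<beta> ^ k * \<beta> ^ k)) * ennreal ((1 + (norm \<xi>)\<^sup>2) powr s * G k \<xi>))" .
    qed
    also have "\<dots> = (\<Sum>k<K. ennreal (3 * (\<beta> ^ k * \<beta> ^ k)) * (\<integral>\<^sup>+\<xi>. ennreal ((1 + (norm \<xi>)\<^sup>2) powr s * G k \<xi>) \<partial>lborel))"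
      by (subst nn_integral_sum) (auto simp: nn_integral_cmult)
    also have "\<dots> \<le> (\<Sum>k<K. ennreal (3 * (\<beta> ^ k * \<beta> ^ k)) * ennreal (C * (2 * 4 ^ k) ^ n))"
      by (intro sum_mono mult_left_mono term_le) simp
    also have "\<dots> = (\<Sum>k<K. ennreal (3 * C * 2 ^ n))"
    proof (intro sum.cong refl)
      fix k
      have "ennreal (3 * (\<beta> ^ k * \<beta> ^ k)) * ennreal (C * (2 * 4 ^ k) ^ n) = ennreal ((3 * (\<beta> ^ k * \<beta> ^ k)) * (C * (2 * 4 ^ k) ^ n))"
        using \<beta> C(1) by (intro ennreal_mult[symmetric]) auto
      also have "(3 * (\<beta> ^ k * \<beta> ^ k)) * (C * (2 * 4 ^ k) ^ n) = 3 * C * (\<beta> ^ k * \<beta> ^ k * (2 * 4 ^ k) ^ n)" by (simp only: mult_ac)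
      finally show "ennreal (3 * (\<beta> ^ k * \<beta> ^ k)) * ennreal (C * (2 * 4 ^ k) ^ n) = ennreal (3 * C * 2 ^ n)" unfolding b4 .
    qed
    also have "\<dots> = ennreal ((3 * C * 2 ^ n) * real K)"
      using C(1) by (simp add: ennreal_of_nat_eq_real_of_nat ennreal_mult mult.commute)
    finally have "(LINT \<xi>|lborel. (1 + (norm \<xi>)\<^sup>2) powr s * (cmod (fourier ?f \<xi>))\<^sup>2) \<le> (3 * C * 2 ^ n) * real K"
      using C(1) by (subst (asm) ennreal_le_iff) auto
    then show ?thesis unfolding sobolev_norm_def
      by (subst real_sqrt_pow2) (auto intro!: Bochner_Integration.integral_nonneg)
  qed
  then show ?thesis using C(1) unfolding s_def n_def by (intro exI[of _ "3 * C * 2 ^ CARD('n)"]) auto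
qed

lemma maximal_estimate_infinity_imp_gt:
  fixes a :: "real ^ 'n::finite"
  assumes est: "maximal_estimate a \<infinity> s"
  shows "s > real CARD('n) / 2"
proof (rule ccontr)
  assume "\<not> ?thesis"
  then have "maximal_estimate a \<infinity> (real CARD('n) / 2)" by (intro maximal_estimate_mono[OF est]) simp
  then obtain C0 where C0: "\<And>f. schwartz f \<Longrightarrow> Lq_norm \<infinity> (maximal_op a f) \<le> ennreal (C0 * sobolev_norm (real CARD('n) / 2) f)"
    unfolding maximal_estimate_def by blast
  obtain C1 where C1: "C1 > 0" "\<And>K. (sobolev_norm (real CARD('n) / 2) (dyadic_packet_sum K :: real ^ 'n \<Rightarrow> complex))\<^sup>2 \<le> C1 * real K"
    using sobolev_dyadic_packet_sum[where 'n='n] by blast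
  define \<kappa> where "\<kappa> = (sqrt (2 * pi) * exp (-1/2)) ^ CARD('n)"
  have \<kappa>: "\<kappa> > 0" by (simp add: \<kappa>_def)
  have bound: "real K \<le> C0\<^sup>2 * C1 / \<kappa>\<^sup>2" if K: "K > 0" for K
  proof -
    let ?f = "dyadic_packet_sum K :: real ^ 'n \<Rightarrow> complex"
    let ?N = "sobolev_norm (real CARD('n) / 2) ?f"
    \<comment> \<open>On a cube of side 2^(-K) all K scales are near their peaks at once, and it has
      positive measure, so the essential supremum sees it.\<close>
    define B :: "(real ^ 'n) set" where "B = cbox 0 (\<chi> j. (1/2) ^ K)"
    have low: "ennreal (real K * \<kappa>) \<le> maximal_op a ?f x" if x: "x \<in> B" for x
    proof -
      have "real K * \<kappa> = (\<Sum>k<K. \<kappa>)" by simp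
      also have "\<dots> \<le> (\<Sum>k<K. ((1/2) ^ CARD('n)) ^ k * Re (S_op a 0 (gauss_packet 0 (\<lambda>_. 2 ^ k)) x))"
      proof (intro sum_mono)
        fix k assume "k \<in> {..<K}"
        then have "(1/2::real) ^ K \<le> (1/2) ^ k" by (intro power_decreasing) auto
        then have "(sqrt (2 * pi) * 2 ^ k * exp (-1/2)) ^ CARD('n) \<le> Re (S_op a 0 (gauss_packet 0 (\<lambda>_. 2 ^ k)) x)"
          using x by (intro gauss_packet_zero_time_lower) (auto simp: B_def mem_box_cart power_one_over intro: order_trans)
        then have "((1/2) ^ CARD('n)) ^ k * (sqrt (2 * pi) * 2 ^ k * exp (-1/2)) ^ CARD('n) \<le> ((1/2) ^ CARD('n)) ^ k * Re (S_op a 0 (gauss_packet 0 (\<lambda>_. 2 ^ k)) x)"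
          by (rule mult_left_mono) simp
        moreover have "((1/2::real) ^ CARD('n)) ^ k = ((1/2) ^ k) ^ CARD('n)" by (simp only: power_mult[symmetric] mult.commute)
        then have "((1/2) ^ CARD('n)) ^ k * (sqrt (2 * pi) * 2 ^ k * exp (-1/2)) ^ CARD('n) = \<kappa>"
        proof -
          have "(1/2) ^ k * (sqrt (2 * pi) * 2 ^ k * exp (-1/2)) = sqrt (2 * pi) * exp (-1/2)" by (simp add: power_one_over)
          then show ?thesis unfolding \<kappa>_def \<open>((1/2::real) ^ CARD('n)) ^ k = _\<close> power_mult_distrib[symmetric] by (simp only:)
        qed
        ultimately show "\<kappa> \<le> ((1/2) ^ CARD('n)) ^ k * Re (S_op a 0 (gauss_packet 0 (\<lambda>_. 2 ^ k)) x)" by (simp only:)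
      qed
      also have "\<dots> = Re (S_op a 0 ?f x)"
      proof -
        have "S_op a 0 ?f x = (\<Sum>k<K. complex_of_real (((1/2) ^ CARD('n)) ^ k) * S_op a 0 (gauss_packet 0 (\<lambda>_. 2 ^ k)) x)"
          unfolding dyadic_packet_sum_def [abs_def] by (intro S_op_sum schwartz_gauss_packet) simp
        then show ?thesis by (simp only: Re_sum Re_complex_of_real Im_complex_of_real complex.sel times_complex.sel mult_zero_left diff_zero)
      qed
      also have "\<dots> \<le> cmod (S_op a 0 ?f x)" by (rule complex_Re_le_cmod)
      finally have "ennreal (real K * \<kappa>) \<le> ennreal (cmod (S_op a 0 ?f x))" by (rule ennreal_leI)
      also have "\<dots> \<le> maximal_op a ?f x"
        by (intro maximal_op_ge_zero_time fourier_integrable schwartz_dyadic_packet_sum)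
      finally show ?thesis .
    qed
    have "ennreal (real K * \<kappa>) \<le> Lq_norm \<infinity> (maximal_op a ?f)"
    proof (rule ccontr)
      assume "\<not> ?thesis"
      then have lt: "esssup lborel (maximal_op a ?f) < ennreal (real K * \<kappa>)" by (simp add: Lq_norm_def)
      have "AE x in lborel. x \<notin> B"
        using esssup_AE[of "maximal_op a ?f" lborel] by eventually_elim (use low lt in \<open>auto dest: order.strict_trans1\<close>)
      then have "emeasure lborel B = 0" by (subst (asm) AE_iff_measurable[of B]) (auto simp: B_def)
      moreover have "emeasure lborel B = ennreal (\<Prod>j\<in>(UNIV::'n set). (1/2) ^ K)"
        unfolding B_def by (subst emeasure_lborel_cbox_vec) auto
      ultimately show False by simp
    qed
    also have "\<dots> \<le> ennreal (C0 * ?N)" by (rule C0[OF schwartz_dyadic_packet_sum])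
    finally have le: "real K * \<kappa> \<le> C0 * ?N" using K \<kappa> by (subst (asm) ennreal_le_iff2) (auto simp: mult_le_0_iff)
    have "(real K * \<kappa>)\<^sup>2 \<le> (C0 * ?N)\<^sup>2" using \<kappa> by (intro power_mono le) simp
    also have "\<dots> = C0\<^sup>2 * ?N\<^sup>2" by (simp add: power_mult_distrib)
    also have "\<dots> \<le> C0\<^sup>2 * (C1 * real K)" by (intro mult_left_mono C1) simp
    finally have "real K * (real K * \<kappa>\<^sup>2) \<le> real K * (C0\<^sup>2 * C1)" by (simp add: power2_eq_square mult_ac)
    then have "real K * \<kappa>\<^sup>2 \<le> C0\<^sup>2 * C1" using K by simp
    then show ?thesis using \<kappa> by (simp add: pos_le_divide_eq)
  qed
  obtain K :: nat where "C0\<^sup>2 * C1 / \<kappa>\<^sup>2 < real K" using reals_Archimedean2 by blast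
  with bound[of "Suc K"] show False by simp
qed

section \<open>Combining the ranges of q\<close>

theorem theorem1p4:
  fixes a :: "real ^ 'n::finite" and n A :: real
  assumes n_def: "n = real CARD('n)" and n_ge_2: "CARD('n) \<ge> 2"
    and a_gt_1: "\<And>j. a $ j > 1"
    and A_def: "A = (\<Sum>j\<in>UNIV. a $ j)"
  shows
    "(\<forall>q::real. 1 \<le> q \<and> q < 2 \<longrightarrow> (\<forall>s. \<not> maximal_estimate a (ennreal q) s)) \<and>
     (\<forall>s. (s > A / 4 \<longrightarrow> maximal_estimate a 2 s) \<and>
          (s < A / 4 \<longrightarrow> \<not> maximal_estimate a 2 s)) \<and>
     (\<forall>q::real. 2 < q \<and> q < 4 \<longrightarrow>
        (\<forall>s. maximal_estimate a (ennreal q) s \<longleftrightarrow> s \<ge> n / 2 - A / 4 + A / q - n / q)) \<and>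
     (\<forall>q::real. 4 \<le> q \<longrightarrow>
        (\<forall>s. maximal_estimate a (ennreal q) s \<longleftrightarrow> s \<ge> n * (1 / 2 - 1 / q))) \<and>
     (\<forall>s. maximal_estimate a \<infinity> s \<longleftrightarrow> s > n / 2)"
proof -
  have E: "(\<Sum>j\<in>UNIV. 1/2 - a $ j/4 + (a $ j - 1)/q) = n / 2 - A / 4 + A / q - n / q" for q :: real
    unfolding A_def n_def by (simp add: sum.distrib sum_subtractf diff_divide_distrib sum_divide_distrib)
  \<comment> \<open>As every a_j exceeds 1, the thresholds come out positive; this is what turns
    bounds on \<open>max s 0\<close> into bounds on s.\<close>
  have A: "A > n"
  proof -
    have "(\<Sum>j\<in>(UNIV::'n set). 1) < (\<Sum>j\<in>UNIV. a $ j)" by (intro sum_strict_mono a_gt_1) auto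
    then show ?thesis by (simp add: A_def n_def)
  qed
  have n: "n > 0" unfolding n_def by simp
  have "\<not> maximal_estimate a (ennreal q) s" if "1 \<le> q \<and> q < 2" for q s
    using maximal_estimate_imp_q_ge_2[of a q s] that by auto
  moreover have "\<not> maximal_estimate a 2 s" if "s < A / 4" for s
  proof
    assume "maximal_estimate a 2 s"
    then have "maximal_estimate a (ennreal 2) s" by simp
    from maximal_estimate_imp_ge_wave_packet[OF a_gt_1 this] have "A / 4 \<le> max s 0" unfolding E by simp
    then show False using that A n by simp
  qed
  moreover have "maximal_estimate a 2 s" if "s > A / 4" for s
    using maximal_estimate_pos_2[OF a_gt_1] that unfolding A_def by blast
  moreover have "maximal_estimate a (ennreal q) s \<longleftrightarrow> s \<ge> n / 2 - A / 4 + A / q - n / q" if q: "2 < q \<and> q < 4" for q s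
  proof
    assume "maximal_estimate a (ennreal q) s"
    from maximal_estimate_imp_ge_wave_packet[OF a_gt_1 this] have le: "n / 2 - A / 4 + A / q - n / q \<le> max s 0"
      unfolding E using q by simp
    \<comment> \<open>Expanded around q = 4, where the threshold is n/4, the threshold is seen to be
      at least n/4 for q < 4.\<close>
    have "(A - n) * (1 / q - 1 / 4) = A / q - n / q - A / 4 + n / 4"
      by (simp add: left_diff_distrib right_diff_distrib diff_divide_distrib)
    then have "n / 2 - A / 4 + A / q - n / q = n / 4 + (A - n) * (1 / q - 1 / 4)" by simp
    moreover have "(A - n) * (1 / q - 1 / 4) \<ge> 0" using q A by (intro mult_nonneg_nonneg) (auto simp: field_simps)
    ultimately show "s \<ge> n / 2 - A / 4 + A / q - n / q" using le n by linarith
  next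
    assume "s \<ge> n / 2 - A / 4 + A / q - n / q"
    then show "maximal_estimate a (ennreal q) s"
      using maximal_estimate_mono[OF maximal_estimate_pos_between[OF a_gt_1, of q]] q unfolding E by blast
  qed
  moreover have "maximal_estimate a (ennreal q) s \<longleftrightarrow> s \<ge> n * (1 / 2 - 1 / q)" if q: "4 \<le> q" for q s
    using maximal_estimate_imp_ge_scaling[of a q s] maximal_estimate_mono[OF maximal_estimate_pos_ge_4[OF a_gt_1 q]] q
    unfolding n_def by auto
  moreover have "maximal_estimate a \<infinity> s \<longleftrightarrow> s > n / 2" for s
    using maximal_estimate_infinity_imp_gt[of a s] maximal_estimate_pos_infinity[of s a] unfolding n_def by blast
  ultimately show ?thesis by blast
qed

end
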